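(* Let $\pi$ be an irreducible cuspidal automorphic representation of $\mathrm{GL}_n(\mathbb{A}_{\mathbb{Q}})$ such that $L(s,\pi)$ is entire, and let $m = \operatorname{ord}_{s=1/2} L(s,\pi)$. Assume the Ramanujan--Petersson Conjecture for $\pi$ and the Riemann Hypothesis for $L(s,\pi)$. Then there exists a constant $c_\pi$ such that $$\sum_{p\le x}\frac{\alpha_{1,p}+\cdots+\alpha_{n,p}}{\sqrt p}=\left(\frac{R(\pi)}{2}-m\right)\log\log x+c_\pi+o(1)$$ for all $x$ outside a set of finite logarithmic measure, where $R(\pi)=\operatorname{ord}_{s=1}L_2(s,\pi)$.
   Context: For $\pi=\bigotimes'\pi_v$ an irreducible cuspidal automorphic representation of $\mathrm{GL}_n(\mathbb{A}_{\mathbb{Q}})$, the $L$-function is written $L(s,\pi)=\prod_p\prod_{j=1}^n(1-\alpha_{j,p}p^{-s})^{-1}$ for $\mathrm{Re}(s)>1$ (continued meromorphically to $\mathbb{C}$). If $\pi_p$ is unramified, $\alpha_{1,p},\dots,\alpha_{n,p}$ are the Satake parameters of $\pi_p$; at a ramified prime the local factor is $P_p(p^{-s})^{-1}$ with $P_p$ a polynomial of degree at most $n$ and $P_p(0)=1$, written in the same form with some $\alpha_{j,p}$ allowed to be zero. The normalization is such that the completed $L$-function $\Lambda(s,\pi)=Q(\pi)^{s/2}\prod_{j=1}^n\Gamma_{\mathbb{R}}(s+\mu_\pi(j))\,L(s,\pi)$, where $Q(\pi)$ is the conductor, the $\mu_\pi(j)$ are the archimedean constants and $\Gamma_{\mathbb{R}}(s)=\pi^{-s/2}\Gamma(s/2)$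 (here $\pi=3.14\ldots$), satisfies $\Lambda(s,\pi)=\epsilon(\pi)\Lambda(1-s,\pi^\vee)$ with $|\epsilon(\pi)|=1$ and $\pi^\vee$ the contragredient. Ramanujan--Petersson Conjecture: for every $p$ such that $\pi_p$ is unramified, $|\alpha_{j,p}|=1$ for all $j\in\{1,\dots,n\}$. Riemann Hypothesis for $L(s,\pi)$: all non-trivial zeros of $L(s,\pi)$ lie on $\mathrm{Re}(s)=\frac12$; the trivial zeros are those at $-2k-\mu_\pi(j)$, $k\ge 0$, $1\le j\le n$. The second-moment $L$-function is $L_2(s,\pi)=\prod_p\prod_{j=1}^n(1-\alpha_{j,p}^2p^{-s})^{-1}$; it continues meromorphically to an open set containing $\{\mathrm{Re}(s)\ge 1\}$. The order $\operatorname{ord}_{s=1}$ is the order of vanishing (negative for a pole). The logarithmic measure of a measurable $S\subseteq\mathbb{R}_{\ge2}$ is $\int_S\frac{dt}{t}$. The $o(1)$ is as $x\to\infty$ through the complement of the exceptional set. *)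

theory Defs
  imports "HOL-Complex_Analysis.Complex_Analysis" "HOL-Number_Theory.Number_Theory"
begin

section \<open>Finite adeles of the rationals\<close>

text \<open>
  The ring of finite adeles is the completion of the rationals for the topology in which
  the groups \<open>N \<int>\<close> (\<open>N \<ge> 1\<close>) form a basis of neighbourhoods of 0: by strong approximation the
  rationals are dense in the finite adeles, and they meet \<open>N\<close> times the profinite integers
  in \<open>N \<int>\<close>. It is constructed by Cauchy sequences, in the same way as the reals.
\<close>

definition adic_null :: "(nat \<Rightarrow> rat) \<Rightarrow> bool" where
  "adic_null X \<longleftrightarrow> (\<forall>N::nat. N > 0 \<longrightarrow> (\<exists>k. \<forall>i\<ge>k. X i / of_nat N \<in> \<int>))"

definition adic_cauchy :: "(nat \<Rightarrow> rat) \<Rightarrow> bool" where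
  "adic_cauchy X \<longleftrightarrow> (\<forall>N::nat. N > 0 \<longrightarrow> (\<exists>k. \<forall>i\<ge>k. \<forall>j\<ge>k. (X i - X j) / of_nat N \<in> \<int>))"

definition adic_rel :: "(nat \<Rightarrow> rat) \<Rightarrow> (nat \<Rightarrow> rat) \<Rightarrow> bool" where
  "adic_rel X Y \<longleftrightarrow> adic_cauchy X \<and> adic_cauchy Y \<and> adic_null (\<lambda>i. X i - Y i)"

lemma adic_null_add:
  assumes "adic_null X" "adic_null Y"
  shows "adic_null (\<lambda>i. X i + Y i)"
  unfolding adic_null_def
proof (intro allI impI)
  fix N :: nat assume "N > 0"
  then obtain k l where "\<forall>i\<ge>k. X i / of_nat N \<in> \<int>" "\<forall>i\<ge>l. Y i / of_nat N \<in> \<int>"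
    using assms unfolding adic_null_def by meson
  then have "\<forall>i\<ge>max k l. (X i + Y i) / of_nat N \<in> \<int>"
    by (auto simp: add_divide_distrib)
  then show "\<exists>k. \<forall>i\<ge>k. (X i + Y i) / of_nat N \<in> \<int>" by blast
qed

lemma adic_null_minus:
  assumes "adic_null X"
  shows "adic_null (\<lambda>i. - X i)"
  using assms unfolding adic_null_def by simp

lemma adic_cauchy_const [simp]: "adic_cauchy (\<lambda>_. q)"
  unfolding adic_cauchy_def by simp

lemma adic_null_zero [simp]: "adic_null (\<lambda>_. 0)"
  unfolding adic_null_def by simp

lemma adic_cauchy_add:
  assumes "adic_cauchy X" "adic_cauchy Y"
  shows "adic_cauchy (\<lambda>i. X i + Y i)"
  unfolding adic_cauchy_def
proof (intro allI impI)
  fix N :: nat assume "N > 0"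
  then obtain k l where k: "\<forall>i\<ge>k. \<forall>j\<ge>k. (X i - X j) / of_nat N \<in> \<int>"
    and l: "\<forall>i\<ge>l. \<forall>j\<ge>l. (Y i - Y j) / of_nat N \<in> \<int>"
    using assms unfolding adic_cauchy_def by meson
  have "(X i + Y i - (X j + Y j)) / of_nat N \<in> \<int>" if "i \<ge> max k l" "j \<ge> max k l" for i j
  proof -
    have "(X i + Y i - (X j + Y j)) / of_nat N
        = (X i - X j) / of_nat N + (Y i - Y j) / of_nat N"
      by (simp add: add_divide_distrib[symmetric])
    then show ?thesis using k l that by simp
  qed
  then show "\<exists>k. \<forall>i\<ge>k. \<forall>j\<ge>k. (X i + Y i - (X j + Y j)) / of_nat N \<in> \<int>" by blast
qed

lemma adic_cauchy_minus:
  assumes "adic_cauchy X"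
  shows "adic_cauchy (\<lambda>i. - X i)"
  unfolding adic_cauchy_def
proof (intro allI impI)
  fix N :: nat assume "N > 0"
  then obtain k where k: "\<forall>i\<ge>k. \<forall>j\<ge>k. (X i - X j) / of_nat N \<in> \<int>"
    using assms unfolding adic_cauchy_def by meson
  have "\<forall>i\<ge>k. \<forall>j\<ge>k. (- X i - - X j) / of_nat N \<in> \<int>"
  proof (intro allI impI)
    fix i j assume "k \<le> i" "k \<le> j"
    then have "(X j - X i) / of_nat N \<in> \<int>" using k by blast
    then show "(- X i - - X j) / of_nat N \<in> \<int>" by (simp add: algebra_simps)
  qed
  then show "\<exists>k. \<forall>i\<ge>k. \<forall>j\<ge>k. (- X i - - X j) / of_nat N \<in> \<int>" by blast
qed

lemma adic_cauchy_bounded_denominator: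
  assumes "adic_cauchy X"
  shows "\<exists>D::nat. D > 0 \<and> (\<exists>k. \<forall>i\<ge>k. of_nat D * X i \<in> \<int>)"
proof -
  obtain k where k: "\<forall>i\<ge>k. \<forall>j\<ge>k. (X i - X j) / of_nat 1 \<in> \<int>"
    using assms unfolding adic_cauchy_def by (meson zero_less_one)
  obtain a b where ab: "quotient_of (X k) = (a, b)" by fastforce
  then have b: "b > 0" and X: "X k = of_int a / of_int b"
    by (simp_all add: quotient_of_denom_pos quotient_of_div)
  have "of_nat (nat b) * X i \<in> \<int>" if "i \<ge> k" for i
  proof -
    have "X i = (X i - X k) / of_nat 1 + X k" by simp
    then have "of_nat (nat b) * X i = of_int b * ((X i - X k) / of_nat 1) + of_int a"
      using b X by (simp add: field_simps)
    then show ?thesis using k that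
      by (metis Ints_add Ints_mult Ints_of_int order_refl)
  qed
  then show ?thesis using b by (metis zero_less_nat_eq)
qed

lemma adic_null_mult:
  assumes "adic_cauchy X" "adic_null Y"
  shows "adic_null (\<lambda>i. X i * Y i)"
  unfolding adic_null_def
proof (intro allI impI)
  fix N :: nat assume N: "N > 0"
  obtain D k where D: "D > 0" and k: "\<forall>i\<ge>k. of_nat D * X i \<in> \<int>"
    using adic_cauchy_bounded_denominator[OF assms(1)] by blast
  obtain l where l: "\<forall>i\<ge>l. Y i / of_nat (N * D) \<in> \<int>"
    using assms(2) N D unfolding adic_null_def by (metis nat_0_less_mult_iff)
  have "X i * Y i / of_nat N \<in> \<int>" if "i \<ge> max k l" for i
  proof -
    have "X i * Y i / of_nat N = (of_nat D * X i) * (Y i / of_nat (N * D))"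
      using D N by simp
    then show ?thesis using k l that by (metis Ints_mult max.bounded_iff)
  qed
  then show "\<exists>k. \<forall>i\<ge>k. X i * Y i / of_nat N \<in> \<int>" by blast
qed

lemma adic_cauchy_mult:
  assumes "adic_cauchy X" "adic_cauchy Y"
  shows "adic_cauchy (\<lambda>i. X i * Y i)"
  unfolding adic_cauchy_def
proof (intro allI impI)
  fix N :: nat assume N: "N > 0"
  obtain D k where D: "D > 0" and k: "\<forall>i\<ge>k. of_nat D * X i \<in> \<int>"
    using adic_cauchy_bounded_denominator[OF assms(1)] by blast
  obtain E l where E: "E > 0" and l: "\<forall>i\<ge>l. of_nat E * Y i \<in> \<int>"
    using adic_cauchy_bounded_denominator[OF assms(2)] by blast
  obtain k' where k': "\<forall>i\<ge>k'. \<forall>j\<ge>k'. (X i - X j) / of_nat (N * E) \<in> \<int>"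
    using assms(1) N E unfolding adic_cauchy_def by (metis nat_0_less_mult_iff)
  obtain l' where l': "\<forall>i\<ge>l'. \<forall>j\<ge>l'. (Y i - Y j) / of_nat (N * D) \<in> \<int>"
    using assms(2) N D unfolding adic_cauchy_def by (metis nat_0_less_mult_iff)
  define M where "M = max (max k l) (max k' l')"
  have "(X i * Y i - X j * Y j) / of_nat N \<in> \<int>" if "i \<ge> M" "j \<ge> M" for i j
  proof -
    have "(X i * Y i - X j * Y j) / of_nat N =
       (of_nat D * X i) * ((Y i - Y j) / of_nat (N * D))
       + (of_nat E * Y j) * ((X i - X j) / of_nat (N * E))"
      using D E N by (simp add: field_simps)
    moreover have "of_nat D * X i \<in> \<int>" "(Y i - Y j) / of_nat (N * D) \<in> \<int>"
      using k l' that unfolding M_def by (meson max.bounded_iff)+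
    moreover have "of_nat E * Y j \<in> \<int>" "(X i - X j) / of_nat (N * E) \<in> \<int>"
      using l k' that unfolding M_def by (meson max.bounded_iff)+
    ultimately show ?thesis by (metis Ints_add Ints_mult)
  qed
  then show "\<exists>k. \<forall>i\<ge>k. \<forall>j\<ge>k. (X i * Y i - X j * Y j) / of_nat N \<in> \<int>" by blast
qed

lemma adic_null_diff_commute:
  "adic_null (\<lambda>i. X i - Y i) \<Longrightarrow> adic_null (\<lambda>i. Y i - X i)"
  using adic_null_minus[of "\<lambda>i. X i - Y i"] by simp

lemma part_equivp_adic_rel: "part_equivp adic_rel"
proof (rule part_equivpI)
  show "\<exists>x. adic_rel x x" by (rule exI[of _ "\<lambda>_. 0"]) (simp add: adic_rel_def)
  show "symp adic_rel"
    by (rule sympI) (auto simp: adic_rel_def intro: adic_null_diff_commute)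
  show "transp adic_rel"
  proof (rule transpI)
    fix X Y Z assume *: "adic_rel X Y" "adic_rel Y Z"
    then have "adic_null (\<lambda>i. (X i - Y i) + (Y i - Z i))"
      unfolding adic_rel_def by (intro adic_null_add) auto
    then show "adic_rel X Z" using * by (simp add: adic_rel_def)
  qed
qed

quotient_type fadele = "nat \<Rightarrow> rat" / partial: adic_rel
  by (rule part_equivp_adic_rel)

instantiation fadele :: comm_ring_1
begin

lift_definition zero_fadele :: fadele is "\<lambda>_. 0" by (simp add: adic_rel_def)

lift_definition one_fadele :: fadele is "\<lambda>_. 1" by (simp add: adic_rel_def)

lift_definition plus_fadele :: "fadele \<Rightarrow> fadele \<Rightarrow> fadele" is "\<lambda>X Y i. X i + Y i"
proof -
  fix X X' Y Y' assume "adic_rel X X'" "adic_rel Y Y'"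
  then show "adic_rel (\<lambda>i. X i + Y i) (\<lambda>i. X' i + Y' i)"
    using adic_null_add[of "\<lambda>i. X i - X' i" "\<lambda>i. Y i - Y' i"]
    unfolding adic_rel_def by (auto intro: adic_cauchy_add simp: algebra_simps)
qed

lift_definition uminus_fadele :: "fadele \<Rightarrow> fadele" is "\<lambda>X i. - X i"
proof -
  fix X X' assume "adic_rel X X'"
  then show "adic_rel (\<lambda>i. - X i) (\<lambda>i. - X' i)"
    using adic_null_minus[of "\<lambda>i. X i - X' i"]
    unfolding adic_rel_def by (auto intro: adic_cauchy_minus)
qed

definition minus_fadele :: "fadele \<Rightarrow> fadele \<Rightarrow> fadele" where
  "minus_fadele x y = x + - y"

lift_definition times_fadele :: "fadele \<Rightarrow> fadele \<Rightarrow> fadele" is "\<lambda>X Y i. X i * Y i"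
proof -
  fix X X' Y Y' assume *: "adic_rel X X'" "adic_rel Y Y'"
  then have "adic_null (\<lambda>i. X i * (Y i - Y' i) + Y' i * (X i - X' i))"
    unfolding adic_rel_def by (intro adic_null_add adic_null_mult) auto
  then have "adic_null (\<lambda>i. X i * Y i - X' i * Y' i)"
    by (simp add: algebra_simps)
  then show "adic_rel (\<lambda>i. X i * Y i) (\<lambda>i. X' i * Y' i)"
    using * unfolding adic_rel_def by (auto intro: adic_cauchy_mult)
qed

instance
proof
  fix a b c :: fadele
  show "a + b + c = a + (b + c)"
    by transfer (auto simp: adic_rel_def add.assoc intro!: adic_cauchy_add)
  show "a + b = b + a"
    by transfer (auto simp: adic_rel_def add.commute intro!: adic_cauchy_add)
  show "0 + a = a" by transfer (auto simp: adic_rel_def)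
  show "- a + a = 0" by transfer (auto simp: adic_rel_def)
  show "a - b = a + - b" by (simp add: minus_fadele_def)
  show "a * b * c = a * (b * c)"
    by transfer (auto simp: adic_rel_def mult.assoc intro!: adic_cauchy_mult)
  show "a * b = b * a"
    by transfer (auto simp: adic_rel_def mult.commute intro!: adic_cauchy_mult)
  show "1 * a = a" by transfer (auto simp: adic_rel_def)
  show "(a + b) * c = a * c + b * c"
    by transfer (auto simp: adic_rel_def distrib_right intro!: adic_cauchy_mult adic_cauchy_add)
  show "(0::fadele) \<noteq> 1"
  proof transfer
    have "\<not> adic_null (\<lambda>_. - 1)"
    proof
      assume "adic_null (\<lambda>_. - 1)"
      then have "(- 1 / of_nat 2 :: rat) \<in> \<int>"
        unfolding adic_null_def by (metis order_refl zero_less_numeral of_nat_numeral)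
      then obtain z :: int where "- 1 / 2 = (of_int z :: rat)" by (auto elim!: Ints_cases)
      then have "of_int (2 * z) = (of_int (- 1) :: rat)" by (simp add: field_simps)
      then have "2 * z = - 1" by (simp only: of_int_eq_iff)
      then show False by presburger
    qed
    then show "\<not> adic_rel (\<lambda>_. 0) (\<lambda>_. 1)" by (simp add: adic_rel_def)
  qed
qed

end

lift_definition fadele_of_rat :: "rat \<Rightarrow> fadele" is "\<lambda>q _. q"
  by (simp add: adic_rel_def)

text \<open>The profinite integers, inside the finite adeles.\<close>

lift_definition profinite_int :: "fadele \<Rightarrow> bool" is "\<lambda>X. \<exists>k. \<forall>i\<ge>k. X i \<in> \<int>"
proof -
  have *: "\<exists>k. \<forall>i\<ge>k. Y i \<in> \<int>"
    if XY: "adic_null (\<lambda>i. X i - Y i)" and X: "\<exists>k. \<forall>i\<ge>k. X i \<in> \<int>" for X Y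
  proof -
    obtain k where k: "\<forall>i\<ge>k. X i \<in> \<int>" using X by blast
    obtain l where "\<forall>i\<ge>l. (X i - Y i) / of_nat 1 \<in> \<int>"
      using XY unfolding adic_null_def by (meson zero_less_one)
    then have "X i - (X i - Y i) / of_nat 1 \<in> \<int>" if "i \<ge> max k l" for i
      using k that by (meson Ints_diff max.bounded_iff)
    then have "Y i \<in> \<int>" if "i \<ge> max k l" for i
      using that by fastforce
    then show ?thesis by blast
  qed
  fix X Y assume "adic_rel X Y"
  then show "(\<exists>k. \<forall>i\<ge>k. X i \<in> \<int>) = (\<exists>k. \<forall>i\<ge>k. Y i \<in> \<int>)"
    using * adic_null_diff_commute unfolding adic_rel_def by meson
qed

definition profinite_ideal :: "nat \<Rightarrow> fadele set" where
  "profinite_ideal N = {of_nat N * z |z. profinite_int z}"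

text \<open>
  The finite adele which is 1 at the prime \<open>p\<close> and 0 at all other primes. Indeed
  \<open>p ^ fact i\<close> tends to 0 \<open>p\<close>-adically, and to 1 modulo every integer prime to \<open>p\<close>.
\<close>

definition at_prime :: "nat \<Rightarrow> fadele" where
  "at_prime p = abs_fadele (\<lambda>i. 1 - of_nat p ^ fact i)"

lemma adic_cauchy_at_prime:
  assumes "prime p"
  shows "adic_cauchy (\<lambda>i. 1 - of_nat p ^ fact i)"
  unfolding adic_cauchy_def
proof (intro allI impI)
  fix N :: nat assume "N > 0"
  then obtain a m where N: "N = p ^ a * m" and m: "\<not> p dvd m"
    using multiplicity_decompose'[of N p] assms by (metis not_prime_unit less_numeral_extra(3))
  have cop: "coprime p m" using assms m by (simp add: prime_imp_coprime)
  define k where "k = max a (totient m)"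
  have "m > 0" using N \<open>N > 0\<close> by simp
  have A: "p ^ a dvd p ^ fact i" if "i \<ge> k" for i
    using that fact_ge_self[of i] unfolding k_def by (intro le_imp_power_dvd) linarith
  have B: "[p ^ fact i = 1] (mod m)" if "i \<ge> k" for i
  proof -
    have "totient m dvd fact i"
      using that \<open>m > 0\<close> unfolding k_def by (intro dvd_fact) (auto simp: Suc_le_eq)
    then obtain t where t: "fact i = totient m * t" by (elim dvdE)
    show ?thesis
      using cong_pow[OF euler_theorem[OF cop], of t] by (simp add: t power_mult)
  qed
  have "((1 - of_nat p ^ fact i) - (1 - of_nat p ^ fact j)) / of_nat N \<in> (\<int> :: rat set)"
    if "i \<ge> k" "j \<ge> k" for i j
  proof -
    have "[p ^ fact j = p ^ fact i] (mod (p ^ a))"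
      using A that by (simp add: cong_def)
    moreover have "[p ^ fact j = p ^ fact i] (mod m)"
      using B that by (meson cong_trans cong_sym)
    ultimately have "[p ^ fact j = p ^ fact i] (mod N)"
      unfolding N using cop by (intro coprime_cong_mult_nat) auto
    then have "[int (p ^ fact j) = int (p ^ fact i)] (mod int N)"
      by (simp only: cong_int_iff)
    then obtain z where z: "int (p ^ fact j) - int (p ^ fact i) = int N * z"
      by (auto simp: cong_iff_dvd_diff elim!: dvdE)
    have "of_int (int (p ^ fact j) - int (p ^ fact i)) / of_nat N = (of_int z :: rat)"
      unfolding z using \<open>N > 0\<close> by simp
    then show ?thesis by (simp add: algebra_simps)
  qed
  then show "\<exists>k. \<forall>i\<ge>k. \<forall>j\<ge>k.
      ((1 - of_nat p ^ fact i) - (1 - of_nat p ^ fact j)) / of_nat N \<in> (\<int> :: rat set)"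
    by blast
qed


section \<open>The adelic general linear group\<close>

text \<open>
  An element of the group is a pair of an archimedean and a finite component. The matrix
  size is the cardinality of the index type.
\<close>

type_synonym 'n adelic_matrix = "(real^'n^'n) \<times> (fadele^'n^'n)"

type_synonym 'n adelic_fun = "'n adelic_matrix \<Rightarrow> complex"

definition GLA :: "('n::finite) adelic_matrix set" where
  "GLA = {(x, y). invertible x \<and> invertible y}"

definition amult :: "('n::finite) adelic_matrix \<Rightarrow> 'n adelic_matrix \<Rightarrow> 'n adelic_matrix" where
  "amult g h = (fst g ** fst h, snd g ** snd h)"

definition rational_point :: "rat^'n^'n \<Rightarrow> ('n::finite) adelic_matrix" where
  "rational_point \<gamma> = ((\<chi> i j. of_rat (\<gamma> $ i $ j)), (\<chi> i j. fadele_of_rat (\<gamma> $ i $ j)))"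

definition GL_profinite :: "(fadele^'n^'n) set" where
  "GL_profinite = {k. \<exists>k'. (\<forall>i j. profinite_int (k $ i $ j)) \<and> (\<forall>i j. profinite_int (k' $ i $ j))
     \<and> k ** k' = mat 1 \<and> k' ** k = mat 1}"

definition congruence_subgroup :: "nat \<Rightarrow> (fadele^'n^'n) set" where
  "congruence_subgroup N =
     {k \<in> GL_profinite. \<forall>i j. (k - mat 1) $ i $ j \<in> profinite_ideal N}"

text \<open>The matrix with component \<open>A\<close> at \<open>p\<close> and trivial component at all other primes.\<close>

definition local_matrix :: "nat \<Rightarrow> fadele^'n^'n \<Rightarrow> fadele^'n^'n" where
  "local_matrix p A = (\<chi> i j. at_prime p * A $ i $ j + (1 - at_prime p) * mat 1 $ i $ j)"

definition GL_Zp :: "nat \<Rightarrow> (fadele^'n^'n) set" where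
  "GL_Zp p = local_matrix p ` GL_profinite"

definition right_translate :: "('n::finite) adelic_matrix \<Rightarrow> 'n adelic_fun \<Rightarrow> 'n adelic_fun" where
  "right_translate h \<phi> = (\<lambda>g. \<phi> (amult g h))"


section \<open>Cusp forms\<close>

text \<open>A function is smooth on an open set iff it lies in a family of functions, differentiable
  on this set, that is closed under directional derivatives.\<close>

definition smooth_fun_on :: "'a::real_normed_vector set \<Rightarrow> ('a \<Rightarrow> complex) \<Rightarrow> bool" where
  "smooth_fun_on S f \<longleftrightarrow> (\<exists>F. f \<in> F \<and> (\<forall>h\<in>F. (\<forall>x\<in>S. h differentiable (at x)) \<and>
     (\<forall>v. (\<lambda>x. frechet_derivative h (at x) v) \<in> F)))"

definition arch_smooth :: "('n::finite) adelic_fun \<Rightarrow> bool" where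
  "arch_smooth \<phi> \<longleftrightarrow> (\<forall>g. g \<notin> GLA \<longrightarrow> \<phi> g = 0) \<and>
     (\<forall>y. invertible y \<longrightarrow> smooth_fun_on {x. invertible x} (\<lambda>x. \<phi> (x, y)))"

text \<open>The curve \<open>1 + t X\<close> has the same tangent vector at 0 as the exponential of \<open>t X\<close>, so this
  is the usual right action of the Lie algebra.\<close>

definition lie_derivative :: "real^'n^'n \<Rightarrow> ('n::finite) adelic_fun \<Rightarrow> 'n adelic_fun" where
  "lie_derivative X \<phi> =
     (\<lambda>(x, y). vector_derivative (\<lambda>t. \<phi> (x ** (mat 1 + t *\<^sub>R X), y)) (at 0))"

text \<open>The action of the universal enveloping algebra of the complexified Lie algebra,
  which is faithful on smooth functions, and its centre.\<close>

inductive_set enveloping_ops :: "(('n::finite) adelic_fun \<Rightarrow> 'n adelic_fun) set" where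
  ident: "(\<lambda>\<phi>. \<phi>) \<in> enveloping_ops"
| lie: "D \<in> enveloping_ops \<Longrightarrow> (\<lambda>\<phi>. lie_derivative X (D \<phi>)) \<in> enveloping_ops"
| add: "D \<in> enveloping_ops \<Longrightarrow> E \<in> enveloping_ops \<Longrightarrow> (\<lambda>\<phi> g. D \<phi> g + E \<phi> g) \<in> enveloping_ops"
| scale: "D \<in> enveloping_ops \<Longrightarrow> (\<lambda>\<phi> g. c * D \<phi> g) \<in> enveloping_ops"

definition enveloping_centre :: "(('n::finite) adelic_fun \<Rightarrow> 'n adelic_fun) set" where
  "enveloping_centre = {D \<in> enveloping_ops. \<forall>X \<phi>. arch_smooth \<phi> \<longrightarrow>
     D (lie_derivative X \<phi>) = lie_derivative X (D \<phi>)}"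

definition spans_finite_dim :: "('a \<Rightarrow> complex) set \<Rightarrow> bool" where
  "spans_finite_dim F \<longleftrightarrow> (\<exists>B. finite B \<and> (\<forall>f\<in>F. \<exists>c. f = (\<lambda>g. \<Sum>b\<in>B. c b * b g)))"

text \<open>Automorphic forms in the sense of Borel and Jacquet: the growth condition is imposed on
  the archimedean component, for each finite component.\<close>

definition automorphic_form :: "('n::finite) adelic_fun \<Rightarrow> bool" where
  "automorphic_form \<phi> \<longleftrightarrow>
     arch_smooth \<phi> \<and>
     (\<forall>\<gamma> g. invertible \<gamma> \<longrightarrow> \<phi> (amult (rational_point \<gamma>) g) = \<phi> g) \<and>
     (\<exists>N>0. \<forall>k\<in>congruence_subgroup N. right_translate (mat 1, k) \<phi> = \<phi>) \<and>
     spans_finite_dim {right_translate (k, mat 1) \<phi> |k. orthogonal_matrix k} \<and>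
     spans_finite_dim {D \<phi> |D. D \<in> enveloping_centre} \<and>
     (\<forall>y. invertible y \<longrightarrow> (\<exists>C r::nat. \<forall>x. invertible x \<longrightarrow>
        norm (\<phi> (x, y)) \<le> real C * (norm x + norm (matrix_inv x)) ^ r))"

text \<open>
  For \<open>I\<close> neither empty nor everything these matrices form the unipotent radical of a maximal
  parabolic subgroup; up to conjugation by permutation matrices these are all the standard ones.
\<close>

definition unipotent :: "'n set \<Rightarrow> 'a^'n^'n \<Rightarrow> ('a::ring_1)^'n^'n" where
  "unipotent I Y = (\<chi> i j. if i = j then 1 else if i \<in> I \<and> j \<notin> I then Y $ i $ j else 0)"

text \<open>
  Vanishing of the constant terms, i.e. of the integrals of \<open>\<phi> (u g)\<close> over \<open>u\<close> in the unipotent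
  group of adelic points modulo rational points. A fundamental domain for the adeles modulo
  the rationals is the product of the real interval from 0 to 1 and the profinite integers.
  If \<open>u \<mapsto> \<phi> (u g)\<close> is invariant under the unipotent matrices over \<open>M\<close> times the profinite integers
  (such an \<open>M\<close> exists for every automorphic form \<open>\<phi>\<close>), the integral over the profinite part is,
  up to a constant, a sum over integer matrices modulo \<open>M\<close>. The entries of \<open>Y\<close> and \<open>A\<close> that
  do not occur in \<open>unipotent I Y\<close> and \<open>unipotent I A\<close> only contribute a positive factor.
\<close>

definition cuspidal :: "('n::finite) adelic_fun \<Rightarrow> bool" where
  "cuspidal \<phi> \<longleftrightarrow> (\<forall>I g. \<forall>M::nat. I \<noteq> {} \<and> I \<noteq> UNIV \<and> g \<in> GLA \<and> M > 0 \<and>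
     (\<forall>X Z W. (\<forall>i j. W $ i $ j \<in> profinite_ideal M) \<longrightarrow>
        \<phi> (amult (unipotent I X, unipotent I Z ** unipotent I W) g)
          = \<phi> (amult (unipotent I X, unipotent I Z) g)) \<longrightarrow>
     integral (cbox 0 (\<chi> i j. 1)) (\<lambda>Y. \<Sum>A\<in>{A :: int^'n^'n. \<forall>i j. A $ i $ j \<in> {0..<int M}}.
        \<phi> (amult (unipotent I Y, unipotent I (\<chi> i j. of_int (A $ i $ j))) g)) = 0)"


section \<open>Cuspidal automorphic representations\<close>

text \<open>Simultaneously a module under the finite adelic group, and a module under the Lie algebra
  and the maximal compact subgroup at the archimedean place.\<close>

definition invariant_subspace :: "('n::finite) adelic_fun set \<Rightarrow> bool" where
  "invariant_subspace V \<longleftrightarrow>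
     (\<lambda>_. 0) \<in> V \<and>
     (\<forall>\<phi>\<in>V. \<forall>\<psi>\<in>V. (\<lambda>g. \<phi> g + \<psi> g) \<in> V) \<and>
     (\<forall>\<phi>\<in>V. \<forall>c. (\<lambda>g. c * \<phi> g) \<in> V) \<and>
     (\<forall>\<phi>\<in>V. \<forall>y. invertible y \<longrightarrow> right_translate (mat 1, y) \<phi> \<in> V) \<and>
     (\<forall>\<phi>\<in>V. \<forall>k. orthogonal_matrix k \<longrightarrow> right_translate (k, mat 1) \<phi> \<in> V) \<and>
     (\<forall>\<phi>\<in>V. \<forall>X. lie_derivative X \<phi> \<in> V)"

definition cuspidal_automorphic_rep :: "('n::finite) adelic_fun set \<Rightarrow> bool" where
  "cuspidal_automorphic_rep V \<longleftrightarrow>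
     (\<forall>\<phi>\<in>V. automorphic_form \<phi> \<and> cuspidal \<phi>) \<and> invariant_subspace V"

definition irreducible_rep :: "('n::finite) adelic_fun set \<Rightarrow> bool" where
  "irreducible_rep V \<longleftrightarrow> V \<noteq> {\<lambda>_. 0} \<and>
     (\<forall>W. W \<subseteq> V \<and> invariant_subspace W \<longrightarrow> W = {\<lambda>_. 0} \<or> W = V)"

definition spherical :: "nat \<Rightarrow> ('n::finite) adelic_fun \<Rightarrow> bool" where
  "spherical p \<phi> \<longleftrightarrow> (\<forall>k\<in>GL_Zp p. right_translate (mat 1, k) \<phi> = \<phi>)"

definition unramified :: "('n::finite) adelic_fun set \<Rightarrow> nat \<Rightarrow> bool" where
  "unramified V p \<longleftrightarrow> (\<exists>\<phi>\<in>V. \<phi> \<noteq> (\<lambda>_. 0) \<and> spherical p \<phi>)"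

text \<open>The Hecke operator of the double coset of the diagonal matrix over the \<open>p\<close>-adic field with
  entries \<open>p\<close> at the places in \<open>I\<close> and 1 elsewhere, applied to spherical functions.\<close>

definition hecke_matrix :: "nat \<Rightarrow> 'n set \<Rightarrow> fadele^'n^'n" where
  "hecke_matrix p I =
     local_matrix p (\<chi> i j. if i = j then (if i \<in> I then of_nat p else 1) else 0)"

definition hecke_cosets :: "nat \<Rightarrow> 'n set \<Rightarrow> (fadele^'n^'n) set set" where
  "hecke_cosets p I =
     (\<lambda>h. (\<lambda>k. h ** k) ` GL_Zp p) ` {k ** hecke_matrix p I ** k' |k k'. k \<in> GL_Zp p \<and> k' \<in> GL_Zp p}"

definition hecke_operator :: "nat \<Rightarrow> 'n set \<Rightarrow> ('n::finite) adelic_fun \<Rightarrow> 'n adelic_fun" where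
  "hecke_operator p I \<phi> =
     (\<lambda>g. \<Sum>c\<in>hecke_cosets p I. \<phi> (amult g (mat 1, SOME h. h \<in> c)))"

text \<open>
  The Satake parameters \<open>a\<close> of an unramified component: with \<open>r\<close> the cardinality of \<open>I\<close> and \<open>n\<close> the
  size of the matrices, the Hecke operator acts by \<open>p powr (r (n - r) / 2)\<close> times the \<open>r\<close>-th
  elementary symmetric function of \<open>a\<close>. This determines \<open>a\<close> up to order.
\<close>

definition satake_parameters ::
  "('n::finite) adelic_fun set \<Rightarrow> nat \<Rightarrow> ('n \<Rightarrow> complex) \<Rightarrow> bool" where
  "satake_parameters V p a \<longleftrightarrow> (\<forall>\<phi>\<in>V. spherical p \<phi> \<longrightarrow> (\<forall>I. \<forall>g. hecke_operator p I \<phi> g =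
     of_real (real p powr (real (card I) * real (CARD('n) - card I) / 2)) *
     (\<Sum>J\<in>{J. card J = card I}. \<Prod>j\<in>J. a j) * \<phi> g))"


section \<open>L-functions\<close>

definition Gamma_R :: "complex \<Rightarrow> complex" where
  "Gamma_R s = of_real pi powr (- s / 2) * Gamma (s / 2)"

text \<open>The product is over the primes in increasing order.\<close>

definition euler_product :: "(nat \<Rightarrow> ('n::finite) \<Rightarrow> complex) \<Rightarrow> complex \<Rightarrow> complex \<Rightarrow> bool" where
  "euler_product \<alpha> s z \<longleftrightarrow>
     (\<lambda>p. if prime p then \<Prod>j\<in>UNIV. inverse (1 - \<alpha> p j * of_nat p powr (- s)) else 1) has_prod z"

definition completed_L ::
  "nat \<Rightarrow> (('n::finite) \<Rightarrow> complex) \<Rightarrow> (complex \<Rightarrow> complex) \<Rightarrow> complex \<Rightarrow> complex" where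
  "completed_L Q \<mu> L s = of_nat Q powr (s / 2) * (\<Prod>j\<in>UNIV. Gamma_R (s + \<mu> j)) * L s"

text \<open>
  \<open>L\<close> is the L-function of the representation on \<open>V\<close>, with local parameters \<open>\<alpha>\<close>, archimedean
  constants \<open>\<mu>\<close>, conductor \<open>Q\<close> and root number \<open>\<epsilon>\<close>. At the unramified primes \<open>\<alpha>\<close> consists of the
  Satake parameters. The ramified and archimedean factors (and \<open>Q\<close>) are those for which the completed
  L-function satisfies the functional equation; together with the bounds of Jacquet and
  Shalika, by which no local factor has a pole with \<open>Re s \<ge> 1/2\<close>, this determines them:
  the quotient of two completed L-functions with the same unramified factors has then neither zeros
  nor poles, so that the finitely many local factors and Gamma factors agree.

  The contragredient representation is the complex conjugate of the (unitary) representation on \<open>V\<close>;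
  it has parameters \<open>cnj \<circ> \<alpha> p\<close>, archimedean constants \<open>cnj \<circ> \<mu>\<close>, conductor \<open>Q\<close>, and
  hence the L-function \<open>\<lambda>s. cnj (L (cnj s))\<close>. The functional equation is one of meromorphic functions,
  i.e. it holds outside a discrete set. As usual, the completed L-function is bounded
  in vertical strips, away from its poles.
\<close>

definition standard_L_function ::
  "('n::finite) adelic_fun set \<Rightarrow> (nat \<Rightarrow> 'n \<Rightarrow> complex) \<Rightarrow> ('n \<Rightarrow> complex) \<Rightarrow> nat \<Rightarrow> complex \<Rightarrow>
   (complex \<Rightarrow> complex) \<Rightarrow> bool" where
  "standard_L_function V \<alpha> \<mu> Q \<epsilon> L \<longleftrightarrow>
     (\<forall>p. prime p \<and> unramified V p \<longrightarrow> satake_parameters V p (\<alpha> p)) \<and>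
     (\<forall>p j. prime p \<longrightarrow> norm (\<alpha> p j) < sqrt (real p)) \<and>
     (\<forall>j. Re (\<mu> j) > - 1 / 2) \<and>
     Q > 0 \<and> norm \<epsilon> = 1 \<and>
     L nicely_meromorphic_on UNIV \<and>
     (\<forall>s. Re s > 1 \<longrightarrow> euler_product \<alpha> s (L s)) \<and>
     (\<forall>\<^sub>\<approx>s\<in>UNIV. completed_L Q \<mu> L s =
        \<epsilon> * completed_L Q (\<lambda>j. cnj (\<mu> j)) (\<lambda>z. cnj (L (cnj z))) (1 - s)) \<and>
     (\<forall>a b. \<exists>T C. \<forall>s. a \<le> Re s \<and> Re s \<le> b \<and> \<bar>Im s\<bar> \<ge> T \<longrightarrow> norm (completed_L Q \<mu> L s) \<le> C)"

definition second_moment_L_function ::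
  "(nat \<Rightarrow> ('n::finite) \<Rightarrow> complex) \<Rightarrow> (complex \<Rightarrow> complex) \<Rightarrow> bool" where
  "second_moment_L_function \<alpha> L2 \<longleftrightarrow>
     (\<forall>s. Re s > 1 \<longrightarrow> euler_product (\<lambda>p j. (\<alpha> p j)\<^sup>2) s (L2 s)) \<and>
     (\<exists>U. open U \<and> {s. Re s \<ge> 1} \<subseteq> U \<and> L2 nicely_meromorphic_on U)"

definition ramanujan_petersson ::
  "('n::finite) adelic_fun set \<Rightarrow> (nat \<Rightarrow> 'n \<Rightarrow> complex) \<Rightarrow> bool" where
  "ramanujan_petersson V \<alpha> \<longleftrightarrow> (\<forall>p. prime p \<and> unramified V p \<longrightarrow> (\<forall>j. norm (\<alpha> p j) = 1))"

text \<open>A nicely meromorphic function takes the value 0 at its poles, hence the first conjunct.\<close>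

definition riemann_hypothesis ::
  "(('n::finite) \<Rightarrow> complex) \<Rightarrow> (complex \<Rightarrow> complex) \<Rightarrow> bool" where
  "riemann_hypothesis \<mu> L \<longleftrightarrow> (\<forall>s. \<not> is_pole L s \<and> L s = 0 \<and>
     (\<forall>(k::nat) j. s \<noteq> - 2 * of_nat k - \<mu> j) \<longrightarrow> Re s = 1 / 2)"

definition finite_log_measure :: "real set \<Rightarrow> bool" where
  "finite_log_measure S \<longleftrightarrow> S \<subseteq> {2..} \<and> S \<in> sets lebesgue \<and>
     (\<integral>\<^sup>+t\<in>S. ennreal (1 / t) \<partial>lebesgue) < \<infinity>"

end

theory Submission
  imports Defs "HOL-Probability.Probability" "HOL-Real_Asymp.Real_Asymp"
begin

text \<open>
  On the Riemann Hypothesis, \<open>log L(1/2 + s)\<close> is holomorphic on \<open>Re s > 0\<close>. Up to an Euler product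
  converging beyond the critical line it is the Dirichlet series of \<open>\<alpha>(p) / sqrt p\<close> over the primes plus
  one half of the Dirichlet series of \<open>\<alpha>(p)\<^sup>2 / p\<close> at \<open>2 s\<close>, where \<open>\<alpha>(p)\<close> and \<open>\<alpha>(p)\<^sup>2\<close> stand for
  power sums of the local parameters. After subtraction of \<open>m log (1 - exp (- s)) + c\<close>, whose inverse
  transform is a harmonic sum, the function vanishes at \<open>s = 0\<close>; divided by \<open>s\<close>, it is the Laplace
  transform of an error term in the variable \<open>t = log x\<close>. Polynomial growth of \<open>L\<close> and Jensen type
  estimates bound its mean square over \<open>Re s = \<sigma>\<close> uniformly in \<open>\<sigma> > 0\<close>, since logarithmic singularities
  are square integrable. By Plancherel the error term is square integrable, hence so small outside a set
  of finite measure in \<open>t\<close>, that is of finite logarithmic measure in \<open>x\<close>. The sum over the squares is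
  evaluated by a Tauberian argument at the edge \<open>s = 1\<close> of the second moment L-function; it is taken
  up to \<open>sqrt x\<close>, and yields the term \<open>R / 2\<close>.
\<close>

section \<open>Gaussians and the Plancherel bound\<close>

text \<open>The exceptional set is the price of a mean square argument: control of the transform on
  vertical lines makes the error small in measure only. Three obstacles shape the rest. The
  Ramanujan-Petersson bound speaks of unramified primes; the finitely many other Euler factors have
  no poles for Re s >= 1/2, so they are divided out, and their primes return in the constant. The
  transform converges absolutely for Re s > 1/2 only; the passage to Re s > 0 goes through a
  Gaussian factor, which makes line integrals converge, permits the shift of the line and disappears
  by Fatou's lemma. Finally, the comparison term is log (1 - exp (- s)) rather than log s because
  its inverse transform is again a step function; its further singularities at 2 pi i k are
  logarithmic as well. The Tauberian argument sees only real s tending to 1 from the right; slow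
  oscillation, which comes from Chebyshev's bound for primes, supplies the remaining
  information.\<close>

lemma measurable_cis [measurable]: "cis \<in> borel_measurable borel"
  by (intro borel_measurable_continuous_onI continuous_intros)

lemma norm_integral_le_nn_integral:
  fixes f :: "'a \<Rightarrow> 'b::{banach, second_countable_topology}"
  shows "ennreal (norm (\<integral>x. f x \<partial>M)) \<le> (\<integral>\<^sup>+x. ennreal (norm (f x)) \<partial>M)"
  by (cases "integrable M f") (auto simp: integral_norm_bound_ennreal not_integrable_integral_eq)

text \<open>Fubini: the kernel has norm at most 1, so the product of the two integrable functions
  dominates. With a \<open>cis\<close> kernel, this moves a Fourier factor from one function to the
  other.\<close>

lemma integral_kernel_swap:
  fixes f g :: "real \<Rightarrow> complex" and k :: "real \<Rightarrow> real \<Rightarrow> complex"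
  assumes [measurable]: "case_prod k \<in> borel_measurable (lborel \<Otimes>\<^sub>M lborel)"
    and f: "integrable lborel f" and g: "integrable lborel g"
    and k: "\<And>x y. norm (k x y) \<le> 1"
  shows "(\<integral>x. f x * (\<integral>y. g y * k x y \<partial>lborel) \<partial>lborel)
    = (\<integral>y. g y * (\<integral>x. f x * k x y \<partial>lborel) \<partial>lborel)"
proof -
  have [measurable]: "f \<in> borel_measurable lborel" "g \<in> borel_measurable lborel"
    using f g by auto
  have [measurable]: "k x \<in> borel_measurable lborel" for x
    using measurable_compose[OF measurable_Pair1' assms(1), of x] by simp
  have [measurable]: "(\<lambda>x. k x y) \<in> borel_measurable lborel" for y
    using measurable_compose[OF measurable_Pair2' assms(1), of y] by simp
  have k2: "norm (g y * k x y) \<le> norm (g y)" for x y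
    using k[of x y] mult_left_le[of "norm (k x y)" "norm (g y)"] by (simp add: norm_mult)
  have gi: "integrable lborel (\<lambda>y. g y * k x y)" for x
    by (rule Bochner_Integration.integrable_bound[OF g]) (use k2 in auto)
  have int: "integrable (lborel \<Otimes>\<^sub>M lborel) (\<lambda>(x,y). f x * (g y * k x y))"
  proof (rule lborel_pair.Fubini_integrable)
    show "AE x in lborel. integrable lborel (\<lambda>y. case (x, y) of (x, y) \<Rightarrow> f x * (g y * k x y))"
      using gi by auto
    show "integrable lborel (\<lambda>x. \<integral>y. norm (case (x, y) of (x, y) \<Rightarrow> f x * (g y * k x y)) \<partial>lborel)"
    proof (rule Bochner_Integration.integrable_bound)
      show "integrable lborel (\<lambda>x. norm (f x) * (\<integral>y. norm (g y) \<partial>lborel))"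
        using f by auto
      show "AE x in lborel. norm (\<integral>y. norm (case (x, y) of (x, y) \<Rightarrow> f x * (g y * k x y)) \<partial>lborel)
          \<le> norm (norm (f x) * (\<integral>y. norm (g y) \<partial>lborel))"
      proof (rule AE_I2)
        fix x
        have "(\<integral>y. norm (g y * k x y) \<partial>lborel) \<le> (\<integral>y. norm (g y) \<partial>lborel)"
          using gi g k2 by (intro integral_mono) auto
        then show "norm (\<integral>y. norm (case (x, y) of (x, y) \<Rightarrow> f x * (g y * k x y)) \<partial>lborel)
          \<le> norm (norm (f x) * (\<integral>y. norm (g y) \<partial>lborel))"
          by (simp add: norm_mult mult_left_mono)
      qed
    qed measurable
  qed measurable
  have "(\<integral>x. f x * (\<integral>y. g y * k x y \<partial>lborel) \<partial>lborel)
      = (\<integral>x. (\<integral>y. f x * (g y * k x y) \<partial>lborel) \<partial>lborel)"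
    by simp
  also have "\<dots> = (\<integral>y. (\<integral>x. f x * (g y * k x y) \<partial>lborel) \<partial>lborel)"
    using lborel_pair.Fubini_integral[OF int] by simp
  also have "\<dots> = (\<integral>y. g y * (\<integral>x. f x * k x y \<partial>lborel) \<partial>lborel)"
    by (simp only: mult.left_commute[of "f _"] integral_mult_right_zero)
  finally show ?thesis .
qed

text \<open>This is the characteristic function of the standard normal distribution after the
  substitution x = sqrt d * u.\<close>

lemma gaussian_fourier:
  fixes d y :: real
  assumes "d > 0"
  shows "integrable lborel (\<lambda>u. complex_of_real (exp (- (d * u\<^sup>2 / 2))) * cis (u * y))"
    and "(\<integral>u. complex_of_real (exp (- (d * u\<^sup>2 / 2))) * cis (u * y) \<partial>lborel)
      = of_real (sqrt (2 * pi / d) * exp (- y\<^sup>2 / (2 * d)))"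
proof -
  let ?g = "\<lambda>x. std_normal_density x *\<^sub>R cis (y / sqrt d * x)"
  have c: "(\<integral>x. ?g x \<partial>lborel) = of_real (exp (- (y / sqrt d)\<^sup>2 / 2))"
    using fun_cong[OF char_std_normal_distribution, of "y / sqrt d"]
    by (simp add: char_def integral_density cis_conv_exp)
  have i: "integrable lborel ?g"
    by (rule Bochner_Integration.integrable_bound[OF integrable_normal_density[of 1 0]]) auto
  have e: "complex_of_real (exp (- (d * u\<^sup>2 / 2))) * cis (u * y) = of_real (sqrt (2*pi)) * ?g (0 + sqrt d * u)" for u
    using assms by (simp add: std_normal_density_def scaleR_conv_of_real power_mult_distrib mult_ac)
  show "integrable lborel (\<lambda>u. complex_of_real (exp (- (d * u\<^sup>2 / 2))) * cis (u * y))"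
    unfolding e using assms by (intro integrable_mult_right lborel_integrable_real_affine[OF i, of "sqrt d" 0]) auto
  have "(\<integral>u. complex_of_real (exp (- (d * u\<^sup>2 / 2))) * cis (u * y) \<partial>lborel)
      = of_real (sqrt (2*pi)) * (\<integral>u. ?g (0 + sqrt d * u) \<partial>lborel)"
    unfolding e by (rule integral_mult_right_zero)
  also have "(\<integral>u. ?g (0 + sqrt d * u) \<partial>lborel) = (1 / sqrt d) *\<^sub>R (\<integral>x. ?g x \<partial>lborel)"
    using assms lborel_integral_real_affine[of "sqrt d" ?g 0] by simp
  finally show "(\<integral>u. complex_of_real (exp (- (d * u\<^sup>2 / 2))) * cis (u * y) \<partial>lborel)
      = of_real (sqrt (2 * pi / d) * exp (- y\<^sup>2 / (2 * d)))"
    unfolding c using assms by (simp add: real_sqrt_divide power_divide scaleR_conv_of_real mult_ac)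
qed

text \<open>The kernel is 2 pi times the normal density with mean \<open>u\<close> and variance
  \<open>e\<close>. Its mass is the constant of Plancherel's formula.\<close>

lemma gaussian_integral:
  fixes e :: real
  assumes "e > 0"
  shows "(\<integral>\<^sup>+v. ennreal (sqrt (2 * pi / e) * exp (- (u - v)\<^sup>2 / (2 * e))) \<partial>lborel) = ennreal (2 * pi)"
proof -
  have "sqrt (2 * pi / e) * exp (- (u - v)\<^sup>2 / (2 * e)) = 2 * pi * normal_density u (sqrt e) v" for v
  proof -
    have "sqrt (2 * pi / e) * sqrt (2 * pi * e) = sqrt ((2 * pi)\<^sup>2)"
      using assms by (simp add: power2_eq_square flip: real_sqrt_mult)
    then have "sqrt (2 * pi / e) * sqrt (2 * pi * e) = 2 * pi"
      unfolding real_sqrt_abs using pi_gt_zero by simp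
    then have "sqrt (2 * pi / e) = 2 * pi / sqrt (2 * pi * e)"
      using assms by (simp add: field_simps)
    then show ?thesis
      using assms by (simp add: normal_density_def power2_commute)
  qed
  then have "(\<integral>\<^sup>+v. ennreal (sqrt (2 * pi / e) * exp (- (u - v)\<^sup>2 / (2 * e))) \<partial>lborel)
      = (\<integral>\<^sup>+v. ennreal (2 * pi) * ennreal (normal_density u (sqrt e) v) \<partial>lborel)"
    by (simp add: ennreal_mult)
  also have "\<dots> = ennreal (2 * pi) * ennreal (\<integral>v. normal_density u (sqrt e) v \<partial>lborel)"
    using assms by (subst nn_integral_cmult) (auto simp: nn_integral_eq_integral)
  also have "\<dots> = ennreal (2 * pi)" using assms by simp
  finally show ?thesis .
qed

text \<open>Expanding the square turns the left side into a quadratic form in \<open>g\<close> with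
  the Gaussian kernel \<open>K\<close>; the bound 2 a b <= a^2 + b^2 and the mass 2 pi of
  \<open>K\<close> in each variable then suffice. The weight makes the double integral converge
  absolutely, and the bound is independent of \<open>e\<close>.\<close>

lemma bessel_gaussian:
  fixes g :: "real \<Rightarrow> complex"
  assumes g: "integrable lborel g" and e: "e > 0"
  shows "(\<integral>\<^sup>+t. ennreal ((norm (\<integral>u. g u * cis (u * t) \<partial>lborel))\<^sup>2 * exp (- (e * t\<^sup>2 / 2))) \<partial>lborel)
     \<le> ennreal (2 * pi) * (\<integral>\<^sup>+u. ennreal ((norm (g u))\<^sup>2) \<partial>lborel)"
proof -
  have gm [measurable]: "g \<in> borel_measurable lborel" using g by auto

  define w where "w = (\<lambda>t. complex_of_real (exp (- (e * t\<^sup>2 / 2))))"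
  define K where "K = (\<lambda>x. sqrt (2 * pi / e) * exp (- x\<^sup>2 / (2 * e)))"
  have [measurable]: "w \<in> borel_measurable borel" "K \<in> borel_measurable borel"
    unfolding w_def K_def by measurable
  define \<Phi> where "\<Phi> = (\<lambda>t. \<integral>u. g u * cis (u * t) \<partial>lborel)"
  have [measurable]: "\<Phi> \<in> borel_measurable lborel" unfolding \<Phi>_def by measurable
  define A where "A = (\<integral>u. norm (g u) \<partial>lborel)"
  have gi: "integrable lborel (\<lambda>u. g u * cis (u * t))" for t
    by (rule Bochner_Integration.integrable_bound[OF g]) (auto simp: norm_mult)
  have \<Phi>le: "norm (\<Phi> t) \<le> A" for t
    unfolding \<Phi>_def A_def using integral_norm_bound[of lborel "\<lambda>u. g u * cis (u * t)"]
    by (simp add: norm_mult)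
  have wi: "integrable lborel w"
    using gaussian_fourier(1)[OF e, of 0] by (simp add: w_def)
  have wn: "norm (w t) = exp (- (e * t\<^sup>2 / 2))" for t by (simp add: w_def)
  have "A \<ge> 0" unfolding A_def by simp
  have \<Phi>w: "integrable lborel (\<lambda>t. \<Phi> t * w t)"
  proof (rule Bochner_Integration.integrable_bound)
    show "integrable lborel (\<lambda>t. of_real A * w t)" using wi by auto
    show "AE t in lborel. norm (\<Phi> t * w t) \<le> norm (of_real A * w t)"
      using \<Phi>le \<open>A \<ge> 0\<close> by (auto simp: norm_mult intro!: mult_right_mono)
  qed measurable
  have inner: "(\<integral>t. (\<Phi> t * w t) * cis (- (v * t)) \<partial>lborel) = (\<integral>u. g u * of_real (K (u - v)) \<partial>lborel)" for v
  proof -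
    have wi': "integrable lborel (\<lambda>t. w t * cis (- (v * t)))"
      by (rule Bochner_Integration.integrable_bound[OF wi]) (auto simp: norm_mult)
    have "(\<integral>t. (\<Phi> t * w t) * cis (- (v * t)) \<partial>lborel)
      = (\<integral>t. (w t * cis (- (v * t))) * (\<integral>u. g u * cis (u * t) \<partial>lborel) \<partial>lborel)"
      unfolding \<Phi>_def by (simp add: mult_ac)
    also have "\<dots> = (\<integral>u. g u * (\<integral>t. (w t * cis (- (v * t))) * cis (u * t) \<partial>lborel) \<partial>lborel)"
      by (rule integral_kernel_swap) (use wi' g in auto)
    also have "(\<lambda>u. \<integral>t. (w t * cis (- (v * t))) * cis (u * t) \<partial>lborel)
       = (\<lambda>u. of_real (K (u - v)))"
    proof
      fix u
      have eq: "(\<lambda>t. (w t * cis (- (v * t))) * cis (u * t)) = (\<lambda>t. w t * cis (t * (u - v)))"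
        by (simp add: mult.assoc cis_mult algebra_simps)
      show "(\<integral>t. (w t * cis (- (v * t))) * cis (u * t) \<partial>lborel) = of_real (K (u - v))"
        unfolding eq using gaussian_fourier(2)[OF e, of "u - v"] by (simp add: w_def K_def)
    qed
    finally show ?thesis .
  qed
  have cg: "integrable lborel (\<lambda>v. cnj (g v))" using g by simp
  have eq: "(\<integral>t. (\<Phi> t * w t) * cnj (\<Phi> t) \<partial>lborel)
     = (\<integral>v. cnj (g v) * (\<integral>u. g u * of_real (K (u - v)) \<partial>lborel) \<partial>lborel)"
  proof -
    have "cnj (\<Phi> t) = (\<integral>v. cnj (g v) * cis (- (v * t)) \<partial>lborel)" for t
      unfolding \<Phi>_def using Bochner_Integration.integral_cnj[of lborel "\<lambda>u. g u * cis (u * t)"] by (simp add: cis_cnj)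
    then have "(\<integral>t. (\<Phi> t * w t) * cnj (\<Phi> t) \<partial>lborel)
      = (\<integral>t. (\<Phi> t * w t) * (\<integral>v. cnj (g v) * cis (- (v * t)) \<partial>lborel) \<partial>lborel)" by simp
    also have "\<dots> = (\<integral>v. cnj (g v) * (\<integral>t. (\<Phi> t * w t) * cis (- (v * t)) \<partial>lborel) \<partial>lborel)"
      by (rule integral_kernel_swap) (use \<Phi>w cg in auto)
    finally show ?thesis by (simp add: inner)
  qed
  have K0: "K x \<ge> 0" for x unfolding K_def using e by simp
  have hi: "integrable lborel (\<lambda>t. (norm (\<Phi> t))\<^sup>2 * exp (- (e * t\<^sup>2 / 2)))"
  proof (rule Bochner_Integration.integrable_bound)
    show "integrable lborel (\<lambda>t. of_real (A\<^sup>2) * w t)" using wi by auto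
    show "AE t in lborel. norm ((norm (\<Phi> t))\<^sup>2 * exp (- (e * t\<^sup>2 / 2))) \<le> norm (of_real (A\<^sup>2) * w t)"
      using \<Phi>le by (auto simp: norm_mult norm_power wn intro!: mult_right_mono power_mono order_trans[OF \<Phi>le])
  qed measurable
  define M where "M = (\<integral>\<^sup>+u. ennreal ((norm (g u))\<^sup>2) \<partial>lborel)"
  have conv: "(\<Phi> t * w t) * cnj (\<Phi> t) = of_real ((norm (\<Phi> t))\<^sup>2 * exp (- (e * t\<^sup>2 / 2)))" for t
    unfolding of_real_mult complex_norm_square w_def by (simp only: mult_ac)
  have "(\<integral>\<^sup>+t. ennreal ((norm (\<Phi> t))\<^sup>2 * exp (- (e * t\<^sup>2 / 2))) \<partial>lborel)
      = ennreal (\<integral>t. (norm (\<Phi> t))\<^sup>2 * exp (- (e * t\<^sup>2 / 2)) \<partial>lborel)"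
    using hi by (intro nn_integral_eq_integral) auto
  also have "\<dots> \<le> ennreal (norm (\<integral>t. (\<Phi> t * w t) * cnj (\<Phi> t) \<partial>lborel))"
    by (rule ennreal_leI) (simp only: conv integral_complex_of_real norm_of_real abs_ge_self)
  also have "\<dots> \<le> (\<integral>\<^sup>+v. ennreal (norm (cnj (g v) * (\<integral>u. g u * of_real (K (u - v)) \<partial>lborel))) \<partial>lborel)"
    unfolding eq by (rule norm_integral_le_nn_integral)
  also have "\<dots> \<le> (\<integral>\<^sup>+v. (\<integral>\<^sup>+u. ennreal (norm (g v) * norm (g u) * K (u - v)) \<partial>lborel) \<partial>lborel)"
  proof (rule nn_integral_mono)
    fix v
    have "ennreal (norm (\<integral>u. g u * of_real (K (u - v)) \<partial>lborel))
       \<le> (\<integral>\<^sup>+u. ennreal (norm (g u) * K (u - v)) \<partial>lborel)"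
      using norm_integral_le_nn_integral[of lborel "\<lambda>u. g u * of_real (K (u - v))"] K0
      by (simp add: norm_mult)
    then have "ennreal (norm (cnj (g v) * (\<integral>u. g u * of_real (K (u - v)) \<partial>lborel)))
       \<le> ennreal (norm (g v)) * (\<integral>\<^sup>+u. ennreal (norm (g u) * K (u - v)) \<partial>lborel)"
      by (simp add: norm_mult ennreal_mult mult_left_mono)
    also have "\<dots> = (\<integral>\<^sup>+u. ennreal (norm (g v)) * ennreal (norm (g u) * K (u - v)) \<partial>lborel)"
      by (rule nn_integral_cmult[symmetric]) measurable
    finally show "ennreal (norm (cnj (g v) * (\<integral>u. g u * of_real (K (u - v)) \<partial>lborel)))
       \<le> (\<integral>\<^sup>+u. ennreal (norm (g v) * norm (g u) * K (u - v)) \<partial>lborel)"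
      using K0 by (simp add: mult.assoc ennreal_mult)
  qed
  also have "\<dots> \<le> (\<integral>\<^sup>+v. (\<integral>\<^sup>+u. (ennreal ((norm (g v))\<^sup>2 / 2) * ennreal (K (u - v))
      + ennreal ((norm (g u))\<^sup>2 / 2) * ennreal (K (u - v))) \<partial>lborel) \<partial>lborel)"
  proof (intro nn_integral_mono)
    fix u v
    have "norm (g v) * norm (g u) \<le> (norm (g v))\<^sup>2 / 2 + (norm (g u))\<^sup>2 / 2"
      using sum_squares_bound[of "norm (g v)" "norm (g u)"] by simp
    then have "norm (g v) * norm (g u) * K (u - v) \<le> (norm (g v))\<^sup>2 / 2 * K (u - v) + (norm (g u))\<^sup>2 / 2 * K (u - v)"
      using mult_right_mono[OF _ K0] by (metis distrib_right)
    then show "ennreal (norm (g v) * norm (g u) * K (u - v)) \<le> ennreal ((norm (g v))\<^sup>2 / 2) * ennreal (K (u - v))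
      + ennreal ((norm (g u))\<^sup>2 / 2) * ennreal (K (u - v))"
      using K0 by (simp flip: ennreal_mult ennreal_plus)
  qed
  also have "\<dots> = (\<integral>\<^sup>+v. (\<integral>\<^sup>+u. ennreal ((norm (g v))\<^sup>2 / 2) * ennreal (K (u - v)) \<partial>lborel) \<partial>lborel)
     + (\<integral>\<^sup>+v. (\<integral>\<^sup>+u. ennreal ((norm (g u))\<^sup>2 / 2) * ennreal (K (u - v)) \<partial>lborel) \<partial>lborel)"
    by (simp add: nn_integral_add)
  also have "(\<integral>\<^sup>+v. (\<integral>\<^sup>+u. ennreal ((norm (g u))\<^sup>2 / 2) * ennreal (K (u - v)) \<partial>lborel) \<partial>lborel)
     = (\<integral>\<^sup>+u. (\<integral>\<^sup>+v. ennreal ((norm (g u))\<^sup>2 / 2) * ennreal (K (u - v)) \<partial>lborel) \<partial>lborel)"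
    by (rule lborel_pair.Fubini') measurable
  also have "\<dots> = (\<integral>\<^sup>+u. ennreal ((norm (g u))\<^sup>2 / 2) * ennreal (2 * pi) \<partial>lborel)"
    using gaussian_integral[OF e] by (simp add: nn_integral_cmult K_def)
  also have "(\<integral>\<^sup>+v. (\<integral>\<^sup>+u. ennreal ((norm (g v))\<^sup>2 / 2) * ennreal (K (u - v)) \<partial>lborel) \<partial>lborel)
     = (\<integral>\<^sup>+u. ennreal ((norm (g u))\<^sup>2 / 2) * ennreal (2 * pi) \<partial>lborel)"
    using gaussian_integral[OF e] by (simp add: nn_integral_cmult K_def power2_commute)
  also have "\<dots> + \<dots> = (\<integral>\<^sup>+u. ennreal (2 * pi) * ennreal ((norm (g u))\<^sup>2) \<partial>lborel)"
    by (subst nn_integral_add[symmetric]) (auto simp: mult_ac simp flip: ennreal_mult ennreal_plus distrib_right intro!: nn_integral_cong)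
  also have "\<dots> = ennreal (2 * pi) * M" unfolding M_def by (simp add: nn_integral_cmult)
  finally show ?thesis unfolding \<Phi>_def M_def by simp
qed

section \<open>Inversion with a Gaussian factor and shift of the line of integration\<close>

lemma laplace_gaussian_inversion:
  fixes f :: "real \<Rightarrow> complex" and s t d :: real
  assumes f: "integrable lborel (\<lambda>v. f v * of_real (exp (- (s * v))))" and d: "d > 0"
    and F: "\<And>u. F (Complex s u) = (\<integral>v. f v * exp (- (Complex s u * of_real v)) \<partial>lborel)"
  shows "(\<integral>u. F (Complex s u) * exp (Complex s u * of_real t + of_real (d / 2) * (Complex s u)\<^sup>2) \<partial>lborel)
     = of_real (sqrt (2 * pi / d)) * (\<integral>v. f v * of_real (exp (- (t - v)\<^sup>2 / (2 * d))) \<partial>lborel)"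
proof -
  define G where "G = (\<lambda>u. exp (Complex s u * of_real t + of_real (d / 2) * (Complex s u)\<^sup>2))"
  define c where "c = exp (s * t + d * s\<^sup>2 / 2)"
  have G: "G u = of_real c * (of_real (exp (- (d * u\<^sup>2 / 2))) * cis (u * (t + d * s)))" for u
  proof -
    have "Complex s u * of_real t + of_real (d / 2) * (Complex s u)\<^sup>2
      = of_real (s * t + d * s\<^sup>2 / 2) + of_real (- (d * u\<^sup>2 / 2)) + \<i> * of_real (u * (t + d * s))"
      by (simp add: complex_eq_iff power2_eq_square field_simps)
    then show ?thesis
      unfolding G_def c_def by (simp only: exp_add exp_of_real cis_conv_exp mult.assoc)
  qed
  have Gi: "integrable lborel G"
    unfolding G using gaussian_fourier(1)[OF d] by auto
  have ex: "exp (- (Complex s u * of_real v)) = of_real (exp (- (s * v))) * cis (- (u * v))" for u v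
  proof -
    have "- (Complex s u * of_real v) = of_real (- (s * v)) + \<i> * of_real (- (u * v))"
      by (simp add: complex_eq_iff)
    then show ?thesis by (simp only: exp_add exp_of_real cis_conv_exp)
  qed
  have inner: "(\<integral>u. G u * cis (- (u * v)) \<partial>lborel)
      = of_real (exp (s * v) * sqrt (2 * pi / d) * exp (- (t - v)\<^sup>2 / (2 * d)))" for v
  proof -
    have "G u * cis (- (u * v))
      = of_real c * (of_real (exp (- (d * u\<^sup>2 / 2))) * cis (u * (t - v + d * s)))" for u
      unfolding G by (simp add: mult.assoc cis_mult algebra_simps)
    then have "(\<integral>u. G u * cis (- (u * v)) \<partial>lborel)
      = of_real c * of_real (sqrt (2 * pi / d) * exp (- (t - v + d * s)\<^sup>2 / (2 * d)))"
      using gaussian_fourier(2)[OF d, of "t - v + d * s"] by simp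
    \<comment> \<open>Completing the square: the shift \<open>d * s\<close> produced by the abscissa
      cancels against \<open>c\<close>, up to exp (s v), which meets exp (- s v) below. Hence the
      result does not depend on the abscissa.\<close>
    also have "c * exp (- (t - v + d * s)\<^sup>2 / (2 * d)) = exp (s * v) * exp (- (t - v)\<^sup>2 / (2 * d))"
    proof -
      have "s * t + d * s\<^sup>2 / 2 + - (t - v + d * s)\<^sup>2 / (2 * d) = s * v + - (t - v)\<^sup>2 / (2 * d)"
        using d by (simp add: field_simps power2_eq_square)
      then show ?thesis unfolding c_def by (simp only: exp_add[symmetric])
    qed
    then have "of_real c * of_real (sqrt (2 * pi / d) * exp (- (t - v + d * s)\<^sup>2 / (2 * d)))
      = complex_of_real (exp (s * v) * sqrt (2 * pi / d) * exp (- (t - v)\<^sup>2 / (2 * d)))"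
      by (metis (no_types, opaque_lifting) mult.assoc mult.left_commute of_real_mult)
    finally show ?thesis .
  qed
  have "(\<integral>u. F (Complex s u) * G u \<partial>lborel)
     = (\<integral>u. G u * (\<integral>v. (f v * of_real (exp (- (s * v)))) * cis (- (u * v)) \<partial>lborel) \<partial>lborel)"
    unfolding F ex by (simp add: mult_ac)
  also have "\<dots> = (\<integral>v. (f v * of_real (exp (- (s * v)))) * (\<integral>u. G u * cis (- (u * v)) \<partial>lborel) \<partial>lborel)"
    by (rule integral_kernel_swap) (use f Gi in auto)
  also have "\<dots> = (\<integral>v. of_real (sqrt (2 * pi / d)) * (f v * of_real (exp (- (t - v)\<^sup>2 / (2 * d)))) \<partial>lborel)"
  proof (rule Bochner_Integration.integral_cong)
    fix v
    have "exp (- (s * v)) * exp (s * v) = 1" by (simp flip: exp_add)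
    then have "complex_of_real (exp (- (s * v))) * of_real (exp (s * v)) = 1"
      by (metis of_real_1 of_real_mult)
    then show "(f v * of_real (exp (- (s * v)))) * (\<integral>u. G u * cis (- (u * v)) \<partial>lborel)
      = of_real (sqrt (2 * pi / d)) * (f v * of_real (exp (- (t - v)\<^sup>2 / (2 * d))))"
      unfolding inner by (simp add: mult_ac)
  qed simp
  finally show ?thesis unfolding G_def by simp
qed

text \<open>The Gaussians form an approximate identity. After the substitution v = t - sqrt (d n) *
  z, one integrable function dominates for all \<open>n\<close>, because d n <= 1 and exponential
  growth is integrable against a Gaussian.\<close>

lemma gaussian_smoothing_tendsto:
  fixes f :: "real \<Rightarrow> complex"
  assumes [measurable]: "f \<in> borel_measurable borel"
    and bd: "\<And>v. norm (f v) \<le> C * exp (\<kappa> * \<bar>v\<bar>)" and \<kappa>: "\<kappa> \<ge> 0"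
    and cont: "isCont f t" and d: "\<And>n. d n > 0" "d \<longlonglongrightarrow> 0" "\<And>n. d n \<le> 1"
  shows "(\<lambda>n. of_real (sqrt (2 * pi / d n)) * (\<integral>v. f v * of_real (exp (- (t - v)\<^sup>2 / (2 * d n))) \<partial>lborel))
     \<longlonglongrightarrow> of_real (2 * pi) * f t"
proof -
  define h where "h = (\<lambda>z. C * exp (\<kappa> * \<bar>t\<bar>) * (exp (\<kappa> * z) * std_normal_density z + exp (- \<kappa> * z) * std_normal_density z))"
  have "C \<ge> 0" using order_trans[OF norm_ge_zero bd[of 0]] by simp
  have ei: "integrable lborel (\<lambda>z. exp (a * z) * std_normal_density z)" for a
  proof -
    have "exp (a * z) * std_normal_density z = exp (a\<^sup>2 / 2) * normal_density a 1 z" for z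
      unfolding normal_density_def by (simp add: power2_eq_square field_simps flip: exp_add)
    then show ?thesis by simp
  qed
  have hi: "integrable lborel h"
    unfolding h_def using ei[of \<kappa>] ei[of "-\<kappa>"] by auto
  have eq: "of_real (sqrt (2 * pi / d n)) * (\<integral>v. f v * of_real (exp (- (t - v)\<^sup>2 / (2 * d n))) \<partial>lborel)
    = of_real (2 * pi) * (\<integral>z. f (t + - sqrt (d n) * z) * of_real (std_normal_density z) \<partial>lborel)" for n
  proof -
    have "(\<integral>v. f v * of_real (exp (- (t - v)\<^sup>2 / (2 * d n))) \<partial>lborel)
      = \<bar>- sqrt (d n)\<bar> *\<^sub>R (\<integral>z. f (t + - sqrt (d n) * z) * of_real (exp (- (t - (t + - sqrt (d n) * z))\<^sup>2 / (2 * d n))) \<partial>lborel)"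
      using d(1)[of n] by (intro lborel_integral_real_affine) auto
    also have "(\<lambda>z. f (t + - sqrt (d n) * z) * complex_of_real (exp (- (t - (t + - sqrt (d n) * z))\<^sup>2 / (2 * d n))))
      = (\<lambda>z. of_real (sqrt (2 * pi)) * (f (t + - sqrt (d n) * z) * of_real (std_normal_density z)))"
      using d(1)[of n] by (auto simp: std_normal_density_def power_mult_distrib fun_eq_iff)
    finally have "(\<integral>v. f v * of_real (exp (- (t - v)\<^sup>2 / (2 * d n))) \<partial>lborel)
      = of_real (sqrt (d n) * sqrt (2 * pi)) * (\<integral>z. f (t + - sqrt (d n) * z) * of_real (std_normal_density z) \<partial>lborel)"
      using d(1)[of n] by (simp only: integral_mult_right_zero) (simp add: scaleR_conv_of_real mult.assoc)
    moreover have "sqrt (2 * pi / d n) * (sqrt (d n) * sqrt (2 * pi)) = 2 * pi"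
      using d(1)[of n] by (simp add: real_sqrt_divide)
    ultimately show ?thesis
      by (metis (no_types, lifting) mult.assoc of_real_mult)
  qed
  have "(\<lambda>n. \<integral>z. f (t + - sqrt (d n) * z) * of_real (std_normal_density z) \<partial>lborel)
      \<longlonglongrightarrow> (\<integral>z. f t * of_real (std_normal_density z) \<partial>lborel)"
  proof (rule integral_dominated_convergence[OF _ _ hi])
    have "(\<lambda>n. t + - sqrt (d n) * z) \<longlonglongrightarrow> t + - sqrt 0 * z" for z
      using d(2) by (intro tendsto_intros)
    then have "(\<lambda>n. f (t + - sqrt (d n) * z)) \<longlonglongrightarrow> f t" for z
      using cont by (intro isCont_tendsto_compose[OF cont]) simp
    then show "AE z in lborel. (\<lambda>n. f (t + - sqrt (d n) * z) * of_real (std_normal_density z)) \<longlonglongrightarrow> f t * of_real (std_normal_density z)"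
      by (intro AE_I2 tendsto_mult tendsto_const)
    show "AE z in lborel. norm (f (t + - sqrt (d n) * z) * of_real (std_normal_density z)) \<le> h z" for n
    proof (rule AE_I2)
      fix z
      have "norm (f (t + - sqrt (d n) * z)) \<le> C * exp (\<kappa> * \<bar>t + - sqrt (d n) * z\<bar>)" by (rule bd)
      also have "\<bar>t + - sqrt (d n) * z\<bar> \<le> \<bar>t\<bar> + sqrt (d n) * \<bar>z\<bar>"
        using abs_triangle_ineq[of t "- sqrt (d n) * z"] d(1)[of n] by (simp add: abs_mult)
      also have "sqrt (d n) * \<bar>z\<bar> \<le> 1 * \<bar>z\<bar>"
        using d(3)[of n] by (intro mult_right_mono) auto
      also have "exp (\<kappa> * (\<bar>t\<bar> + 1 * \<bar>z\<bar>)) = exp (\<kappa> * \<bar>t\<bar>) * exp (\<kappa> * \<bar>z\<bar>)"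
        by (simp add: algebra_simps flip: exp_add)
      also have "exp (\<kappa> * \<bar>z\<bar>) \<le> exp (\<kappa> * z) + exp (- \<kappa> * z)"
        by (cases "z \<ge> 0") auto
      finally have "norm (f (t + - sqrt (d n) * z)) \<le> C * (exp (\<kappa> * \<bar>t\<bar>) * (exp (\<kappa> * z) + exp (- \<kappa> * z)))"
        using \<open>C \<ge> 0\<close> \<kappa> by (simp add: mult_left_mono)
      then show "norm (f (t + - sqrt (d n) * z) * of_real (std_normal_density z)) \<le> h z"
        unfolding h_def using mult_right_mono[OF _ normal_density_nonneg[of 0 1 z]]
        by (fastforce simp: norm_mult algebra_simps)
    qed
  qed measurable
  also have "(\<integral>z. f t * of_real (std_normal_density z) \<partial>lborel) = f t"
    by (simp add: integral_complex_of_real)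
  finally show ?thesis unfolding eq by (intro tendsto_mult tendsto_const)
qed

lemma filterlim_gaussian_tail:
  fixes d :: real
  assumes "d > 0"
  shows "((\<lambda>T. exp (- (d * T\<^sup>2))) \<longlongrightarrow> 0) at_top"
  using assms by real_asymp

lemma integrable_exp_Ici:
  fixes a l :: real
  assumes "a > 0"
  shows "integrable lborel (\<lambda>x. indicator {l..} x * exp (- (a * x)))"
proof (rule integrableI_nonneg)
  have "(\<integral>\<^sup>+x. ennreal (exp (- (a * x))) * indicator {l..} x \<partial>lborel) = ennreal (0 - (- exp (- (a * l)) / a))"
  proof (rule nn_integral_FTC_atLeast)
    show "((\<lambda>x. - exp (- (a * x)) / a) has_real_derivative exp (- (a * x))) (at x)" for x
      using assms by (auto intro!: derivative_eq_intros)
    show "((\<lambda>x. - exp (- (a * x)) / a) \<longlongrightarrow> 0) at_top"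
      using assms by real_asymp
  qed auto
  then show "(\<integral>\<^sup>+x. ennreal (indicator {l..} x * exp (- (a * x))) \<partial>lborel) < \<infinity>"
    by (simp add: ennreal_mult' mult.commute ennreal_indicator)
qed auto

lemma continuous_on_vertical:
  assumes "H holomorphic_on {s. Re s > 0}" and "c > 0"
  shows "continuous_on UNIV (\<lambda>u. H (Complex c u))"
proof -
  have "continuous_on UNIV (Complex c)" unfolding Complex_eq by (intro continuous_intros)
  then show ?thesis
    by (rule continuous_on_compose2[OF holomorphic_on_imp_continuous_on[OF assms(1)], of UNIV "Complex c"])
      (use assms(2) in auto)
qed

text \<open>A primitive of \<open>H\<close> on the convex half-plane replaces the contour integral:
  truncated vertical integrals are differences of its values, and two of them differ by increments
  along horizontal segments, which the Gaussian decay sends to 0.\<close>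

lemma vertical_line_shift:
  fixes H :: "complex \<Rightarrow> complex"
  assumes hol: "H holomorphic_on {s. Re s > 0}" and ab: "0 < a" "a \<le> b" and d: "d > 0"
    and bd: "\<And>s. a \<le> Re s \<Longrightarrow> Re s \<le> b \<Longrightarrow> norm (H s) \<le> C * exp (- (d * (Im s)\<^sup>2))"
  shows "(\<integral>u. H (Complex a u) \<partial>lborel) = (\<integral>u. H (Complex b u) \<partial>lborel)"
proof -
  define S where "S = {s. Re s > 0}"
  have S: "convex S" "open S" unfolding S_def by (auto simp: convex_halfspace_Re_gt open_halfspace_Re_gt)
  obtain P where P0: "\<And>x. x \<in> S \<Longrightarrow> (P has_field_derivative H x) (at x within S)"
    by (rule holomorphic_convex_primitive'[OF S hol[folded S_def]]) blast
  have P: "(P has_field_derivative H x) (at x)" if "Re x > 0" for x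
  proof -
    have "x \<in> S" using that by (simp add: S_def)
    then show ?thesis using P0[of x] at_within_open[of x S] S(2) by simp
  qed
  have vert: "((\<lambda>T. \<integral>u. indicator {-T..T} u *\<^sub>R H (Complex c u) \<partial>lborel) \<longlongrightarrow> (\<integral>u. H (Complex c u) \<partial>lborel)) at_top"
    and vertP: "T \<ge> 0 \<Longrightarrow> (\<integral>u. indicator {-T..T} u *\<^sub>R H (Complex c u) \<partial>lborel) = - \<i> * (P (Complex c T) - P (Complex c (- T)))"
    if c: "a \<le> c" "c \<le> b" for c T
  proof -
    have contH: "continuous_on UNIV (\<lambda>u. H (Complex c u))"
      using continuous_on_vertical[OF hol] c ab by auto
    have [measurable]: "(\<lambda>u. H (Complex c u)) \<in> borel_measurable borel"
      using contH by (rule borel_measurable_continuous_onI)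
    have gi: "integrable lborel (\<lambda>u. complex_of_real C * complex_of_real (exp (- (d * u\<^sup>2))))"
      using gaussian_fourier(1)[of "2 * d" 0] d by simp
    have Hi: "integrable lborel (\<lambda>u. H (Complex c u))"
    proof (rule Bochner_Integration.integrable_bound[OF gi])
      show "AE u in lborel. norm (H (Complex c u)) \<le> norm (complex_of_real C * complex_of_real (exp (- (d * u\<^sup>2))))"
      proof (rule AE_I2)
        fix u
        have "norm (H (Complex c u)) \<le> C * exp (- (d * u\<^sup>2))" using bd[of "Complex c u"] c by simp
        also have "\<dots> \<le> \<bar>C\<bar> * exp (- (d * u\<^sup>2))" by (intro mult_right_mono) auto
        finally show "norm (H (Complex c u)) \<le> norm (complex_of_real C * complex_of_real (exp (- (d * u\<^sup>2))))"
          by (simp add: norm_mult)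
      qed
    qed measurable
    show "((\<lambda>T. \<integral>u. indicator {-T..T} u *\<^sub>R H (Complex c u) \<partial>lborel) \<longlongrightarrow> (\<integral>u. H (Complex c u) \<partial>lborel)) at_top"
    proof (rule integral_dominated_convergence_at_top[where w = "\<lambda>u. norm (H (Complex c u))"])
      show "\<forall>\<^sub>F T in at_top. AE u in lborel. norm (indicator {-T..T} u *\<^sub>R H (Complex c u)) \<le> norm (H (Complex c u))"
        by (auto simp: indicator_def)
      show "AE u in lborel. ((\<lambda>T. indicator {-T..T} u *\<^sub>R H (Complex c u)) \<longlongrightarrow> H (Complex c u)) at_top"
      proof (rule AE_I2)
        fix u :: real
        have "\<forall>\<^sub>F T in at_top. T \<ge> \<bar>u\<bar>" by (rule eventually_ge_at_top)
        then have "\<forall>\<^sub>F T in at_top. H (Complex c u) = indicator {-T..T} u *\<^sub>R H (Complex c u)"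
          by eventually_elim (auto simp: indicator_def)
        then show "((\<lambda>T. indicator {-T..T} u *\<^sub>R H (Complex c u)) \<longlongrightarrow> H (Complex c u)) at_top"
          by (rule tendsto_eventually[OF eventually_mono]) simp
      qed
    qed (use Hi in auto)
    assume "T \<ge> 0"
    have "((\<lambda>u. - \<i> * P (Complex c u)) has_vector_derivative H (Complex c u)) (at u within {-T..T})" for u
    proof -
      have l: "((\<lambda>u. Complex c u) has_vector_derivative \<i>) (at u)"
        unfolding Complex_eq has_vector_derivative_def
        by (auto intro!: derivative_eq_intros simp: scaleR_conv_of_real)
      have "((P \<circ> Complex c) has_vector_derivative \<i> * H (Complex c u)) (at u)"
        by (rule field_vector_diff_chain_at[OF l]) (use P[of "Complex c u"] c ab in auto)
      then have "((\<lambda>u. - \<i> * (P \<circ> Complex c) u) has_vector_derivative - \<i> * (\<i> * H (Complex c u))) (at u)"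
        by (rule has_vector_derivative_mult_right)
      moreover have "- \<i> * (\<i> * H (Complex c u)) = H (Complex c u)"
        by (simp add: complex_eq_iff)
      ultimately show ?thesis
        unfolding o_def by (metis has_vector_derivative_at_within)
    qed
    then have "has_bochner_integral lborel (\<lambda>u. indicator {-T..T} u *\<^sub>R H (Complex c u))
        (- \<i> * P (Complex c T) - - \<i> * P (Complex c (- T)))"
      using \<open>T \<ge> 0\<close> by (intro has_bochner_integral_FTC_Icc continuous_on_subset[OF contH]) auto
    then show "(\<integral>u. indicator {-T..T} u *\<^sub>R H (Complex c u) \<partial>lborel) = - \<i> * (P (Complex c T) - P (Complex c (- T)))"
      by (simp add: has_bochner_integral_iff algebra_simps)
  qed
  have hor: "norm (P (Complex a T) - P (Complex b T)) \<le> \<bar>C\<bar> * exp (- (d * T\<^sup>2)) * (b - a)" for T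
  proof -
    have "norm (P (Complex b T) - P (Complex a T)) \<le> (\<bar>C\<bar> * exp (- (d * T\<^sup>2))) * norm (Complex b T - Complex a T)"
    proof (rule field_differentiable_bound[where S = "{s. a \<le> Re s \<and> Re s \<le> b \<and> Im s = T}"])
      show "convex {s. a \<le> Re s \<and> Re s \<le> b \<and> Im s = T}"
      proof -
        have "{s. a \<le> Re s \<and> Re s \<le> b \<and> Im s = T} = {s. Re s \<ge> a} \<inter> {s. Re s \<le> b} \<inter> ({s. Im s \<ge> T} \<inter> {s. Im s \<le> T})"
          by auto
        then show ?thesis
          by (auto intro!: convex_Int convex_halfspace_Re_ge convex_halfspace_Re_le convex_halfspace_Im_ge convex_halfspace_Im_le)
      qed
      fix z assume z: "z \<in> {s. a \<le> Re s \<and> Re s \<le> b \<and> Im s = T}"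
      show "(P has_field_derivative H z) (at z within {s. a \<le> Re s \<and> Re s \<le> b \<and> Im s = T})"
        using P[of z] z ab by (auto intro: has_field_derivative_at_within)
      have "norm (H z) \<le> C * exp (- (d * (Im z)\<^sup>2))" using bd z by auto
      also have "\<dots> \<le> \<bar>C\<bar> * exp (- (d * T\<^sup>2))" using z by (auto intro: mult_right_mono)
      finally show "norm (H z) \<le> \<bar>C\<bar> * exp (- (d * T\<^sup>2))" .
    qed (use ab in auto)
    moreover have "norm (Complex b T - Complex a T) = b - a" using ab by (simp add: cmod_def)
    ultimately show ?thesis by (simp add: norm_minus_commute)
  qed
  let ?D = "\<lambda>T. (\<integral>u. indicator {-T..T} u *\<^sub>R H (Complex a u) \<partial>lborel) - (\<integral>u. indicator {-T..T} u *\<^sub>R H (Complex b u) \<partial>lborel)"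
  have "(?D \<longlongrightarrow> 0) at_top"
  proof (rule Lim_null_comparison)
    show "\<forall>\<^sub>F T in at_top. norm (?D T) \<le> 2 * (\<bar>C\<bar> * exp (- (d * T\<^sup>2)) * (b - a))"
    proof (rule eventually_mono[OF eventually_ge_at_top[of 0]])
      fix T :: real assume T: "0 \<le> T"
      have "?D T = - \<i> * ((P (Complex a T) - P (Complex b T)) - (P (Complex a (- T)) - P (Complex b (- T))))"
      proof -
        have v: "(\<integral>u. indicator {-T..T} u *\<^sub>R H (Complex a u) \<partial>lborel) = - \<i> * (P (Complex a T) - P (Complex a (- T)))"
          "(\<integral>u. indicator {-T..T} u *\<^sub>R H (Complex b u) \<partial>lborel) = - \<i> * (P (Complex b T) - P (Complex b (- T)))"
          using vertP T ab by auto
        show ?thesis unfolding v by (simp add: algebra_simps)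
      qed
      then have "norm (?D T) = norm ((P (Complex a T) - P (Complex b T)) - (P (Complex a (- T)) - P (Complex b (- T))))"
        by (simp add: norm_mult)
      also have "\<dots> \<le> norm (P (Complex a T) - P (Complex b T)) + norm (P (Complex a (- T)) - P (Complex b (- T)))"
        by (rule norm_triangle_ineq4)
      finally show "norm (?D T) \<le> 2 * (\<bar>C\<bar> * exp (- (d * T\<^sup>2)) * (b - a))"
        using hor[of T] hor[of "-T"] by simp
    qed
    show "((\<lambda>T. 2 * (\<bar>C\<bar> * exp (- (d * T\<^sup>2)) * (b - a))) \<longlongrightarrow> 0) at_top"
      using tendsto_mult_right[OF filterlim_gaussian_tail[OF d], of "2 * \<bar>C\<bar> * (b - a)"] by (simp only: mult_ac mult_zero_right mult_zero_left)
  qed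
  moreover have "(?D \<longlongrightarrow> (\<integral>u. H (Complex a u) \<partial>lborel) - (\<integral>u. H (Complex b u) \<partial>lborel)) at_top"
    using ab by (intro tendsto_diff vert) auto
  ultimately show ?thesis using tendsto_unique trivial_limit_at_top_linorder by force
qed

text \<open>The growth bound makes the transform converge for Re s > \<kappa>, and it is used at Re
  s = 1; the mean square is controlled arbitrarily close to Re s = 0. For each \<open>n\<close>, a
  Gaussian with parameter \<open>d n\<close> allows the shift from abscissa 1 to abscissa
  \<open>d n\<close>, and the Bessel bound is uniform in \<open>n\<close>. Abscissa and parameter
  tend to 0 together, and Fatou's lemma at the points of continuity of \<open>f\<close>
  concludes.\<close>

theorem laplace_L2_bound:
  fixes f :: "real \<Rightarrow> complex" and F :: "complex \<Rightarrow> complex"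
  assumes fm [measurable]: "f \<in> borel_measurable borel"
    and bd: "\<And>v. norm (f v) \<le> C * exp (\<kappa> * v)" and neg: "\<And>v. v < 0 \<Longrightarrow> f v = 0"
    and \<kappa>: "0 < \<kappa>" "\<kappa> < 1"
    and cont: "AE t in lborel. isCont f t"
    and hol: "F holomorphic_on {s. Re s > 0}"
    and F: "\<And>s. Re s = 1 \<Longrightarrow> F s = (\<integral>v. f v * exp (- (s * of_real v)) \<partial>lborel)"
    and Fb: "\<And>a. 0 < a \<Longrightarrow> \<exists>B. \<forall>s. a \<le> Re s \<and> Re s \<le> 1 \<longrightarrow> norm (F s) \<le> B"
    and K: "\<And>\<sigma>. 0 < \<sigma> \<Longrightarrow> \<sigma> \<le> 1 \<Longrightarrow> (\<integral>\<^sup>+u. ennreal ((norm (F (Complex \<sigma> u)))\<^sup>2) \<partial>lborel) \<le> ennreal K"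
  shows "(\<integral>\<^sup>+t. ennreal ((norm (f t))\<^sup>2) \<partial>lborel) < \<infinity>"
proof -
  define d where "d = (\<lambda>n::nat. 1 / real (Suc n))"
  have d: "d n > 0" "d n \<le> 1" for n unfolding d_def by (auto simp: divide_simps)
  have d0: "d \<longlonglongrightarrow> 0" unfolding d_def by (rule LIMSEQ_Suc[OF lim_1_over_n])
  have "C \<ge> 0" using order_trans[OF norm_ge_zero bd[of 0]] by simp
  have fi: "integrable lborel (\<lambda>v. f v * of_real (exp (- (1 * v))))"
  proof (rule Bochner_Integration.integrable_bound)
    show "integrable lborel (\<lambda>v. C * (indicator {0..} v * exp (- ((1 - \<kappa>) * v))))"
      using integrable_exp_Ici[of "1 - \<kappa>" 0] \<kappa> by simp
    show "AE v in lborel. norm (f v * of_real (exp (- (1 * v)))) \<le> norm (C * (indicator {0..} v * exp (- ((1 - \<kappa>) * v))))"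
    proof (rule AE_I2)
      fix v
      have "norm (f v * of_real (exp (- (1 * v)))) \<le> C * exp (\<kappa> * v) * exp (- v)"
        using bd[of v] by (simp add: norm_mult mult_right_mono)
      also have "\<dots> = C * exp (- ((1 - \<kappa>) * v))" by (simp add: algebra_simps flip: exp_add)
      finally show "norm (f v * of_real (exp (- (1 * v)))) \<le> norm (C * (indicator {0..} v * exp (- ((1 - \<kappa>) * v))))"
        using neg[of v] \<kappa> \<open>C \<ge> 0\<close> by (cases "v < 0") (auto simp: abs_mult)
    qed
  qed measurable
  define J where "J = (\<lambda>n t. of_real (sqrt (2 * pi / d n)) * (\<integral>v. f v * of_real (exp (- (t - v)\<^sup>2 / (2 * d n))) \<partial>lborel))"
  have [measurable]: "J n \<in> borel_measurable borel" for n unfolding J_def by measurable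
  define g where "g = (\<lambda>n u. F (Complex (d n) u) * exp (of_real (d n / 2) * (Complex (d n) u)\<^sup>2))"
  have FmC: "continuous_on UNIV (\<lambda>u. F (Complex a u))" if "a > 0" for a
    using continuous_on_vertical[OF hol that] .
  have ne: "norm (exp (of_real (e / 2) * s\<^sup>2)) = exp (e * (Re s)\<^sup>2 / 2) * exp (- (e / 2 * (Im s)\<^sup>2))" for e and s :: complex
    by (simp add: Re_power2 algebra_simps diff_divide_distrib flip: exp_add)
  have gi: "integrable lborel (g n)" for n
  proof -
    obtain B where B: "\<And>s. d n \<le> Re s \<Longrightarrow> Re s \<le> 1 \<Longrightarrow> norm (F s) \<le> B" using Fb d by meson
    have "B \<ge> 0" using order_trans[OF norm_ge_zero B[of 1]] d[of n] by simp
    show ?thesis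
    proof (rule Bochner_Integration.integrable_bound)
      show "integrable lborel (\<lambda>u. complex_of_real (B * exp (d n * (d n)\<^sup>2 / 2)) * complex_of_real (exp (- (d n / 2 * u\<^sup>2))))"
        using gaussian_fourier(1)[of "d n" 0] d by simp
      show "g n \<in> borel_measurable lborel"
        unfolding g_def using FmC[OF d(1)]
        by (auto simp: Complex_eq intro!: borel_measurable_continuous_onI continuous_intros)
      show "AE u in lborel. norm (g n u) \<le> norm (complex_of_real (B * exp (d n * (d n)\<^sup>2 / 2)) * complex_of_real (exp (- (d n / 2 * u\<^sup>2))))"
        unfolding g_def norm_mult ne using B d \<open>B \<ge> 0\<close>
        by (auto simp: norm_mult mult.assoc intro!: mult_right_mono)
    qed
  qed
  have Jg: "J n t = exp (of_real (d n * t)) * (\<integral>u. g n u * cis (u * t) \<partial>lborel)" for n t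
  proof -
    define H where "H = (\<lambda>s. F s * exp (s * of_real t + of_real (d n / 2) * s\<^sup>2))"
    obtain B where B: "\<And>s. d n \<le> Re s \<Longrightarrow> Re s \<le> 1 \<Longrightarrow> norm (F s) \<le> B" using Fb d by meson
    have "B \<ge> 0" using order_trans[OF norm_ge_zero B[of 1]] d[of n] by simp
    have "J n t = (\<integral>u. H (Complex 1 u) \<partial>lborel)"
      unfolding H_def J_def
      by (rule laplace_gaussian_inversion[symmetric]) (use fi d F in auto)
    also have "\<dots> = (\<integral>u. H (Complex (d n) u) \<partial>lborel)"
    proof (rule vertical_line_shift[symmetric])
      show "H holomorphic_on {s. Re s > 0}" unfolding H_def using hol by (intro holomorphic_intros)
      show "norm (H s) \<le> (B * exp \<bar>t\<bar> * exp (d n / 2)) * exp (- (d n / 2 * (Im s)\<^sup>2))"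
        if s: "d n \<le> Re s" "Re s \<le> 1" for s
      proof -
        have "Re s * t \<le> Re s * \<bar>t\<bar>" using s d(1)[of n] by (intro mult_left_mono) auto
        then have "Re s * t \<le> \<bar>t\<bar>"
          using s d(1)[of n] mult_left_mono[of t "\<bar>t\<bar>" "Re s"] mult_right_mono[of "Re s" 1 "\<bar>t\<bar>"] by linarith
        then have e1: "norm (exp (s * of_real t)) \<le> exp \<bar>t\<bar>" by simp
        have "(Re s)\<^sup>2 \<le> 1" using s d[of n] by (simp add: power_le_one)
        then have "exp (d n * (Re s)\<^sup>2 / 2) \<le> exp (d n / 2)"
          using d[of n] mult_left_mono[of "(Re s)\<^sup>2" 1 "d n"] by simp
        then have e2: "norm (exp (of_real (d n / 2) * s\<^sup>2)) \<le> exp (d n / 2) * exp (- (d n / 2 * (Im s)\<^sup>2))"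
          unfolding ne by (intro mult_right_mono) auto
        have "norm (H s) = norm (F s) * (norm (exp (s * of_real t)) * norm (exp (of_real (d n / 2) * s\<^sup>2)))"
          unfolding H_def exp_add by (simp only: norm_mult)
        also have "\<dots> \<le> B * (exp \<bar>t\<bar> * (exp (d n / 2) * exp (- (d n / 2 * (Im s)\<^sup>2))))"
          using \<open>B \<ge> 0\<close> by (intro mult_mono B s e1 e2) auto
        finally show ?thesis by (simp only: mult.assoc)
      qed
    qed (use d in auto)
    also have "\<dots> = (\<integral>u. exp (of_real (d n * t)) * (g n u * cis (u * t)) \<partial>lborel)"
    proof (rule Bochner_Integration.integral_cong[OF refl])
      fix u
      have "Complex (d n) u * of_real t = of_real (d n * t) + \<i> * of_real (u * t)" by (simp add: complex_eq_iff)
      then show "H (Complex (d n) u) = exp (of_real (d n * t)) * (g n u * cis (u * t))"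
        unfolding H_def g_def by (simp only: exp_add cis_conv_exp mult_ac)
    qed
    finally show ?thesis by simp
  qed
  \<comment> \<open>The first exponential undoes the factor exp (d n * t) that the abscissa
    \<open>d n\<close> puts into \<open>J n t\<close>, the second is the weight of the Bessel bound;
    both tend to 1 for fixed \<open>t\<close>.\<close>
  define k where "k = (\<lambda>n t. (norm (J n t))\<^sup>2 * exp (- (2 * (d n * t))) * exp (- (d n * t\<^sup>2 / 2)))"
  have kle: "(\<integral>\<^sup>+t. ennreal (k n t) \<partial>lborel) \<le> ennreal (2 * pi * exp 1 * K)" for n
  proof -
    have "k n t = (norm (\<integral>u. g n u * cis (u * t) \<partial>lborel))\<^sup>2 * exp (- (d n * t\<^sup>2 / 2))" for t
    proof -
      have "(exp (d n * t))\<^sup>2 * exp (- (2 * (d n * t))) = 1"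
        by (simp add: power2_eq_square flip: exp_add)
      then show ?thesis unfolding k_def Jg by (simp add: norm_mult power_mult_distrib)
    qed
    then have "(\<integral>\<^sup>+t. ennreal (k n t) \<partial>lborel) \<le> ennreal (2 * pi) * (\<integral>\<^sup>+u. ennreal ((norm (g n u))\<^sup>2) \<partial>lborel)"
      using bessel_gaussian[OF gi d(1)] by simp
    also have "(\<integral>\<^sup>+u. ennreal ((norm (g n u))\<^sup>2) \<partial>lborel) \<le> (\<integral>\<^sup>+u. ennreal (exp 1) * ennreal ((norm (F (Complex (d n) u)))\<^sup>2) \<partial>lborel)"
    proof (rule nn_integral_mono)
      fix u
      \<comment> \<open>At abscissa \<open>d n\<close> the Gaussian factor has norm at most exp
        (1/2); squaring gives the factor exp 1.\<close>
      have "d n * (d n)\<^sup>2 \<le> 1 * 1" using d[of n] by (intro mult_mono power_le_one) auto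
      then have "exp (d n * (d n)\<^sup>2 / 2) * exp (- (d n / 2 * u\<^sup>2)) \<le> exp (1/2) * 1"
        using d(1)[of n] by (intro mult_mono) auto
      then have "(exp (d n * (d n)\<^sup>2 / 2) * exp (- (d n / 2 * u\<^sup>2)))\<^sup>2 \<le> (exp (1/2))\<^sup>2"
        by (intro power_mono) auto
      also have "\<dots> = exp (1::real)" by (simp add: power2_eq_square flip: exp_add)
      finally have "(norm (g n u))\<^sup>2 \<le> exp 1 * (norm (F (Complex (d n) u)))\<^sup>2"
        unfolding g_def norm_mult ne power_mult_distrib[of "norm (F _)"] by (subst mult.commute) (simp add: mult_right_mono)
      then show "ennreal ((norm (g n u))\<^sup>2) \<le> ennreal (exp 1) * ennreal ((norm (F (Complex (d n) u)))\<^sup>2)"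
        by (simp flip: ennreal_mult)
    qed
    also have "\<dots> = ennreal (exp 1) * (\<integral>\<^sup>+u. ennreal ((norm (F (Complex (d n) u)))\<^sup>2) \<partial>lborel)"
    proof (rule nn_integral_cmult)
      have "(\<lambda>u. F (Complex (d n) u)) \<in> borel_measurable borel" using FmC[OF d(1)] by (rule borel_measurable_continuous_onI)
      then show "(\<lambda>u. ennreal ((norm (F (Complex (d n) u)))\<^sup>2)) \<in> borel_measurable lborel" by measurable
    qed
    also have "\<dots> \<le> ennreal (exp 1) * ennreal K"
      using K[OF d] by (intro mult_left_mono) auto
    finally show ?thesis
      by (simp add: mult_left_mono ennreal_mult' mult.assoc flip: ennreal_mult'')
  qed
  have conv: "AE t in lborel. (\<lambda>n. ennreal (k n t)) \<longlonglongrightarrow> ennreal ((2 * pi)\<^sup>2 * (norm (f t))\<^sup>2)"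
    using cont
  proof eventually_elim
    fix t assume t: "isCont f t"
    have "(\<lambda>n. J n t) \<longlonglongrightarrow> of_real (2 * pi) * f t"
      unfolding J_def
    proof (rule gaussian_smoothing_tendsto[where \<kappa> = \<kappa> and C = C])
      show "norm (f v) \<le> C * exp (\<kappa> * \<bar>v\<bar>)" for v
        using bd[of v] neg[of v] \<open>C \<ge> 0\<close> by (cases "v < 0") auto
    qed (use \<kappa> t d d0 in auto)
    then have "(\<lambda>n. k n t) \<longlonglongrightarrow> (norm (of_real (2 * pi) * f t))\<^sup>2 * exp (- (2 * (0 * t))) * exp (- (0 * t\<^sup>2 / 2))"
      unfolding k_def using d0 by (intro tendsto_intros) auto
    then show "(\<lambda>n. ennreal (k n t)) \<longlonglongrightarrow> ennreal ((2 * pi)\<^sup>2 * (norm (f t))\<^sup>2)"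
      by (intro tendsto_ennrealI) (simp add: norm_mult power_mult_distrib)
  qed
  have [measurable]: "k n \<in> borel_measurable borel" for n unfolding k_def by measurable
  have "ennreal ((2 * pi)\<^sup>2) * (\<integral>\<^sup>+t. ennreal ((norm (f t))\<^sup>2) \<partial>lborel) = (\<integral>\<^sup>+t. ennreal ((2 * pi)\<^sup>2 * (norm (f t))\<^sup>2) \<partial>lborel)"
    by (subst nn_integral_cmult[symmetric]) (auto simp flip: ennreal_mult)
  also have "\<dots> = (\<integral>\<^sup>+t. liminf (\<lambda>n. ennreal (k n t)) \<partial>lborel)"
    by (rule nn_integral_cong_AE) (use conv in \<open>auto elim!: eventually_mono dest!: lim_imp_Liminf[rotated]\<close>)
  also have "\<dots> \<le> liminf (\<lambda>n. \<integral>\<^sup>+t. ennreal (k n t) \<partial>lborel)"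
    by (rule nn_integral_liminf) measurable
  also have "\<dots> \<le> ennreal (2 * pi * exp 1 * K)"
    using kle by (intro Liminf_le) auto
  finally have le: "ennreal ((2 * pi)\<^sup>2) * (\<integral>\<^sup>+t. ennreal ((norm (f t))\<^sup>2) \<partial>lborel) \<le> ennreal (2 * pi * exp 1 * K)" .
  then have "ennreal ((2 * pi)\<^sup>2) * (\<integral>\<^sup>+t. ennreal ((norm (f t))\<^sup>2) \<partial>lborel) < \<infinity>"
    using le_less_trans ennreal_less_top by force
  then show ?thesis by (auto simp: ennreal_mult_less_top)
qed

section \<open>Polynomial growth in vertical strips\<close>

text \<open>The factor exp (\<eta> s^2) decays like exp (- \<eta> (Im s)^2) and beats the growth exp
  (D |Im s|), so the maximum principle applies on a tall rectangle; then \<eta> tends to 0. The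
  summand \<eta> in the auxiliary bound covers the horizontal edges, also when \<open>M\<close> is
  0.\<close>

lemma phragmen_lindelof_strip:
  fixes f :: "complex \<Rightarrow> complex"
  assumes hol: "f holomorphic_on S" and S: "{s. a \<le> Re s \<and> Re s \<le> b} \<subseteq> S"
    and growth: "\<And>s. a \<le> Re s \<Longrightarrow> Re s \<le> b \<Longrightarrow> \<bar>Im s\<bar> \<ge> T \<Longrightarrow> norm (f s) \<le> C * exp (D * \<bar>Im s\<bar>)"
    and edge: "\<And>s. Re s = a \<or> Re s = b \<Longrightarrow> norm (f s) \<le> M"
    and s: "a \<le> Re s" "Re s \<le> b"
  shows "norm (f s) \<le> M"
proof -
  have M0: "M \<ge> 0" using order_trans[OF norm_ge_zero edge[of "Complex a 0"]] by simp
  define m where "m = max \<bar>a\<bar> \<bar>b\<bar>"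
  have rm: "(Re w)\<^sup>2 \<le> m\<^sup>2" if "a \<le> Re w" "Re w \<le> b" for w
    using that by (intro abs_le_square_iff[THEN iffD1]) (auto simp: m_def)
  have *: "norm (f s) * norm (exp (of_real \<eta> * s\<^sup>2)) \<le> (M + \<eta>) * exp (\<eta> * m\<^sup>2)" if \<eta>: "\<eta> > 0" for \<eta>
  proof -
    define F where "F = (\<lambda>w. f w * exp (of_real \<eta> * w\<^sup>2))"
    have ne: "norm (exp (of_real \<eta> * w\<^sup>2)) = exp (\<eta> * ((Re w)\<^sup>2 - (Im w)\<^sup>2))" for w
      by (simp add: Re_power2)
    have "filterlim (\<lambda>\<tau>. D * \<tau> - \<eta> * \<tau>\<^sup>2) at_bot at_top"
      using \<eta> by real_asymp
    from tendsto_mult_left[OF filterlim_compose[OF exp_at_bot this], of "\<bar>C\<bar>"]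
    have "((\<lambda>\<tau>. \<bar>C\<bar> * exp (D * \<tau>) * exp (- (\<eta> * \<tau>\<^sup>2))) \<longlongrightarrow> 0) at_top"
      by (simp add: mult.assoc flip: exp_add)
    then have "\<forall>\<^sub>F \<tau> in at_top. \<bar>C\<bar> * exp (D * \<tau>) * exp (- (\<eta> * \<tau>\<^sup>2)) < \<eta>"
      using \<eta> by (rule order_tendstoD)
    then have "\<forall>\<^sub>F \<tau> in at_top. \<bar>C\<bar> * exp (D * \<tau>) * exp (- (\<eta> * \<tau>\<^sup>2)) < \<eta> \<and> \<tau> \<ge> T \<and> \<tau> \<ge> \<bar>Im s\<bar> \<and> \<tau> \<ge> 0"
      by (intro eventually_conj eventually_ge_at_top)
    then obtain \<tau> where \<tau>: "\<bar>C\<bar> * exp (D * \<tau>) * exp (- (\<eta> * \<tau>\<^sup>2)) < \<eta>" "\<tau> \<ge> T" "\<tau> \<ge> \<bar>Im s\<bar>" "\<tau> \<ge> 0"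
      using eventually_happens[of _ "at_top :: real filter"] by force
    define X where "X = cbox (Complex a (-\<tau>)) (Complex b \<tau>)"
    have X: "w \<in> X \<longleftrightarrow> a \<le> Re w \<and> Re w \<le> b \<and> -\<tau> \<le> Im w \<and> Im w \<le> \<tau>" for w
      by (auto simp: X_def in_cbox_complex_iff)
    have "X \<subseteq> S" using S X by auto
    then have Fh: "F holomorphic_on X" unfolding F_def
      by (intro holomorphic_intros holomorphic_on_subset[OF hol])
    have "norm (F s) \<le> (M + \<eta>) * exp (\<eta> * m\<^sup>2)"
    proof (rule maximum_modulus_frontier[where S = X and f = F and \<xi> = s])
      show "F holomorphic_on interior X" by (rule holomorphic_on_subset[OF Fh interior_subset])
      show "continuous_on (closure X) F" using Fh by (simp add: X_def holomorphic_on_imp_continuous_on)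
      show "bounded X" by (simp add: X_def)
      show "s \<in> X" using s \<tau> by (auto simp: X)
      fix w assume "w \<in> frontier X"
      then have w: "w \<in> X" "w \<notin> box (Complex a (-\<tau>)) (Complex b \<tau>)"
        by (auto simp: X_def frontier_def interior_cbox)
      then have "Re w = a \<or> Re w = b \<or> \<bar>Im w\<bar> = \<tau>" by (auto simp: X in_box_complex_iff)
      then show "norm (F w) \<le> (M + \<eta>) * exp (\<eta> * m\<^sup>2)"
      proof (cases "\<bar>Im w\<bar> = \<tau>")
        case True
        have e: "exp (\<eta> * ((Re w)\<^sup>2 - (Im w)\<^sup>2)) \<le> exp (\<eta> * m\<^sup>2) * exp (- (\<eta> * \<tau>\<^sup>2))"
        proof -
          have "(Im w)\<^sup>2 = \<tau>\<^sup>2" using True by (metis power2_abs)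
          moreover have "\<eta> * (Re w)\<^sup>2 \<le> \<eta> * m\<^sup>2" using rm w \<eta> by (intro mult_left_mono) (auto simp: X)
          ultimately show ?thesis by (simp add: right_diff_distrib flip: exp_add)
        qed
        have "norm (f w) \<le> C * exp (D * \<tau>)" using growth[of w] w \<tau> True by (auto simp: X)
        moreover have "C * exp (D * \<tau>) \<le> \<bar>C\<bar> * exp (D * \<tau>)" by (intro mult_right_mono) auto
        ultimately have "norm (f w) \<le> \<bar>C\<bar> * exp (D * \<tau>)" by linarith
        then have "norm (F w) \<le> (\<bar>C\<bar> * exp (D * \<tau>)) * (exp (\<eta> * m\<^sup>2) * exp (- (\<eta> * \<tau>\<^sup>2)))"
          unfolding F_def norm_mult ne using e by (intro mult_mono) auto
        also have "\<dots> = (\<bar>C\<bar> * exp (D * \<tau>) * exp (- (\<eta> * \<tau>\<^sup>2))) * exp (\<eta> * m\<^sup>2)" by (simp only: mult_ac)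
        also have "\<dots> \<le> (M + \<eta>) * exp (\<eta> * m\<^sup>2)" using \<tau>(1) M0 by (intro mult_right_mono) auto
        finally show ?thesis .
      next
        case False
        then have "Re w = a \<or> Re w = b" using \<open>Re w = a \<or> Re w = b \<or> \<bar>Im w\<bar> = \<tau>\<close> by blast
        then have "norm (f w) \<le> M" by (rule edge)
        moreover have "exp (\<eta> * ((Re w)\<^sup>2 - (Im w)\<^sup>2)) \<le> exp (\<eta> * m\<^sup>2)"
        proof -
          have "(Re w)\<^sup>2 \<le> m\<^sup>2" using rm[of w] w by (auto simp: X)
          then have "(Re w)\<^sup>2 - (Im w)\<^sup>2 \<le> m\<^sup>2" using zero_le_power2[of "Im w"] by linarith
          then show ?thesis using \<eta> by simp
        qed
        ultimately have "norm (F w) \<le> M * exp (\<eta> * m\<^sup>2)"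
          unfolding F_def norm_mult ne using M0 by (intro mult_mono) auto
        also have "\<dots> \<le> (M + \<eta>) * exp (\<eta> * m\<^sup>2)" using \<eta> by (intro mult_right_mono) auto
        finally show ?thesis .
      qed
    qed
    then show ?thesis by (simp add: F_def norm_mult)
  qed
  have "((\<lambda>\<eta>. norm (f s) * norm (exp (of_real \<eta> * s\<^sup>2))) \<longlongrightarrow> norm (f s) * norm (exp (of_real 0 * s\<^sup>2))) (at_right 0)"
    by (intro tendsto_intros)
  moreover have "((\<lambda>\<eta>. (M + \<eta>) * exp (\<eta> * m\<^sup>2)) \<longlongrightarrow> (M + 0) * exp (0 * m\<^sup>2)) (at_right 0)"
    by (intro tendsto_intros)
  moreover have "\<forall>\<^sub>F \<eta> in at_right 0. norm (f s) * norm (exp (of_real \<eta> * s\<^sup>2)) \<le> (M + \<eta>) * exp (\<eta> * m\<^sup>2)"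
    using * by (auto simp: eventually_at_filter)
  ultimately show ?thesis
    using tendsto_le[OF trivial_limit_at_right_real] by (fastforce)
qed

section \<open>Growth of the Gamma function and its reciprocal in vertical strips\<close>

lemma norm_Gamma_le:
  assumes "Re z > 0"
  shows "norm (Gamma z) \<le> Gamma (Re z)"
proof -
  have "norm (integral {0..} (\<lambda>t. complex_of_real t powr (z - 1) / of_real (exp t)))
      \<le> integral {0..} (\<lambda>t. t powr (Re z - 1) / exp t)"
  proof (rule integral_norm_bound_integral)
    show "(\<lambda>t. complex_of_real t powr (z - 1) / of_real (exp t)) integrable_on {0..}"
      using Gamma_integral_complex[OF assms] by (rule has_integral_integrable)
    show "(\<lambda>t. t powr (Re z - 1) / exp t) integrable_on {0..}"
      using Gamma_integral_real[OF assms] by (rule has_integral_integrable)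
    fix t :: real assume "t \<in> {0..}"
    then show "norm (complex_of_real t powr (z - 1) / of_real (exp t)) \<le> t powr (Re z - 1) / exp t"
      by (simp add: norm_divide norm_powr_real_powr)
  qed
  then show ?thesis
    using Gamma_integral_complex[OF assms] Gamma_integral_real[OF assms] by (simp add: integral_unique)
qed

lemma norm_sin_le_exp: "norm (sin z) \<le> exp \<bar>Im z\<bar>"
proof -
  have "norm (sin z) \<le> (norm (exp (\<i> * z)) + norm (exp (- (\<i> * z)))) / 2"
    unfolding sin_exp_eq using norm_triangle_ineq4[of "exp (\<i> * z)" "exp (- (\<i> * z))"]
    by (simp add: norm_divide norm_mult)
  also have "\<dots> \<le> exp \<bar>Im z\<bar>"
  proof -
    have "norm (exp (\<i> * z)) = exp (- Im z)" "norm (exp (- (\<i> * z))) = exp (Im z)" by simp_all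
    moreover have "exp (- Im z) + exp (Im z) \<le> exp \<bar>Im z\<bar> + exp \<bar>Im z\<bar>" by (intro add_mono) auto
    ultimately show ?thesis by simp
  qed
  finally show ?thesis .
qed

text \<open>After a shift to the left by \<open>K\<close>, the reflection formula writes the
  reciprocal as a sine times Gamma (1 - w), with 1 - w in a strip where Euler's integral bounds
  Gamma; the sine accounts for exp (pi |Im z|).\<close>

lemma rGamma_vertical_bound:
  fixes a b :: real
  shows "\<exists>C\<ge>0. \<forall>z. a \<le> Re z \<and> Re z \<le> b \<and> \<bar>Im z\<bar> \<ge> 1 \<longrightarrow> norm (rGamma z) \<le> C * exp (pi * \<bar>Im z\<bar>)"
proof -
  obtain K :: nat where K: "real K > b" using reals_Archimedean2 by blast
  have "continuous_on {1 - b + K..1 - a + K} (Gamma :: real \<Rightarrow> real)"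
    using K by (intro continuous_intros) (auto elim!: nonpos_Ints_cases)
  then have "bounded (Gamma ` {1 - b + K..1 - a + K})"
    by (intro compact_imp_bounded compact_continuous_image) auto
  then obtain C where C: "\<forall>x\<in>{1 - b + K..1 - a + K}. norm (Gamma x) \<le> C"
    unfolding bounded_iff by auto
  have "norm (rGamma z) \<le> \<bar>C\<bar> * exp (pi * \<bar>Im z\<bar>)" if z: "a \<le> Re z" "Re z \<le> b" "\<bar>Im z\<bar> \<ge> 1" for z
  proof -
    define w where "w = z - of_nat K"
    have "rGamma w = pochhammer w K * rGamma z"
      using pochhammer_rGamma[of w K] by (simp add: w_def)
    \<comment> \<open>Every factor has imaginary part of modulus at least 1, so the shift cannot
      decrease the norm of \<open>rGamma\<close>.\<close>
    moreover have "norm (pochhammer w K) \<ge> 1"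
    proof -
      have "(\<Prod>i<K. 1) \<le> (\<Prod>i<K. norm (w + of_nat i))"
      proof (intro prod_mono conjI)
        fix i
        have "1 \<le> \<bar>Im (w + of_nat i)\<bar>" using z by (simp add: w_def)
        also have "\<dots> \<le> norm (w + of_nat i)" by (rule abs_Im_le_cmod)
        finally show "1 \<le> norm (w + of_nat i)" .
      qed simp
      then show ?thesis by (simp add: pochhammer_prod prod_norm lessThan_atLeast0)
    qed
    ultimately have "norm (rGamma z) \<le> norm (rGamma w)"
      using mult_right_mono[of 1 "norm (pochhammer w K)" "norm (rGamma z)"] by (simp add: norm_mult)
    also have "rGamma w = Gamma (1 - w) * (sin (of_real pi * w) / of_real pi)"
    proof -
      have "1 - w \<notin> \<int>\<^sub>\<le>\<^sub>0" using z by (auto simp: w_def elim!: nonpos_Ints_cases) (auto simp: complex_eq_iff)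
      then have "Gamma (1 - w) * rGamma (1 - w) = 1"
        by (simp add: rGamma_inverse_Gamma Gamma_eq_zero_iff)
      then show ?thesis
        using rGamma_reflection_complex[of w] by (metis mult.commute mult.left_commute mult.right_neutral)
    qed
    also have "norm (Gamma (1 - w) * (sin (of_real pi * w) / of_real pi)) \<le> \<bar>C\<bar> * exp (pi * \<bar>Im z\<bar>)"
      unfolding norm_mult
    proof (rule mult_mono)
      have "norm (Gamma (1 - w)) \<le> Gamma (Re (1 - w))"
        by (rule norm_Gamma_le) (use z K in \<open>simp add: w_def\<close>)
      also have "\<dots> \<le> \<bar>C\<bar>" using C[rule_format, of "Re (1 - w)"] z by (simp add: w_def)
      finally show "norm (Gamma (1 - w)) \<le> \<bar>C\<bar>" .
      have "norm (sin (of_real pi * w)) \<le> exp (pi * \<bar>Im z\<bar>)"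
        using norm_sin_le_exp[of "of_real pi * w"] by (simp add: w_def abs_mult)
      moreover have "exp (pi * \<bar>Im z\<bar>) * 1 \<le> exp (pi * \<bar>Im z\<bar>) * pi"
        using pi_ge_two by (intro mult_left_mono) auto
      ultimately have "norm (sin (of_real pi * w)) \<le> exp (pi * \<bar>Im z\<bar>) * pi" by linarith
      then show "norm (sin (of_real pi * w) / of_real pi) \<le> exp (pi * \<bar>Im z\<bar>)"
        by (simp add: norm_divide divide_le_eq)
    qed auto
    finally show ?thesis .
  qed
  then show ?thesis by (intro exI[of _ "\<bar>C\<bar>"]) auto
qed

lemma norm_pochhammer_le:
  fixes z :: complex
  shows "norm (pochhammer z k) \<le> (norm z + real k) ^ k"
proof -
  have "norm (pochhammer z k) = (\<Prod>i<k. norm (z + of_nat i))"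
    by (simp add: pochhammer_prod prod_norm lessThan_atLeast0)
  also have "\<dots> \<le> (\<Prod>i<k. norm z + real k)"
  proof (intro prod_mono conjI)
    fix i assume "i \<in> {..<k}"
    then show "norm (z + of_nat i) \<le> norm z + real k"
      using norm_triangle_ineq[of z "of_nat i"] by simp
  qed simp
  finally show ?thesis by simp
qed

section \<open>Gamma factors and the functional equation left of the critical line\<close>

lemma nonpos_Ints_complexD:
  fixes z :: complex
  assumes "z \<in> \<int>\<^sub>\<le>\<^sub>0"
  shows "Im z = 0" "Re z \<le> 0"
  using assms by (auto elim!: nonpos_Ints_cases)

lemma Gamma_R_inverse:
  assumes "s / 2 \<notin> \<int>\<^sub>\<le>\<^sub>0"
  shows "Gamma_R s * (of_real pi powr (s / 2) * rGamma (s / 2)) = 1"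
proof -
  have "of_real pi powr (- s / 2) = inverse (of_real pi powr (s / 2) :: complex)"
    by (simp only: minus_divide_left[symmetric] powr_minus)
  moreover have *: "inverse a * g * (a * inverse g) = 1" if "a \<noteq> 0" "g \<noteq> 0" for a g :: complex
    using that by (simp add: field_simps)
  moreover have "Gamma (s / 2) \<noteq> 0" using assms by (simp add: Gamma_eq_zero_iff)
  moreover have "of_real pi powr (s / 2) \<noteq> (0 :: complex)" by simp
  ultimately show ?thesis
    unfolding Gamma_R_def rGamma_inverse_Gamma using * by simp
qed

text \<open>The conductor and Gamma factors of the contragredient at 1 - s, divided by those at s.
  The denominator is written with \<open>rGamma\<close> and so stays meaningful at the poles of the
  Gamma factors; for Re s < 1/2 and Re (\<mu> j) > - 1/2 the arguments of \<open>Gamma\<close> have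
  positive real part.\<close>

definition functional_factor :: "nat \<Rightarrow> ('n::finite \<Rightarrow> complex) \<Rightarrow> complex \<Rightarrow> complex" where
  "functional_factor Q \<mu> s = of_nat Q powr ((1 - s) / 2) * of_nat Q powr (- (s / 2)) *
     (\<Prod>j\<in>UNIV. (of_real pi powr (- (1 - s + cnj (\<mu> j)) / 2) * of_real pi powr ((s + \<mu> j) / 2)) *
        (Gamma ((1 - s + cnj (\<mu> j)) / 2) * rGamma ((s + \<mu> j) / 2)))"

text \<open>\<open>Gamma\<close> takes the value 0 at its poles, so the Gamma factors can be
  cancelled only off the poles; this is what the hypothesis on (s + \<mu> j) / 2 ensures.\<close>

lemma functional_equation_pointwise:
  fixes \<mu> :: "'n::finite \<Rightarrow> complex"
  assumes Q: "Q > 0" and eq: "completed_L Q \<mu> L s = \<epsilon> * completed_L Q (\<lambda>j. cnj (\<mu> j)) (\<lambda>z. cnj (L (cnj z))) (1 - s)"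
    and np: "\<And>j. (s + \<mu> j) / 2 \<notin> \<int>\<^sub>\<le>\<^sub>0"
  shows "L s = \<epsilon> * functional_factor Q \<mu> s * cnj (L (cnj (1 - s)))"
proof -
  define q where "q = of_nat Q powr (s / 2)"
  define g where "g = (\<Prod>j\<in>UNIV. Gamma_R (s + \<mu> j))"
  have qi: "q * of_nat Q powr (- (s / 2)) = 1" unfolding q_def using Q by (simp add: powr_minus)
  have gi: "g * (\<Prod>j\<in>UNIV. of_real pi powr ((s + \<mu> j) / 2) * rGamma ((s + \<mu> j) / 2)) = 1"
  proof -
    have "Gamma_R (s + \<mu> j) * (of_real pi powr ((s + \<mu> j) / 2) * rGamma ((s + \<mu> j) / 2)) = 1" for j
      using Gamma_R_inverse[OF np] .
    then show ?thesis unfolding g_def by (simp flip: prod.distrib)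
  qed
  have "L s = (q * of_nat Q powr (- (s / 2))) * (g * (\<Prod>j\<in>UNIV. of_real pi powr ((s + \<mu> j) / 2) * rGamma ((s + \<mu> j) / 2))) * L s"
    unfolding qi gi by simp
  also have "\<dots> = completed_L Q \<mu> L s * (of_nat Q powr (- (s / 2)) * (\<Prod>j\<in>UNIV. of_real pi powr ((s + \<mu> j) / 2) * rGamma ((s + \<mu> j) / 2)))"
    unfolding completed_L_def q_def g_def by (simp only: mult_ac)
  also have "\<dots> = (\<epsilon> * completed_L Q (\<lambda>j. cnj (\<mu> j)) (\<lambda>z. cnj (L (cnj z))) (1 - s)) * (of_nat Q powr (- (s / 2)) * (\<Prod>j\<in>UNIV. of_real pi powr ((s + \<mu> j) / 2) * rGamma ((s + \<mu> j) / 2)))"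
    unfolding eq ..
  also have "\<dots> = \<epsilon> * functional_factor Q \<mu> s * cnj (L (cnj (1 - s)))"
    unfolding completed_L_def functional_factor_def Gamma_R_def prod.distrib by (simp only: mult_ac)
  finally show ?thesis .
qed

text \<open>The functional equation is given off a sparse set, and cancellation has to avoid poles.
  Both sides are continuous at \<open>s\<close>, so it suffices to approach \<open>s\<close> through
  points where both are legitimate.\<close>

lemma functional_equation_left:
  fixes \<mu> :: "'n::finite \<Rightarrow> complex"
  assumes Q: "Q > 0" and L: "L holomorphic_on UNIV"
    and feq: "\<forall>\<^sub>\<approx>s\<in>UNIV. completed_L Q \<mu> L s = \<epsilon> * completed_L Q (\<lambda>j. cnj (\<mu> j)) (\<lambda>z. cnj (L (cnj z))) (1 - s)"
    and \<mu>: "\<And>j. Re (\<mu> j) > - 1 / 2" and s: "Re s < 1 / 2"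
  shows "L s = \<epsilon> * functional_factor Q \<mu> s * cnj (L (cnj (1 - s)))"
proof -
  define R where "R = (\<lambda>s. \<epsilon> * functional_factor Q \<mu> s * cnj (L (cnj (1 - s))))"
  have contL: "isCont L z" for z
    using holomorphic_on_imp_continuous_on[OF L] by (simp add: continuous_on_eq_continuous_at)
  have contR: "isCont R s"
  proof -
    have 1: "isCont (\<lambda>s. cnj (L (cnj (1 - s)))) s"
      by (intro continuous_intros isCont_o2[OF _ contL])
    have 2: "isCont (functional_factor Q \<mu>) s"
      unfolding functional_factor_def
    proof (intro continuous_intros)
      show "(1 - s + cnj (\<mu> j)) / 2 \<notin> \<int>\<^sub>\<le>\<^sub>0" for j
      proof
        assume "(1 - s + cnj (\<mu> j)) / 2 \<in> \<int>\<^sub>\<le>\<^sub>0"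
        then have "Re ((1 - s + cnj (\<mu> j)) / 2) \<le> 0" by (rule nonpos_Ints_complexD)
        then show False using s \<mu>[of j] by simp
      qed
    qed (use Q in auto)
    show ?thesis unfolding R_def
      by (rule continuous_mult[OF continuous_mult[OF continuous_const 2] 1])
  qed
  \<comment> \<open>A vertical approach: the poles of the Gamma factors lie on the horizontal lines
    Im s = - Im (\<mu> j), which the path avoids for small t > 0.\<close>
  define y where "y = (\<lambda>t::real. s + of_real t * \<i>)"
  have y0: "(y \<longlongrightarrow> s) (at_right 0)" unfolding y_def by (auto intro!: tendsto_eq_intros)
  have yat: "filterlim y (at s) (at_right 0)"
    by (rule filterlim_atI[OF y0]) (auto simp: y_def eventually_at_filter)
  have "\<forall>\<^sub>F z in at s. completed_L Q \<mu> L z = \<epsilon> * completed_L Q (\<lambda>j. cnj (\<mu> j)) (\<lambda>z. cnj (L (cnj z))) (1 - z)"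
    using eventually_cosparse_imp_eventually_at[OF feq, of s] by simp
  then have e1: "\<forall>\<^sub>F t in at_right 0. completed_L Q \<mu> L (y t) = \<epsilon> * completed_L Q (\<lambda>j. cnj (\<mu> j)) (\<lambda>z. cnj (L (cnj z))) (1 - y t)"
    using yat by (rule eventually_compose_filterlim)
  have e2: "\<forall>\<^sub>F t in at_right 0. \<forall>j\<in>UNIV. Im (s + \<mu> j) + t \<noteq> 0"
  proof (rule eventually_ball_finite)
    show "\<forall>j\<in>UNIV. \<forall>\<^sub>F t in at_right 0. Im (s + \<mu> j) + t \<noteq> 0"
    proof
      fix j
      have "\<forall>\<^sub>F t in at_right (0::real). t \<noteq> - Im (s + \<mu> j)"
        by (rule eventually_neq_at_within)
      then show "\<forall>\<^sub>F t in at_right 0. Im (s + \<mu> j) + t \<noteq> 0" by eventually_elim auto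
    qed
  qed simp
  have ev: "\<forall>\<^sub>F t in at_right 0. L (y t) = R (y t)"
    using e1 e2
  proof eventually_elim
    fix t assume 1: "completed_L Q \<mu> L (y t) = \<epsilon> * completed_L Q (\<lambda>j. cnj (\<mu> j)) (\<lambda>z. cnj (L (cnj z))) (1 - y t)"
      and 2: "\<forall>j\<in>UNIV. Im (s + \<mu> j) + t \<noteq> 0"
    show "L (y t) = R (y t)" unfolding R_def
    proof (rule functional_equation_pointwise[OF Q 1])
      show "(y t + \<mu> j) / 2 \<notin> \<int>\<^sub>\<le>\<^sub>0" for j
      proof
        assume "(y t + \<mu> j) / 2 \<in> \<int>\<^sub>\<le>\<^sub>0"
        then have "Im ((y t + \<mu> j) / 2) = 0" by (rule nonpos_Ints_complexD)
        then show False using 2 by (auto simp: y_def algebra_simps)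
      qed
    qed
  qed
  have "((\<lambda>t. L (y t)) \<longlongrightarrow> L s) (at_right 0)"
    by (rule isCont_tendsto_compose[OF contL y0])
  then have "((\<lambda>t. R (y t)) \<longlongrightarrow> L s) (at_right 0)"
    using tendsto_cong[OF ev] by blast
  moreover have "((\<lambda>t. R (y t)) \<longlongrightarrow> R s) (at_right 0)"
    by (rule isCont_tendsto_compose[OF contR y0])
  ultimately have "L s = R s"
    by (rule tendsto_unique[OF trivial_limit_at_right_real])
  then show ?thesis unfolding R_def .
qed

text \<open>On Re s = 1/2 - k, the conjugate of (1 - s + cnj (\<mu> j)) / 2 equals (s + \<mu> j) / 2
  + k. The product of \<open>Gamma\<close> and \<open>rGamma\<close> is then in norm a Pochhammer
  symbol of length \<open>k\<close>, hence polynomially bounded. This is why the strip is bounded by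
  lines at integral distance from 1/2.\<close>

lemma functional_factor_bound:
  fixes \<mu> :: "'n::finite \<Rightarrow> complex"
  assumes Q: "Q > 0" and \<mu>: "\<And>j. Re (\<mu> j) > - 1 / 2" and s: "Re s = 1 / 2 - real k"
  shows "norm (functional_factor Q \<mu> s) \<le> real Q ^ k * (\<Prod>j\<in>UNIV. (norm s + norm (\<mu> j) + real k) ^ k)"
proof -
  have n1: "norm (of_nat Q powr ((1 - s) / 2) * of_nat Q powr (- (s / 2))) = real Q ^ k"
  proof -
    have "norm (of_nat Q powr ((1 - s) / 2) * of_nat Q powr (- (s / 2))) = real Q powr (Re ((1 - s) / 2) + Re (- (s / 2)))"
      unfolding norm_mult powr_add by (subst (1 2) norm_powr_real_powr) auto
    also have "Re ((1 - s) / 2) + Re (- (s / 2)) = real k" using s by (simp add: field_simps)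
    finally show ?thesis using Q by (simp add: powr_realpow)
  qed
  have n2: "norm ((of_real pi powr (- (1 - s + cnj (\<mu> j)) / 2) * of_real pi powr ((s + \<mu> j) / 2)) *
        (Gamma ((1 - s + cnj (\<mu> j)) / 2) * rGamma ((s + \<mu> j) / 2))) \<le> (norm s + norm (\<mu> j) + real k) ^ k" for j
  proof -
    define z where "z = (s + \<mu> j) / 2"
    have "norm (of_real pi powr (- (1 - s + cnj (\<mu> j)) / 2) * of_real pi powr ((s + \<mu> j) / 2))
      = pi powr (Re (- (1 - s + cnj (\<mu> j)) / 2) + Re ((s + \<mu> j) / 2))"
      unfolding norm_mult powr_add by (subst (1 2) norm_powr_real_powr) auto
    also have "Re (- (1 - s + cnj (\<mu> j)) / 2) + Re ((s + \<mu> j) / 2) = - real k" using s by (simp add: field_simps)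
    also have "pi powr (- real k) \<le> pi powr 0" using pi_ge_two by (intro powr_mono) auto
    finally have 1: "norm (of_real pi powr (- (1 - s + cnj (\<mu> j)) / 2) * of_real pi powr ((s + \<mu> j) / 2)) \<le> 1" by simp
    have c: "cnj ((1 - s + cnj (\<mu> j)) / 2) = z + of_nat k"
      using s by (simp add: z_def complex_eq_iff field_simps)
    have "norm (Gamma ((1 - s + cnj (\<mu> j)) / 2)) = norm (Gamma (z + of_nat k))"
      unfolding c[symmetric] cnj_Gamma[symmetric] by simp
    moreover have "rGamma z = pochhammer z k * rGamma (z + of_nat k)" by (rule pochhammer_rGamma)
    moreover have "Gamma (z + of_nat k) * rGamma (z + of_nat k) = 1"
    proof -
      have "Re (z + of_nat k) > 0"
      proof -
        have "4 * Re (z + of_nat k) = (1 + 2 * Re (\<mu> j)) + 2 * real k" using s by (simp add: z_def field_simps)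
        moreover have "1 + 2 * Re (\<mu> j) > 0" using \<mu>[of j] by simp
        ultimately have "4 * Re (z + of_nat k) > 0" by (simp only: add_pos_nonneg of_nat_0_le_iff mult_nonneg_nonneg zero_le_numeral)
        then show ?thesis by simp
      qed
      then have "z + of_nat k \<notin> \<int>\<^sub>\<le>\<^sub>0" using nonpos_Ints_complexD(2)[of "z + of_nat k"] by linarith
      then show ?thesis by (simp add: rGamma_inverse_Gamma Gamma_eq_zero_iff)
    qed
    then have "norm (Gamma (z + of_nat k)) * norm (rGamma (z + of_nat k)) = 1"
      by (simp flip: norm_mult)
    ultimately have "norm (Gamma ((1 - s + cnj (\<mu> j)) / 2) * rGamma z) = norm (pochhammer z k)"
      by (simp add: norm_mult)
    also have "\<dots> \<le> (norm z + real k) ^ k" by (rule norm_pochhammer_le)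
    also have "\<dots> \<le> (norm s + norm (\<mu> j) + real k) ^ k"
    proof (rule power_mono)
      show "norm z + real k \<le> norm s + norm (\<mu> j) + real k"
        using norm_triangle_ineq[of s "\<mu> j"] norm_ge_zero[of s] norm_ge_zero[of "\<mu> j"] unfolding z_def norm_divide
        by (simp, linarith)
    qed auto
    finally have 2: "norm (Gamma ((1 - s + cnj (\<mu> j)) / 2) * rGamma ((s + \<mu> j) / 2)) \<le> (norm s + norm (\<mu> j) + real k) ^ k"
      unfolding z_def .
    show ?thesis unfolding norm_mult[of "_ powr _ * _ powr _"] using mult_mono[OF 1 2] by simp
  qed
  have "norm (functional_factor Q \<mu> s) = real Q ^ k * (\<Prod>j\<in>UNIV. norm ((of_real pi powr (- (1 - s + cnj (\<mu> j)) / 2) * of_real pi powr ((s + \<mu> j) / 2)) *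
        (Gamma ((1 - s + cnj (\<mu> j)) / 2) * rGamma ((s + \<mu> j) / 2))))"
    unfolding functional_factor_def norm_mult[of "_ powr _ * _ powr _" "prod _ _"] n1 prod_norm ..
  also have "\<dots> \<le> real Q ^ k * (\<Prod>j\<in>UNIV. (norm s + norm (\<mu> j) + real k) ^ k)"
    using n2 by (intro mult_left_mono prod_mono) auto
  finally show ?thesis .
qed

text \<open>The completed function is bounded in the strip away from the real axis, and dividing by
  each Gamma factor costs at most a constant times exp (pi |Im s|). Such growth is admissible in the
  Phragmen-Lindelof principle.\<close>

lemma exponential_growth:
  fixes \<mu> :: "'n::finite \<Rightarrow> complex"
  assumes Q: "Q > 0"
    and bd: "\<forall>a b. \<exists>T C. \<forall>s. a \<le> Re s \<and> Re s \<le> b \<and> \<bar>Im s\<bar> \<ge> T \<longrightarrow> norm (completed_L Q \<mu> L s) \<le> C"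
  shows "\<exists>T C D. \<forall>s. a \<le> Re s \<and> Re s \<le> b \<and> \<bar>Im s\<bar> \<ge> T \<longrightarrow> norm (L s) \<le> C * exp (D * \<bar>Im s\<bar>)"
proof -
  obtain T0 C0 where C0: "\<And>s. a \<le> Re s \<Longrightarrow> Re s \<le> b \<Longrightarrow> \<bar>Im s\<bar> \<ge> T0 \<Longrightarrow> norm (completed_L Q \<mu> L s) \<le> C0"
    using bd by meson
  define m where "m = (\<Sum>j\<in>UNIV. norm (\<mu> j))"
  have m: "norm (\<mu> j) \<le> m" for j unfolding m_def by (rule member_le_sum) auto
  have m0: "m \<ge> 0" unfolding m_def by (intro sum_nonneg) auto
  define M where "M = max \<bar>a\<bar> \<bar>b\<bar> + m"
  obtain C1 where C1: "C1 \<ge> 0" "\<And>z. - M \<le> Re z \<Longrightarrow> Re z \<le> M \<Longrightarrow> \<bar>Im z\<bar> \<ge> 1 \<Longrightarrow> norm (rGamma z) \<le> C1 * exp (pi * \<bar>Im z\<bar>)"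
    using rGamma_vertical_bound[of "-M" M] by blast
  define N where "N = CARD('n)"
  define c where "c = pi powr M * (C1 * exp (pi * m))"
  define C where "C = \<bar>C0\<bar> * real Q powr M * c ^ N"
  have "norm (L s) \<le> C * exp ((pi * real N) * \<bar>Im s\<bar>)"
    if s: "a \<le> Re s" "Re s \<le> b" "\<bar>Im s\<bar> \<ge> max T0 (m + 2)" for s
  proof -
    have Re: "\<bar>Re (s + \<mu> j)\<bar> \<le> M" for j
      using s abs_Re_le_cmod[of "\<mu> j"] m[of j] unfolding M_def by (auto simp: abs_le_iff)
    have Re': "\<bar>Re s\<bar> \<le> M" using s m0 unfolding M_def by (auto simp: abs_le_iff)
    have M0: "M \<ge> 0" using order_trans[OF abs_ge_zero Re'] .
    have Im: "\<bar>Im (s + \<mu> j)\<bar> \<ge> 2" "\<bar>Im (s + \<mu> j)\<bar> \<le> \<bar>Im s\<bar> + m" for j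
      using s abs_Im_le_cmod[of "\<mu> j"] m[of j] by (auto simp: abs_le_iff)
    define P where "P = (\<Prod>j\<in>UNIV. of_real pi powr ((s + \<mu> j) / 2) * rGamma ((s + \<mu> j) / 2))"
    have g: "Gamma_R (s + \<mu> j) * (of_real pi powr ((s + \<mu> j) / 2) * rGamma ((s + \<mu> j) / 2)) = 1" for j
    proof -
      have "(s + \<mu> j) / 2 \<notin> \<int>\<^sub>\<le>\<^sub>0"
      proof
        assume "(s + \<mu> j) / 2 \<in> \<int>\<^sub>\<le>\<^sub>0"
        then have "Im ((s + \<mu> j) / 2) = 0" by (rule nonpos_Ints_complexD)
        then show False using Im(1)[of j] by simp
      qed
      then show ?thesis by (rule Gamma_R_inverse)
    qed
    have gP: "(\<Prod>j\<in>UNIV. Gamma_R (s + \<mu> j)) * P = 1"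
      unfolding P_def using g by (simp flip: prod.distrib)
    have qq: "of_nat Q powr (s / 2) * of_nat Q powr (- (s / 2)) = (1::complex)" using Q by (simp add: powr_minus)
    have "L s = (of_nat Q powr (s / 2) * of_nat Q powr (- (s / 2))) * ((\<Prod>j\<in>UNIV. Gamma_R (s + \<mu> j)) * P) * L s"
      unfolding gP qq by simp
    also have "\<dots> = completed_L Q \<mu> L s * (of_nat Q powr (- (s / 2)) * P)"
      unfolding completed_L_def by (simp only: mult_ac)
    finally have "norm (L s) = norm (completed_L Q \<mu> L s * (of_nat Q powr (- (s / 2)) * P))"
      by (rule arg_cong)
    also have "\<dots> = norm (completed_L Q \<mu> L s) * (norm (of_nat Q powr (- (s / 2)) :: complex) * norm P)"
      by (simp only: norm_mult)
    finally have "norm (L s) = norm (completed_L Q \<mu> L s) * (norm (of_nat Q powr (- (s / 2)) :: complex) * norm P)" .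
    also have "\<dots> \<le> \<bar>C0\<bar> * (real Q powr M * (c ^ N * exp ((pi * real N) * \<bar>Im s\<bar>)))"
    proof (intro mult_mono)
      show "norm (completed_L Q \<mu> L s) \<le> \<bar>C0\<bar>" using C0[of s] s by auto
      have "norm (of_nat Q powr (- (s / 2)) :: complex) = real Q powr (- Re s / 2)"
        by (simp add: norm_powr_real_powr)
      also have "\<dots> \<le> real Q powr M" using Re' Q M0 by (intro powr_mono) (auto simp: abs_le_iff)
      finally show "norm (of_nat Q powr (- (s / 2)) :: complex) \<le> real Q powr M" .
      have f: "norm (of_real pi powr ((s + \<mu> j) / 2) * rGamma ((s + \<mu> j) / 2)) \<le> c * exp (pi * \<bar>Im s\<bar>)" for j
      proof -
        have "norm (of_real pi powr ((s + \<mu> j) / 2)) = pi powr (Re (s + \<mu> j) / 2)"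
          by (subst norm_powr_real_powr) auto
        also have "\<dots> \<le> pi powr M" using Re[of j] pi_ge_two M0 by (intro powr_mono) (auto simp: abs_le_iff)
        finally have 1: "norm (of_real pi powr ((s + \<mu> j) / 2)) \<le> pi powr M" .
        have "norm (rGamma ((s + \<mu> j) / 2)) \<le> C1 * exp (pi * \<bar>Im ((s + \<mu> j) / 2)\<bar>)"
          using Re[of j] Im(1)[of j] M0 by (intro C1(2)) (auto simp: abs_le_iff)
        also have "\<dots> \<le> C1 * (exp (pi * m) * exp (pi * \<bar>Im s\<bar>))"
        proof (intro mult_left_mono C1(1))
          have "\<bar>Im ((s + \<mu> j) / 2)\<bar> \<le> m + \<bar>Im s\<bar>" using Im(2)[of j] by simp
          then have "pi * \<bar>Im ((s + \<mu> j) / 2)\<bar> \<le> pi * (m + \<bar>Im s\<bar>)" by (intro mult_left_mono) auto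
          then show "exp (pi * \<bar>Im ((s + \<mu> j) / 2)\<bar>) \<le> exp (pi * m) * exp (pi * \<bar>Im s\<bar>)"
            by (simp add: distrib_left flip: exp_add)
        qed
        finally have 2: "norm (rGamma ((s + \<mu> j) / 2)) \<le> C1 * (exp (pi * m) * exp (pi * \<bar>Im s\<bar>))" .
        show ?thesis unfolding norm_mult c_def using mult_mono[OF 1 2] by (simp add: mult.assoc)
      qed
      have "norm P \<le> (\<Prod>j\<in>(UNIV::'n set). c * exp (pi * \<bar>Im s\<bar>))"
        unfolding P_def prod_norm[symmetric] using f by (intro prod_mono) auto
      also have "\<dots> = c ^ N * exp ((pi * real N) * \<bar>Im s\<bar>)"
        by (simp add: N_def power_mult_distrib mult_ac flip: exp_of_nat_mult)
      finally show "norm P \<le> c ^ N * exp ((pi * real N) * \<bar>Im s\<bar>)" .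
    qed auto
    finally show ?thesis unfolding C_def by (simp only: mult.assoc)
  qed
  then show ?thesis by blast
qed

text \<open>On the right edge \<open>L\<close> is bounded, on the left edge the functional equation
  gives a polynomial bound. Division by a power of s + K makes both bounded, and the
  Phragmen-Lindelof principle fills the strip.\<close>

lemma polynomial_growth:
  fixes \<mu> :: "'n::finite \<Rightarrow> complex"
  assumes Q: "Q > 0" and L: "L holomorphic_on UNIV" and \<epsilon>: "norm \<epsilon> = 1"
    and feq: "\<forall>\<^sub>\<approx>s\<in>UNIV. completed_L Q \<mu> L s = \<epsilon> * completed_L Q (\<lambda>j. cnj (\<mu> j)) (\<lambda>z. cnj (L (cnj z))) (1 - s)"
    and \<mu>: "\<And>j. Re (\<mu> j) > - 1 / 2"
    and bd: "\<forall>a b. \<exists>T C. \<forall>s. a \<le> Re s \<and> Re s \<le> b \<and> \<bar>Im s\<bar> \<ge> T \<longrightarrow> norm (completed_L Q \<mu> L s) \<le> C"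
    and k: "k > 0" and right: "\<And>s. Re s = 1 / 2 + real k \<Longrightarrow> norm (L s) \<le> M"
  shows "\<exists>C A. \<forall>s. \<bar>Re s - 1 / 2\<bar> \<le> real k \<longrightarrow> norm (L s) \<le> C * (norm s + C) ^ A"
proof -
  define m where "m = (\<Sum>j\<in>UNIV. norm (\<mu> j))"
  have m: "norm (\<mu> j) \<le> m" for j unfolding m_def by (rule member_le_sum) auto
  have m0: "m \<ge> 0" unfolding m_def by (intro sum_nonneg) auto
  define N where "N = CARD('n)"
  have M0: "M \<ge> 0" using order_trans[OF norm_ge_zero right[of "Complex (1/2 + real k) 0"]] by simp
  \<comment> \<open>\<open>K\<close> keeps the real part of s + K at least 1 in the strip, and it
    dominates |\<mu> j| + k in the bound of the functional factor.\<close>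
  define K where "K = 2 * real k + m + 1"
  define f where "f = (\<lambda>s. L s / (s + of_real K) ^ (k * N))"
  define B where "B = (3 * K) ^ (k * N) * real Q ^ k * M"
  have K: "norm (s + of_real K) \<ge> 1" if "\<bar>Re s - 1 / 2\<bar> \<le> real k" for s
  proof -
    have "1 \<le> Re (s + of_real K)" using that m0 k unfolding K_def by (auto simp: abs_le_iff)
    also have "\<dots> \<le> norm (s + of_real K)" by (rule complex_Re_le_cmod)
    finally show ?thesis .
  qed
  have K1: "K \<ge> 1" using m0 unfolding K_def by simp
  have fL: "norm (f s) \<le> norm (L s)" if "\<bar>Re s - 1 / 2\<bar> \<le> real k" for s
  proof -
    have p: "1 \<le> norm (s + of_real K) ^ (k * N)" using K[OF that] by (rule one_le_power)
    have "norm (L s) * 1 \<le> norm (L s) * norm (s + of_real K) ^ (k * N)" using p by (intro mult_left_mono) auto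
    then show ?thesis using p unfolding f_def by (simp add: norm_divide norm_power divide_le_eq)
  qed
  obtain T C D where TCD: "\<And>s. 1/2 - real k \<le> Re s \<Longrightarrow> Re s \<le> 1/2 + real k \<Longrightarrow> \<bar>Im s\<bar> \<ge> T \<Longrightarrow> norm (L s) \<le> C * exp (D * \<bar>Im s\<bar>)"
    using exponential_growth[OF Q bd, of "1/2 - real k" "1/2 + real k"] by blast
  have main: "norm (f s) \<le> B" if s: "\<bar>Re s - 1 / 2\<bar> \<le> real k" for s
  proof (rule phragmen_lindelof_strip[where f = f and s = s and a = "1/2 - real k" and b = "1/2 + real k" and S = "{s. Re s > - K}" and T = T and C = C and D = D])
    show "f holomorphic_on {s. Re s > - K}" unfolding f_def
    proof (intro holomorphic_intros holomorphic_on_subset[OF L])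
      fix z assume "z \<in> {s. Re s > - K}"
      then have "Re (z + of_real K) > 0" by simp
      then have "z + of_real K \<noteq> 0" by (metis less_irrefl zero_complex.sel(1))
      then show "(z + of_real K) ^ (k * N) \<noteq> 0" by simp
    qed auto
    show "{s. 1/2 - real k \<le> Re s \<and> Re s \<le> 1/2 + real k} \<subseteq> {s. Re s > - K}"
      using m0 k unfolding K_def by auto
    show "norm (f s) \<le> C * exp (D * \<bar>Im s\<bar>)" if "1/2 - real k \<le> Re s" "Re s \<le> 1/2 + real k" "T \<le> \<bar>Im s\<bar>" for s
      using fL[of s] TCD[OF that] that by (auto simp: abs_le_iff)
    show "1/2 - real k \<le> Re s" "Re s \<le> 1/2 + real k" using s by (auto simp: abs_le_iff)
    fix s assume edge: "Re s = 1/2 - real k \<or> Re s = 1/2 + real k"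
    show "norm (f s) \<le> B"
    proof (cases "Re s = 1/2 + real k")
      case True
      have "norm (f s) \<le> 1 * 1 * M" using fL[of s] right[OF True] True by simp
      also have "\<dots> \<le> B" unfolding B_def using K1 Q M0 by (intro mult_mono one_le_power) auto
      finally show ?thesis .
    next
      case False
      then have e: "Re s = 1/2 - real k" using edge by blast
      have "norm (L s) = norm (functional_factor Q \<mu> s) * norm (L (cnj (1 - s)))"
        using functional_equation_left[OF Q L feq \<mu>, of s] e k \<epsilon> by (simp add: norm_mult)
      also have "\<dots> \<le> (real Q ^ k * (\<Prod>j\<in>UNIV. (norm s + norm (\<mu> j) + real k) ^ k)) * M"
        using functional_factor_bound[OF Q \<mu> e] right[of "cnj (1 - s)"] e by (intro mult_mono) (auto intro!: mult_nonneg_nonneg prod_nonneg)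
      also have "\<dots> \<le> (real Q ^ k * (3 * K * norm (s + of_real K)) ^ (k * N)) * M"
      proof (intro mult_right_mono mult_left_mono M0)
        have "(\<Prod>j\<in>UNIV. (norm s + norm (\<mu> j) + real k) ^ k) \<le> (\<Prod>j\<in>(UNIV::'n set). (norm s + K) ^ k)"
        proof (intro prod_mono conjI power_mono)
          fix j show "norm s + norm (\<mu> j) + real k \<le> norm s + K" using m[of j] unfolding K_def by simp
        qed auto
        also have "\<dots> = (norm s + K) ^ (k * N)" by (simp add: N_def power_mult)
        also have "\<dots> \<le> (3 * K * norm (s + of_real K)) ^ (k * N)"
        proof (rule power_mono)
          have 1: "1 \<le> norm (s + of_real K)" using K[of s] e by simp
          have "norm s \<le> norm (s + of_real K) + K"
            using norm_triangle_ineq4[of "s + of_real K" "of_real K"] K1 by simp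
          moreover have "1 * norm (s + of_real K) \<le> K * norm (s + of_real K)" using K1 by (intro mult_right_mono) auto
          moreover have "K * 1 \<le> K * norm (s + of_real K)" using K1 1 by (intro mult_left_mono) auto
          ultimately show "norm s + K \<le> 3 * K * norm (s + of_real K)" by linarith
        qed (use K1 in auto)
        finally show "(\<Prod>j\<in>UNIV. (norm s + norm (\<mu> j) + real k) ^ k) \<le> (3 * K * norm (s + of_real K)) ^ (k * N)" .
      qed auto
      also have "\<dots> = B * norm (s + of_real K) ^ (k * N)" unfolding B_def by (simp only: power_mult_distrib mult_ac)
      finally have 2: "norm (L s) \<le> B * norm (s + of_real K) ^ (k * N)" .
      have "0 < norm (s + of_real K) ^ (k * N)" using K[of s] e by (intro zero_less_power) auto
      then have "norm (L s) / norm (s + of_real K) ^ (k * N) \<le> B" using 2 by (simp only: pos_divide_le_eq)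
      then show ?thesis unfolding f_def norm_divide norm_power .
    qed
  qed
  define C where "C = max B K"
  have "norm (L s) \<le> C * (norm s + C) ^ (k * N)" if s: "\<bar>Re s - 1 / 2\<bar> \<le> real k" for s
  proof -
    have "norm (L s) = norm (f s) * norm (s + of_real K) ^ (k * N)"
    proof -
      have "norm (s + of_real K) \<noteq> 0" using K[OF s] by linarith
      then show ?thesis unfolding f_def norm_divide norm_power by simp
    qed
    also have "\<dots> \<le> C * (norm s + C) ^ (k * N)"
    proof (intro mult_mono power_mono)
      show "norm (f s) \<le> C" using main[OF s] unfolding C_def by simp
      show "norm (s + of_real K) \<le> norm s + C"
        using norm_triangle_ineq[of s "of_real K"] K1 unfolding C_def by simp
      show "0 \<le> C" using K1 unfolding C_def by simp
    qed auto
    finally show ?thesis .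
  qed
  then show ?thesis by blast
qed

section \<open>Local estimates for logarithms\<close>

lemma holomorphic_factor_zero:
  assumes h: "h holomorphic_on UNIV" and z: "h a = 0"
  obtains k where "k holomorphic_on UNIV" and "\<And>z. h z = (z - a) * k z"
proof -
  define k where "k = (\<lambda>z. if z = a then deriv h a else h z / (z - a))"
  have "k holomorphic_on UNIV"
    by (rule pole_theorem_open_0[OF h, of a]) (auto simp: k_def z)
  moreover have "h w = (w - a) * k w" for w unfolding k_def using z by auto
  ultimately show ?thesis using that by blast
qed

text \<open>A constant exponential forces the derivative to vanish. Applied to the difference of two
  branches of a logarithm, this shows that they agree up to a constant.\<close>

lemma exp_const_imp_const:
  assumes S: "convex S" "open S" and D: "D holomorphic_on S" and e: "\<And>z. z \<in> S \<Longrightarrow> exp (D z) = C"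
    and "a \<in> S" "b \<in> S"
  shows "D a = D b"
proof -
  have "(D has_field_derivative 0) (at z within S)" if z: "z \<in> S" for z
  proof -
    have d: "(D has_field_derivative deriv D z) (at z)"
      using holomorphic_derivI[OF D S(2) z] .
    then have "((\<lambda>z. exp (D z)) has_field_derivative exp (D z) * deriv D z) (at z)"
      by (rule DERIV_fun_exp)
    moreover have "((\<lambda>z. exp (D z)) has_field_derivative 0) (at z)"
      by (rule has_field_derivative_transform_within_open[OF DERIV_const[of C] S(2) z]) (simp add: e)
    ultimately have "exp (D z) * deriv D z = 0" by (rule DERIV_unique)
    then show ?thesis using d by (auto intro: has_field_derivative_at_within)
  qed
  then obtain c where "\<And>z. z \<in> S \<Longrightarrow> D z = c"
    using has_field_derivative_zero_constant[OF S(1)] by blast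
  then show ?thesis using assms by simp
qed

text \<open>The map w / (2 A - w) takes the half-plane Re w < A into the unit disc and fixes 0, so
  Schwarz's lemma applies; at half the radius it gives |k z| <= |2 A - k z| / 2.\<close>

lemma borel_caratheodory_half:
  assumes k: "k holomorphic_on ball c r" and k0: "k c = 0" and A: "\<And>z. z \<in> ball c r \<Longrightarrow> Re (k z) < A"
    and z: "norm (z - c) \<le> r / 2" and r: "r > 0"
  shows "norm (k z) \<le> 2 * A"
proof -
  have A0: "A > 0" using A[of c] k0 r by simp
  define f where "f = (\<lambda>w. k (c + of_real r * w) / (2 * of_real A - k (c + of_real r * w)))"
  have mem: "c + of_real r * w \<in> ball c r" if "norm w < 1" for w
    using that r by (simp add: dist_norm norm_mult)
  have nz: "2 * of_real A - k (c + of_real r * w) \<noteq> 0" if "norm w < 1" for w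
  proof
    assume "2 * of_real A - k (c + of_real r * w) = 0"
    then have "Re (2 * of_real A - k (c + of_real r * w)) = 0" by simp
    then show False using A[OF mem[OF that]] A0 by simp
  qed
  have fh: "f holomorphic_on ball 0 1"
  proof -
    have "(k \<circ> (\<lambda>w. c + of_real r * w)) holomorphic_on ball 0 1"
      by (rule holomorphic_on_compose_gen[OF _ k]) (use mem in \<open>auto intro!: holomorphic_intros\<close>)
    then show ?thesis unfolding f_def o_def using nz by (intro holomorphic_intros) auto
  qed
  have fl: "norm (f w) < 1" if w: "norm w < 1" for w
  proof -
    let ?k = "k (c + of_real r * w)"
    have "(Re ?k)\<^sup>2 < (2 * A - Re ?k)\<^sup>2"
    proof -
      have "(2 * A - Re ?k)\<^sup>2 - (Re ?k)\<^sup>2 = 4 * A * (A - Re ?k)" by (simp add: power2_eq_square algebra_simps)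
      also have "\<dots> > 0" using A0 A[OF mem[OF w]] by simp
      finally show ?thesis by simp
    qed
    then have "(norm ?k)\<^sup>2 < (norm (2 * of_real A - ?k))\<^sup>2"
      by (simp add: cmod_power2)
    then have "norm ?k < norm (2 * of_real A - ?k)" by (rule power2_less_imp_less) simp
    then show ?thesis unfolding f_def using nz[OF w] by (simp add: norm_divide divide_less_eq)
  qed
  define w where "w = (z - c) / of_real r"
  have w: "norm w \<le> 1 / 2" unfolding w_def using z r by (simp add: norm_divide field_simps)
  then have w1: "norm w < 1" by simp
  have cw: "c + of_real r * w = z" unfolding w_def using r by simp
  have "norm (f w) \<le> norm w"
    using Schwarz_Lemma(1)[OF fh _ fl w1] k0 by (simp add: f_def)
  then have "norm (f w) \<le> 1 / 2" using w by simp
  then have "norm (k z) \<le> norm (2 * of_real A - k z) / 2"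
    unfolding f_def cw using nz[OF w1] by (simp add: norm_divide divide_le_eq cw)
  also have "\<dots> \<le> (2 * A + norm (k z)) / 2"
    using norm_triangle_ineq4[of "2 * of_real A" "k z"] A0 by (simp add: norm_mult)
  finally show ?thesis by simp
qed

text \<open>The mechanism of Jensen's inequality: a zero in the disc of radius \<open>r\<close> has
  distance at least 2 r from the circle of radius 3 r and at most \<open>r\<close> from the centre,
  so each zero gains a factor 2. At z = c the bound counts the zeros; elsewhere it controls h z / h
  c.\<close>

lemma factor_bound:
  fixes W h :: "complex \<Rightarrow> complex" and \<rho> :: "nat \<Rightarrow> complex"
  assumes h: "h holomorphic_on UNIV" and fac: "\<And>z. W z = h z * (\<Prod>i<n. z - \<rho> i)"
    and \<rho>: "\<And>i. i < n \<Longrightarrow> norm (\<rho> i - c) \<le> r" and r: "r > 0" and R: "R = 3 * r"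
    and B: "\<And>z. norm (z - c) = R \<Longrightarrow> norm (W z) \<le> B" and b: "norm (W c) \<ge> b"
    and z: "norm (z - c) \<le> R"
  shows "norm (h z) * b * 2 ^ n \<le> B * norm (h c)"
proof -
  have hB: "norm (h w) * (2 * r) ^ n \<le> B" if w: "norm (w - c) = R" for w
  proof -
    have "2 * r \<le> norm (w - \<rho> i)" if "i < n" for i
    proof -
      have "norm (w - c) \<le> norm (w - \<rho> i) + norm (\<rho> i - c)"
        using norm_triangle_ineq[of "w - \<rho> i" "\<rho> i - c"] by simp
      then show ?thesis using \<rho>[OF that] w R by simp
    qed
    then have "(\<Prod>i<n. 2 * r) \<le> (\<Prod>i<n. norm (w - \<rho> i))"
      using r by (intro prod_mono) auto
    then have "norm (h w) * (2 * r) ^ n \<le> norm (h w) * (\<Prod>i<n. norm (w - \<rho> i))"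
      by (intro mult_left_mono) auto
    also have "\<dots> = norm (W w)" unfolding fac by (simp add: norm_mult prod_norm)
    finally show ?thesis using B[OF w] by simp
  qed
  have "norm (h z) \<le> B / (2 * r) ^ n"
  proof (rule maximum_modulus_frontier[where S = "cball c R" and f = h and \<xi> = z])
    show "h holomorphic_on interior (cball c R)" using h by (rule holomorphic_on_subset) simp
    show "continuous_on (closure (cball c R)) h"
      by (rule holomorphic_on_imp_continuous_on[OF holomorphic_on_subset[OF h]]) simp
    fix w assume "w \<in> frontier (cball c R)"
    then have "norm (w - c) = R" using r R by (simp add: dist_norm norm_minus_commute)
    then show "norm (h w) \<le> B / (2 * r) ^ n" using hB[of w] r by (simp add: field_simps)
  qed (use z in \<open>auto simp: dist_norm norm_minus_commute\<close>)
  then have 1: "norm (h z) * (2 * r) ^ n \<le> B" using r by (simp add: field_simps)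
  have "b \<le> norm (h c) * (\<Prod>i<n. norm (c - \<rho> i))"
    using b unfolding fac by (simp add: norm_mult prod_norm)
  also have "(\<Prod>i<n. norm (c - \<rho> i)) \<le> (\<Prod>i<n. r)"
    using \<rho> by (intro prod_mono) (auto simp: norm_minus_commute)
  finally have 2: "b \<le> norm (h c) * r ^ n" by (simp add: mult_left_mono)
  have B0: "B \<ge> 0" using order_trans[OF _ 1, of 0] r by simp
  have "(norm (h z) * b * 2 ^ n) * r ^ n \<le> (norm (h z) * (2 * r) ^ n) * (norm (h c) * r ^ n)"
    using mult_left_mono[OF 2, of "norm (h z) * 2 ^ n * r ^ n"] r
    by (simp add: power_mult_distrib mult_ac)
  also have "\<dots> \<le> B * (norm (h c) * r ^ n)" using 1 r by (intro mult_right_mono) auto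
  finally show ?thesis using r by (simp add: mult.assoc[symmetric])
qed

text \<open>Zeros are split off one at a time, with multiplicity. The bound at the centre limits
  their number, so a factorisation with the largest number exists; a further zero of
  \<open>h\<close> in the disc could be split off as well, against maximality.\<close>

lemma zero_factorization:
  fixes W :: "complex \<Rightarrow> complex"
  assumes W: "W holomorphic_on UNIV" and r: "r > 0" and R: "R = 3 * r"
    and B: "\<And>z. norm (z - c) = R \<Longrightarrow> norm (W z) \<le> B" and b: "norm (W c) \<ge> b" "b > 0"
  obtains n :: nat and \<rho> h where "h holomorphic_on UNIV" "\<And>z. W z = h z * (\<Prod>i<n. z - \<rho> i)"
    "\<And>i. i < n \<Longrightarrow> norm (\<rho> i - c) \<le> r" "\<And>z. norm (z - c) \<le> r \<Longrightarrow> h z \<noteq> 0"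
    "2 ^ n \<le> B / b" "\<And>z. norm (z - c) \<le> R \<Longrightarrow> norm (h z / h c) \<le> B / b"
proof -
  define P where "P = (\<lambda>n::nat. \<exists>\<rho> h. h holomorphic_on UNIV \<and> (\<forall>z. W z = h z * (\<Prod>i<n. z - \<rho> i)) \<and>
     (\<forall>i<n. norm (\<rho> i - c) \<le> r))"
  have hc: "h c \<noteq> 0" if "\<forall>z. W z = h z * (\<Prod>i<n. z - \<rho> i)" for h n and \<rho> :: "nat \<Rightarrow> complex"
    using b that by auto
  have bnd: "2 ^ n \<le> B / b" if "P n" for n
  proof -
    obtain \<rho> h where h: "h holomorphic_on UNIV" "\<forall>z. W z = h z * (\<Prod>i<n. z - \<rho> i)" "\<forall>i<n. norm (\<rho> i - c) \<le> r"
      using \<open>P n\<close> unfolding P_def by blast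
    have "norm (h c) * b * 2 ^ n \<le> B * norm (h c)"
      by (rule factor_bound[OF h(1), of W \<rho> n c r R]) (use h r R B b in auto)
    then show ?thesis using hc[OF h(2)] b by (simp add: field_simps)
  qed
  have "P 0" unfolding P_def using W by (intro exI[of _ "\<lambda>_. 0"] exI[of _ W]) simp
  have lt: "id n < Suc (nat \<lceil>B / b\<rceil>)" if "P n" for n
  proof -
    have "real n \<le> B / b" using bnd[OF that] of_nat_less_two_power[of n, where 'a = real] by linarith
    then have "int n \<le> \<lceil>B / b\<rceil>" using le_of_int_ceiling[of "B / b"] by linarith
    then show ?thesis by simp
  qed
  then obtain n where n: "P n" and max: "\<And>k. P k \<Longrightarrow> k \<le> n"
    using ex_has_greatest_nat[of P 0 id "Suc (nat \<lceil>B / b\<rceil>)"] \<open>P 0\<close> lt by auto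
  obtain \<rho> h where h: "h holomorphic_on UNIV" "\<forall>z. W z = h z * (\<Prod>i<n. z - \<rho> i)" "\<forall>i<n. norm (\<rho> i - c) \<le> r"
    using n unfolding P_def by blast
  show ?thesis
  proof (rule that[of h \<rho> n])
    show "h z \<noteq> 0" if z: "norm (z - c) \<le> r" for z
    proof
      assume "h z = 0"
      then obtain k where k: "k holomorphic_on UNIV" "\<And>w. h w = (w - z) * k w"
        using holomorphic_factor_zero[OF h(1)] by metis
      have "P (Suc n)" unfolding P_def
      proof (intro exI conjI)
        show "k holomorphic_on UNIV" by fact
        show "\<forall>w. W w = k w * (\<Prod>i<Suc n. w - (\<rho>(n := z)) i)"
          using h(2) k(2) by (simp add: mult_ac)
        show "\<forall>i<Suc n. norm ((\<rho>(n := z)) i - c) \<le> r" using h(3) z by (simp add: less_Suc_eq)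
      qed
      then show False using max[of "Suc n"] by simp
    qed
    show "norm (h z / h c) \<le> B / b" if z: "norm (z - c) \<le> R" for z
    proof -
      have "norm (h z) * b * 2 ^ n \<le> B * norm (h c)"
        by (rule factor_bound[OF h(1), of W \<rho> n c r R]) (use h r R B b z in auto)
      moreover have "norm (h z) * b * 1 \<le> norm (h z) * b * 2 ^ n"
        using b by (intro mult_left_mono) auto
      ultimately have "norm (h z) * b \<le> B * norm (h c)" by linarith
      then show ?thesis using hc[OF h(2)] b by (simp add: norm_divide field_simps)
    qed
  qed (use h bnd[OF n] in auto)
qed

lemma norm_Ln_le:
  assumes "w \<noteq> 0"
  shows "norm (Ln w) \<le> \<bar>ln (norm w)\<bar> + pi"
proof -
  have "norm (Ln w) \<le> \<bar>Re (Ln w)\<bar> + \<bar>Im (Ln w)\<bar>" by (rule cmod_le)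
  then show ?thesis using assms mpi_less_Im_Ln[of w] Im_Ln_le_pi[of w] by simp
qed

lemma local_log_formula:
  fixes W g :: "complex \<Rightarrow> complex" and T :: real
  defines "c \<equiv> Complex 1 T"
  assumes W: "W holomorphic_on UNIV" and nz: "\<And>z. Re z > 0 \<Longrightarrow> W z \<noteq> 0"
    and g: "g holomorphic_on {z. Re z > 0}" "\<And>z. Re z > 0 \<Longrightarrow> exp (g z) = W z"
    and B: "\<And>z. norm (z - c) = 12 \<Longrightarrow> norm (W z) \<le> B" and b: "norm (W c) \<ge> b" "b > 0"
    and G: "norm (g c) \<le> G"
  obtains n :: nat and \<gamma> :: "nat \<Rightarrow> real" where
    "B / b \<ge> 1" "real n \<le> 2 * (ln (B / b) + 1)"
    "\<And>s u. 0 < s \<Longrightarrow> s \<le> 1 \<Longrightarrow> \<bar>u - T\<bar> \<le> 1 \<Longrightarrow>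
      norm (g (Complex s u)) \<le> G + 26 * (ln (B / b) + 1) + (\<Sum>i<n. max 0 (- ln (max s \<bar>u - \<gamma> i\<bar>)))"
proof -
  have R12: "(12::real) = 3 * 4" "(0::real) < 4" by simp_all
  obtain n :: nat and \<rho> h where h: "h holomorphic_on UNIV" "\<And>z. W z = h z * (\<Prod>i<n. z - \<rho> i)"
    and \<rho>: "\<And>i. i < n \<Longrightarrow> norm (\<rho> i - c) \<le> 4" and hnz: "\<And>z. norm (z - c) \<le> 4 \<Longrightarrow> h z \<noteq> 0"
    and n2: "2 ^ n \<le> B / b" and hB: "\<And>z. norm (z - c) \<le> 12 \<Longrightarrow> norm (h z / h c) \<le> B / b"
    by (rule zero_factorization[OF W R12(2) R12(1) B b]) (assumption, rule that)
  have Bb: "B / b \<ge> 1" using order_trans[OF _ n2, of 1] by simp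
  define A where "A = ln (B / b) + 1"
  have A1: "A \<ge> 1" unfolding A_def using Bb by simp
  have n: "real n \<le> 2 * A"
  proof -
    have "real n * ln 2 = ln (2 ^ n)" by (simp add: ln_realpow)
    also have "\<dots> \<le> ln (B / b)" using n2 Bb by (subst ln_le_cancel_iff) auto
    finally have "real n * ln 2 \<le> A" unfolding A_def by simp
    moreover have "real n * (1/2) \<le> real n * ln 2" using ln2_ge_two_thirds by (intro mult_left_mono) auto
    ultimately show ?thesis by simp
  qed
  have Re\<rho>: "Re (\<rho> i) \<le> 0" if "i < n" for i
  proof (rule ccontr)
    assume "\<not> Re (\<rho> i) \<le> 0"
    then have "W (\<rho> i) \<noteq> 0" using nz by auto
    then show False unfolding h(2) using that by auto
  qed
  obtain k0 where k0: "k0 holomorphic_on ball c 4" "\<And>z. z \<in> ball c 4 \<Longrightarrow> exp (k0 z) = h z / h c"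
  proof (rule holomorphic_logarithm_exists[of "ball c 4" "\<lambda>z. h z / h c" c])
    show "(\<lambda>z. h z / h c) holomorphic_on ball c 4"
      using h(1) hnz[of c] by (intro holomorphic_intros holomorphic_on_subset[OF h(1)]) auto
    show "h z / h c \<noteq> 0" if "z \<in> ball c 4" for z
      using that hnz[of c] hnz[of z] by (auto simp: dist_norm norm_minus_commute)
  qed auto
  define k where "k = (\<lambda>z. k0 z - k0 c)"
  have kc: "k c = 0" unfolding k_def by simp
  have kh: "k holomorphic_on ball c 4" unfolding k_def using k0(1) by (intro holomorphic_intros)
  have ek: "exp (k z) = h z / h c" if "z \<in> ball c 4" for z
    unfolding k_def exp_diff using k0(2)[OF that] k0(2)[of c] hnz[of c] by simp
  have Rek: "Re (k z) < A" if z: "z \<in> ball c 4" for z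
  proof -
    have "exp (Re (k z)) = norm (h z / h c)" using ek[OF z] by (metis norm_exp_eq_Re)
    also have "\<dots> \<le> B / b" using hB[of z] z by (simp add: dist_norm norm_minus_commute)
    finally have "Re (k z) \<le> ln (B / b)" using Bb by (simp add: ln_ge_iff)
    then show ?thesis unfolding A_def by simp
  qed
  have kb: "norm (k z) \<le> 2 * A" if "norm (z - c) \<le> 2" for z
    by (rule borel_caratheodory_half[OF kh kc Rek]) (use that in auto)
  define S where "S = ball c 4 \<inter> {z. Re z > 0}"
  have S: "convex S" "open S" unfolding S_def
    by (auto intro!: convex_Int open_Int convex_halfspace_Re_gt open_halfspace_Re_gt)
  have cS: "c \<in> S" unfolding S_def c_def by simp
  have nzr: "Re (z - \<rho> i) > 0" if "z \<in> S" "i < n" for z i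
    using that Re\<rho>[of i] unfolding S_def by simp
  define D where "D = (\<lambda>z. g z - k z - (\<Sum>i<n. Ln (z - \<rho> i)))"
  have Dh: "D holomorphic_on S" unfolding D_def
  proof (intro holomorphic_intros)
    show "g holomorphic_on S" using g(1) by (rule holomorphic_on_subset) (auto simp: S_def)
    show "k holomorphic_on S" using kh by (rule holomorphic_on_subset) (auto simp: S_def)
    fix i z assume iz: "i \<in> {..<n}" "z \<in> S"
    show "z - \<rho> i \<notin> \<real>\<^sub>\<le>\<^sub>0" using nzr[OF iz(2), of i] iz(1) by (auto simp: complex_nonpos_Reals_iff)
  qed
  have De: "exp (D z) = h c" if z: "z \<in> S" for z
  proof -
    have "(\<Prod>i<n. exp (Ln (z - \<rho> i))) = (\<Prod>i<n. z - \<rho> i)"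
    proof (rule prod.cong[OF refl])
      fix i assume "i \<in> {..<n}"
      then have "z - \<rho> i \<noteq> 0" using nzr[OF z, of i] by auto
      then show "exp (Ln (z - \<rho> i)) = z - \<rho> i" by simp
    qed
    moreover have "W z \<noteq> 0" "exp (g z) = W z" using nz g(2) z by (auto simp: S_def)
    moreover have "exp (k z) = h z / h c" using ek z by (auto simp: S_def)
    moreover have "h z \<noteq> 0" "h c \<noteq> 0" using hnz z by (auto simp: S_def dist_norm norm_minus_commute)
    ultimately show ?thesis unfolding D_def exp_diff exp_sum[OF finite_lessThan] h(2)[of z]
      by (auto simp: field_simps)
  qed
  have main: "norm (g (Complex s u)) \<le> G + 26 * A + (\<Sum>i<n. max 0 (- ln (max s \<bar>u - Im (\<rho> i)\<bar>)))"
    if s: "0 < s" "s \<le> 1" and u: "\<bar>u - T\<bar> \<le> 1" for s u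
  proof -
    define z where "z = Complex s u"
    have "norm (z - c) \<le> \<bar>Re (z - c)\<bar> + \<bar>Im (z - c)\<bar>" by (rule cmod_le)
    also have "\<dots> \<le> 2" using s u by (simp add: z_def c_def)
    finally have zc: "norm (z - c) \<le> 2" .
    have zS: "z \<in> S" unfolding S_def using zc s by (simp add: dist_norm norm_minus_commute) (simp add: z_def)
    have "D z = D c" using exp_const_imp_const[OF S Dh De zS cS] .
    then have "g z = g c + k z + (\<Sum>i<n. Ln (z - \<rho> i) - Ln (c - \<rho> i))"
      unfolding D_def kc sum_subtractf by (simp add: algebra_simps)
    then have "norm (g z) \<le> norm (g c + k z) + norm (\<Sum>i<n. Ln (z - \<rho> i) - Ln (c - \<rho> i))"
      by (simp add: norm_triangle_ineq)
    also have "\<dots> \<le> (G + 2 * A) + (\<Sum>i<n. 12 + max 0 (- ln (max s \<bar>u - Im (\<rho> i)\<bar>)))"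
    proof (rule add_mono)
      show "norm (g c + k z) \<le> G + 2 * A" using norm_triangle_ineq[of "g c" "k z"] G kb[OF zc] by simp
      show "norm (\<Sum>i<n. Ln (z - \<rho> i) - Ln (c - \<rho> i)) \<le> (\<Sum>i<n. 12 + max 0 (- ln (max s \<bar>u - Im (\<rho> i)\<bar>)))"
      proof (rule sum_norm_le)
        fix i assume "i \<in> {..<n}"
        then have i: "i < n" by simp
        define m where "m = max s \<bar>u - Im (\<rho> i)\<bar>"
        have m0: "m > 0" unfolding m_def using s by simp
        have "s \<le> \<bar>Re (z - \<rho> i)\<bar>" "\<bar>Re (z - \<rho> i)\<bar> \<le> norm (z - \<rho> i)" "\<bar>Im (z - \<rho> i)\<bar> \<le> norm (z - \<rho> i)"
          using Re\<rho>[OF i] s by (auto simp: z_def abs_Re_le_cmod abs_Im_le_cmod simp del: minus_complex.sel) (simp add: z_def)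
        then have lo: "m \<le> norm (z - \<rho> i)" unfolding m_def by (simp add: z_def)
        have "norm (z - \<rho> i) \<le> norm (z - c) + norm (\<rho> i - c)"
          using norm_triangle_ineq4[of "z - c" "\<rho> i - c"] by simp
        then have hi: "norm (z - \<rho> i) \<le> 6" using zc \<rho>[OF i] by simp
        have ln6: "ln (6::real) \<le> 2"
        proof -
          have "(5/2) * (5/2) \<le> exp 1 * exp (1::real)" using exp_lower_Taylor_quadratic[of "1::real"] by (intro mult_mono) auto
          then have "(6::real) \<le> exp 2" by (simp flip: exp_add)
          then have "ln 6 \<le> ln (exp (2::real))" by (subst ln_le_cancel_iff) auto
          then show ?thesis by simp
        qed
        have "\<bar>ln (norm (z - \<rho> i))\<bar> \<le> 2 + max 0 (- ln m)"
        proof -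
          have "ln m \<le> ln (norm (z - \<rho> i))" using lo m0 by (subst ln_le_cancel_iff) linarith+
          moreover have "ln (norm (z - \<rho> i)) \<le> ln 6" using lo hi m0 by (subst ln_le_cancel_iff) linarith+
          ultimately show ?thesis using ln6 by linarith
        qed
        then have 1: "norm (Ln (z - \<rho> i)) \<le> 2 + max 0 (- ln m) + pi"
          using norm_Ln_le[of "z - \<rho> i"] lo m0 by force
        have "1 \<le> norm (c - \<rho> i)"
          using Re\<rho>[OF i] complex_Re_le_cmod[of "c - \<rho> i"] by (simp add: c_def)
        moreover have "norm (c - \<rho> i) \<le> 6" using \<rho>[OF i] by (simp add: norm_minus_commute)
        ultimately have "0 \<le> ln (norm (c - \<rho> i))" "ln (norm (c - \<rho> i)) \<le> ln 6"
          by (simp, subst ln_le_cancel_iff) linarith+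
        then have 2: "norm (Ln (c - \<rho> i)) \<le> 2 + pi"
          using norm_Ln_le[of "c - \<rho> i"] \<open>1 \<le> norm (c - \<rho> i)\<close> ln6 by force
        show "norm (Ln (z - \<rho> i) - Ln (c - \<rho> i)) \<le> 12 + max 0 (- ln (max s \<bar>u - Im (\<rho> i)\<bar>))"
          using norm_triangle_ineq4[of "Ln (z - \<rho> i)" "Ln (c - \<rho> i)"] 1 2 pi_less_4 unfolding m_def by linarith
      qed
    qed
    also have "\<dots> = (G + 2 * A) + 12 * real n + (\<Sum>i<n. max 0 (- ln (max s \<bar>u - Im (\<rho> i)\<bar>)))"
      by (simp add: sum.distrib)
    \<comment> \<open>26 = 2 + 12 * 2: two from Borel-Caratheodory and twelve for each of at most 2
      A zeros, where 12 exceeds 4 + 2 pi, the regular part of the two logarithms.\<close>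
    also have "\<dots> \<le> G + 26 * A + (\<Sum>i<n. max 0 (- ln (max s \<bar>u - Im (\<rho> i)\<bar>)))" using n by simp
    finally show ?thesis unfolding z_def .
  qed
  show ?thesis
    by (rule that[of n "\<lambda>i. Im (\<rho> i)"]) (use Bb n main in \<open>auto simp: A_def\<close>)
qed

text \<open>The first bound serves for fixed \<open>s\<close>, the second is uniform in
  \<open>s\<close>: the square of |y| powr (-1/4) is still integrable at 0, as the mean square
  requires.\<close>

lemma ln_max_le:
  fixes s y :: real
  assumes "s > 0"
  shows "max 0 (- ln (max s \<bar>y\<bar>)) \<le> 4 + \<bar>ln s\<bar>"
    and "y \<noteq> 0 \<Longrightarrow> max 0 (- ln (max s \<bar>y\<bar>)) \<le> 4 * \<bar>y\<bar> powr (-1/4) * indicator {-1..1} y"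
proof -
  show "max 0 (- ln (max s \<bar>y\<bar>)) \<le> 4 + \<bar>ln s\<bar>"
  proof -
    have "ln s \<le> ln (max s \<bar>y\<bar>)" using assms by (subst ln_le_cancel_iff) auto
    then show ?thesis by linarith
  qed
  assume y: "y \<noteq> 0"
  show "max 0 (- ln (max s \<bar>y\<bar>)) \<le> 4 * \<bar>y\<bar> powr (-1/4) * indicator {-1..1} y"
  proof (cases "\<bar>y\<bar> \<le> 1")
    case True
    have "ln (\<bar>y\<bar> powr (-1/4)) \<le> \<bar>y\<bar> powr (-1/4)"
      using ln_le_minus_one[of "\<bar>y\<bar> powr (-1/4)"] y by simp
    then have "- ln \<bar>y\<bar> \<le> 4 * \<bar>y\<bar> powr (-1/4)" using y by (simp add: ln_powr)
    moreover have "ln \<bar>y\<bar> \<le> ln (max s \<bar>y\<bar>)" using y by (subst ln_le_cancel_iff) auto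
    ultimately show ?thesis using True by (auto simp: indicator_def)
  next
    case False
    then have "0 \<le> ln (max s \<bar>y\<bar>)" by simp
    then show ?thesis by simp
  qed
qed

lemma nn_integral_inverse_sqrt:
  "(\<integral>\<^sup>+u. ennreal (indicator {-1..1} (u - v) * \<bar>u - v\<bar> powr (-1/2)) \<partial>lborel) \<le> ennreal 4"
proof -
  have 1: "(\<integral>\<^sup>+u. ennreal (indicator {0..1} u * u powr (-1/2)) \<partial>lborel) = ennreal 2"
  proof -
    have "((\<lambda>x. x powr (-1/2)) has_integral 2) {0..1::real}"
      using has_integral_powr_from_0[of "-1/2" 1] by simp
    from nn_integral_has_integral_lebesgue[OF _ this] show ?thesis by simp
  qed
  have 2: "(\<integral>\<^sup>+u. ennreal (indicator {0..1} (-u) * (-u) powr (-1/2)) \<partial>lborel) = ennreal 2"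
    using nn_integral_real_affine[of "\<lambda>u. ennreal (indicator {0..1} u * u powr (-1/2))" "-1" 0] 1 by simp
  have "(\<integral>\<^sup>+u. ennreal (indicator {-1..1} (u - v) * \<bar>u - v\<bar> powr (-1/2)) \<partial>lborel)
    = (\<integral>\<^sup>+u. ennreal (indicator {-1..1} u * \<bar>u\<bar> powr (-1/2)) \<partial>lborel)"
    using nn_integral_real_affine[of "\<lambda>u. ennreal (indicator {-1..1} (u - v) * \<bar>u - v\<bar> powr (-1/2))" 1 v] by simp
  also have "\<dots> \<le> (\<integral>\<^sup>+u. ennreal (indicator {0..1} u * u powr (-1/2)) + ennreal (indicator {0..1} (-u) * (-u) powr (-1/2)) \<partial>lborel)"
    by (intro nn_integral_mono) (auto simp: indicator_def)
  also have "\<dots> = ennreal 2 + ennreal 2"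
    by (subst nn_integral_add) (use 1 2 in auto)
  also have "\<dots> = ennreal 4" by (simp flip: ennreal_plus)
  finally show ?thesis .
qed

text \<open>Cauchy-Schwarz over the at most \<open>X\<close> zeros makes the mean square quadratic
  in \<open>X\<close>, uniformly in \<open>s\<close>, because every squared singularity has bounded
  integral. The pointwise bound may grow like |ln s| as \<open>s\<close> tends to 0; it serves on
  half-planes Re s >= a > 0.\<close>

lemma local_log_L2:
  fixes W g :: "complex \<Rightarrow> complex" and T :: real
  defines "c \<equiv> Complex 1 T"
  assumes W: "W holomorphic_on UNIV" and nz: "\<And>z. Re z > 0 \<Longrightarrow> W z \<noteq> 0"
    and g: "g holomorphic_on {z. Re z > 0}" "\<And>z. Re z > 0 \<Longrightarrow> exp (g z) = W z"
    and B: "\<And>z. norm (z - c) = 12 \<Longrightarrow> norm (W z) \<le> B" and b: "norm (W c) \<ge> b" "b > 0"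
    and G: "norm (g c) \<le> G"
  defines "X \<equiv> G + 26 * (ln (B / b) + 1)"
  shows "0 < s \<Longrightarrow> s \<le> 1 \<Longrightarrow> norm (g (Complex s T)) \<le> X * (5 + \<bar>ln s\<bar>)"
    and "0 < s \<Longrightarrow> s \<le> 1 \<Longrightarrow>
      (\<integral>\<^sup>+u. ennreal (indicator {T-1..T+1} u * (norm (g (Complex s u)))\<^sup>2) \<partial>lborel) \<le> ennreal (300 * X\<^sup>2)"
proof -
  obtain n :: nat and \<gamma> :: "nat \<Rightarrow> real" where
    Bb: "B / b \<ge> 1" and n: "real n \<le> 2 * (ln (B / b) + 1)" and
    gb: "\<And>s u. 0 < s \<Longrightarrow> s \<le> 1 \<Longrightarrow> \<bar>u - T\<bar> \<le> 1 \<Longrightarrow>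
      norm (g (Complex s u)) \<le> G + 26 * (ln (B / b) + 1) + (\<Sum>i<n. max 0 (- ln (max s \<bar>u - \<gamma> i\<bar>)))"
    using local_log_formula[OF W nz g B[unfolded c_def] b[unfolded c_def] G[unfolded c_def]] by auto
  have G0: "G \<ge> 0" using order_trans[OF norm_ge_zero G] .
  have nX: "real n \<le> X" unfolding X_def using n G0 Bb ln_ge_zero[of "B / b"] by linarith
  have X0: "X \<ge> 0" using nX by linarith
  show "norm (g (Complex s T)) \<le> X * (5 + \<bar>ln s\<bar>)" if s: "0 < s" "s \<le> 1" for s
  proof -
    have "(\<Sum>i<n. max 0 (- ln (max s \<bar>T - \<gamma> i\<bar>))) \<le> (\<Sum>i<n. 4 + \<bar>ln s\<bar>)"
      by (intro sum_mono ln_max_le(1) s)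
    also have "\<dots> \<le> X * (4 + \<bar>ln s\<bar>)" using nX by (simp add: mult_right_mono)
    finally show ?thesis using gb[OF s, of T] unfolding X_def[symmetric] by (simp add: algebra_simps)
  qed
  show "(\<integral>\<^sup>+u. ennreal (indicator {T-1..T+1} u * (norm (g (Complex s u)))\<^sup>2) \<partial>lborel) \<le> ennreal (300 * X\<^sup>2)"
    if s: "0 < s" "s \<le> 1" for s
  proof -
    have pw: "indicator {T-1..T+1} u * (norm (g (Complex s u)))\<^sup>2
       \<le> 2 * X\<^sup>2 * indicator {T-1..T+1} u + (\<Sum>i<n. 32 * X * (indicator {-1..1} (u - \<gamma> i) * \<bar>u - \<gamma> i\<bar> powr (-1/2)))"
      if u: "u \<notin> \<gamma> ` {..<n}" for u
    proof (cases "u \<in> {T-1..T+1}")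
      case False
      then show ?thesis using X0 by (auto intro!: sum_nonneg)
    next
      case True
      define h where "h = (\<lambda>i. 4 * \<bar>u - \<gamma> i\<bar> powr (-1/4) * indicator {-1..1} (u - \<gamma> i))"
      have "norm (g (Complex s u)) \<le> X + (\<Sum>i<n. max 0 (- ln (max s \<bar>u - \<gamma> i\<bar>)))"
        using gb[OF s, of u] True by (auto simp: X_def abs_le_iff)
      also have "(\<Sum>i<n. max 0 (- ln (max s \<bar>u - \<gamma> i\<bar>))) \<le> (\<Sum>i<n. h i)"
        unfolding h_def by (intro sum_mono ln_max_le(2) s) (use u in auto)
      finally have "(norm (g (Complex s u)))\<^sup>2 \<le> (X + (\<Sum>i<n. h i))\<^sup>2" by (simp add: power_mono)
      also have "\<dots> \<le> 2 * X\<^sup>2 + 2 * (\<Sum>i<n. h i)\<^sup>2"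
        using sum_squares_bound[of X "\<Sum>i<n. h i"] by (simp add: power2_sum)
      also have "(\<Sum>i<n. h i)\<^sup>2 \<le> (\<Sum>i<n. (h i)\<^sup>2) * real n"
        using sum_squared_le_sum_of_squares[of h "{..<n}"] by simp
      also have "\<dots> \<le> (\<Sum>i<n. (h i)\<^sup>2) * X" using nX by (intro mult_left_mono sum_nonneg) auto
      finally have 1: "(norm (g (Complex s u)))\<^sup>2 \<le> 2 * X\<^sup>2 + 2 * ((\<Sum>i<n. (h i)\<^sup>2) * X)" by simp
      have "(h i)\<^sup>2 = 16 * (indicator {-1..1} (u - \<gamma> i) * \<bar>u - \<gamma> i\<bar> powr (-1/2))" for i
        unfolding h_def power_mult_distrib by (auto simp: indicator_def power2_eq_square simp flip: powr_add)
      with 1 have "(norm (g (Complex s u)))\<^sup>2 \<le> 2 * X\<^sup>2 + 2 * ((\<Sum>i<n. 16 * (indicator {-1..1} (u - \<gamma> i) * \<bar>u - \<gamma> i\<bar> powr (-1/2))) * X)"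
        by simp
      also have "2 * ((\<Sum>i<n. 16 * (indicator {-1..1} (u - \<gamma> i) * \<bar>u - \<gamma> i\<bar> powr (-1/2))) * X)
        = (\<Sum>i<n. 32 * X * (indicator {-1..1} (u - \<gamma> i) * \<bar>u - \<gamma> i\<bar> powr (-1/2)))"
        by (simp add: sum_distrib_left sum_distrib_right mult_ac)
      finally show ?thesis using True by simp
    qed
    have "(\<integral>\<^sup>+u. ennreal (indicator {T-1..T+1} u * (norm (g (Complex s u)))\<^sup>2) \<partial>lborel)
      \<le> (\<integral>\<^sup>+u. ennreal (2 * X\<^sup>2) * indicator {T-1..T+1} u + (\<Sum>i<n. ennreal (32 * X) * ennreal (indicator {-1..1} (u - \<gamma> i) * \<bar>u - \<gamma> i\<bar> powr (-1/2))) \<partial>lborel)"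
    proof (rule nn_integral_mono_AE)
      have "AE u in lborel. u \<notin> \<gamma> ` {..<n}"
        by (rule AE_not_in) (simp add: finite_imp_null_set_lborel)
      then show "AE u in lborel. ennreal (indicator {T-1..T+1} u * (norm (g (Complex s u)))\<^sup>2)
        \<le> ennreal (2 * X\<^sup>2) * indicator {T-1..T+1} u + (\<Sum>i<n. ennreal (32 * X) * ennreal (indicator {-1..1} (u - \<gamma> i) * \<bar>u - \<gamma> i\<bar> powr (-1/2)))"
      proof eventually_elim
        fix u assume "u \<notin> \<gamma> ` {..<n}"
        have "ennreal (indicator {T-1..T+1} u * (norm (g (Complex s u)))\<^sup>2)
          \<le> ennreal (2 * X\<^sup>2 * indicator {T-1..T+1} u + (\<Sum>i<n. 32 * X * (indicator {-1..1} (u - \<gamma> i) * \<bar>u - \<gamma> i\<bar> powr (-1/2))))"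
          by (rule ennreal_leI) (rule pw, fact)
        also have "\<dots> = ennreal (2 * X\<^sup>2 * indicator {T-1..T+1} u) + (\<Sum>i<n. ennreal (32 * X * (indicator {-1..1} (u - \<gamma> i) * \<bar>u - \<gamma> i\<bar> powr (-1/2))))"
          using X0 by (subst ennreal_plus) (auto intro!: sum_nonneg simp: sum_ennreal)
        also have "\<dots> = ennreal (2 * X\<^sup>2) * indicator {T-1..T+1} u + (\<Sum>i<n. ennreal (32 * X) * ennreal (indicator {-1..1} (u - \<gamma> i) * \<bar>u - \<gamma> i\<bar> powr (-1/2)))"
          using X0 by (subst (1 2) ennreal_mult) (auto simp: ennreal_indicator)
        finally show "ennreal (indicator {T-1..T+1} u * (norm (g (Complex s u)))\<^sup>2)
        \<le> ennreal (2 * X\<^sup>2) * indicator {T-1..T+1} u + (\<Sum>i<n. ennreal (32 * X) * ennreal (indicator {-1..1} (u - \<gamma> i) * \<bar>u - \<gamma> i\<bar> powr (-1/2)))" .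
      qed
    qed
    also have "\<dots> = ennreal (2 * X\<^sup>2) * ennreal 2 + (\<Sum>i<n. ennreal (32 * X) * (\<integral>\<^sup>+u. ennreal (indicator {-1..1} (u - \<gamma> i) * \<bar>u - \<gamma> i\<bar> powr (-1/2)) \<partial>lborel))"
      by (simp add: nn_integral_add nn_integral_sum nn_integral_cmult)
    also have "\<dots> \<le> ennreal (2 * X\<^sup>2) * ennreal 2 + (\<Sum>i<n. ennreal (32 * X) * ennreal 4)"
      by (intro add_mono sum_mono mult_left_mono nn_integral_inverse_sqrt) auto
    also have "\<dots> = ennreal (4 * X\<^sup>2 + real n * (128 * X))"
    proof -
      have "ennreal (2 * X\<^sup>2) * ennreal 2 + (\<Sum>i<n. ennreal (32 * X) * ennreal 4)
        = ennreal (2 * X\<^sup>2 * 2) + (\<Sum>i<n. ennreal (32 * X * 4))"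
        by (simp only: ennreal_mult''[symmetric] zero_le_numeral)
      also have "(\<Sum>i<n. ennreal (32 * X * 4)) = ennreal (\<Sum>i<n. 32 * X * 4)"
        using X0 by (intro sum_ennreal) auto
      also have "ennreal (2 * X\<^sup>2 * 2) + \<dots> = ennreal (2 * X\<^sup>2 * 2 + (\<Sum>i<n. 32 * X * 4))"
        using X0 by (intro ennreal_plus[symmetric]) auto
      finally show ?thesis by (simp add: mult_ac)
    qed
    \<comment> \<open>The constant 4 + 32 * 4 = 132 is rounded up to 300.\<close>
    also have "\<dots> \<le> ennreal (300 * X\<^sup>2)"
    proof (rule ennreal_leI)
      have "real n * (128 * X) \<le> X * (128 * X)" using nX X0 by (intro mult_right_mono) auto
      then show "4 * X\<^sup>2 + real n * (128 * X) \<le> 300 * X\<^sup>2"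
        using zero_le_square[of X] unfolding power2_eq_square by linarith
    qed
    finally show ?thesis .
  qed
qed

section \<open>Step functions and their Laplace transforms\<close>

lemma integrable_complex_exp_Ici:
  fixes s :: complex
  assumes "Re s > 0"
  shows "integrable lborel (\<lambda>x. indicator {l..} x *\<^sub>R exp (- (s * of_real x)))"
proof (rule Bochner_Integration.integrable_bound[OF integrable_exp_Ici[OF assms, of l]])
  show "AE x in lborel. norm (indicator {l..} x *\<^sub>R exp (- (s * of_real x))) \<le> norm (indicator {l..} x * exp (- (Re s * x)))"
    by (auto simp: indicator_def)
qed simp

lemma integral_complex_exp_Ici:
  fixes s :: complex
  assumes s: "Re s > 0"
  shows "(\<integral>x. indicator {l..} x *\<^sub>R exp (- (s * of_real x)) \<partial>lborel) = exp (- (s * of_real l)) / s"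
proof -
  have s0: "s \<noteq> 0" using s by auto
  have fin: "(\<integral>x. indicator {l..T} x *\<^sub>R exp (- (s * of_real x)) \<partial>lborel)
      = exp (- (s * of_real l)) / s - exp (- (s * of_real T)) / s" if "l \<le> T" for T
  proof -
    have "has_bochner_integral lborel (\<lambda>x. indicator {l..T} x *\<^sub>R exp (- (s * of_real x)))
      (- exp (- (s * of_real T)) / s - - exp (- (s * of_real l)) / s)"
    proof (rule has_bochner_integral_FTC_Icc[OF that])
      fix x
      have "((\<lambda>z. - exp (- (s * z)) / s) has_field_derivative exp (- (s * of_real x))) (at (of_real x))"
        using s0 by (auto intro!: derivative_eq_intros)
      then show "((\<lambda>x. - exp (- (s * of_real x)) / s) has_vector_derivative exp (- (s * of_real x))) (at x within {l..T})"
        by (rule has_vector_derivative_real_field)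
    next
      show "continuous_on {l..T} (\<lambda>x. exp (- (s * complex_of_real x)))" by (intro continuous_intros)
    qed
    then show ?thesis by (simp add: has_bochner_integral_iff)
  qed
  have "((\<lambda>T. \<integral>x. indicator {l..T} x *\<^sub>R exp (- (s * of_real x)) \<partial>lborel)
      \<longlongrightarrow> (\<integral>x. indicator {l..} x *\<^sub>R exp (- (s * of_real x)) \<partial>lborel)) at_top"
  proof (rule integral_dominated_convergence_at_top[where w = "\<lambda>x. indicator {l..} x * exp (- (Re s * x))"])
    show "integrable lborel (\<lambda>x. indicator {l..} x * exp (- (Re s * x)))" by (rule integrable_exp_Ici[OF s])
    show "\<forall>\<^sub>F T in at_top. AE x in lborel. norm (indicator {l..T} x *\<^sub>R exp (- (s * of_real x))) \<le> indicator {l..} x * exp (- (Re s * x))"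
      by (auto simp: indicator_def)
    show "AE x in lborel. ((\<lambda>T. indicator {l..T} x *\<^sub>R exp (- (s * of_real x))) \<longlongrightarrow> indicator {l..} x *\<^sub>R exp (- (s * of_real x))) at_top"
    proof (rule AE_I2)
      fix x :: real
      have "\<forall>\<^sub>F T in at_top. T \<ge> x" by (rule eventually_ge_at_top)
      then have "\<forall>\<^sub>F T in at_top. indicator {l..T} x *\<^sub>R exp (- (s * of_real x)) = indicator {l..} x *\<^sub>R exp (- (s * of_real x))"
        by eventually_elim (auto simp: indicator_def)
      then show "((\<lambda>T. indicator {l..T} x *\<^sub>R exp (- (s * of_real x))) \<longlongrightarrow> indicator {l..} x *\<^sub>R exp (- (s * of_real x))) at_top"
        by (rule tendsto_eventually)
    qed
  qed simp_all
  moreover have "((\<lambda>T. \<integral>x. indicator {l..T} x *\<^sub>R exp (- (s * of_real x)) \<partial>lborel) \<longlongrightarrow> exp (- (s * of_real l)) / s - 0) at_top"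
  proof (rule Lim_transform_eventually)
    have "((\<lambda>T. exp (- (s * of_real T))) \<longlongrightarrow> 0) at_top"
    proof (rule tendsto_norm_zero_cancel)
      have "((\<lambda>T. exp (- (Re s * T))) \<longlongrightarrow> 0) at_top" using s by real_asymp
      then show "((\<lambda>T. norm (exp (- (s * of_real T)))) \<longlongrightarrow> 0) at_top" by simp
    qed
    then have "((\<lambda>T. exp (- (s * of_real l)) / s - exp (- (s * of_real T)) / s) \<longlongrightarrow> exp (- (s * of_real l)) / s - 0 / s) at_top"
      using s0 by (intro tendsto_intros)
    then show "((\<lambda>T. exp (- (s * of_real l)) / s - exp (- (s * of_real T)) / s) \<longlongrightarrow> exp (- (s * of_real l)) / s - 0) at_top" by simp
    show "\<forall>\<^sub>F T in at_top. exp (- (s * of_real l)) / s - exp (- (s * of_real T)) / s = (\<integral>x. indicator {l..T} x *\<^sub>R exp (- (s * of_real x)) \<partial>lborel)"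
      using eventually_ge_at_top[of l] by eventually_elim (simp add: fin)
  qed
  ultimately have "(\<integral>x. indicator {l..} x *\<^sub>R exp (- (s * of_real x)) \<partial>lborel) = exp (- (s * of_real l)) / s - 0"
    by (rule tendsto_unique[OF trivial_limit_at_top_linorder])
  then show ?thesis by simp
qed

text \<open>The function jumps by \<open>a n\<close> at \<open>l n\<close>. Summation over all
  indices makes measurability immediate; when \<open>l\<close> tends to infinity, only finitely many
  terms are nonzero at each point.\<close>

definition step_sum :: "(nat \<Rightarrow> real) \<Rightarrow> (nat \<Rightarrow> complex) \<Rightarrow> real \<Rightarrow> complex" where
  "step_sum l a t = (\<Sum>n. indicator {l n..} t *\<^sub>R a n)"

lemma step_sum_finite:
  assumes "filterlim l at_top sequentially"
  shows "finite {n. l n \<le> t}" and "step_sum l a t = (\<Sum>n | l n \<le> t. a n)"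
proof -
  have "\<forall>\<^sub>F n in sequentially. l n > t" using assms by (simp add: filterlim_at_top_dense)
  then obtain N where "\<And>n. n \<ge> N \<Longrightarrow> l n > t" by (auto simp: eventually_sequentially)
  then have "{n. l n \<le> t} \<subseteq> {..<N}" by (force simp: not_less[symmetric])
  then show fin: "finite {n. l n \<le> t}" using finite_subset by blast
  have "step_sum l a t = (\<Sum>n\<in>{n. l n \<le> t}. indicator {l n..} t *\<^sub>R a n)"
    unfolding step_sum_def by (rule suminf_finite[OF fin]) (auto simp: indicator_def)
  then show "step_sum l a t = (\<Sum>n | l n \<le> t. a n)" by simp
qed

lemma step_sum_measurable [measurable]: "step_sum l a \<in> borel_measurable borel"
  unfolding step_sum_def[abs_def] by measurable

lemma step_sum_neg:
  assumes "\<And>n. l n \<ge> 0" "t < 0"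
  shows "step_sum l a t = 0"
proof -
  have "indicator {l n..} t = (0::real)" for n using assms(1)[of n] assms(2) by (simp add: indicator_def)
  then show ?thesis unfolding step_sum_def by simp
qed

text \<open>Rankin's trick: for l n <= t the weight exp (\<kappa> (t - l n)) is at least 1, and
  inserting it turns the finite sum into part of a convergent series times exp (\<kappa> t).\<close>

lemma step_sum_bound:
  assumes "filterlim l at_top sequentially" and "summable (\<lambda>n. norm (a n) * exp (- (\<kappa> * l n)))" and "\<kappa> \<ge> 0"
  shows "norm (step_sum l a t) \<le> (\<Sum>n. norm (a n) * exp (- (\<kappa> * l n))) * exp (\<kappa> * t)"
proof -
  have "norm (step_sum l a t) \<le> (\<Sum>n | l n \<le> t. norm (a n))"
    unfolding step_sum_finite(2)[OF assms(1)] by (rule norm_sum)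
  also have "\<dots> \<le> (\<Sum>n | l n \<le> t. norm (a n) * exp (- (\<kappa> * l n)) * exp (\<kappa> * t))"
  proof (rule sum_mono)
    fix n assume "n \<in> {n. l n \<le> t}"
    then have "\<kappa> * l n \<le> \<kappa> * t" using assms(3) by (auto intro: mult_left_mono)
    then have "1 \<le> exp (- (\<kappa> * l n)) * exp (\<kappa> * t)" by (simp flip: exp_add)
    then have "norm (a n) * 1 \<le> norm (a n) * (exp (- (\<kappa> * l n)) * exp (\<kappa> * t))" by (intro mult_left_mono) auto
    then show "norm (a n) \<le> norm (a n) * exp (- (\<kappa> * l n)) * exp (\<kappa> * t)" by (simp add: mult.assoc)
  qed
  also have "\<dots> = (\<Sum>n | l n \<le> t. norm (a n) * exp (- (\<kappa> * l n))) * exp (\<kappa> * t)"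
    by (simp add: sum_distrib_right)
  also have "\<dots> \<le> (\<Sum>n. norm (a n) * exp (- (\<kappa> * l n))) * exp (\<kappa> * t)"
    by (intro mult_right_mono sum_le_suminf assms(2) step_sum_finite(1)[OF assms(1)]) auto
  finally show ?thesis .
qed

lemma step_sum_isCont:
  assumes l: "filterlim l at_top sequentially" and t: "t \<notin> range l"
  shows "isCont (step_sum l a) t"
proof -
  have "finite (l ` {n. l n \<le> t + 1})" by (intro finite_imageI step_sum_finite[OF l])
  from finite_set_avoid[OF this, of t]
  obtain d where d: "d > 0" "\<forall>x \<in> l ` {n. l n \<le> t + 1}. x \<noteq> t \<longrightarrow> d \<le> dist t x"
    by blast
  have "step_sum l a x = step_sum l a t" if x: "dist x t < min d 1" for x
  proof -
    have "{n. l n \<le> x} = {n. l n \<le> t}"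
    proof (intro Set.set_eqI)
      fix n
      have "d \<le> \<bar>t - l n\<bar>" if "l n \<le> t + 1"
      proof -
        have "l n \<in> l ` {n. l n \<le> t + 1}" "l n \<noteq> t" using that t by blast+
        then have "d \<le> dist t (l n)" using d(2) by blast
        then show ?thesis by (simp add: dist_real_def)
      qed
      moreover have "\<bar>x - t\<bar> < d" "\<bar>x - t\<bar> < 1" using x by (simp_all add: dist_real_def)
      ultimately have "l n \<le> x \<longleftrightarrow> l n \<le> t" by linarith
      then show "n \<in> {n. l n \<le> x} \<longleftrightarrow> n \<in> {n. l n \<le> t}" by simp
    qed
    then show ?thesis by (simp add: step_sum_finite(2)[OF l])
  qed
  note eq = this
  have "\<forall>\<^sub>F x in nhds t. step_sum l a x = step_sum l a t"
    unfolding eventually_nhds_metric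
  proof (intro exI conjI allI impI)
    show "min d 1 > 0" using d(1) by simp
    show "step_sum l a x = step_sum l a t" if "dist x t < min d 1" for x by (rule eq[OF that])
  qed
  then have "\<forall>\<^sub>F x in at t. step_sum l a x = step_sum l a t"
    unfolding eventually_at_filter by (rule eventually_mono) (rule impI, rule impI)
  then show ?thesis unfolding isCont_def by (rule tendsto_eventually)
qed

lemma step_sum_AE_isCont:
  assumes "filterlim l at_top sequentially"
  shows "AE t in lborel. isCont (step_sum l a) t"
proof -
  have "countable (range l)" by (rule countable_image) simp
  then have "range l \<in> null_sets lborel" by (rule countable_imp_null_set_lborel)
  then have *: "AE t in lborel. t \<notin> range l" by (rule AE_not_in)
  show ?thesis
    using step_sum_isCont[OF assms] by (intro eventually_mono[OF *]) blast
qed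

text \<open>Each jump contributes the transform of a half-line, exp (- s l n) / s. Absolute
  convergence of the Dirichlet series justifies integration term by term.\<close>

lemma step_sum_laplace:
  assumes s: "Re s > 0" and l: "\<And>n. l n \<ge> 0" and sm: "summable (\<lambda>n. norm (a n) * exp (- (Re s * l n)))"
    and l': "filterlim l at_top sequentially"
  shows "(\<integral>v. step_sum l a v * exp (- (s * of_real v)) \<partial>lborel) = (\<Sum>n. a n * exp (- (s * of_real (l n)))) / s"
    and "integrable lborel (\<lambda>v. step_sum l a v * exp (- (s * of_real v)))"
    and "summable (\<lambda>n. a n * exp (- (s * of_real (l n))))"
proof -
  define f where "f = (\<lambda>n v. a n * (indicator {l n..} v *\<^sub>R exp (- (s * of_real v))))"
  have fi: "integrable lborel (f n)" for n unfolding f_def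
    by (intro integrable_mult_right integrable_complex_exp_Ici s)
  have nf: "norm (f n v) = norm (a n) * (indicator {l n..} v * exp (- (Re s * v)))" for n v
    unfolding f_def by (simp add: norm_mult)
  have int_n: "(\<integral>v. norm (f n v) \<partial>lborel) = norm (a n) * exp (- (Re s * l n)) / Re s" for n
  proof -
    have e: "complex_of_real (indicator {l n..} v * exp (- (Re s * v))) = indicator {l n..} v *\<^sub>R exp (- (of_real (Re s) * complex_of_real v))" for v
      by (cases "l n \<le> v") (simp_all flip: exp_of_real)
    have "complex_of_real (\<integral>v. indicator {l n..} v * exp (- (Re s * v)) \<partial>lborel) = (\<integral>v. indicator {l n..} v *\<^sub>R exp (- (of_real (Re s) * complex_of_real v)) \<partial>lborel)"
      unfolding e[symmetric] by (rule integral_complex_of_real[symmetric])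
    also have "\<dots> = exp (- (of_real (Re s) * of_real (l n))) / of_real (Re s)"
      using s by (intro integral_complex_exp_Ici) simp
    also have "\<dots> = of_real (exp (- (Re s * l n)) / Re s)"
      by (simp flip: exp_of_real)
    finally show ?thesis unfolding nf by (simp only: of_real_eq_iff integral_mult_right_zero times_divide_eq_right)
  qed
  have fs: "f n v = (indicator {l n..} v *\<^sub>R a n) * exp (- (s * of_real v))" for n v
    unfolding f_def by simp
  have sums1: "summable (\<lambda>n. norm (f n v))" for v
  proof (rule summable_finite[OF step_sum_finite(1)[OF l', of v]])
    show "norm (f n v) = 0" if "n \<notin> {n. l n \<le> v}" for n using that unfolding f_def by simp
  qed
  have sums2: "summable (\<lambda>n. \<integral>v. norm (f n v) \<partial>lborel)"
    unfolding int_n using sm by (rule summable_divide)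
  have eq: "(\<Sum>n. f n v) = step_sum l a v * exp (- (s * of_real v))" for v
  proof -
    have "summable (\<lambda>n. indicator {l n..} v *\<^sub>R a n)"
      by (rule summable_finite[OF step_sum_finite(1)[OF l', of v]]) auto
    then show ?thesis unfolding fs step_sum_def by (simp add: suminf_mult2)
  qed
  have "integrable lborel (\<lambda>v. \<Sum>n. f n v)"
    by (rule integrable_suminf[OF fi _ sums2]) (use sums1 in auto)
  then show "integrable lborel (\<lambda>v. step_sum l a v * exp (- (s * of_real v)))" unfolding eq .
  have int_f: "(\<integral>v. f n v \<partial>lborel) = a n * exp (- (s * of_real (l n))) / s" for n
    unfolding f_def integral_mult_right_zero integral_complex_exp_Ici[OF s] by simp
  show sm': "summable (\<lambda>n. a n * exp (- (s * of_real (l n))))"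
    by (rule summable_norm_cancel) (use sm in \<open>simp add: norm_mult\<close>)
  have "(\<integral>v. (\<Sum>n. f n v) \<partial>lborel) = (\<Sum>n. \<integral>v. f n v \<partial>lborel)"
    by (rule integral_suminf[OF fi _ sums2]) (use sums1 in auto)
  also have "\<dots> = (\<Sum>n. a n * exp (- (s * of_real (l n)))) / s"
    unfolding int_f using suminf_divide[OF sm'] by simp
  finally show "(\<integral>v. step_sum l a v * exp (- (s * of_real v)) \<partial>lborel) = (\<Sum>n. a n * exp (- (s * of_real (l n)))) / s"
    unfolding eq .
qed

section \<open>A Tauberian theorem for sums over primes\<close>

lemma integral_exp_Ici_real:
  fixes a l :: real
  assumes "a > 0"
  shows "(\<integral>x. indicator {l..} x * exp (- (a * x)) \<partial>lborel) = exp (- (a * l)) / a"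
proof -
  have e: "complex_of_real (indicator {l..} v * exp (- (a * v))) = indicator {l..} v *\<^sub>R exp (- (of_real a * complex_of_real v))" for v
    by (cases "l \<le> v") (simp_all flip: exp_of_real)
  have "complex_of_real (\<integral>v. indicator {l..} v * exp (- (a * v)) \<partial>lborel) = (\<integral>v. indicator {l..} v *\<^sub>R exp (- (of_real a * complex_of_real v)) \<partial>lborel)"
    unfolding e[symmetric] by (rule integral_complex_of_real[symmetric])
  also have "\<dots> = exp (- (of_real a * of_real l)) / of_real a"
    using assms by (intro integral_complex_exp_Ici) simp
  also have "\<dots> = of_real (exp (- (a * l)) / a)"
    by (simp flip: exp_of_real)
  finally show ?thesis by (simp only: of_real_eq_iff)
qed

text \<open>The factor 1 - exp (- x) vanishes at 0 and compensates the logarithm there; for large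
  \<open>x\<close>, half of the decay of a weight exp (- x) survives. The right side is at least 8 +
  4 x + x^2, which exceeds x + 1 + x^2.\<close>

lemma ln_bound_weight:
  fixes x :: real
  assumes "x > 0"
  shows "(1 - exp (- x)) * (1 + \<bar>ln x\<bar>) \<le> 8 * exp (x / 2)"
proof -
  have e: "8 * exp (x / 2) \<ge> 8 + 4 * x + x\<^sup>2"
    using exp_lower_Taylor_quadratic[of "x / 2"] assms by (simp add: power2_eq_square field_simps)
  have "(1 - exp (- x)) * (1 + \<bar>ln x\<bar>) \<le> x * (1 + \<bar>ln x\<bar>)"
    using exp_ge_add_one_self[of "- x"] by (intro mult_right_mono) auto
  also have "\<dots> \<le> x + 1 + x\<^sup>2"
  proof (cases "x \<ge> 1")
    case True
    then have "\<bar>ln x\<bar> \<le> x" using ln_le_minus_one[of x] by simp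
    then have "x * \<bar>ln x\<bar> \<le> x * x" using assms by (intro mult_left_mono) auto
    then show ?thesis by (simp add: algebra_simps power2_eq_square)
  next
    case False
    then have "\<bar>ln x\<bar> = ln (1 / x)" using assms by (simp add: ln_div)
    also have "\<dots> \<le> 1 / x" using ln_le_minus_one[of "1 / x"] assms by simp
    finally have "x * \<bar>ln x\<bar> \<le> x * (1 / x)" using assms by (intro mult_left_mono) auto
    then have "x * \<bar>ln x\<bar> \<le> 1" using assms by simp
    then have "x * \<bar>ln x\<bar> \<le> 1 + x\<^sup>2" using zero_le_power2[of x] by linarith
    then show ?thesis by (simp add: algebra_simps)
  qed
  finally show ?thesis using e assms by linarith
qed

text \<open>Oscillation is slow on a multiplicative scale: the variation depends on the ratio of t'
  and t. The shift by 2 in the denominator absorbs rounding to integers and to powers of 2 in the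
  sums to which this applies. Karamata's method passes from the Abel means in \<open>lap\<close> to
  the function itself.\<close>

locale slowly_oscillating =
  fixes f :: "real \<Rightarrow> complex" and K M :: real
  assumes fm [measurable]: "f \<in> borel_measurable borel"
    and neg: "\<And>t. t < 0 \<Longrightarrow> f t = 0"
    and osc: "\<And>t t'. 3 \<le> t \<Longrightarrow> t \<le> t' \<Longrightarrow> norm (f t' - f t) \<le> K * ln (t' / (t - 2))"
    and small: "\<And>t. t \<le> 3 \<Longrightarrow> norm (f t) \<le> M" and K0: "K \<ge> 0"
    and int: "\<And>d. d > 0 \<Longrightarrow> integrable lborel (\<lambda>v. f v * of_real (exp (- (d * v))))"
    and lap: "((\<lambda>d. of_real d * (\<integral>v. f v * of_real (exp (- (d * v))) \<partial>lborel)) \<longlongrightarrow> 0) (at_right 0)"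
begin

lemma M0: "M \<ge> 0" using order_trans[OF norm_ge_zero small[of 0]] by simp

text \<open>For t >= 3 the denominator t - 2 is at least t / 3, at the cost of ln 3 <= 2; below 3
  the bound \<open>M\<close> takes over.\<close>

lemma osc_ratio:
  assumes t: "t \<ge> 3" and u: "u > 0"
  shows "norm (f u - f t) \<le> (2 * K + 2 * M) * (1 + \<bar>ln (u / t)\<bar>)"
proof -
  have ln3: "ln (3::real) \<le> 2" using ln_le_minus_one[of "3::real"] by simp
  have main: "norm (f b - f a) \<le> 2 * K + K * ln (b / a)" if ab: "3 \<le> a" "a \<le> b" for a b
  proof -
    have "ln (b / (a - 2)) \<le> ln (3 * (b / a))"
      using ab by (subst ln_le_cancel_iff) (auto simp: field_simps)
    also have "ln (3 * (b / a)) = ln 3 + ln (b / a)" using ab by (subst ln_mult) auto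
    finally have "ln (b / (a - 2)) \<le> 2 + ln (b / a)" using ln3 by linarith
    then have "K * ln (b / (a - 2)) \<le> K * (2 + ln (b / a))" using K0 by (rule mult_left_mono)
    then show ?thesis using osc[OF ab] by (simp add: algebra_simps)
  qed
  define l where "l = \<bar>ln (u / t)\<bar>"
  have lut: "ln (t / u) = - ln (u / t)" using t u by (simp add: ln_div)
  have nonneg: "0 \<le> K * l" "0 \<le> M * l" unfolding l_def using K0 M0 by simp_all
  have "norm (f u - f t) \<le> 2 * K + 2 * M + K * l"
  proof -
    consider "u \<ge> t" | "3 \<le> u" "u < t" | "u < 3" by linarith
    then show ?thesis
    proof cases
      case 1
      have "norm (f u - f t) \<le> 2 * K + K * ln (u / t)" using main[of t u] 1 t by simp
      also have "K * ln (u / t) \<le> K * l" unfolding l_def using K0 by (intro mult_left_mono) auto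
      finally show ?thesis using M0 by simp
    next
      case 2
      have "norm (f t - f u) \<le> 2 * K + K * ln (t / u)" using main[of u t] 2 by simp
      also have "K * ln (t / u) \<le> K * l" unfolding l_def lut using K0 by (intro mult_left_mono) auto
      finally show ?thesis using M0 by (simp add: norm_minus_commute)
    next
      case 3
      have "norm (f u - f t) \<le> norm (f u - f 3) + norm (f t - f 3)"
        using norm_triangle_ineq4[of "f u - f 3" "f t - f 3"] by simp
      moreover have "norm (f u - f 3) \<le> 2 * M"
        using norm_triangle_ineq4[of "f u" "f 3"] small[of u] small[of 3] 3 by simp
      moreover have "norm (f t - f 3) \<le> 2 * K + K * ln (t / 3)" using main[of 3 t] t by simp
      moreover have "K * ln (t / 3) \<le> K * l"
      proof (rule mult_left_mono[OF _ K0])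
        have "ln (t / 3) \<le> ln (t / u)" using u 3 t by (subst ln_le_cancel_iff) (auto simp: field_simps)
        then show "ln (t / 3) \<le> l" unfolding lut l_def by linarith
      qed
      ultimately show ?thesis by linarith
    qed
  qed
  then show ?thesis using nonneg unfolding l_def[symmetric] by (simp add: algebra_simps)
qed

text \<open>exp (- d u) ^ (k + 1) is the Abel kernel with parameter (k + 1) d, so these are rescaled
  Abel means. By linearity, every polynomial in exp (- d u) becomes a permissible weight.\<close>

lemma scaled_integrable:
  shows "d > 0 \<Longrightarrow> integrable lborel (\<lambda>u. f u * of_real (d * exp (- (d * u)) * exp (- (d * u)) ^ k))"
    and "((\<lambda>d. \<integral>u. f u * of_real (d * exp (- (d * u)) * exp (- (d * u)) ^ k) \<partial>lborel) \<longlongrightarrow> 0) (at_right 0)"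
proof -
  have e: "f u * of_real (d * exp (- (d * u)) * exp (- (d * u)) ^ k)
      = of_real d * (f u * of_real (exp (- ((real (Suc k) * d) * u))))" for d u
  proof -
    have "exp (- (d * u)) * exp (- (d * u)) ^ k = exp (- ((real (Suc k) * d) * u))"
      by (simp add: algebra_simps flip: exp_of_nat_mult exp_add)
    then show ?thesis by (simp add: mult.assoc)
  qed
  show "integrable lborel (\<lambda>u. f u * of_real (d * exp (- (d * u)) * exp (- (d * u)) ^ k))" if "d > 0"
    unfolding e by (intro integrable_mult_right int) (use that in simp)
  have "filterlim (\<lambda>d. real (Suc k) * d) (at_right 0) (at_right 0)"
    by real_asymp
  then have "((\<lambda>d. of_real (real (Suc k) * d) * (\<integral>v. f v * of_real (exp (- ((real (Suc k) * d) * v))) \<partial>lborel)) \<longlongrightarrow> 0) (at_right 0)"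
    by (rule filterlim_compose[OF lap])
  then have "((\<lambda>d. of_real (1 / real (Suc k)) * (of_real (real (Suc k) * d) * (\<integral>v. f v * of_real (exp (- ((real (Suc k) * d) * v))) \<partial>lborel))) \<longlongrightarrow> of_real (1 / real (Suc k)) * 0) (at_right 0)"
    by (intro tendsto_mult tendsto_const)
  moreover have "of_real (1 / real (Suc k)) * (of_real (real (Suc k) * d) * X) = of_real d * X" for d and X :: complex
    by (simp add: of_nat_Suc[symmetric] del: of_nat_Suc)
  ultimately show "((\<lambda>d. \<integral>u. f u * of_real (d * exp (- (d * u)) * exp (- (d * u)) ^ k) \<partial>lborel) \<longlongrightarrow> 0) (at_right 0)"
    unfolding e by simp
qed

lemma polynomial_weight:
  fixes a :: "nat \<Rightarrow> real"
  shows "((\<lambda>d. \<integral>u. f u * of_real (d * exp (- (d * u)) * (\<Sum>i\<le>n. a i * exp (- (d * u)) ^ i)) \<partial>lborel) \<longlongrightarrow> 0) (at_right 0)"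
    and "d > 0 \<Longrightarrow> integrable lborel (\<lambda>u. f u * of_real (d * exp (- (d * u)) * (\<Sum>i\<le>n. a i * exp (- (d * u)) ^ i)))"
proof -
  have e: "f u * of_real (d * exp (- (d * u)) * (\<Sum>i\<le>n. a i * exp (- (d * u)) ^ i))
     = (\<Sum>i\<le>n. of_real (a i) * (f u * of_real (d * exp (- (d * u)) * exp (- (d * u)) ^ i)))" for d u
    by (simp add: sum_distrib_left mult_ac)
  show "integrable lborel (\<lambda>u. f u * of_real (d * exp (- (d * u)) * (\<Sum>i\<le>n. a i * exp (- (d * u)) ^ i)))" if "d > 0"
    unfolding e using that by (intro Bochner_Integration.integrable_sum integrable_mult_right scaled_integrable(1))
  have "((\<lambda>d. \<Sum>i\<le>n. of_real (a i) * (\<integral>u. f u * of_real (d * exp (- (d * u)) * exp (- (d * u)) ^ i) \<partial>lborel)) \<longlongrightarrow> (\<Sum>i\<le>n. of_real (a i) * 0)) (at_right 0)"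
    by (intro tendsto_sum tendsto_mult tendsto_const scaled_integrable(2))
  moreover have "\<forall>\<^sub>F d in at_right 0. (\<Sum>i\<le>n. of_real (a i) * (\<integral>u. f u * of_real (d * exp (- (d * u)) * exp (- (d * u)) ^ i) \<partial>lborel))
     = (\<integral>u. f u * of_real (d * exp (- (d * u)) * (\<Sum>i\<le>n. a i * exp (- (d * u)) ^ i)) \<partial>lborel)"
  proof (rule eventually_mono[OF eventually_at_right_less[of 0]])
    fix d :: real assume "0 < d"
    then show "(\<Sum>i\<le>n. of_real (a i) * (\<integral>u. f u * of_real (d * exp (- (d * u)) * exp (- (d * u)) ^ i) \<partial>lborel))
     = (\<integral>u. f u * of_real (d * exp (- (d * u)) * (\<Sum>i\<le>n. a i * exp (- (d * u)) ^ i)) \<partial>lborel)"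
      unfolding e by (subst Bochner_Integration.integral_sum) (auto intro!: integrable_mult_right scaled_integrable(1) simp del: of_real_mult of_real_power)
  qed
  ultimately show "((\<lambda>d. \<integral>u. f u * of_real (d * exp (- (d * u)) * (\<Sum>i\<le>n. a i * exp (- (d * u)) ^ i)) \<partial>lborel) \<longlongrightarrow> 0) (at_right 0)"
    by (simp add: Lim_transform_eventually)
qed

text \<open>The mean of \<open>f\<close> against \<open>w\<close> is compared with
  \<open>f t\<close> times the mass of \<open>w\<close>, and \<open>b\<close> dominates the
  oscillation of \<open>f\<close> around \<open>f t\<close>. The point u = 0 is a null set, where a
  logarithmic bound may be infinite.\<close>

lemma mean_difference:
  fixes w :: "real \<Rightarrow> real"
  assumes wi: "integrable lborel (\<lambda>u. indicator {0..} u * w u)" and fi: "integrable lborel (\<lambda>u. f u * of_real (w u))"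
    and bi: "integrable lborel b" and b: "\<And>u. u > 0 \<Longrightarrow> norm (f u - f t) * \<bar>w u\<bar> \<le> b u" and b0: "\<And>u. b u \<ge> 0"
  shows "norm (f t * of_real (\<integral>u. indicator {0..} u * w u \<partial>lborel)) \<le> norm (\<integral>u. f u * of_real (w u) \<partial>lborel) + (\<integral>u. b u \<partial>lborel)"
proof -
  have i2: "integrable lborel (\<lambda>u. f t * of_real (indicator {0..} u * w u))"
    by (intro integrable_mult_right integrable_of_real wi)
  have eq: "f t * of_real (\<integral>u. indicator {0..} u * w u \<partial>lborel) = (\<integral>u. f t * of_real (indicator {0..} u * w u) \<partial>lborel)"
    by (simp only: integral_mult_right_zero integral_complex_of_real)
  have "norm ((\<integral>u. f u * of_real (w u) \<partial>lborel) - (\<integral>u. f t * of_real (indicator {0..} u * w u) \<partial>lborel))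
     = norm (\<integral>u. f u * of_real (w u) - f t * of_real (indicator {0..} u * w u) \<partial>lborel)"
    by (simp only: Bochner_Integration.integral_diff[OF fi i2])
  also have "\<dots> \<le> (\<integral>u. norm (f u * of_real (w u) - f t * of_real (indicator {0..} u * w u)) \<partial>lborel)"
    by (rule integral_norm_bound)
  also have "\<dots> \<le> (\<integral>u. b u \<partial>lborel)"
  proof (rule integral_mono_AE)
    show "integrable lborel (\<lambda>u. norm (f u * of_real (w u) - f t * of_real (indicator {0..} u * w u)))"
      by (intro integrable_norm Bochner_Integration.integrable_diff fi i2)
    have "AE u in lborel. u \<noteq> (0::real)" by (rule AE_lborel_singleton)
    then show "AE u in lborel. norm (f u * of_real (w u) - f t * of_real (indicator {0..} u * w u)) \<le> b u"
    proof (rule eventually_mono)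
      fix u :: real assume "u \<noteq> 0"
      show "norm (f u * of_real (w u) - f t * of_real (indicator {0..} u * w u)) \<le> b u"
      proof (cases "u < 0")
        case True
        then show ?thesis using neg[of u] b0[of u] by simp
      next
        case False
        then have "u > 0" using \<open>u \<noteq> 0\<close> by simp
        then have "f u * of_real (w u) - f t * of_real (indicator {0..} u * w u) = (f u - f t) * of_real (w u)"
          by (simp add: algebra_simps)
        then show ?thesis using b[OF \<open>u > 0\<close>] by (simp add: norm_mult)
      qed
    qed
  qed (rule bi)
  finally show ?thesis unfolding eq
    using norm_triangle_ineq2[of "\<integral>u. f t * of_real (indicator {0..} u * w u) \<partial>lborel" "\<integral>u. f u * of_real (w u) \<partial>lborel"]
    by (simp only: norm_minus_commute)
qed

text \<open>With y = exp (- d u) and d = 1 / t, the weight d y (1 - y) is polynomial, so its means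
  tend to 0; it vanishes at u = 0, where the oscillation bound has a logarithmic singularity. Its
  mass is 1/2.\<close>

lemma bounded: "\<exists>C. \<forall>t. norm (f t) \<le> C"
proof -
  define a where "a = (\<lambda>i::nat. if i = 0 then 1 else (- 1::real))"
  have a: "(\<Sum>i\<le>1. a i * x ^ i) = 1 - x" for x :: real unfolding a_def by simp
  define w where "w = (\<lambda>d u. d * exp (- (d * u)) * (1 - exp (- (d * u))) :: real)"
  define C where "C = 2 * K + 2 * M"
  have C0: "C \<ge> 0" unfolding C_def using K0 M0 by simp
  have "((\<lambda>d. \<integral>u. f u * of_real (w d u) \<partial>lborel) \<longlongrightarrow> 0) (at_right 0)"
    using polynomial_weight(1)[of a 1] unfolding a w_def .
  then have "\<forall>\<^sub>F d in at_right 0. norm (\<integral>u. f u * of_real (w d u) \<partial>lborel) < 1"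
    by (auto simp: tendsto_iff)
  then have "\<forall>\<^sub>F t in at_top. norm (\<integral>u. f u * of_real (w (inverse t) u) \<partial>lborel) < 1"
    by (rule eventually_compose_filterlim[OF _ filterlim_inverse_at_right_top])
  then obtain T where T: "\<And>t. t \<ge> T \<Longrightarrow> norm (\<integral>u. f u * of_real (w (inverse t) u) \<partial>lborel) < 1"
    by (auto simp: eventually_at_top_linorder)
  \<comment> \<open>With mass 1/2, mean at most 1 and oscillation at most 16 C, the bound is 2 (1 +
    16 C).\<close>
  have large: "norm (f t) \<le> 2 + 32 * C" if t: "t \<ge> 3" "t \<ge> T" for t
  proof -
    define d where "d = inverse t"
    have d: "d > 0" using t by (simp add: d_def)
    have w: "indicator {0..} u * w d u = d * (indicator {0..} u * exp (- (d * u))) - d * (indicator {0..} u * exp (- ((2 * d) * u)))" for u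
    proof -
      have "exp (- (d * u)) * exp (- (d * u)) = exp (- ((2 * d) * u))" by (simp flip: exp_add)
      then show ?thesis unfolding w_def by (simp add: algebra_simps)
    qed
    have i1: "integrable lborel (\<lambda>u. d * (indicator {0..} u * exp (- (d * u))))"
      and i2: "integrable lborel (\<lambda>u. d * (indicator {0..} u * exp (- ((2 * d) * u))))"
      and i3: "integrable lborel (\<lambda>u. (8 * C * d) * (indicator {0..} u * exp (- ((d / 2) * u))))"
      using d by (intro integrable_mult_right integrable_exp_Ici; simp)+
    have wi: "integrable lborel (\<lambda>u. indicator {0..} u * w d u)"
      unfolding w by (rule Bochner_Integration.integrable_diff[OF i1 i2])
    have wint: "(\<integral>u. indicator {0..} u * w d u \<partial>lborel) = 1 / 2"
      unfolding w Bochner_Integration.integral_diff[OF i1 i2] integral_mult_right_zero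
      using d integral_exp_Ici_real[of d 0] integral_exp_Ici_real[of "2 * d" 0] by simp
    have fi: "integrable lborel (\<lambda>u. f u * of_real (w d u))"
      using polynomial_weight(2)[OF d, of a 1] unfolding a w_def .
    have "norm (f t * of_real (\<integral>u. indicator {0..} u * w d u \<partial>lborel)) \<le> norm (\<integral>u. f u * of_real (w d u) \<partial>lborel)
       + (\<integral>u. (8 * C * d) * (indicator {0..} u * exp (- ((d / 2) * u))) \<partial>lborel)"
    proof (rule mean_difference[OF wi fi i3])
      fix u :: real assume u: "u > 0"
      have du: "d * u > 0" using d u by simp
      have "norm (f u - f t) \<le> C * (1 + \<bar>ln (d * u)\<bar>)"
        using osc_ratio[OF t(1) u] unfolding C_def d_def by (simp add: divide_inverse mult.commute)
      moreover have w0: "\<bar>w d u\<bar> = d * exp (- (d * u)) * (1 - exp (- (d * u)))"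
        unfolding w_def using d u by simp
      ultimately have "norm (f u - f t) * \<bar>w d u\<bar> \<le> (C * (1 + \<bar>ln (d * u)\<bar>)) * (d * exp (- (d * u)) * (1 - exp (- (d * u))))"
        unfolding w0 using d u by (intro mult_right_mono) auto
      also have "\<dots> = (C * d * exp (- (d * u))) * ((1 - exp (- (d * u))) * (1 + \<bar>ln (d * u)\<bar>))" by (simp only: mult_ac)
      also have "\<dots> \<le> (C * d * exp (- (d * u))) * (8 * exp (d * u / 2))"
        using C0 d by (intro mult_left_mono ln_bound_weight[OF du]) auto
      also have "\<dots> = (8 * C * d) * (exp (- (d * u)) * exp (d * u / 2))" by (simp only: mult_ac)
      also have "exp (- (d * u)) * exp (d * u / 2) = exp (- ((d / 2) * u))" by (simp flip: exp_add)
      finally show "norm (f u - f t) * \<bar>w d u\<bar> \<le> (8 * C * d) * (indicator {0..} u * exp (- ((d / 2) * u)))"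
        using u by simp
    qed (use C0 d in auto)
    also have "norm (\<integral>u. f u * of_real (w d u) \<partial>lborel) \<le> 1" using T[OF t(2)] unfolding d_def by simp
    also have "(\<integral>u. (8 * C * d) * (indicator {0..} u * exp (- ((d / 2) * u))) \<partial>lborel) = 16 * C"
      unfolding integral_mult_right_zero using d integral_exp_Ici_real[of "d / 2" 0] by simp
    finally show ?thesis unfolding wint by (simp add: norm_mult)
  qed
  define U where "U = max 3 T"
  have "norm (f t) \<le> M + (2 + 32 * C) + (M + K * ln U)" for t
  proof -
    have U3: "U \<ge> 3" unfolding U_def by simp
    then have lnU: "0 \<le> K * ln U" using K0 by simp
    consider "t \<le> 3" | "t \<ge> U" | "3 \<le> t" "t \<le> U" by linarith
    then show ?thesis
    proof cases
      case 1
      then show ?thesis using small[OF 1] M0 C0 lnU by simp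
    next
      case 2
      then have "norm (f t) \<le> 2 + 32 * C" by (intro large) (simp_all add: U_def)
      then show ?thesis using M0 C0 lnU by simp
    next
      case 3
      have "norm (f t - f 3) \<le> K * ln (t / (3 - 2))" using 3 by (intro osc) auto
      also have "\<dots> \<le> K * ln U"
      proof (rule mult_left_mono[OF _ K0])
        show "ln (t / (3 - 2)) \<le> ln U" using 3 by simp
      qed
      finally have "norm (f t) \<le> norm (f 3) + K * ln U" using norm_triangle_ineq2[of "f t" "f 3"] by linarith
      then show ?thesis using small[of 3] M0 C0 by simp
    qed
  qed
  then show ?thesis by blast
qed

text \<open>The condition t >= 2 / \<eta> makes the shift 2 at most \<eta> t, comparable with the
  window; t >= 8 keeps a - 2 above t / 4. The factor 8 is 2 \<eta> t divided by t / 4.\<close>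

lemma near_oscillation:
  assumes \<eta>: "0 < \<eta>" "\<eta> \<le> 1 / 2" and t: "t \<ge> 8" "t \<ge> 2 / \<eta>" and u: "\<bar>u - t\<bar> \<le> \<eta> * t"
  shows "norm (f u - f t) \<le> 8 * K * \<eta>"
proof -
  have \<eta>t: "2 \<le> \<eta> * t" "\<eta> * t \<le> t / 2" using \<eta> t by (auto simp: field_simps)
  have main: "norm (f b - f a) \<le> 8 * K * \<eta>" if ab: "a \<le> b" "t / 2 \<le> a" "b - a \<le> \<eta> * t" for a b
  proof -
    have a2: "a - 2 \<ge> t / 4" using ab t by linarith
    have "ln (b / (a - 2)) \<le> b / (a - 2) - 1"
      by (rule ln_le_minus_one) (use a2 ab t in \<open>auto intro!: divide_pos_pos\<close>)
    also have "\<dots> = (b - a + 2) / (a - 2)" using a2 t by (simp add: field_simps)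
    also have "\<dots> \<le> (2 * (\<eta> * t)) / (t / 4)"
      using a2 ab \<eta>t t by (intro frac_le) linarith+
    also have "\<dots> = 8 * \<eta>" using t by simp
    finally have "K * ln (b / (a - 2)) \<le> K * (8 * \<eta>)" using K0 by (rule mult_left_mono)
    then show ?thesis using osc[of a b] ab t by simp
  qed
  show ?thesis
  proof (cases "t \<le> u")
    case True
    then show ?thesis using u \<eta>t t by (intro main) auto
  next
    case False
    have "norm (f t - f u) \<le> 8 * K * \<eta>"
      by (rule main) (use False u \<eta>t in linarith)+
    then show ?thesis by (simp add: norm_minus_commute)
  qed
qed

text \<open>A continuous bump concentrated near u = t serves as kernel. Weierstrass approximation
  replaces it by a polynomial weight, whose means tend to 0; boundedness of \<open>f\<close>
  controls the approximation error, and on the support of the bump \<open>f\<close> hardly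
  varies.\<close>

theorem tendsto_zero: "(f \<longlongrightarrow> 0) at_top"
proof (rule tendstoI)
  fix \<epsilon> :: real assume \<epsilon>: "\<epsilon> > 0"
  obtain Bd where Bd: "\<And>t. norm (f t) \<le> Bd" using bounded by blast
  have Bd0: "Bd \<ge> 0" using order_trans[OF norm_ge_zero Bd[of 0]] .
  define \<eta> where "\<eta> = min (1 / 2) (\<epsilon> / (32 * (K + 1)))"
  have \<eta>: "\<eta> > 0" "\<eta> \<le> 1 / 2" unfolding \<eta>_def by (use \<epsilon> K0 in simp) (rule min.cobounded1)
  have K\<eta>: "8 * K * \<eta> \<le> \<epsilon> / 4"
  proof -
    have "8 * K * \<eta> \<le> 8 * K * (\<epsilon> / (32 * (K + 1)))"
      unfolding \<eta>_def using K0 by (intro mult_left_mono) auto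
    also have "\<dots> = (\<epsilon> / 4) * (K / (K + 1))" using K0 by (simp add: field_simps)
    also have "\<dots> \<le> (\<epsilon> / 4) * 1" using K0 \<epsilon> by (intro mult_left_mono) auto
    finally show ?thesis by simp
  qed
  \<comment> \<open>In the variable y = exp (- u / t), the point u = t is y = exp (- 1) for every
    \<open>t\<close>.\<close>
  define y0 :: real where "y0 = exp (- 1)"
  have y0: "y0 > 0" unfolding y0_def by simp
  have "isCont ln y0" using y0 by (intro isCont_ln) simp
  then obtain \<rho>' where \<rho>': "\<rho>' > 0" "\<And>y. \<bar>y - y0\<bar> < \<rho>' \<Longrightarrow> \<bar>ln y - ln y0\<bar> < \<eta>"
    using \<eta>(1) unfolding continuous_at_eps_delta dist_real_def by (auto simp: dist_real_def)
  define \<rho> where "\<rho> = min \<rho>' y0"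
  have \<rho>: "\<rho> > 0" "\<rho> \<le> \<rho>'" unfolding \<rho>_def using \<rho>'(1) y0 by auto
  define q where "q = (\<lambda>y. max 0 (1 - \<bar>y - y0\<bar> / \<rho>))"
  have q0: "q y \<ge> 0" and q1: "q y \<le> 1" for y unfolding q_def using \<rho> by auto
  have qz: "q y = 0" if "\<bar>y - y0\<bar> \<ge> \<rho>" for y unfolding q_def using that \<rho> by (simp add: field_simps)
  have qc: "continuous_on UNIV q" unfolding q_def using \<rho> by (intro continuous_intros) auto
  have [measurable]: "q \<in> borel_measurable borel" using qc by (rule borel_measurable_continuous_onI)
  define \<kappa> where "\<kappa> = (\<lambda>d u. d * exp (- (d * u)) * q (exp (- (d * u))) :: real)"
  have \<kappa>0: "d > 0 \<Longrightarrow> \<kappa> d u \<ge> 0" for d u unfolding \<kappa>_def using q0 by simp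
  have \<kappa>i: "integrable lborel (\<lambda>u. indicator {0..} u * \<kappa> d u)" if d: "d > 0" for d
  proof (rule Bochner_Integration.integrable_bound)
    show "integrable lborel (\<lambda>u. d * (indicator {0..} u * exp (- (d * u))))"
      using d by (intro integrable_mult_right integrable_exp_Ici)
    have "\<kappa> d u \<le> d * exp (- (d * u))" for u
      unfolding \<kappa>_def using d q1 mult_left_mono[of "q (exp (- (d * u)))" 1 "d * exp (- (d * u))"] by simp
    then show "AE u in lborel. norm (indicator {0..} u * \<kappa> d u) \<le> norm (d * (indicator {0..} u * exp (- (d * u))))"
      using \<kappa>0[OF d] d by (auto simp: indicator_def)
  qed (unfold \<kappa>_def, measurable)
  \<comment> \<open>The mass of the kernel; by scaling it is the same for all
    \<open>d\<close>.\<close>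
  define c where "c = (\<integral>u. indicator {0..} u * \<kappa> 1 u \<partial>lborel)"
  have c: "(\<integral>u. indicator {0..} u * \<kappa> d u \<partial>lborel) = c" if d: "d > 0" for d
  proof -
    have "c = \<bar>d\<bar> *\<^sub>R (\<integral>u. indicator {0..} (0 + d * u) * \<kappa> 1 (0 + d * u) \<partial>lborel)"
      unfolding c_def using d by (intro lborel_integral_real_affine) simp
    also have "\<dots> = (\<integral>u. d * (indicator {0..} (0 + d * u) * \<kappa> 1 (0 + d * u)) \<partial>lborel)" using d by simp
    also have "\<dots> = (\<integral>u. indicator {0..} u * \<kappa> d u \<partial>lborel)"
      using d by (intro Bochner_Integration.integral_cong) (auto simp: \<kappa>_def indicator_def zero_le_mult_iff)
    finally show ?thesis by simp
  qed
  have c0: "c > 0"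
  proof -
    have "isCont (\<lambda>u::real. exp (- u)) 1" by (intro continuous_intros)
    from this[unfolded continuous_at_eps_delta, rule_format, OF half_gt_zero[OF \<rho>(1)]]
    obtain \<tau>' where \<tau>': "\<tau>' > 0" "\<And>u. \<bar>u - 1\<bar> < \<tau>' \<Longrightarrow> \<bar>exp (- u) - y0\<bar> < \<rho> / 2"
      unfolding y0_def dist_real_def by blast
    define \<tau> where "\<tau> = min (\<tau>' / 2) 1"
    have \<tau>: "0 < \<tau>" "\<tau> \<le> 1" "\<tau> < \<tau>'" unfolding \<tau>_def using \<tau>'(1) by auto
    have "(\<integral>u. (exp (- 2) / 2) * indicator {1..1 + \<tau>} u \<partial>lborel) \<le> (\<integral>u. indicator {0..} u * \<kappa> 1 u \<partial>lborel)"
    proof (rule integral_mono)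
      show "integrable lborel (\<lambda>u. (exp (- 2) / 2) * indicator {1..1 + \<tau>} u :: real)"
        by (intro integrable_mult_right integrable_real_indicator) (auto simp: emeasure_lborel_Icc_eq)
      fix u :: real
      show "(exp (- 2) / 2) * indicator {1..1 + \<tau>} u \<le> indicator {0..} u * \<kappa> 1 u"
      proof (cases "u \<in> {1..1 + \<tau>}")
        case True
        have "\<bar>exp (- u) - y0\<bar> < \<rho> / 2" using True \<tau> by (intro \<tau>'(2)) auto
        then have "1 / 2 \<le> q (exp (- u))" unfolding q_def using \<rho> by (simp add: field_simps max_def)
        then have "exp (- 2) * (1 / 2) \<le> exp (- u) * q (exp (- u))"
          using True \<tau> by (intro mult_mono) auto
        then show ?thesis using True by (simp add: \<kappa>_def)
      next
        case False
        then show ?thesis using \<kappa>0[of 1 u] by simp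
      qed
    qed (rule \<kappa>i, simp)
    also have "(\<integral>u. (exp (- 2) / 2) * indicator {1..1 + \<tau>} u \<partial>lborel) = (exp (- 2) / 2) * \<tau>"
      using \<tau> by simp
    finally show ?thesis unfolding c_def[symmetric] using \<tau>(1) by (smt (verit) exp_gt_zero half_gt_zero mult_pos_pos)
  qed
  \<comment> \<open>Chosen so that Bd * e <= \<epsilon> c / 4: three contributions of this size stay
    below \<epsilon> c.\<close>
  define e where "e = \<epsilon> * c / (4 * (Bd + 1))"
  have e0: "e > 0" unfolding e_def using \<epsilon> c0 Bd0 by simp
  have Be: "Bd * e \<le> \<epsilon> * c / 4"
  proof -
    have "Bd * e = (\<epsilon> * c / 4) * (Bd / (Bd + 1))" unfolding e_def using Bd0 by (simp add: field_simps)
    also have "\<dots> \<le> (\<epsilon> * c / 4) * 1" using Bd0 \<epsilon> c0 by (intro mult_left_mono) auto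
    finally show ?thesis by simp
  qed
  obtain g where g: "real_polynomial_function g" "\<And>x. x \<in> {0..1} \<Longrightarrow> \<bar>q x - g x\<bar> < e"
    using Stone_Weierstrass_real_polynomial_function[OF _ continuous_on_subset[OF qc] e0, of "{0..1}"] by auto
  obtain a n where an: "g = (\<lambda>x. \<Sum>i\<le>n. a i * x ^ i)"
    using g(1) unfolding real_polynomial_function_iff_sum by blast
  have "((\<lambda>d. \<integral>u. f u * of_real (d * exp (- (d * u)) * g (exp (- (d * u)))) \<partial>lborel) \<longlongrightarrow> 0) (at_right 0)"
    unfolding an by (rule polynomial_weight(1))
  moreover have "\<epsilon> * c / 4 > 0" using \<epsilon> c0 by simp
  ultimately have "\<forall>\<^sub>F d in at_right 0. norm (\<integral>u. f u * of_real (d * exp (- (d * u)) * g (exp (- (d * u)))) \<partial>lborel) < \<epsilon> * c / 4"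
    unfolding tendsto_iff dist_norm diff_zero by blast
  then have "\<forall>\<^sub>F t in at_top. norm (\<integral>u. f u * of_real (inverse t * exp (- (inverse t * u)) * g (exp (- (inverse t * u)))) \<partial>lborel) < \<epsilon> * c / 4"
    by (rule eventually_compose_filterlim[OF _ filterlim_inverse_at_right_top])
  moreover have "\<forall>\<^sub>F t in at_top. t \<ge> (8::real)" "\<forall>\<^sub>F t in at_top. t \<ge> 2 / \<eta>"
    by (rule eventually_ge_at_top)+
  ultimately show "\<forall>\<^sub>F t in at_top. dist (f t) 0 < \<epsilon>"
  proof eventually_elim
    fix t assume P: "norm (\<integral>u. f u * of_real (inverse t * exp (- (inverse t * u)) * g (exp (- (inverse t * u)))) \<partial>lborel) < \<epsilon> * c / 4"
      and t: "8 \<le> t" "2 / \<eta> \<le> t"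
    define d where "d = inverse t"
    have d: "d > 0" "d * t = 1" using t by (auto simp: d_def)
    let ?G = "\<lambda>u. f u * of_real (d * exp (- (d * u)) * g (exp (- (d * u))))"
    have Gi: "integrable lborel ?G" unfolding an by (rule polynomial_weight(2)[OF d(1)])
    have ei: "integrable lborel (\<lambda>u. (Bd * e * d) * (indicator {0..} u * exp (- (d * u))))"
      using d by (intro integrable_mult_right integrable_exp_Ici)
    have fki: "integrable lborel (\<lambda>u. f u * of_real (\<kappa> d u))"
    proof (rule Bochner_Integration.integrable_bound)
      show "integrable lborel (\<lambda>u. Bd * (indicator {0..} u * \<kappa> d u))" by (intro integrable_mult_right \<kappa>i d)
      show "AE u in lborel. norm (f u * of_real (\<kappa> d u)) \<le> norm (Bd * (indicator {0..} u * \<kappa> d u))"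
      proof (rule AE_I2)
        fix u show "norm (f u * of_real (\<kappa> d u)) \<le> norm (Bd * (indicator {0..} u * \<kappa> d u))"
          using neg[of u] Bd[of u] Bd0 \<kappa>0[OF d(1), of u] by (cases "u < 0") (auto simp: norm_mult intro!: mult_right_mono)
      qed
    qed (unfold \<kappa>_def, measurable)
    have "norm ((\<integral>u. f u * of_real (\<kappa> d u) \<partial>lborel) - (\<integral>u. ?G u \<partial>lborel)) \<le> (\<integral>u. (Bd * e * d) * (indicator {0..} u * exp (- (d * u))) \<partial>lborel)"
      unfolding Bochner_Integration.integral_diff[OF fki Gi, symmetric]
    proof (rule Bochner_Integration.integral_norm_bound_integral[OF _ ei])
      show "integrable lborel (\<lambda>u. f u * of_real (\<kappa> d u) - ?G u)" by (rule Bochner_Integration.integrable_diff[OF fki Gi])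
      fix u :: real
      show "norm (f u * of_real (\<kappa> d u) - ?G u) \<le> (Bd * e * d) * (indicator {0..} u * exp (- (d * u)))"
      proof (cases "u < 0")
        case True
        then show ?thesis using neg[of u] by simp
      next
        case False
        define y where "y = exp (- (d * u))"
        have y: "y \<in> {0..1}" unfolding y_def using False d by simp
        have "f u * of_real (\<kappa> d u) - ?G u = f u * of_real (d * y * (q y - g y))"
          unfolding \<kappa>_def y_def by (simp add: algebra_simps)
        then have "norm (f u * of_real (\<kappa> d u) - ?G u) = norm (f u) * \<bar>d * y * (q y - g y)\<bar>"
          by (simp only: norm_mult norm_of_real)
        also have "\<dots> = norm (f u) * ((d * y) * \<bar>q y - g y\<bar>)"
          using d y by (simp add: abs_mult)
        also have "\<dots> \<le> Bd * ((d * y) * e)"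
          using Bd[of u] g(2)[OF y] d y Bd0 by (intro mult_mono) auto
        finally show ?thesis using False by (simp add: y_def mult_ac)
      qed
    qed
    also have "\<dots> = Bd * e" unfolding integral_mult_right_zero using d integral_exp_Ici_real[of d 0] by simp
    finally have 1: "norm (\<integral>u. f u * of_real (\<kappa> d u) \<partial>lborel) \<le> \<epsilon> * c / 2"
      using P Be norm_triangle_ineq2[of "\<integral>u. f u * of_real (\<kappa> d u) \<partial>lborel" "\<integral>u. ?G u \<partial>lborel"]
      unfolding d_def by linarith
    have "norm (f t * of_real (\<integral>u. indicator {0..} u * \<kappa> d u \<partial>lborel)) \<le> norm (\<integral>u. f u * of_real (\<kappa> d u) \<partial>lborel)
      + (\<integral>u. (\<epsilon> / 4) * (indicator {0..} u * \<kappa> d u) \<partial>lborel)"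
    proof (rule mean_difference[OF \<kappa>i[OF d(1)] fki])
      show "integrable lborel (\<lambda>u. (\<epsilon> / 4) * (indicator {0..} u * \<kappa> d u))" by (intro integrable_mult_right \<kappa>i d)
      show "0 \<le> (\<epsilon> / 4) * (indicator {0..} u * \<kappa> d u)" for u using \<epsilon> \<kappa>0[OF d(1), of u] by simp
      fix u :: real assume u: "u > 0"
      show "norm (f u - f t) * \<bar>\<kappa> d u\<bar> \<le> (\<epsilon> / 4) * (indicator {0..} u * \<kappa> d u)"
      proof (cases "\<bar>exp (- (d * u)) - y0\<bar> \<ge> \<rho>")
        case True
        then show ?thesis unfolding \<kappa>_def using qz by simp
      next
        case False
        then have "\<bar>ln (exp (- (d * u))) - ln y0\<bar> < \<eta>" using \<rho> by (intro \<rho>'(2)) auto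
        then have "\<bar>d * u - 1\<bar> \<le> \<eta>" unfolding y0_def by (simp add: abs_if split: if_splits)
        then have "t * \<bar>d * u - 1\<bar> \<le> t * \<eta>" using t by (intro mult_left_mono) auto
        moreover have "t * \<bar>d * u - 1\<bar> = \<bar>u - t\<bar>"
        proof -
          have "t * \<bar>d * u - 1\<bar> = \<bar>t * (d * u - 1)\<bar>" using t by (simp add: abs_mult)
          also have "t * (d * u - 1) = (d * t) * u - t" by (simp add: algebra_simps)
          finally show ?thesis using d by simp
        qed
        ultimately have "norm (f u - f t) \<le> 8 * K * \<eta>"
          by (intro near_oscillation \<eta> t) (simp add: mult.commute)
        then have "norm (f u - f t) \<le> \<epsilon> / 4" using K\<eta> by linarith
        then have "norm (f u - f t) * \<kappa> d u \<le> \<epsilon> / 4 * \<kappa> d u"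
          by (rule mult_right_mono[OF _ \<kappa>0[OF d(1)]])
        then show ?thesis using u \<kappa>0[OF d(1), of u] by simp
      qed
    qed
    also have "(\<integral>u. (\<epsilon> / 4) * (indicator {0..} u * \<kappa> d u) \<partial>lborel) = \<epsilon> / 4 * c"
      unfolding integral_mult_right_zero c[OF d(1)] ..
    finally have "norm (f t * of_real c) \<le> norm (\<integral>u. f u * of_real (\<kappa> d u) \<partial>lborel) + \<epsilon> / 4 * c"
      unfolding c[OF d(1)] .
    moreover have "norm (f t * of_real c) = norm (f t) * c" using c0 by (simp add: norm_mult)
    ultimately have "norm (f t) * c \<le> \<epsilon> * c / 2 + \<epsilon> / 4 * c" using 1 by linarith
    also have "\<dots> < \<epsilon> * c" using \<epsilon> c0 by (simp add: field_simps)
    finally show "dist (f t) 0 < \<epsilon>" using c0 by simp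
  qed
qed

end

section \<open>Chebyshev's bound and sums of 1 / p\<close>

lemma prod_primes_dvd:
  fixes m :: nat
  assumes "finite S" "\<And>p. p \<in> S \<Longrightarrow> prime p \<and> p dvd m"
  shows "\<Prod>S dvd m"
  using assms
proof (induction S rule: finite_induct)
  case (insert p S)
  have "coprime p (\<Prod>S)"
    using insert by (intro prod_coprime_right) (metis insertCI primes_coprime)
  then show ?case using insert by (simp add: divides_mult)
qed simp

text \<open>Chebyshev's argument with n = 2^j: the primes in (n, 2 n] divide the binomial
  coefficient of 2 n over n, which is at most 4^n, whereas their product is at least n to the power
  of their number.\<close>

lemma card_primes_dyadic:
  assumes j: "j \<ge> 1"
  shows "real (card {p. prime p \<and> 2 ^ j < p \<and> p \<le> (2::nat) ^ Suc j}) \<le> 2 * 2 ^ j / real j"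
proof -
  define n :: nat where "n = 2 ^ j"
  define S where "S = {p. prime p \<and> n < p \<and> p \<le> 2 * n}"
  have fin: "finite S" by (rule finite_subset[of _ "{..2 * n}"]) (auto simp: S_def)
  have "\<Prod>S dvd (2 * n choose n)"
  proof (rule prod_primes_dvd[OF fin])
    fix p assume p: "p \<in> S"
    then have pp: "prime p" by (simp add: S_def)
    have "p dvd fact (2 * n)" using p pp by (simp add: S_def prime_dvd_fact_iff)
    moreover have "fact (2 * n) = fact n * fact n * (2 * n choose n)"
      using binomial_fact_lemma[of n "2 * n"] by simp
    moreover have "\<not> p dvd fact n" using p pp by (simp add: S_def prime_dvd_fact_iff)
    ultimately have "p dvd (2 * n choose n)" using pp by (simp add: prime_dvd_mult_iff)
    then show "prime p \<and> p dvd (2 * n choose n)" using pp by blast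
  qed
  moreover have "(2 * n choose n) > 0" by simp
  ultimately have "\<Prod>S \<le> (2 * n choose n)" by (rule dvd_imp_le)
  also have "\<dots> \<le> 2 ^ (2 * n)" by (rule binomial_le_pow2)
  finally have 1: "\<Prod>S \<le> 2 ^ (2 * n)" .
  have "(\<Prod>p\<in>S. n) \<le> \<Prod>S" by (rule prod_mono) (auto simp: S_def)
  then have "n ^ card S \<le> 2 ^ (2 * n)" using 1 by simp
  then have "(2::nat) ^ (j * card S) \<le> 2 ^ (2 * n)" by (simp add: n_def power_mult)
  then have "j * card S \<le> 2 * n" by simp
  then have "real j * real (card S) \<le> 2 * real n" by (metis of_nat_le_iff of_nat_mult of_nat_numeral)
  then show ?thesis using j by (simp add: S_def n_def field_simps)
qed

lemma sum_inverse_primes_dyadic: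
  assumes j: "j \<ge> 1"
  shows "(\<Sum>p | prime p \<and> 2 ^ j < p \<and> p \<le> (2::nat) ^ Suc j. 1 / real p) \<le> 2 / real j"
proof -
  let ?S = "{p. prime p \<and> 2 ^ j < p \<and> p \<le> (2::nat) ^ Suc j}"
  have "(\<Sum>p\<in>?S. 1 / real p) \<le> (\<Sum>p\<in>?S. 1 / 2 ^ j)"
  proof (rule sum_mono)
    fix p assume "p \<in> ?S"
    then have "real (2 ^ j) \<le> real p" by (simp only: of_nat_le_iff) simp
    then show "1 / real p \<le> 1 / 2 ^ j" by (intro divide_left_mono) (auto intro!: mult_pos_pos less_le_trans[of 0 "2 ^ j" "real p"])
  qed
  also have "\<dots> = real (card ?S) / 2 ^ j" by simp
  also have "\<dots> \<le> (2 * 2 ^ j / real j) / 2 ^ j" by (intro divide_right_mono card_primes_dyadic j) simp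
  finally show ?thesis by simp
qed

lemma sum_inverse_le_ln:
  assumes "1 \<le> m" "m \<le> n"
  shows "(\<Sum>j=Suc m..n. 1 / real j) \<le> ln (real n / real m)"
  using assms(2)
proof (induction n rule: dec_induct)
  case base
  then show ?case using assms(1) by simp
next
  case (step n)
  have n: "n > 0" using step assms by simp
  have "ln (real n / real (Suc n)) \<le> real n / real (Suc n) - 1"
    using n by (intro ln_le_minus_one) simp
  also have "\<dots> = - (1 / real (Suc n))" by (simp add: field_simps)
  finally have "1 / real (Suc n) \<le> ln (real (Suc n) / real n)" using n by (simp add: ln_div)
  moreover have "ln (real (Suc n) / real m) = ln (real (Suc n) / real n) + ln (real n / real m)"
    using n assms by (simp add: ln_div)
  ultimately show ?case using step by simp
qed

lemma sum_inverse_interval: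
  assumes "3 \<le> t" "t \<le> t'"
  shows "(\<Sum>k | t < real k \<and> real k \<le> t'. 1 / real k) \<le> ln (t' / (t - 2))"
proof -
  define m where "m = nat \<lfloor>t\<rfloor>"
  define n where "n = nat \<lfloor>t'\<rfloor>"
  have m: "real m \<le> t" "t - 1 < real m" unfolding m_def using assms by linarith+
  have n: "real n \<le> t'" "t' - 1 < real n" unfolding n_def using assms by linarith+
  have mn: "m \<le> n" unfolding m_def n_def using assms by (intro nat_mono floor_mono)
  have m1: "1 \<le> m" using m(2) assms by linarith
  have "{k. t < real k \<and> real k \<le> t'} = {Suc m..n}"
  proof (intro Set.set_eqI iffI)
    fix k assume "k \<in> {k. t < real k \<and> real k \<le> t'}"
    then have "real m < real k" "real k < real n + 1" using m n by auto
    then show "k \<in> {Suc m..n}" by auto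
  next
    fix k assume "k \<in> {Suc m..n}"
    then have "real m + 1 \<le> real k" "real k \<le> real n" by auto
    then show "k \<in> {k. t < real k \<and> real k \<le> t'}" using m n by auto
  qed
  then have "(\<Sum>k | t < real k \<and> real k \<le> t'. 1 / real k) \<le> ln (real n / real m)"
    using sum_inverse_le_ln[OF m1 mn] by simp
  also have "\<dots> \<le> ln (t' / (t - 2))"
  proof (subst ln_le_cancel_iff)
    show "real n / real m \<le> t' / (t - 2)" using m n assms by (intro frac_le) auto
  qed (use m1 mn assms in auto)
  finally show ?thesis .
qed

lemma sum_UNION_le:
  fixes f :: "'a \<Rightarrow> real"
  assumes "finite I" "\<And>i. i \<in> I \<Longrightarrow> finite (A i)" "\<And>x. f x \<ge> 0"
  shows "sum f (\<Union>i\<in>I. A i) \<le> (\<Sum>i\<in>I. sum f (A i))"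
  using assms(1,2)
proof (induction I rule: finite_induct)
  case (insert i I)
  have "sum f (A i \<union> (\<Union>i\<in>I. A i)) + sum f (A i \<inter> (\<Union>i\<in>I. A i)) = sum f (A i) + sum f (\<Union>i\<in>I. A i)"
    by (rule sum.union_inter) (use insert in auto)
  moreover have "0 \<le> sum f (A i \<inter> (\<Union>i\<in>I. A i))" by (intro sum_nonneg assms(3))
  moreover have "sum f (\<Union>i\<in>I. A i) \<le> (\<Sum>i\<in>I. sum f (A i))" using insert by simp
  ultimately show ?case using insert by simp
qed simp

text \<open>The range of ln p is covered by dyadic blocks; block \<open>j\<close> contributes at
  most 2 / j, and the harmonic sum over the blocks gives the logarithm. The 2 in t - 2 covers the
  rounding loss 2 ln 2.\<close>

lemma sum_inverse_primes_interval:
  assumes t: "3 \<le> t" "t \<le> t'"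
  shows "(\<Sum>p | prime p \<and> t < ln (real p) \<and> ln (real p) \<le> t'. 1 / real p) \<le> 2 * ln (t' / (t - 2))"
proof -
  have l2: "0 < ln (2::real)" "ln (2::real) \<le> 1" using ln_2_less_1 by auto
  \<comment> \<open>One below t / ln 2: a prime with ln p > t in block \<open>j\<close> satisfies (j
    + 1) ln 2 > t, hence j > m.\<close>
  define m where "m = nat \<lfloor>t / ln 2 - 1\<rfloor>"
  define n where "n = nat \<lfloor>t' / ln 2\<rfloor>"
  have tl: "t \<le> t / ln 2" using l2 t by (simp add: field_simps mult_left_le)
  have m: "real m \<le> t / ln 2 - 1" "t / ln 2 - 2 < real m" unfolding m_def using tl t by linarith+
  have tt: "t / ln 2 \<le> t' / ln 2" using t l2 by (intro divide_right_mono) auto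
  have n: "real n \<le> t' / ln 2" "t' / ln 2 < real n + 1" unfolding n_def using tl tt t by linarith+
  have m1: "1 \<le> m" using m(2) tl t by linarith
  have mn: "m \<le> n" unfolding m_def n_def using tt by (intro nat_mono floor_mono) linarith
  define D where "D = (\<lambda>j. {p. prime p \<and> 2 ^ j < p \<and> p \<le> (2::nat) ^ Suc j})"
  have finD: "finite (D j)" for j by (rule finite_subset[of _ "{..2 ^ Suc j}"]) (auto simp: D_def)
  have sub: "{p. prime p \<and> t < ln (real p) \<and> ln (real p) \<le> t'} \<subseteq> (\<Union>j\<in>{Suc m..n}. D j)"
  proof
    fix p assume "p \<in> {p. prime p \<and> t < ln (real p) \<and> ln (real p) \<le> t'}"
    then have p: "prime p" "t < ln (real p)" "ln (real p) \<le> t'" by auto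
    have p2: "p \<ge> 2" using p(1) by (rule prime_ge_2_nat)
    define j where "j = (LEAST j. p \<le> 2 ^ Suc j)"
    have ex: "p \<le> 2 ^ Suc p" using less_exp[of "Suc p"] by simp
    have j1: "p \<le> 2 ^ Suc j" unfolding j_def by (rule LeastI[of "\<lambda>j. p \<le> 2 ^ Suc j", OF ex])
    have j2: "2 ^ j < p"
    proof (cases j)
      case 0
      then show ?thesis using p2 by simp
    next
      case (Suc i)
      then have "\<not> p \<le> 2 ^ Suc i" unfolding j_def using not_less_Least[of i "\<lambda>j. p \<le> 2 ^ Suc j"] by auto
      then show ?thesis using Suc by simp
    qed
    have "real j * ln 2 = ln (real (2 ^ j))" by (simp add: ln_realpow)
    also have "\<dots> \<le> ln (real p)" using j2 by (subst ln_le_cancel_iff) (auto simp del: of_nat_power)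
    finally have "real j \<le> t' / ln 2" using p(3) l2 by (simp add: field_simps)
    then have "j \<le> n" using n by linarith
    moreover have "ln (real p) \<le> ln (real (2 ^ Suc j))" using j1 p2 by (subst ln_le_cancel_iff) (auto simp del: of_nat_power power_Suc)
    then have "ln (real p) \<le> real (Suc j) * ln 2" by (simp add: ln_realpow del: power_Suc)
    then have "t / ln 2 < real j + 1" using p(2) l2 by (simp add: field_simps)
    then have "m < j" using m by linarith
    ultimately show "p \<in> (\<Union>j\<in>{Suc m..n}. D j)" using p(1) j1 j2 by (auto simp: D_def)
  qed
  have "(\<Sum>p | prime p \<and> t < ln (real p) \<and> ln (real p) \<le> t'. 1 / real p) \<le> (\<Sum>p\<in>(\<Union>j\<in>{Suc m..n}. D j). 1 / real p)"
    by (rule sum_mono2[OF _ sub]) (auto simp: finD)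
  also have "\<dots> \<le> (\<Sum>j\<in>{Suc m..n}. \<Sum>p\<in>D j. 1 / real p)"
    by (intro sum_UNION_le) (auto simp: finD)
  also have "\<dots> \<le> (\<Sum>j=Suc m..n. 2 * (1 / real j))"
  proof (rule sum_mono)
    fix j assume "j \<in> {Suc m..n}"
    then show "(\<Sum>p\<in>D j. 1 / real p) \<le> 2 * (1 / real j)" using sum_inverse_primes_dyadic[of j] by (simp add: D_def)
  qed
  also have "\<dots> = 2 * (\<Sum>j=Suc m..n. 1 / real j)" by (rule sum_distrib_left[symmetric])
  also have "\<dots> \<le> 2 * ln (real n / real m)" using sum_inverse_le_ln[OF m1 mn] by simp
  also have "\<dots> \<le> 2 * ln (t' / (t - 2))"
  proof -
    have "t / ln 2 - 2 > 0" using tl t by linarith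
    then have "real n / real m \<le> (t' / ln 2) / (t / ln 2 - 2)" using m n t l2 by (intro frac_le) auto
    also have "\<dots> = t' / (t - 2 * ln 2)" using l2 by (simp add: field_simps)
    also have "\<dots> \<le> t' / (t - 2)" using l2 t by (intro divide_left_mono) (auto intro!: mult_pos_pos)
    finally show ?thesis using m1 mn t by (subst mult_le_cancel_left_pos, simp, subst ln_le_cancel_iff) auto
  qed
  finally show ?thesis .
qed

section \<open>Harmonic sums as inverse transforms, and asymptotics of sums over primes\<close>

lemma filterlim_ln_real: "filterlim (\<lambda>n::nat. ln (real n)) at_top sequentially"
  by real_asymp

lemma exp_ln_powr: "n > 0 \<Longrightarrow> exp (- (d * ln (real n))) = real n powr (- d)"
  by (simp add: powr_def)

lemma cexp_ln_powr: "n > 0 \<Longrightarrow> exp (- ((s :: complex) * of_real (ln (real n)))) = of_nat n powr (- s)"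
  by (simp add: powr_def Ln_of_nat)

lemma ln_of_nat_nonneg: "0 \<le> ln (real n)"
  by (cases "n = 0") auto

lemma summable_ln_exp:
  fixes a :: "nat \<Rightarrow> complex"
  assumes a: "\<And>n. n > 0 \<Longrightarrow> norm (a n) \<le> A * real n powr (- x)" and a0: "a 0 = 0" and x: "x + d > 1"
  shows "summable (\<lambda>n. norm (a n) * exp (- (d * ln (real n))))"
proof (rule summable_comparison_test')
  show "summable (\<lambda>n. A * real n powr (- (x + d)))"
    using x by (intro summable_mult) (simp add: summable_real_powr_iff)
  show "norm (norm (a n) * exp (- (d * ln (real n)))) \<le> A * real n powr (- (x + d))" if "n \<ge> 0" for n
  proof (cases "n = 0")
    case False
    then have "norm (a n) * real n powr (- d) \<le> (A * real n powr (- x)) * real n powr (- d)"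
      using a[of n] by (intro mult_right_mono) auto
    also have "\<dots> = A * real n powr (- (x + d))" by (simp add: mult.assoc flip: powr_add)
    finally show ?thesis using False by (simp add: exp_ln_powr)
  qed (simp add: a0)
qed

text \<open>The logarithmic series at exp (- s). Index 0 has frequency 0 and does not occur in a
  harmonic sum, so it can carry the constant \<open>c\<close>; a single step function then
  represents both.\<close>

lemma harmonic_exp_sums:
  fixes s c r :: complex
  assumes s: "Re s > 0"
  shows "(\<lambda>n. (if n = 0 then c else r / of_nat n) * exp (- (s * of_real (real n)))) sums (c - r * Ln (1 - exp (- s)))"
proof -
  have n1: "norm (- exp (- s)) < 1" using s by simp
  have p: "exp (- (s * of_real (real n))) = exp (- s) ^ n" for n
    by (simp add: mult.commute flip: exp_of_nat_mult)
  have S0: "(\<lambda>n. - r * ((- 1) ^ Suc n / of_nat n * (- exp (- s)) ^ n)) sums (- r * Ln (1 + - exp (- s)))"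
    by (intro sums_mult Ln_series n1)
  have E: "- r * ((- 1) ^ Suc n / of_nat n * (- exp (- s)) ^ n) = r / of_nat n * exp (- s) ^ n" for n
  proof -
    have w: "(- 1) ^ n * (- exp (- s)) ^ n = exp (- s) ^ n" by (simp flip: power_mult_distrib)
    have "- r * ((- 1) ^ Suc n / of_nat n * (- exp (- s)) ^ n) = r / of_nat n * ((- 1) ^ n * (- exp (- s)) ^ n)"
      by simp
    then show ?thesis unfolding w .
  qed
  have A: "(\<lambda>n. r / of_nat n * exp (- s) ^ n) sums (- r * Ln (1 - exp (- s)))"
    using S0[unfolded E] by simp
  have B: "(\<lambda>n. if n = 0 then c else 0) sums c" using sums_single[of 0 "\<lambda>_. c"] by simp
  have "(\<lambda>n. (if n = 0 then c else 0) + r / of_nat n * exp (- s) ^ n) sums (c + - r * Ln (1 - exp (- s)))"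
    by (rule sums_add[OF B A])
  also have "(\<lambda>n. (if n = 0 then c else 0) + r / of_nat n * exp (- s) ^ n) = (\<lambda>n. (if n = 0 then c else r / of_nat n) * exp (- (s * of_real (real n))))"
    unfolding p by (auto simp: fun_eq_iff)
  finally show ?thesis by simp
qed

lemma harmonic_exp_summable:
  fixes c r :: complex
  assumes d: "d > 0"
  shows "summable (\<lambda>n. norm (if n = 0 then c else r / of_nat n) * exp (- (d * real n)))"
proof (rule summable_comparison_test')
  show "summable (\<lambda>n. (norm c + norm r) * exp (- d) ^ n)"
    using d by (intro summable_mult summable_geometric) auto
  show "norm (norm (if n = 0 then c else r / of_nat n) * exp (- (d * real n))) \<le> (norm c + norm r) * exp (- d) ^ n" if "n \<ge> 0" for n
  proof -
    have "exp (- (d * real n)) = exp (- d) ^ n" by (simp add: mult.commute flip: exp_of_nat_mult)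
    moreover have "norm (if n = 0 then c else r / of_nat n) \<le> norm c + norm r"
    proof (cases "n = 0")
      case False
      then have "norm r / real n \<le> norm r / 1" by (intro divide_left_mono) auto
      then show ?thesis using False by (simp add: norm_divide add_increasing)
    qed simp
    ultimately show ?thesis by (simp add: mult_right_mono)
  qed
qed

lemma step_sum_harmonic:
  assumes "t \<ge> 0"
  shows "step_sum real (\<lambda>n. if n = 0 then c else r / of_nat n) t = c + r * of_real (harm (nat \<lfloor>t\<rfloor>))"
proof -
  have "{n. real n \<le> t} = {..nat \<lfloor>t\<rfloor>}" using assms by (auto simp: le_nat_floor) linarith
  then have "step_sum real (\<lambda>n. if n = 0 then c else r / of_nat n) t = (\<Sum>n\<le>nat \<lfloor>t\<rfloor>. if n = 0 then c else r / of_nat n)"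
    using step_sum_finite(2)[OF filterlim_real_sequentially] by simp
  also have "{..nat \<lfloor>t\<rfloor>} = insert 0 {1..nat \<lfloor>t\<rfloor>}" by auto
  also have "(\<Sum>n\<in>insert 0 {1..nat \<lfloor>t\<rfloor>}. if n = 0 then c else r / of_nat n) = c + (\<Sum>n=1..nat \<lfloor>t\<rfloor>. r / of_nat n)"
    by simp
  finally show ?thesis by (simp add: harm_def sum_distrib_left divide_inverse)
qed

lemma harm_floor_minus_ln: "((\<lambda>t::real. harm (nat \<lfloor>t\<rfloor>) - ln t) \<longlongrightarrow> euler_mascheroni) at_top"
proof -
  have "filterlim (\<lambda>t::real. nat \<lfloor>t\<rfloor>) sequentially at_top"
    by (rule filterlim_compose[OF filterlim_nat_sequentially filterlim_floor_sequentially])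
  then have "((\<lambda>t::real. harm (nat \<lfloor>t\<rfloor>) - ln (real (nat \<lfloor>t\<rfloor>))) \<longlongrightarrow> (euler_mascheroni :: real)) at_top"
    by (rule filterlim_compose[OF euler_mascheroni_LIMSEQ])
  moreover have "((\<lambda>t::real. ln (real (nat \<lfloor>t\<rfloor>)) - ln t) \<longlongrightarrow> 0) at_top"
  proof (rule Lim_null_comparison)
    show "\<forall>\<^sub>F t::real in at_top. norm (ln (real (nat \<lfloor>t\<rfloor>)) - ln t) \<le> 1 / (t - 1)"
    proof (rule eventually_mono[OF eventually_ge_at_top[of 2]])
      fix t :: real assume t: "2 \<le> t"
      define m where "m = real (nat \<lfloor>t\<rfloor>)"
      have m: "m \<le> t" "t - 1 < m" unfolding m_def using t by linarith+
      have "ln t - ln m = ln (t / m)" using m t by (simp add: ln_div)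
      also have "\<dots> \<le> t / m - 1" using m t by (intro ln_le_minus_one) auto
      also have "\<dots> = (t - m) / m" using m t by (simp add: field_simps)
      also have "\<dots> \<le> 1 / (t - 1)" using m t by (intro frac_le) auto
      finally have "ln t - ln m \<le> 1 / (t - 1)" .
      moreover have "ln m \<le> ln t" using m t by simp
      ultimately show "norm (ln (real (nat \<lfloor>t\<rfloor>)) - ln t) \<le> 1 / (t - 1)" unfolding m_def[symmetric] by simp
    qed
    show "((\<lambda>t::real. 1 / (t - 1)) \<longlongrightarrow> 0) at_top" by real_asymp
  qed
  ultimately have "((\<lambda>t::real. (harm (nat \<lfloor>t\<rfloor>) - ln (real (nat \<lfloor>t\<rfloor>))) + (ln (real (nat \<lfloor>t\<rfloor>)) - ln t)) \<longlongrightarrow> (euler_mascheroni :: real) + 0) at_top"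
    by (rule tendsto_add)
  then show ?thesis by simp
qed

text \<open>A harmonic sum with weight \<open>R\<close> and the constant - C is added, so that - R
  ln (1 - exp (- d)) - C cancels R ln d + C and the Abel means tend to 0. Chebyshev's bound supplies
  slow oscillation, and Euler's constant turns the harmonic sum back into R ln t.\<close>

lemma prime_sum_asymptotics:
  fixes b :: "nat \<Rightarrow> complex" and R :: real
  assumes b: "\<And>p. prime p \<Longrightarrow> norm (b p) \<le> B"
    and lim: "((\<lambda>d. (\<Sum>n. (if prime n then b n / of_nat n else 0) * exp (- (of_real d * of_real (ln (real n))))) - of_real (R * ln d)) \<longlongrightarrow> C) (at_right 0)"
  shows "\<exists>c. ((\<lambda>t. (\<Sum>p | prime p \<and> ln (real p) \<le> t. b p / of_nat p) + of_real (R * ln t)) \<longlongrightarrow> c) at_top"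
proof -
  define a where "a = (\<lambda>n. if prime n then b n / of_nat n else 0)"
  define h where "h = (\<lambda>n::nat. if n = 0 then - C else of_real R / of_nat n)"
  define f where "f = (\<lambda>t. step_sum (\<lambda>n. ln (real n)) a t + step_sum real h t)"
  have B0: "B \<ge> 0" using order_trans[OF norm_ge_zero b[of 2]] by simp
  have a_bd: "norm (a n) \<le> B * real n powr (- 1)" if "n > 0" for n
    using that b[of n] B0 by (auto simp: a_def norm_mult norm_inverse powr_minus divide_inverse intro: mult_right_mono)
  have sa: "summable (\<lambda>n. norm (a n) * exp (- (d * ln (real n))))" if "d > 0" for d
    by (rule summable_ln_exp[OF a_bd]) (use that in \<open>auto simp: a_def\<close>)
  have sh: "summable (\<lambda>n. norm (h n) * exp (- (d * real n)))" if "d > 0" for d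
    unfolding h_def by (rule harmonic_exp_summable[OF that])
  have fin: "finite {n. ln (real n) \<le> t}" "finite {n. real n \<le> t}" for t
    by (rule step_sum_finite[OF filterlim_ln_real], rule step_sum_finite[OF filterlim_real_sequentially])
  have fsum: "f t = (\<Sum>n | ln (real n) \<le> t. a n) + (\<Sum>n | real n \<le> t. h n)" for t
    unfolding f_def using step_sum_finite(2)[OF filterlim_ln_real] step_sum_finite(2)[OF filterlim_real_sequentially] by simp
  have eex: "complex_of_real (exp (- (d * v))) = exp (- (of_real d * of_real v))" for d v
    by (simp flip: exp_of_real)
  have osc: "norm (f t' - f t) \<le> (2 * B + \<bar>R\<bar>) * ln (t' / (t - 2))" if t: "3 \<le> t" "t \<le> t'" for t t'
  proof -
    have d1: "(\<Sum>n | ln (real n) \<le> t'. a n) - (\<Sum>n | ln (real n) \<le> t. a n) = (\<Sum>p | prime p \<and> t < ln (real p) \<and> ln (real p) \<le> t'. a p)"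
    proof -
      have "(\<Sum>n | ln (real n) \<le> t'. a n) - (\<Sum>n | ln (real n) \<le> t. a n) = (\<Sum>n\<in>{n. ln (real n) \<le> t'} - {n. ln (real n) \<le> t}. a n)"
        using t by (intro sum_diff[symmetric] fin) auto
      also have "\<dots> = (\<Sum>p | prime p \<and> t < ln (real p) \<and> ln (real p) \<le> t'. a p)"
        by (rule sum.mono_neutral_right) (auto simp: a_def fin)
      finally show ?thesis .
    qed
    have d2: "(\<Sum>n | real n \<le> t'. h n) - (\<Sum>n | real n \<le> t. h n) = (\<Sum>k | t < real k \<and> real k \<le> t'. h k)"
    proof -
      have "(\<Sum>n | real n \<le> t'. h n) - (\<Sum>n | real n \<le> t. h n) = (\<Sum>n\<in>{n. real n \<le> t'} - {n. real n \<le> t}. h n)"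
        using t by (intro sum_diff[symmetric] fin) auto
      also have "{n. real n \<le> t'} - {n. real n \<le> t} = {k. t < real k \<and> real k \<le> t'}" by auto
      finally show ?thesis .
    qed
    have "norm (\<Sum>p | prime p \<and> t < ln (real p) \<and> ln (real p) \<le> t'. a p) \<le> (\<Sum>p | prime p \<and> t < ln (real p) \<and> ln (real p) \<le> t'. B * (1 / real p))"
      by (rule sum_norm_le) (use b in \<open>auto simp: a_def norm_divide intro: divide_right_mono\<close>)
    also have "\<dots> \<le> B * (2 * ln (t' / (t - 2)))"
      unfolding sum_distrib_left[symmetric] by (intro mult_left_mono sum_inverse_primes_interval t B0)
    finally have 1: "norm (\<Sum>p | prime p \<and> t < ln (real p) \<and> ln (real p) \<le> t'. a p) \<le> 2 * B * ln (t' / (t - 2))" by simp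
    have "norm (\<Sum>k | t < real k \<and> real k \<le> t'. h k) \<le> (\<Sum>k | t < real k \<and> real k \<le> t'. \<bar>R\<bar> * (1 / real k))"
      by (rule sum_norm_le) (use t in \<open>auto simp: h_def norm_divide\<close>)
    also have "\<dots> \<le> \<bar>R\<bar> * ln (t' / (t - 2))"
      unfolding sum_distrib_left[symmetric] by (intro mult_left_mono sum_inverse_interval t) auto
    finally have 2: "norm (\<Sum>k | t < real k \<and> real k \<le> t'. h k) \<le> \<bar>R\<bar> * ln (t' / (t - 2))" .
    have "f t' - f t = (\<Sum>p | prime p \<and> t < ln (real p) \<and> ln (real p) \<le> t'. a p) + (\<Sum>k | t < real k \<and> real k \<le> t'. h k)"
      unfolding fsum d1[symmetric] d2[symmetric] by simp
    then have "norm (f t' - f t) \<le> norm (\<Sum>p | prime p \<and> t < ln (real p) \<and> ln (real p) \<le> t'. a p) + norm (\<Sum>k | t < real k \<and> real k \<le> t'. h k)"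
      by (simp add: norm_triangle_ineq)
    then show ?thesis using 1 2 by (simp add: algebra_simps)
  qed
  define M where "M = (\<Sum>n | ln (real n) \<le> 3. norm (a n)) + (\<Sum>n | real n \<le> 3. norm (h n))"
  have small: "norm (f t) \<le> M" if "t \<le> 3" for t
  proof -
    have "norm (f t) \<le> norm (\<Sum>n | ln (real n) \<le> t. a n) + norm (\<Sum>n | real n \<le> t. h n)"
      unfolding fsum by (rule norm_triangle_ineq)
    also have "\<dots> \<le> (\<Sum>n | ln (real n) \<le> t. norm (a n)) + (\<Sum>n | real n \<le> t. norm (h n))"
      by (intro add_mono norm_sum)
    also have "\<dots> \<le> M" unfolding M_def using that by (intro add_mono sum_mono2 fin) auto
    finally show ?thesis .
  qed
  have L1: "integrable lborel (\<lambda>v. step_sum (\<lambda>n. ln (real n)) a v * exp (- (of_real d * of_real v)))"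
     "(\<integral>v. step_sum (\<lambda>n. ln (real n)) a v * exp (- (of_real d * of_real v)) \<partial>lborel) = (\<Sum>n. a n * exp (- (of_real d * of_real (ln (real n))))) / of_real d"
     "integrable lborel (\<lambda>v. step_sum real h v * exp (- (of_real d * of_real v)))"
     "(\<integral>v. step_sum real h v * exp (- (of_real d * of_real v)) \<partial>lborel) = (\<Sum>n. h n * exp (- (of_real d * of_real (real n)))) / of_real d"
    if d: "d > 0" for d
    using d sa[OF d] sh[OF d]
    by (intro step_sum_laplace filterlim_ln_real filterlim_real_sequentially; simp add: ln_of_nat_nonneg)+
  have fint: "integrable lborel (\<lambda>v. f v * of_real (exp (- (d * v))))" if d: "d > 0" for d
    unfolding f_def distrib_right eex by (intro Bochner_Integration.integrable_add L1 d)
  have flap: "of_real d * (\<integral>v. f v * of_real (exp (- (d * v))) \<partial>lborel)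
     = ((\<Sum>n. a n * exp (- (of_real d * of_real (ln (real n))))) - of_real (R * ln d)) - C + of_real (R * (ln d - ln (1 - exp (- d))))" if d: "d > 0" for d
  proof -
    have "(\<Sum>n. h n * exp (- (of_real d * of_real (real n)))) = - C - of_real R * Ln (1 - exp (- of_real d))"
      unfolding h_def using d by (intro sums_unique[symmetric] harmonic_exp_sums) simp
    also have "Ln (1 - exp (- of_real d)) = of_real (ln (1 - exp (- d)))"
    proof -
      have "1 - exp (- complex_of_real d) = of_real (1 - exp (- d))" by (simp flip: exp_of_real)
      moreover have "0 < 1 - exp (- d)" using d by simp
      ultimately show ?thesis by (simp only: Ln_of_real)
    qed
    finally have H: "(\<Sum>n. h n * exp (- (of_real d * of_real (real n)))) = - C - of_real R * of_real (ln (1 - exp (- d)))" .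
    have "(\<integral>v. f v * of_real (exp (- (d * v))) \<partial>lborel) = (\<Sum>n. a n * exp (- (of_real d * of_real (ln (real n))))) / of_real d + (\<Sum>n. h n * exp (- (of_real d * of_real (real n)))) / of_real d"
      unfolding f_def distrib_right eex Bochner_Integration.integral_add[OF L1(1)[OF d] L1(3)[OF d]] L1(2)[OF d] L1(4)[OF d] ..
    moreover have "of_real d * (X / of_real d + Y / of_real d) = X + Y" for X Y :: complex
      using d by (simp add: field_simps)
    ultimately show ?thesis unfolding H by (simp only:) (simp add: algebra_simps)
  qed
  have "((\<lambda>d. ((\<Sum>n. a n * exp (- (of_real d * of_real (ln (real n))))) - of_real (R * ln d)) - C + of_real (R * (ln d - ln (1 - exp (- d))))) \<longlongrightarrow> C - C + of_real (R * 0)) (at_right 0)"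
  proof (intro tendsto_intros)
    show "((\<lambda>d. (\<Sum>n. a n * exp (- (of_real d * of_real (ln (real n))))) - of_real (R * ln d)) \<longlongrightarrow> C) (at_right 0)"
      using lim unfolding a_def .
    show "((\<lambda>d. ln d - ln (1 - exp (- d))) \<longlongrightarrow> (0::real)) (at_right 0)" by real_asymp
  qed
  then have lim0: "((\<lambda>d. ((\<Sum>n. a n * exp (- (of_real d * of_real (ln (real n))))) - of_real (R * ln d)) - C + of_real (R * (ln d - ln (1 - exp (- d))))) \<longlongrightarrow> 0) (at_right 0)"
    by simp
  have lap: "((\<lambda>d. of_real d * (\<integral>v. f v * of_real (exp (- (d * v))) \<partial>lborel)) \<longlongrightarrow> 0) (at_right 0)"
  proof (rule Lim_transform_eventually[OF lim0])
    show "\<forall>\<^sub>F d in at_right 0. ((\<Sum>n. a n * exp (- (of_real d * of_real (ln (real n))))) - of_real (R * ln d)) - C + of_real (R * (ln d - ln (1 - exp (- d))))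
      = of_real d * (\<integral>v. f v * of_real (exp (- (d * v))) \<partial>lborel)"
      by (rule eventually_mono[OF eventually_at_right_less[of 0]]) (rule flap[symmetric])
  qed
  interpret slowly_oscillating f "2 * B + \<bar>R\<bar>" M
  proof
    show "f \<in> borel_measurable borel" unfolding f_def by measurable
    show "f t = 0" if "t < 0" for t
      unfolding f_def using that by (simp add: step_sum_neg ln_of_nat_nonneg)
  qed (use osc small fint lap B0 in auto)
  have l1: "((\<lambda>t. f t + C - of_real (R * (harm (nat \<lfloor>t\<rfloor>) - ln t))) \<longlongrightarrow> 0 + C - of_real (R * euler_mascheroni)) at_top"
    by (intro tendsto_intros tendsto_zero harm_floor_minus_ln)
  have l2: "\<forall>\<^sub>F t in at_top. f t + C - of_real (R * (harm (nat \<lfloor>t\<rfloor>) - ln t)) = (\<Sum>p | prime p \<and> ln (real p) \<le> t. b p / of_nat p) + of_real (R * ln t)"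
  proof (rule eventually_mono[OF eventually_ge_at_top[of 0]])
    fix t :: real assume t: "0 \<le> t"
    have "step_sum real h t = - C + of_real R * of_real (harm (nat \<lfloor>t\<rfloor>))"
      unfolding h_def by (rule step_sum_harmonic[OF t])
    moreover have "step_sum (\<lambda>n. ln (real n)) a t = (\<Sum>p | prime p \<and> ln (real p) \<le> t. b p / of_nat p)"
    proof -
      have "(\<Sum>n | ln (real n) \<le> t. a n) = (\<Sum>p | prime p \<and> ln (real p) \<le> t. a p)"
        by (rule sum.mono_neutral_right) (auto simp: a_def fin)
      then show ?thesis unfolding step_sum_finite(2)[OF filterlim_ln_real] by (simp add: a_def)
    qed
    ultimately show "f t + C - of_real (R * (harm (nat \<lfloor>t\<rfloor>) - ln t)) = (\<Sum>p | prime p \<and> ln (real p) \<le> t. b p / of_nat p) + of_real (R * ln t)"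
      unfolding f_def by (simp add: algebra_simps)
  qed
  show ?thesis by (rule exI, rule Lim_transform_eventually[OF l1 l2])
qed

section \<open>Ramified primes\<close>

lemma fadele_abs_eqI: "adic_rel X Y \<Longrightarrow> abs_fadele X = abs_fadele Y"
  using Quotient_rel_abs[OF Quotient_fadele] by blast

lemma of_nat_fadele: "of_nat N = abs_fadele (\<lambda>_. of_nat N)"
proof (induction N)
  case 0
  show ?case by (simp add: zero_fadele_def)
next
  case (Suc N)
  have "adic_rel (\<lambda>_. of_nat N) (\<lambda>_. of_nat N)" "adic_rel (\<lambda>_. 1) (\<lambda>_. 1)"
    by (simp_all add: adic_rel_def)
  then have "abs_fadele (\<lambda>_. 1) + abs_fadele (\<lambda>_. of_nat N) = abs_fadele (\<lambda>_. 1 + of_nat N)"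
    using plus_fadele.abs_eq[of "\<lambda>_. 1" "\<lambda>_. of_nat N"] by simp
  then show ?case using Suc by (simp add: one_fadele_def)
qed

lemma profinite_int_add: "profinite_int x \<Longrightarrow> profinite_int y \<Longrightarrow> profinite_int (x + y)"
proof transfer
  fix x y :: "nat \<Rightarrow> rat"
  assume "\<exists>k. \<forall>i\<ge>k. x i \<in> \<int>" "\<exists>k. \<forall>i\<ge>k. y i \<in> \<int>"
  then obtain k l where "\<forall>i\<ge>k. x i \<in> \<int>" "\<forall>i\<ge>l. y i \<in> \<int>" by blast
  then show "\<exists>k. \<forall>i\<ge>k. x i + y i \<in> \<int>" by (intro exI[of _ "max k l"]) auto
qed

lemma profinite_int_mult: "profinite_int x \<Longrightarrow> profinite_int y \<Longrightarrow> profinite_int (x * y)"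
proof transfer
  fix x y :: "nat \<Rightarrow> rat"
  assume "\<exists>k. \<forall>i\<ge>k. x i \<in> \<int>" "\<exists>k. \<forall>i\<ge>k. y i \<in> \<int>"
  then obtain k l where "\<forall>i\<ge>k. x i \<in> \<int>" "\<forall>i\<ge>l. y i \<in> \<int>" by blast
  then show "\<exists>k. \<forall>i\<ge>k. x i * y i \<in> \<int>" by (intro exI[of _ "max k l"]) auto
qed

lemma profinite_int_minus: "profinite_int x \<Longrightarrow> profinite_int (- x)"
  by transfer simp

lemma profinite_int_0: "profinite_int 0" by transfer simp

lemma profinite_int_1: "profinite_int 1" by transfer simp

lemma profinite_int_diff: "profinite_int x \<Longrightarrow> profinite_int y \<Longrightarrow> profinite_int (x - y)"
  using profinite_int_add[of x "- y"] profinite_int_minus[of y] by simp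

section \<open>The idempotent of a prime, congruence subgroups and ramification\<close>

lemma adic_rel_at_prime:
  "prime p \<Longrightarrow> adic_rel (\<lambda>i. 1 - of_nat p ^ fact i) (\<lambda>i. 1 - of_nat p ^ fact i)"
  using adic_cauchy_at_prime by (simp add: adic_rel_def)

lemma profinite_int_at_prime: "prime p \<Longrightarrow> profinite_int (at_prime p)"
  unfolding at_prime_def by (subst profinite_int.abs_eq) (auto intro: adic_rel_at_prime)

lemma power_fact_cong_1:
  assumes "coprime p m" "m > 0" "i \<ge> totient m"
  shows "[p ^ fact i = 1] (mod m)"
proof -
  have "totient m dvd fact i"
    using assms by (intro dvd_fact) (auto simp: Suc_le_eq)
  then obtain t where t: "fact i = totient m * t" by (elim dvdE)
  show ?thesis using cong_pow[OF euler_theorem[OF assms(1)], of t] by (simp add: t power_mult)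
qed

lemma one_minus_power_fact_div_Ints:
  assumes "coprime p m" "m > 0" "i \<ge> totient m"
  shows "(1 - of_nat p ^ fact i) / of_nat m \<in> (\<int> :: rat set)"
proof -
  have "[int (p ^ fact i) = int 1] (mod int m)"
    using power_fact_cong_1[OF assms] by (simp only: cong_int_iff)
  then obtain z where z: "int (p ^ fact i) - 1 = int m * z" by (auto simp: cong_iff_dvd_diff elim!: dvdE)
  have "(1 - of_nat p ^ fact i :: rat) = - of_int (int (p ^ fact i) - 1)" by simp
  also have "\<dots> = of_nat m * of_int (- z)" unfolding z by simp
  finally show ?thesis using assms(2) by simp
qed

text \<open>For X = 1 - p^(i!) one has X^2 - X = - p^(i!) (1 - p^(i!)). If N = p^a m with
  \<open>m\<close> prime to \<open>p\<close>, the first factor is eventually divisible by p^a and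
  the second by \<open>m\<close>.\<close>

lemma at_prime_idem:
  assumes p: "prime p"
  shows "at_prime p * at_prime p = at_prime p"
proof -
  let ?X = "\<lambda>i. 1 - of_nat p ^ fact i :: rat"
  have c: "adic_cauchy ?X" by (rule adic_cauchy_at_prime[OF p])
  have "adic_null (\<lambda>i. ?X i * ?X i - ?X i)"
    unfolding adic_null_def
  proof (intro allI impI)
    fix N :: nat assume N0: "N > 0"
    then obtain a m where N: "N = p ^ a * m" and m: "\<not> p dvd m"
      using multiplicity_decompose'[of N p] p by (metis not_prime_unit less_numeral_extra(3))
    have cop: "coprime p m" using p m by (simp add: prime_imp_coprime)
    have m0: "m > 0" using N N0 by simp
    have p0: "p > 0" using p by (rule prime_gt_0_nat)
    have "(?X i * ?X i - ?X i) / of_nat N \<in> \<int>" if i: "i \<ge> max a (totient m)" for i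
    proof -
      have "fact i \<ge> a" using i fact_ge_self[of i] by linarith
      then have "(of_nat p :: rat) ^ fact i = of_nat p ^ a * of_nat p ^ (fact i - a)"
        by (simp flip: power_add)
      then have "(?X i * ?X i - ?X i) / of_nat N = - (?X i / of_nat m * of_nat p ^ (fact i - a))"
        unfolding N using p0 m0 by (simp add: field_simps)
      moreover have "?X i / of_nat m \<in> \<int>"
        by (rule one_minus_power_fact_div_Ints[OF cop m0]) (use i in simp)
      then have "?X i / of_nat m * of_nat p ^ (fact i - a) \<in> \<int>"
        by (intro Ints_mult Ints_power Ints_of_nat)
      ultimately show ?thesis by (simp only: Ints_minus)
    qed
    then show "\<exists>k. \<forall>i\<ge>k. (?X i * ?X i - ?X i) / of_nat N \<in> \<int>" by blast
  qed
  then have "adic_rel (\<lambda>i. ?X i * ?X i) ?X"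
    using c by (simp add: adic_rel_def adic_cauchy_mult)
  then show ?thesis
    unfolding at_prime_def using times_fadele.abs_eq[OF adic_rel_at_prime[OF p] adic_rel_at_prime[OF p]]
    by (simp add: fadele_abs_eqI)
qed

text \<open>For \<open>p\<close> not dividing \<open>N\<close>, the integers 1 - p^(i!) are
  eventually divisible by \<open>N\<close>; termwise division gives the integral cofactor.\<close>

lemma at_prime_in_profinite_ideal:
  assumes p: "prime p" and N: "N > 0" "\<not> p dvd N"
  obtains z where "profinite_int z" "at_prime p = of_nat N * z"
proof -
  let ?X = "\<lambda>i. 1 - of_nat p ^ fact i :: rat"
  let ?Y = "\<lambda>i. ?X i / of_nat N"
  have cop: "coprime p N" using p N by (simp add: prime_imp_coprime)
  have Y: "adic_cauchy ?Y" unfolding adic_cauchy_def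
  proof (intro allI impI)
    fix M :: nat assume "M > 0"
    then have "N * M > 0" using N by simp
    then obtain k where "\<forall>i\<ge>k. \<forall>j\<ge>k. (?X i - ?X j) / of_nat (N * M) \<in> \<int>"
      using adic_cauchy_at_prime[OF p] unfolding adic_cauchy_def by meson
    moreover have "(?Y i - ?Y j) / of_nat M = (?X i - ?X j) / of_nat (N * M)" for i j
      by (simp add: diff_divide_distrib)
    ultimately show "\<exists>k. \<forall>i\<ge>k. \<forall>j\<ge>k. (?Y i - ?Y j) / of_nat M \<in> \<int>" by metis
  qed
  then have YY: "adic_rel ?Y ?Y" by (simp add: adic_rel_def)
  have "profinite_int (abs_fadele ?Y)"
    using one_minus_power_fact_div_Ints[OF cop N(1)] by (subst profinite_int.abs_eq[OF YY]) blast
  moreover have "at_prime p = of_nat N * abs_fadele ?Y"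
  proof -
    have "adic_rel (\<lambda>_. of_nat N) (\<lambda>_. of_nat N :: rat)" by (simp add: adic_rel_def)
    then show ?thesis
      unfolding of_nat_fadele at_prime_def using times_fadele.abs_eq[OF _ YY] N by simp
  qed
  ultimately show ?thesis using that by blast
qed

text \<open>The idempotent splits the finite adeles into the component at \<open>p\<close> and the
  rest, and multiplication respects the splitting; the second component is the identity on both
  sides.\<close>

lemma local_matrix_mult:
  fixes A B :: "fadele^'n^'n"
  assumes p: "prime p" and AB: "A ** B = mat 1"
  shows "local_matrix p A ** local_matrix p B = mat 1"
proof -
  define e where "e = at_prime p"
  have ee: "e * e = e" unfolding e_def by (rule at_prime_idem[OF p])
  have idem: "(e * a + (1 - e) * c) * (e * b + (1 - e) * d) = e * (a * b) + (1 - e) * (c * d)" for a b c d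
  proof -
    have "(e * a + (1 - e) * c) * (e * b + (1 - e) * d)
      = (e * e) * (a * b) + (e - e * e) * (a * d + c * b) + (1 - 2 * e + e * e) * (c * d)"
      by (simp add: algebra_simps)
    then show ?thesis unfolding ee by (simp add: algebra_simps)
  qed
  have "(local_matrix p A ** local_matrix p B) $ i $ j = mat 1 $ i $ j" for i j
  proof -
    have "(local_matrix p A ** local_matrix p B) $ i $ j
      = (\<Sum>k\<in>UNIV. e * (A $ i $ k * B $ k $ j) + (1 - e) * (mat 1 $ i $ k * mat 1 $ k $ j))"
      unfolding matrix_matrix_mult_def local_matrix_def e_def[symmetric] by (simp add: idem)
    also have "\<dots> = e * (A ** B) $ i $ j + (1 - e) * ((mat 1 :: fadele^'n^'n) ** mat 1) $ i $ j"
      by (simp add: matrix_matrix_mult_def sum.distrib sum_distrib_left)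
    finally show ?thesis unfolding AB by (simp add: algebra_simps)
  qed
  then show ?thesis by (simp add: vec_eq_iff)
qed

text \<open>A matrix concentrated at \<open>p\<close> differs from the identity by a multiple of
  \<open>at_prime p\<close>, and this idempotent is divisible by \<open>N\<close>.\<close>

lemma GL_Zp_subset_congruence_subgroup:
  fixes k :: "fadele^'n^'n"
  assumes p: "prime p" and N: "N > 0" "\<not> p dvd N" and k: "k \<in> GL_Zp p"
  shows "k \<in> congruence_subgroup N"
proof -
  obtain A where A: "A \<in> GL_profinite" and kA: "k = local_matrix p A"
    using k unfolding GL_Zp_def by blast
  obtain A' :: "fadele^'n^'n" where A': "\<And>i j. profinite_int (A $ i $ j)" "\<And>i j. profinite_int (A' $ i $ j)"
    "A ** A' = mat 1" "A' ** A = mat 1"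
    using A unfolding GL_profinite_def by blast
  have mat1: "profinite_int ((mat 1 :: fadele^'n^'n) $ i $ j)" for i j
    by (simp add: mat_def profinite_int_0 profinite_int_1)
  have loc: "profinite_int (local_matrix p B $ i $ j)" if "\<And>i j. profinite_int (B $ i $ j)"
    for B :: "fadele^'n^'n" and i j
    unfolding local_matrix_def
    using that profinite_int_at_prime[OF p] mat1
    by (simp add: profinite_int_add profinite_int_mult profinite_int_diff profinite_int_1)
  have "k \<in> GL_profinite"
    unfolding GL_profinite_def kA
    using loc A' local_matrix_mult[OF p A'(3)] local_matrix_mult[OF p A'(4)] by blast
  moreover have "(k - mat 1) $ i $ j \<in> profinite_ideal N" for i j
  proof -
    obtain z where z: "profinite_int z" "at_prime p = of_nat N * z"
      using at_prime_in_profinite_ideal[OF p N] .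
    have "(k - mat 1) $ i $ j = of_nat N * (z * (A $ i $ j - mat 1 $ i $ j))"
      unfolding kA local_matrix_def z(2) by (simp add: algebra_simps)
    then show ?thesis
      unfolding profinite_ideal_def using z(1) A'(1) mat1
      by (auto intro!: exI[of _ "z * (A $ i $ j - mat 1 $ i $ j)"] profinite_int_mult profinite_int_diff)
  qed
  ultimately show ?thesis unfolding congruence_subgroup_def by blast
qed

text \<open>A nonzero form in \<open>V\<close> is fixed by a congruence subgroup of some level
  \<open>N\<close>, which contains the local group \<open>GL_Zp p\<close> for every \<open>p\<close>
  not dividing \<open>N\<close>. So ramified primes divide \<open>N\<close>.\<close>

lemma finite_ramified:
  fixes V :: "('n::finite) adelic_fun set"
  assumes V: "cuspidal_automorphic_rep V" and irr: "irreducible_rep V"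
  shows "finite {p. prime p \<and> \<not> unramified V p}"
proof -
  have "(\<lambda>_. 0) \<in> V" using V unfolding cuspidal_automorphic_rep_def invariant_subspace_def by blast
  moreover have "V \<noteq> {\<lambda>_. 0}" using irr unfolding irreducible_rep_def by blast
  ultimately obtain \<phi> where \<phi>: "\<phi> \<in> V" "\<phi> \<noteq> (\<lambda>_. 0)" by blast
  then have "automorphic_form \<phi>" using V unfolding cuspidal_automorphic_rep_def by blast
  then obtain N where N: "N > 0" "\<And>k. k \<in> congruence_subgroup N \<Longrightarrow> right_translate (mat 1, k) \<phi> = \<phi>"
    unfolding automorphic_form_def by blast
  have "unramified V p" if "prime p" "\<not> p dvd N" for p
    unfolding unramified_def spherical_def
    using \<phi> N GL_Zp_subset_congruence_subgroup[OF that(1) N(1) that(2)] by blast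
  then have "{p. prime p \<and> \<not> unramified V p} \<subseteq> {p. p dvd N}" by blast
  then show ?thesis using N(1) finite_divisors_nat finite_subset by blast
qed

section \<open>Logarithms of Euler products\<close>

lemma holomorphic_on_suminf:
  fixes f :: "nat \<Rightarrow> complex \<Rightarrow> complex"
  assumes S: "open S" and f: "\<And>n. f n holomorphic_on S"
    and M: "\<And>x. x \<in> S \<Longrightarrow> \<exists>d>0. \<exists>M. cball x d \<subseteq> S \<and> summable M \<and> (\<forall>n. \<forall>y\<in>cball x d. norm (f n y) \<le> M n)"
  shows "(\<lambda>s. \<Sum>n. f n s) holomorphic_on S"
proof (rule holomorphic_uniform_sequence[OF S, of "\<lambda>N s. \<Sum>n<N. f n s"])
  show "(\<lambda>s. \<Sum>n<N. f n s) holomorphic_on S" for N using f by (intro holomorphic_intros)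
  fix x assume "x \<in> S"
  from M[OF this] obtain d M where d: "d > 0" "cball x d \<subseteq> S" "summable M" "\<forall>n. \<forall>y\<in>cball x d. norm (f n y) \<le> M n"
    by blast
  have "uniform_limit (cball x d) (\<lambda>N s. \<Sum>n<N. f n s) (\<lambda>s. \<Sum>n. f n s) sequentially"
    by (rule Weierstrass_m_test[OF _ d(3)]) (rule d(4)[rule_format])
  then show "\<exists>d>0. cball x d \<subseteq> S \<and> uniform_limit (cball x d) (\<lambda>N s. \<Sum>n<N. f n s) (\<lambda>s. \<Sum>n. f n s) sequentially"
    by (intro exI[of _ d] conjI d(1,2))
qed

text \<open>The constants fit the Taylor remainders of the logarithm, and \<open>2 powr (- 2 / 5) \<le> 4 / 5\<close>.\<close>

definition small_order :: "nat \<Rightarrow> (complex \<Rightarrow> complex) \<Rightarrow> bool" where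
  "small_order k \<phi> \<longleftrightarrow> \<phi> holomorphic_on ball 0 1 \<and> (\<forall>z. norm z \<le> 4 / 5 \<longrightarrow> norm (\<phi> z) \<le> 5 * norm z ^ k)"

text \<open>The mean value inequality on the disc of radius |z|, where |1 - w| >= 1/5 because |z| <=
  4/5.\<close>

lemma small_orderI:
  assumes d: "\<And>z. norm z < 1 \<Longrightarrow> (\<phi> has_field_derivative z ^ k / (1 - z)) (at z)" and zero: "\<phi> 0 = 0"
  shows "small_order (Suc k) \<phi>"
proof -
  have hol: "\<phi> holomorphic_on ball 0 1"
  proof (rule holomorphic_onI)
    fix z :: complex assume "z \<in> ball 0 1"
    then have "norm z < 1" by simp
    from has_field_derivative_at_within[OF d[OF this], of "ball 0 1"]
    show "\<phi> field_differentiable at z within ball 0 1" unfolding field_differentiable_def by (rule exI)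
  qed
  have bd: "norm (\<phi> z) \<le> 5 * norm z ^ Suc k" if z: "norm z \<le> 4 / 5" for z
  proof -
    have "norm (\<phi> z - \<phi> 0) \<le> (5 * norm z ^ k) * norm (z - 0)"
    proof (rule field_differentiable_bound[where S = "cball 0 (norm z)" and f' = "\<lambda>w. w ^ k / (1 - w)"])
      fix w :: complex assume "w \<in> cball 0 (norm z)"
      then have w: "norm w \<le> norm z" by simp
      then have w1: "norm w < 1" using z by simp
      show "(\<phi> has_field_derivative w ^ k / (1 - w)) (at w within cball 0 (norm z))"
        by (rule has_field_derivative_at_within[OF d[OF w1]])
      have "1 / 5 \<le> norm (1 - w)" using norm_triangle_ineq2[of 1 w] w z by simp
      then have "norm w ^ k / norm (1 - w) \<le> norm z ^ k / (1 / 5)"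
        using w by (intro frac_le power_mono) auto
      then show "norm (w ^ k / (1 - w)) \<le> 5 * norm z ^ k" by (simp add: norm_divide norm_power)
    qed auto
    then show ?thesis using zero by (simp add: mult_ac)
  qed
  show ?thesis unfolding small_order_def using hol bd by blast
qed

lemma one_minus_not_nonpos: "norm (z :: complex) < 1 \<Longrightarrow> 1 - z \<notin> \<real>\<^sub>\<le>\<^sub>0"
  using complex_Re_le_cmod[of z] by (auto simp: complex_nonpos_Reals_iff)

text \<open>Subtracting Taylor terms from 1 / (1 - z) leaves z^k / (1 - z). Order 1 serves in the
  region of absolute convergence, order 2 at the edge s = 1, order 3 on the critical line.\<close>

lemma small_order_log:
  "small_order 1 (\<lambda>z. - Ln (1 - z))"
  "small_order 2 (\<lambda>z. - Ln (1 - z) - z)"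
  "small_order 3 (\<lambda>z. - Ln (1 - z) - z - z\<^sup>2 / 2)"
proof -
  have l: "((\<lambda>z. - Ln (1 - z)) has_field_derivative 1 / (1 - z)) (at z)" if "norm z < 1" for z
  proof -
    have "((\<lambda>z. Ln (1 - z)) has_field_derivative inverse (1 - z) * (0 - 1)) (at z)"
      by (rule DERIV_chain2[where f = Ln and g = "\<lambda>z. 1 - z", OF has_field_derivative_Ln[OF one_minus_not_nonpos[OF that]]])
        (rule DERIV_diff[OF DERIV_const DERIV_ident])
    from DERIV_minus[OF this] show ?thesis by (simp add: inverse_eq_divide)
  qed
  have nz: "1 - z \<noteq> 0" if "norm z < 1" for z :: complex using that by auto
  have "small_order (Suc 0) (\<lambda>z. - Ln (1 - z))"
  proof (rule small_orderI)
    show "((\<lambda>z. - Ln (1 - z)) has_field_derivative z ^ 0 / (1 - z)) (at z)" if "norm z < 1" for z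
      using l[OF that] by simp
  qed simp
  then show "small_order 1 (\<lambda>z. - Ln (1 - z))" by simp
  have "small_order (Suc 1) (\<lambda>z. - Ln (1 - z) - z)"
  proof (rule small_orderI)
    fix z :: complex assume z: "norm z < 1"
    have "((\<lambda>z. - Ln (1 - z) - z) has_field_derivative 1 / (1 - z) - 1) (at z)"
      by (intro derivative_intros l z)
    also have "1 / (1 - z) - 1 = z ^ 1 / (1 - z)" using nz[OF z] by (simp add: field_simps)
    finally show "((\<lambda>z. - Ln (1 - z) - z) has_field_derivative z ^ 1 / (1 - z)) (at z)" .
  qed simp
  then show "small_order 2 (\<lambda>z. - Ln (1 - z) - z)" by (simp only: Suc_1 One_nat_def[symmetric])
  have "small_order (Suc 2) (\<lambda>z. - Ln (1 - z) - z - z\<^sup>2 / 2)"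
  proof (rule small_orderI)
    fix z :: complex assume z: "norm z < 1"
    have "((\<lambda>z. - Ln (1 - z) - z - z\<^sup>2 / 2) has_field_derivative 1 / (1 - z) - 1 - z) (at z)"
    proof -
      have "((\<lambda>z::complex. z\<^sup>2 / 2) has_field_derivative z) (at z)"
        by (auto intro!: derivative_eq_intros)
      from DERIV_diff[OF DERIV_diff[OF l[OF z] DERIV_ident] this] show ?thesis .
    qed
    also have "1 / (1 - z) - 1 - z = z ^ 2 / (1 - z)" using nz[OF z] by (simp add: field_simps power2_eq_square)
    finally show "((\<lambda>z. - Ln (1 - z) - z - z\<^sup>2 / 2) has_field_derivative z ^ 2 / (1 - z)) (at z)" .
  qed simp
  moreover have "Suc 2 = 3" by simp
  ultimately show "small_order 3 (\<lambda>z. - Ln (1 - z) - z - z\<^sup>2 / 2)" by (simp only:)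
qed

section \<open>Series over the primes formed with a function of small order\<close>

definition prime_term :: "(nat \<Rightarrow> 'n::finite \<Rightarrow> complex) \<Rightarrow> (complex \<Rightarrow> complex) \<Rightarrow> nat \<Rightarrow> complex \<Rightarrow> complex" where
  "prime_term \<beta> \<phi> n s = (if prime n then \<Sum>j\<in>UNIV. \<phi> (\<beta> n j * of_nat n powr (- s)) else 0)"

definition prime_series :: "(nat \<Rightarrow> 'n::finite \<Rightarrow> complex) \<Rightarrow> (complex \<Rightarrow> complex) \<Rightarrow> complex \<Rightarrow> complex" where
  "prime_series \<beta> \<phi> s = (\<Sum>n. prime_term \<beta> \<phi> n s)"

lemma two_powr_le: "(2::real) powr (- (2 / 5)) \<le> 4 / 5"
proof -
  have "((2::real) powr (- (2 / 5))) ^ 5 = 2 powr (- 2)" by (simp add: powr_power)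
  also have "\<dots> = 1 / 4" by (simp add: powr_minus)
  also have "\<dots> \<le> (4 / 5) ^ 5" by (simp add: power_divide)
  finally have "((2::real) powr (- (2 / 5))) ^ 5 \<le> (4 / 5) ^ 5" .
  then show ?thesis by (subst (asm) power_mono_iff) auto
qed

lemma local_root_bound:
  assumes "prime n" "norm b \<le> 1" "Re s \<ge> \<sigma>" "\<sigma> \<ge> 2 / 5"
  shows "norm (b * of_nat n powr (- s)) \<le> real n powr (- \<sigma>)" "norm (b * of_nat n powr (- s)) \<le> 4 / 5"
proof -
  have n: "n \<ge> 2" using assms(1) by (rule prime_ge_2_nat)
  have "norm (b * of_nat n powr (- s)) \<le> 1 * real n powr (- Re s)"
    unfolding norm_mult using assms(2) n by (intro mult_mono) (auto simp: norm_powr_real_powr)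
  also have "\<dots> \<le> real n powr (- \<sigma>)" using assms n by (simp add: powr_mono)
  finally show 1: "norm (b * of_nat n powr (- s)) \<le> real n powr (- \<sigma>)" .
  also have "\<dots> \<le> real n powr (- (2 / 5))" using assms n by (intro powr_mono) auto
  also have "\<dots> \<le> 2 powr (- (2 / 5))" using n by (intro powr_mono2') auto
  finally show "norm (b * of_nat n powr (- s)) \<le> 4 / 5" using two_powr_le by linarith
qed

text \<open>Order \<open>k\<close> gives convergence for Re s > 1 / k. The abscissa 2/5 lies between
  1/3 and 1/2: the tail of third order is holomorphic beyond the critical line, while all arguments
  stay in the disc of radius 4/5.\<close>

lemma prime_term_bound:
  fixes \<beta> :: "nat \<Rightarrow> 'n::finite \<Rightarrow> complex"
  assumes \<beta>: "\<And>p j. prime p \<Longrightarrow> norm (\<beta> p j) \<le> 1" and \<phi>: "small_order k \<phi>"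
    and s: "Re s \<ge> \<sigma>" "\<sigma> \<ge> 2 / 5"
  shows "norm (prime_term \<beta> \<phi> n s) \<le> 5 * real CARD('n) * real n powr (- (\<sigma> * real k))"
proof (cases "prime n")
  case True
  have "norm (\<Sum>j\<in>UNIV. \<phi> (\<beta> n j * of_nat n powr (- s))) \<le> (\<Sum>j\<in>(UNIV::'n set). 5 * real n powr (- (\<sigma> * real k)))"
  proof (rule sum_norm_le)
    fix j
    note lb = local_root_bound[OF True \<beta>[OF True] s, of j]
    have "norm (\<phi> (\<beta> n j * of_nat n powr (- s))) \<le> 5 * norm (\<beta> n j * of_nat n powr (- s)) ^ k"
      using \<phi> lb(2) unfolding small_order_def by blast
    also have "\<dots> \<le> 5 * (real n powr (- \<sigma>)) ^ k" using lb(1) by (intro mult_left_mono power_mono) auto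
    also have "(real n powr (- \<sigma>)) ^ k = real n powr (- (\<sigma> * real k))"
      using True by (simp add: powr_power prime_gt_0_nat mult.commute)
    finally show "norm (\<phi> (\<beta> n j * of_nat n powr (- s))) \<le> 5 * real n powr (- (\<sigma> * real k))" .
  qed
  then show ?thesis using True by (simp add: prime_term_def mult_ac)
qed (simp add: prime_term_def)

lemma prime_term_holomorphic:
  fixes \<beta> :: "nat \<Rightarrow> 'n::finite \<Rightarrow> complex"
  assumes \<beta>: "\<And>p j. prime p \<Longrightarrow> norm (\<beta> p j) \<le> 1" and \<phi>: "small_order k \<phi>"
  shows "prime_term \<beta> \<phi> n holomorphic_on {s. Re s > 2 / 5}"
proof (cases "prime n")
  case True
  have "(\<lambda>s. \<phi> (\<beta> n j * of_nat n powr (- s))) holomorphic_on {s. Re s > 2 / 5}" for j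
  proof -
    have "(\<phi> \<circ> (\<lambda>s. \<beta> n j * of_nat n powr (- s))) holomorphic_on {s. Re s > 2 / 5}"
    proof (rule holomorphic_on_compose_gen)
      show "(\<lambda>s. \<beta> n j * of_nat n powr (- s)) holomorphic_on {s. Re s > 2 / 5}"
        using True by (intro holomorphic_intros) (auto simp: prime_gt_0_nat)
      show "\<phi> holomorphic_on ball 0 1" using \<phi> by (simp add: small_order_def)
      show "(\<lambda>s. \<beta> n j * of_nat n powr (- s)) ` {s. Re s > 2 / 5} \<subseteq> ball 0 1"
      proof safe
        fix s :: complex assume "2 / 5 < Re s"
        then have "norm (\<beta> n j * of_nat n powr (- s)) \<le> 4 / 5"
          using local_root_bound(2)[OF True \<beta>[OF True], of "2 / 5" s j] by simp
        then show "\<beta> n j * of_nat n powr (- s) \<in> ball 0 1" by simp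
      qed
    qed
    then show ?thesis by (simp add: o_def)
  qed
  then have "(\<lambda>s. \<Sum>j\<in>UNIV. \<phi> (\<beta> n j * of_nat n powr (- s))) holomorphic_on {s. Re s > 2 / 5}"
    by (intro holomorphic_intros)
  then show ?thesis using True by (simp add: prime_term_def[abs_def])
qed (simp add: prime_term_def[abs_def])

context
  fixes \<beta> :: "nat \<Rightarrow> 'n::finite \<Rightarrow> complex" and k :: nat and \<phi> :: "complex \<Rightarrow> complex"
  assumes \<beta>: "\<And>p j. prime p \<Longrightarrow> norm (\<beta> p j) \<le> 1" and \<phi>: "small_order k \<phi>"
begin

lemma prime_series_summable:
  assumes "Re s \<ge> \<sigma>" "\<sigma> \<ge> 2 / 5" "\<sigma> * real k > 1"
  shows "summable (\<lambda>n. prime_term \<beta> \<phi> n s)"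
    and "norm (prime_series \<beta> \<phi> s) \<le> (\<Sum>n. 5 * real CARD('n) * real n powr (- (\<sigma> * real k)))"
proof -
  have sm: "summable (\<lambda>n. 5 * real CARD('n) * real n powr (- (\<sigma> * real k)))"
    using assms(3) by (intro summable_mult) (simp add: summable_real_powr_iff)
  have b: "norm (prime_term \<beta> \<phi> n s) \<le> 5 * real CARD('n) * real n powr (- (\<sigma> * real k))" for n
    by (rule prime_term_bound[OF \<beta> \<phi> assms(1,2)])
  show "summable (\<lambda>n. prime_term \<beta> \<phi> n s)"
    by (rule summable_comparison_test'[OF sm, of 0]) (use b in simp)
  show "norm (prime_series \<beta> \<phi> s) \<le> (\<Sum>n. 5 * real CARD('n) * real n powr (- (\<sigma> * real k)))"
  proof -
    have "summable (\<lambda>n. norm (prime_term \<beta> \<phi> n s))"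
      by (rule summable_comparison_test'[OF sm, of 0]) (use b in simp)
    from order_trans[OF summable_norm[OF this] suminf_le[OF b this sm]] show ?thesis
      unfolding prime_series_def .
  qed
qed

lemma prime_series_holomorphic:
  assumes "\<sigma> \<ge> 2 / 5" "\<sigma> * real k \<ge> 1"
  shows "prime_series \<beta> \<phi> holomorphic_on {s. Re s > \<sigma>}"
proof -
  have "(\<lambda>s. \<Sum>n. prime_term \<beta> \<phi> n s) holomorphic_on {s. Re s > \<sigma>}"
  proof (rule holomorphic_on_suminf)
    show "open {s. Re s > \<sigma>}" by (simp add: open_halfspace_Re_gt)
    show "prime_term \<beta> \<phi> n holomorphic_on {s. Re s > \<sigma>}" for n
      by (rule holomorphic_on_subset[OF prime_term_holomorphic[OF \<beta> \<phi>]]) (use assms in auto)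
    fix x assume "x \<in> {s. Re s > \<sigma>}"
    then have x: "Re x > \<sigma>" by simp
    define d where "d = (Re x - \<sigma>) / 2"
    have d: "d > 0" using x by (simp add: d_def)
    have k0: "real k > 0" using assms by (cases "k = 0") auto
    have "(\<sigma> + d) * real k > \<sigma> * real k" using d k0 by simp
    then have dk: "(\<sigma> + d) * real k > 1" using assms by linarith
    have y: "Re y \<ge> \<sigma> + d" if "y \<in> cball x d" for y
    proof -
      have "\<bar>Re x - Re y\<bar> \<le> d" using that abs_Re_le_cmod[of "x - y"] by (simp add: dist_norm)
      moreover have "Re x = \<sigma> + 2 * d" by (simp add: d_def field_simps)
      ultimately show ?thesis by linarith
    qed
    show "\<exists>d>0. \<exists>M. cball x d \<subseteq> {s. Re s > \<sigma>} \<and> summable M \<and> (\<forall>n. \<forall>y\<in>cball x d. norm (prime_term \<beta> \<phi> n y) \<le> M n)"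
    proof (intro exI conjI allI ballI)
      show "d > 0" by (rule d)
      show "cball x d \<subseteq> {s. Re s > \<sigma>}"
      proof
        fix w assume "w \<in> cball x d"
        from y[OF this] d show "w \<in> {s. Re s > \<sigma>}" by simp
      qed
      show "summable (\<lambda>n. 5 * real CARD('n) * real n powr (- ((\<sigma> + d) * real k)))"
        using dk by (intro summable_mult) (simp add: summable_real_powr_iff)
      show "norm (prime_term \<beta> \<phi> n z) \<le> 5 * real CARD('n) * real n powr (- ((\<sigma> + d) * real k))" if "z \<in> cball x d" for n z
        by (rule prime_term_bound[OF \<beta> \<phi> y[OF that]]) (use assms d in auto)
    qed
  qed
  then show ?thesis by (simp add: prime_series_def[abs_def])
qed

end

text \<open>Partial products of the Euler product are exponentials of partial sums of the series,
  and both converge.\<close>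

lemma exp_prime_series_log:
  fixes \<beta> :: "nat \<Rightarrow> 'n::finite \<Rightarrow> complex"
  assumes \<beta>: "\<And>p j. prime p \<Longrightarrow> norm (\<beta> p j) \<le> 1" and s: "Re s > 1" and z: "euler_product \<beta> s z"
  shows "exp (prime_series \<beta> (\<lambda>z. - Ln (1 - z)) s) = z"
proof -
  let ?t = "\<lambda>n. prime_term \<beta> (\<lambda>z. - Ln (1 - z)) n s"
  have "summable ?t"
    by (rule prime_series_summable(1)[OF \<beta> small_order_log(1), where \<sigma> = "Re s"]) (use s in auto)
  then have "(\<lambda>N. \<Sum>n\<le>N. ?t n) \<longlonglongrightarrow> prime_series \<beta> (\<lambda>z. - Ln (1 - z)) s"
    unfolding prime_series_def by (rule summable_LIMSEQ')
  then have "(\<lambda>N. exp (\<Sum>n\<le>N. ?t n)) \<longlonglongrightarrow> exp (prime_series \<beta> (\<lambda>z. - Ln (1 - z)) s)"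
    by (rule tendsto_exp)
  moreover have "exp (\<Sum>n\<le>N. ?t n) = (\<Prod>p\<le>N. if prime p then \<Prod>j\<in>UNIV. inverse (1 - \<beta> p j * of_nat p powr (- s)) else 1)" for N
  proof -
    have "exp (?t p) = (if prime p then \<Prod>j\<in>UNIV. inverse (1 - \<beta> p j * of_nat p powr (- s)) else 1)" for p
    proof (cases "prime p")
      case True
      have "exp (- Ln (1 - \<beta> p j * of_nat p powr (- s))) = inverse (1 - \<beta> p j * of_nat p powr (- s))" for j
      proof -
        have "norm (\<beta> p j * of_nat p powr (- s)) \<le> 4 / 5"
          using s by (intro local_root_bound(2)[OF True \<beta>[OF True], of "2 / 5"]) auto
        then have "1 - \<beta> p j * of_nat p powr (- s) \<noteq> 0" by auto
        then show ?thesis by (simp add: exp_minus)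
      qed
      then show ?thesis using True by (simp add: prime_term_def exp_sum)
    qed (simp add: prime_term_def)
    then show ?thesis by (simp add: exp_sum)
  qed
  ultimately have "(\<lambda>N. \<Prod>p\<le>N. if prime p then \<Prod>j\<in>UNIV. inverse (1 - \<beta> p j * of_nat p powr (- s)) else 1)
     \<longlonglongrightarrow> exp (prime_series \<beta> (\<lambda>z. - Ln (1 - z)) s)" by simp
  then show ?thesis
    by (rule LIMSEQ_unique[OF _ has_prod_imp_tendsto[OF z[unfolded euler_product_def]]])
qed

section \<open>Measure theory: exceptional sets, unit intervals and logarithmic measure\<close>

lemma L2_tendsto_zero:
  fixes f :: "real \<Rightarrow> complex"
  assumes [measurable]: "f \<in> borel_measurable borel"
    and fin: "(\<integral>\<^sup>+t. ennreal ((norm (f t))\<^sup>2) \<partial>lborel) < \<infinity>"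
  obtains E where "E \<in> sets borel" "emeasure lborel E < \<infinity>" "(f \<longlongrightarrow> 0) (inf at_top (principal (- E)))"
proof -
  define A where "A = (\<lambda>k::nat. {t. 1 / real (Suc k) \<le> norm (f t)})"
  have [measurable]: "A k \<in> sets borel" for k unfolding A_def by measurable
  have Afin: "emeasure lborel (A k) < \<infinity>" for k
  proof -
    have "emeasure lborel {t \<in> space lborel. 1 \<le> ennreal ((real (Suc k))\<^sup>2) * ennreal ((norm (f t))\<^sup>2)} \<le> ennreal ((real (Suc k))\<^sup>2) * (\<integral>\<^sup>+t. ennreal ((norm (f t))\<^sup>2) * indicator (space lborel) t \<partial>lborel)"
      using nn_integral_Markov_inequality[of "\<lambda>t. ennreal ((norm (f t))\<^sup>2)" "space lborel" lborel "ennreal ((real (Suc k))\<^sup>2)"] by simp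
    note markov = this
    have sub: "A k \<subseteq> {t \<in> space lborel. 1 \<le> ennreal ((real (Suc k))\<^sup>2) * ennreal ((norm (f t))\<^sup>2)}"
    proof
      fix t assume "t \<in> A k"
      then have "1 \<le> real (Suc k) * norm (f t)" by (simp add: A_def field_simps)
      then have "1 \<le> (real (Suc k) * norm (f t))\<^sup>2" by (rule one_le_power)
      then have "ennreal 1 \<le> ennreal ((real (Suc k))\<^sup>2 * (norm (f t))\<^sup>2)" by (simp only: ennreal_leI power_mult_distrib)
      then show "t \<in> {t \<in> space lborel. 1 \<le> ennreal ((real (Suc k))\<^sup>2) * ennreal ((norm (f t))\<^sup>2)}"
        by (simp add: ennreal_mult)
    qed
    have "emeasure lborel (A k) \<le> emeasure lborel {t \<in> space lborel. 1 \<le> ennreal ((real (Suc k))\<^sup>2) * ennreal ((norm (f t))\<^sup>2)}"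
      by (rule emeasure_mono[OF sub]) measurable
    then have "emeasure lborel (A k) \<le> ennreal ((real (Suc k))\<^sup>2) * (\<integral>\<^sup>+t. ennreal ((norm (f t))\<^sup>2) * indicator (space lborel) t \<partial>lborel)"
      using markov by (rule order_trans)
    also have "\<dots> < \<infinity>" using fin by (auto simp: ennreal_mult_less_top)
    finally show ?thesis .
  qed
  \<comment> \<open>The level set has finite measure by Markov's inequality, so a far tail of it has
    measure below 2^(-k). The union of these tails has finite measure and contains every level set
    from some point on.\<close>
  have "\<exists>T::nat. emeasure lborel (A k \<inter> {real T..}) < ennreal ((1 / 2) ^ k)" for k
  proof -
    have "(\<lambda>T::nat. emeasure lborel (A k \<inter> {real T..})) \<longlonglongrightarrow> emeasure lborel (\<Inter>T::nat. A k \<inter> {real T..})"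
    proof (rule Lim_emeasure_decseq)
      show "emeasure lborel (A k \<inter> {real T..}) \<noteq> \<infinity>" for T
        using Afin[of k] emeasure_mono[of "A k \<inter> {real T..}" "A k" lborel] by auto
    qed (auto simp: decseq_def)
    moreover have "(\<Inter>T::nat. A k \<inter> {real T..}) = {}"
    proof -
      have "\<exists>T::nat. t < real T" for t by (rule reals_Archimedean2)
      then show ?thesis by (auto simp: not_le) (meson not_le)
    qed
    ultimately have "(\<lambda>T::nat. emeasure lborel (A k \<inter> {real T..})) \<longlonglongrightarrow> 0" by simp
    then have "\<forall>\<^sub>F T in sequentially. emeasure lborel (A k \<inter> {real T..}) < ennreal ((1 / 2) ^ k)"
      by (rule order_tendstoD) simp
    then show ?thesis using eventually_happens'[OF sequentially_bot] by fast
  qed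
  then obtain T :: "nat \<Rightarrow> nat" where T: "\<And>k. emeasure lborel (A k \<inter> {real (T k)..}) < ennreal ((1 / 2) ^ k)"
    by metis
  define E where "E = (\<Union>k. A k \<inter> {real (T k)..})"
  show ?thesis
  proof (rule that)
    show "E \<in> sets borel" unfolding E_def by measurable
    have "emeasure lborel E \<le> (\<Sum>k. emeasure lborel (A k \<inter> {real (T k)..}))"
      unfolding E_def by (rule emeasure_subadditive_countably) auto
    also have "\<dots> \<le> (\<Sum>k. ennreal ((1 / 2) ^ k))"
      by (rule suminf_le) (auto intro: less_imp_le[OF T])
    also have "\<dots> = ennreal (\<Sum>k. (1 / 2) ^ k)" by (rule suminf_ennreal2) (auto intro: summable_geometric)
    also have "\<dots> < \<infinity>" by simp
    finally show "emeasure lborel E < \<infinity>" .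
    show "(f \<longlongrightarrow> 0) (inf at_top (principal (- E)))"
    proof (rule tendstoI)
      fix e :: real assume "e > 0"
      then obtain k where k: "1 / real (Suc k) < e" using nat_approx_posE by blast
      have "\<forall>\<^sub>F t in at_top. t \<ge> real (T k)" by (rule eventually_ge_at_top)
      then show "\<forall>\<^sub>F t in inf at_top (principal (- E)). dist (f t) 0 < e"
        unfolding eventually_inf_principal
      proof eventually_elim
        fix t assume t: "real (T k) \<le> t"
        show "t \<in> - E \<longrightarrow> dist (f t) 0 < e"
        proof
          assume "t \<in> - E"
          then have "t \<notin> A k" using t unfolding E_def by auto
          then show "dist (f t) 0 < e" using k unfolding A_def by simp
        qed
      qed
    qed
  qed
qed

text \<open>\<open>K\<close> is fixed before \<open>h\<close>, so the bound is uniform over a family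
  of functions. The line is covered by intervals around the integers k and - k; there the weight
  decays like k^(-2) against growth k^(1/2).\<close>

lemma weighted_unit_intervals:
  fixes D :: real
  assumes D: "D \<ge> 0"
  obtains K where "K \<ge> 0" "\<And>h. h \<in> borel_measurable borel \<Longrightarrow> (\<And>u. h u \<ge> 0) \<Longrightarrow>
     (\<And>T::real. (\<integral>\<^sup>+u. ennreal (indicator {T-1..T+1} u * h u) \<partial>lborel) \<le> ennreal (D * (1 + \<bar>T\<bar>) powr (1 / 2))) \<Longrightarrow>
     (\<integral>\<^sup>+u. ennreal (h u / (1 + u\<^sup>2)) \<partial>lborel) \<le> ennreal K"
proof
  \<comment> \<open>12 = 6 * 2: the weight 3 / (1 + k^2) is at most 6 / (k + 1)^2, and the two
    intervals around k and - k contribute equally.\<close>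
  define c where "c = (\<lambda>k::nat. 12 * D * real (Suc k) powr (- (3 / 2)))"
  have c0: "c k \<ge> 0" for k using D by (simp add: c_def)
  have "summable (\<lambda>n. real n powr (- (3 / 2)))" by (simp add: summable_real_powr_iff)
  then have "summable (\<lambda>k. real (Suc k) powr (- (3 / 2)))" by (subst summable_Suc_iff)
  then have sc: "summable c" unfolding c_def by (rule summable_mult)
  show "suminf c \<ge> 0" using c0 sc by (intro suminf_nonneg) auto
  fix h :: "real \<Rightarrow> real"
  assume [measurable]: "h \<in> borel_measurable borel" and h0: "\<And>u. h u \<ge> 0"
    and hT: "\<And>T::real. (\<integral>\<^sup>+u. ennreal (indicator {T-1..T+1} u * h u) \<partial>lborel) \<le> ennreal (D * (1 + \<bar>T\<bar>) powr (1 / 2))"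
  define I where "I = (\<lambda>k u. ennreal (3 / (1 + (real k)\<^sup>2)) * (ennreal (indicator {real k-1..real k+1} u * h u) + ennreal (indicator {- real k-1..- real k+1} u * h u)))"
  have [measurable]: "I k \<in> borel_measurable borel" for k unfolding I_def by measurable
  have pt: "ennreal (h u / (1 + u\<^sup>2)) \<le> (\<Sum>k. I k u)" for u
  proof -
    define k where "k = nat \<lfloor>\<bar>u\<bar>\<rfloor>"
    have k: "real k \<le> \<bar>u\<bar>" "\<bar>u\<bar> < real k + 1" unfolding k_def by linarith+
    have "(real k)\<^sup>2 \<le> u\<^sup>2" using k by (simp add: abs_le_square_iff[symmetric])
    then have "1 + (real k)\<^sup>2 \<le> 1 * (1 + u\<^sup>2)" by simp
    also have "\<dots> \<le> 3 * (1 + u\<^sup>2)" by (rule mult_right_mono) auto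
    finally have "1 + (real k)\<^sup>2 \<le> 3 * (1 + u\<^sup>2)" .
    then have "1 / (1 + u\<^sup>2) \<le> 3 / (1 + (real k)\<^sup>2)"
      by (simp add: field_simps add_pos_nonneg)
    then have "h u * (1 / (1 + u\<^sup>2)) \<le> h u * (3 / (1 + (real k)\<^sup>2))" using h0 by (rule mult_left_mono)
    then have le: "h u / (1 + u\<^sup>2) \<le> 3 / (1 + (real k)\<^sup>2) * h u" by (simp add: mult.commute)
    have "ennreal (h u) \<le> ennreal (indicator {real k-1..real k+1} u * h u) + ennreal (indicator {- real k-1..- real k+1} u * h u)"
    proof (cases "u \<ge> 0")
      case True
      then have "u \<in> {real k-1..real k+1}" using k by auto
      then show ?thesis by simp
    next
      case False
      then have "u \<in> {- real k-1..- real k+1}" using k by auto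
      then show ?thesis by simp
    qed
    then have "ennreal (3 / (1 + (real k)\<^sup>2)) * ennreal (h u) \<le> I k u" unfolding I_def by (intro mult_left_mono) auto
    note Ibound = this
    have "ennreal (h u / (1 + u\<^sup>2)) \<le> ennreal (3 / (1 + (real k)\<^sup>2) * h u)" by (rule ennreal_leI[OF le])
    also have "\<dots> = ennreal (3 / (1 + (real k)\<^sup>2)) * ennreal (h u)" by (rule ennreal_mult''[OF h0])
    also have "\<dots> \<le> I k u" by (rule Ibound)
    also have "\<dots> \<le> (\<Sum>k. I k u)" using sum_le_suminf[of "\<lambda>k. I k u" "{k}"] by simp
    finally show ?thesis .
  qed
  have Ik: "(\<integral>\<^sup>+u. I k u \<partial>lborel) \<le> ennreal (c k)" for k
  proof -
    have "(\<integral>\<^sup>+u. I k u \<partial>lborel) = ennreal (3 / (1 + (real k)\<^sup>2)) *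
       ((\<integral>\<^sup>+u. ennreal (indicator {real k-1..real k+1} u * h u) \<partial>lborel) + (\<integral>\<^sup>+u. ennreal (indicator {- real k-1..- real k+1} u * h u) \<partial>lborel))"
      unfolding I_def by (simp add: nn_integral_cmult nn_integral_add)
    also have "\<dots> \<le> ennreal (3 / (1 + (real k)\<^sup>2)) * (ennreal (D * (1 + \<bar>real k\<bar>) powr (1 / 2)) + ennreal (D * (1 + \<bar>- real k\<bar>) powr (1 / 2)))"
      by (intro mult_left_mono add_mono hT) auto
    also have "\<dots> = ennreal (3 / (1 + (real k)\<^sup>2) * (2 * (D * real (Suc k) powr (1 / 2))))"
      using D by (simp add: add.commute flip: ennreal_plus ennreal_mult'')
    also have "\<dots> \<le> ennreal (c k)"
    proof (rule ennreal_leI)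
      have sq: "(real (Suc k))\<^sup>2 \<le> 2 * (1 + (real k)\<^sup>2)"
        using sum_squares_bound[of "real k" 1] by (simp add: power2_eq_square algebra_simps)
      have "3 / (1 + (real k)\<^sup>2) \<le> 6 / (real (Suc k))\<^sup>2"
      proof -
        have "3 * (real (Suc k))\<^sup>2 \<le> 6 * (1 + (real k)\<^sup>2)" using sq by simp
        then show ?thesis by (subst frac_le_eq) (auto simp: divide_le_0_iff add_nonneg_eq_0_iff add_pos_nonneg)
      qed
      then have "3 / (1 + (real k)\<^sup>2) * (2 * (D * real (Suc k) powr (1 / 2))) \<le> 6 / (real (Suc k))\<^sup>2 * (2 * (D * real (Suc k) powr (1 / 2)))"
        using D by (intro mult_right_mono) auto
      also have "\<dots> = 12 * D * (real (Suc k) powr (1 / 2) / (real (Suc k))\<^sup>2)" by simp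
      also have "real (Suc k) powr (1 / 2) / (real (Suc k))\<^sup>2 = real (Suc k) powr (- (3 / 2))"
        using powr_diff[of "real (Suc k)" "1 / 2" 2] by (simp del: of_nat_Suc)
      also have "12 * D * real (Suc k) powr (- (3 / 2)) = c k" unfolding c_def ..
      finally show "3 / (1 + (real k)\<^sup>2) * (2 * (D * real (Suc k) powr (1 / 2))) \<le> c k" .
    qed
    finally show ?thesis .
  qed
  have "(\<integral>\<^sup>+u. ennreal (h u / (1 + u\<^sup>2)) \<partial>lborel) \<le> (\<integral>\<^sup>+u. (\<Sum>k. I k u) \<partial>lborel)"
    by (rule nn_integral_mono) (rule pt)
  also have "\<dots> = (\<Sum>k. \<integral>\<^sup>+u. I k u \<partial>lborel)" by (rule nn_integral_suminf) measurable
  also have "\<dots> \<le> (\<Sum>k. ennreal (c k))" by (rule suminf_le) (use Ik in auto)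
  also have "\<dots> = ennreal (suminf c)" by (rule suminf_ennreal2[OF c0 sc])
  finally show "(\<integral>\<^sup>+u. ennreal (h u / (1 + u\<^sup>2)) \<partial>lborel) \<le> ennreal (suminf c)" .
qed

text \<open>The substitution x = exp t turns dx / x into dt. It is carried out between 1 and exp n,
  and Fatou's lemma passes to the half-line.\<close>

lemma nn_integral_log_measure:
  assumes [measurable]: "E \<in> sets borel"
  shows "(\<integral>\<^sup>+x. ennreal (1 / x) * indicator {x. 1 \<le> x \<and> ln x \<in> E} x \<partial>lborel) \<le> emeasure lborel E"
proof -
  define f where "f = (\<lambda>x::real. indicator E (ln x) / x :: real)"
  have [measurable]: "f \<in> borel_measurable borel" unfolding f_def by measurable
  have part: "(\<integral>\<^sup>+x. ennreal (f x * indicator {exp 0..exp (real n)} x) \<partial>lborel) \<le> emeasure lborel E" for n :: nat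
  proof -
    have "(\<integral>\<^sup>+x. ennreal (f x * indicator {exp 0..exp (real n)} x) \<partial>lborel)
       = (\<integral>\<^sup>+x. ennreal (f (exp x) * exp x * indicator {0..real n} x) \<partial>lborel)"
      by (rule nn_integral_substitution) (auto simp: set_borel_measurable_def intro!: derivative_eq_intros continuous_intros)
    also have "\<dots> \<le> (\<integral>\<^sup>+x. indicator E x \<partial>lborel)"
      by (rule nn_integral_mono) (auto simp: f_def indicator_def)
    finally show ?thesis by simp
  qed
  have "(\<integral>\<^sup>+x. ennreal (1 / x) * indicator {x. 1 \<le> x \<and> ln x \<in> E} x \<partial>lborel)
      = (\<integral>\<^sup>+x. liminf (\<lambda>n. ennreal (f x * indicator {exp 0..exp (real n)} x)) \<partial>lborel)"
  proof (rule nn_integral_cong)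
    fix x :: real
    have "(\<lambda>n. ennreal (f x * indicator {exp 0..exp (real n)} x)) \<longlonglongrightarrow> ennreal (1 / x) * indicator {x. 1 \<le> x \<and> ln x \<in> E} x"
    proof (rule tendsto_eventually)
      have "\<forall>\<^sub>F n in sequentially. exp (real n) \<ge> x"
        using filterlim_compose[OF exp_at_top filterlim_real_sequentially] by (auto simp: filterlim_at_top)
      then show "\<forall>\<^sub>F n in sequentially. ennreal (f x * indicator {exp 0..exp (real n)} x) = ennreal (1 / x) * indicator {x. 1 \<le> x \<and> ln x \<in> E} x"
        by eventually_elim (auto simp: f_def indicator_def)
    qed
    then show "ennreal (1 / x) * indicator {x. 1 \<le> x \<and> ln x \<in> E} x = liminf (\<lambda>n. ennreal (f x * indicator {exp 0..exp (real n)} x))"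
      by (rule lim_imp_Liminf[OF sequentially_bot, symmetric])
  qed
  also have "\<dots> \<le> liminf (\<lambda>n. \<integral>\<^sup>+x. ennreal (f x * indicator {exp 0..exp (real n)} x) \<partial>lborel)"
    by (rule nn_integral_liminf) measurable
  also have "\<dots> \<le> emeasure lborel E" using part by (intro Liminf_le) auto
  finally show ?thesis .
qed

section \<open>Mean square bounds on the critical line\<close>

lemma ln_le_root: "y \<ge> 1 \<Longrightarrow> ln y \<le> 4 * y powr (1 / 4)" for y :: real
  using ln_le_minus_one[of "y powr (1 / 4)"] by (simp add: ln_powr)

text \<open>\<open>\<alpha>\<close> and \<open>L\<close> are meant after removal of the ramified
  primes, so that the bound 1 holds at all primes. The half-width 14 leaves room for the circles of
  radius 12 around points of abscissa 3/2. The zero at 1/2 enters through a local factorisation,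
  which also covers m = 0.\<close>

locale central_L =
  fixes \<alpha> :: "nat \<Rightarrow> 'n::finite \<Rightarrow> complex" and L :: "complex \<Rightarrow> complex" and C :: real and A m :: nat
  assumes \<alpha>: "\<And>p j. prime p \<Longrightarrow> norm (\<alpha> p j) \<le> 1"
    and L: "L holomorphic_on UNIV"
    and ep: "\<And>s. Re s > 1 \<Longrightarrow> euler_product \<alpha> s (L s)"
    and nz: "\<And>s. Re s > 1 / 2 \<Longrightarrow> L s \<noteq> 0"
    and C1: "C \<ge> 1"
    and growth: "\<And>s. \<bar>Re s - 1 / 2\<bar> \<le> 14 \<Longrightarrow> norm (L s) \<le> C * (norm s + C) ^ A"
    and zero: "\<exists>r>0. \<exists>q. q holomorphic_on ball (1 / 2) r \<and> (\<forall>s\<in>ball (1 / 2) r. L s = q s * (s - 1 / 2) ^ m \<and> q s \<noteq> 0)"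
begin

definition log_series :: "complex \<Rightarrow> complex" where
  "log_series = prime_series \<alpha> (\<lambda>z. - Ln (1 - z))"

definition log_tail :: "complex \<Rightarrow> complex" where
  "log_tail = prime_series \<alpha> (\<lambda>z. - Ln (1 - z) - z - z\<^sup>2 / 2)"

definition W :: "complex \<Rightarrow> complex" where "W s = L (1 / 2 + s)"

lemma W_holomorphic: "W holomorphic_on UNIV"
proof -
  have "(L \<circ> (\<lambda>s. 1 / 2 + s)) holomorphic_on UNIV"
    by (rule holomorphic_on_compose_gen[OF _ L]) (auto intro!: holomorphic_intros)
  then show ?thesis by (simp add: o_def W_def[abs_def])
qed

lemma W_nonzero: "Re s > 0 \<Longrightarrow> W s \<noteq> 0" unfolding W_def by (rule nz) simp

text \<open>In the region of absolute convergence any branch differs from the series for log L by a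
  constant whose exponential is 1; subtracting it normalises the branch on the whole
  half-plane.\<close>

lemma log_W: "\<exists>g. g holomorphic_on {s. Re s > 0} \<and> (\<forall>s. Re s > 0 \<longrightarrow> exp (g s) = W s) \<and>
   (\<forall>s. Re s > 1 / 2 \<longrightarrow> g s = log_series (1 / 2 + s))"
proof -
  have S: "convex {s. Re s > 0}" "open {s. Re s > 0}"
    by (auto simp: convex_halfspace_Re_gt open_halfspace_Re_gt)
  obtain g where g: "g holomorphic_on {s. Re s > 0}" "\<And>s. s \<in> {s. Re s > 0} \<Longrightarrow> exp (g s) = W s"
    by (rule holomorphic_logarithm_exists[OF S, of W 1])
       (use W_nonzero in \<open>auto intro: holomorphic_on_subset[OF W_holomorphic]\<close>)
  define U where "U = {s. Re s > 1 / 2}"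
  have U: "convex U" "open U" unfolding U_def by (rule convex_halfspace_Re_gt, rule open_halfspace_Re_gt)
  have lh: "(\<lambda>s. log_series (1 / 2 + s)) holomorphic_on U"
  proof -
    have "(log_series \<circ> (\<lambda>s. 1 / 2 + s)) holomorphic_on U"
    proof (rule holomorphic_on_compose_gen)
      show "log_series holomorphic_on {s. Re s > 1}" unfolding log_series_def
        by (rule prime_series_holomorphic[OF \<alpha> small_order_log(1)]) auto
    qed (auto intro!: holomorphic_intros simp: U_def)
    then show ?thesis by (simp add: o_def)
  qed
  have el: "exp (log_series (1 / 2 + s)) = W s" if "s \<in> U" for s
    unfolding log_series_def W_def using that by (intro exp_prime_series_log[OF \<alpha>] ep) (auto simp: U_def)
  have gU: "g holomorphic_on U" by (rule holomorphic_on_subset[OF g(1)]) (auto simp: U_def)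
  define D where "D = (\<lambda>s. g s - log_series (1 / 2 + s))"
  have Dh: "D holomorphic_on U" unfolding D_def by (intro holomorphic_intros gU lh)
  have De: "exp (D s) = 1" if "s \<in> U" for s
    using that el[OF that] g(2)[of s] W_nonzero[of s] by (simp add: D_def exp_diff U_def)
  have Dc: "D s = D 1" if "s \<in> U" for s
    by (rule exp_const_imp_const[OF U Dh De that]) (auto simp: U_def)
  have e1: "exp (D 1) = 1" by (rule De) (simp add: U_def)
  show ?thesis
  proof (intro exI conjI allI impI)
    show "(\<lambda>s. g s - D 1) holomorphic_on {s. Re s > 0}" using g(1) by (intro holomorphic_intros)
    show "exp (g s - D 1) = W s" if "Re s > 0" for s using g(2)[of s] that e1 by (simp add: exp_diff)
    show "g s - D 1 = log_series (1 / 2 + s)" if "Re s > 1 / 2" for s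
    proof -
      have 1: "D s = D 1" by (rule Dc) (unfold U_def, rule CollectI, rule that)
      have 2: "D s = g s - log_series (1 / 2 + s)" by (simp only: D_def)
      show ?thesis unfolding 1[symmetric] 2 by simp
    qed
  qed
qed

definition log_L :: "complex \<Rightarrow> complex" where
  "log_L = (SOME g. g holomorphic_on {s. Re s > 0} \<and> (\<forall>s. Re s > 0 \<longrightarrow> exp (g s) = W s) \<and>
   (\<forall>s. Re s > 1 / 2 \<longrightarrow> g s = log_series (1 / 2 + s)))"

lemma log_L: "log_L holomorphic_on {s. Re s > 0}" "Re s > 0 \<Longrightarrow> exp (log_L s) = W s"
    "Re s > 1 / 2 \<Longrightarrow> log_L s = log_series (1 / 2 + s)"
  using someI_ex[OF log_W] unfolding log_L_def[symmetric] by auto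

text \<open>A bound for the logarithm of \<open>L\<close> on the abscissa 3/2: 5 is the constant of
  \<open>small_order\<close>, and each prime has CARD('n) parameters.\<close>

definition G0 :: real where "G0 = (\<Sum>n. 5 * real CARD('n) * real n powr (- (3 / 2)))"

lemma log_L_centre: "norm (log_L (Complex 1 T)) \<le> G0"
proof -
  have "norm (log_series (1 / 2 + Complex 1 T)) \<le> (\<Sum>n. 5 * real CARD('n) * real n powr (- (3 / 2 * real 1)))"
    unfolding log_series_def
    by (rule prime_series_summable(2)[OF \<alpha> small_order_log(1)]) auto
  then show ?thesis unfolding G0_def using log_L(3)[of "Complex 1 T"] by simp
qed

text \<open>The quantity \<open>X\<close> of the local estimate, with each of its terms replaced by
  its coefficient in a bound by (1 + |T|) powr (1/4).\<close>

definition D1 :: real where "D1 = G0 + 26 * (ln C + real A * (4 + ln (14 + C)) + G0 + 1)"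

lemma G0_nonneg: "G0 \<ge> 0" using order_trans[OF norm_ge_zero log_L_centre] .

lemma D1_nonneg: "D1 \<ge> 0"
  unfolding D1_def using G0_nonneg C1 by (intro add_nonneg_nonneg mult_nonneg_nonneg) auto

text \<open>On the circle \<open>W\<close> grows polynomially in the height, and at the centre its
  logarithm bounds it from below, so ln (B / b) is logarithmic in T. The power 1/4 is a convenient
  majorant: its square is the growth that \<open>weighted_unit_intervals\<close> admits.\<close>

lemma log_L_bounds:
  assumes s: "0 < s" "s \<le> 1"
  shows "norm (log_L (Complex s T)) \<le> (D1 * (1 + \<bar>T\<bar>) powr (1 / 4)) * (5 + \<bar>ln s\<bar>)"
    and "(\<integral>\<^sup>+u. ennreal (indicator {T-1..T+1} u * (norm (log_L (Complex s u)))\<^sup>2) \<partial>lborel)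
       \<le> ennreal (300 * (D1 * (1 + \<bar>T\<bar>) powr (1 / 4))\<^sup>2)"
proof -
  define B where "B = C * (\<bar>T\<bar> + 14 + C) ^ A"
  define b where "b = exp (- G0)"
  define X where "X = G0 + 26 * (ln (B / b) + 1)"
  have Bb: "norm (W z) \<le> B" if z: "norm (z - Complex 1 T) = 12" for z
  proof -
    have re: "\<bar>Re z - 1\<bar> \<le> 12" using abs_Re_le_cmod[of "z - Complex 1 T"] z by simp
    have "norm (1 / 2 + z) \<le> norm (1 / 2 :: complex) + (norm (Complex 1 T) + norm (z - Complex 1 T))"
      using norm_triangle_ineq[of "1 / 2" z] norm_triangle_ineq[of "Complex 1 T" "z - Complex 1 T"] by simp
    also have "norm (Complex 1 T) \<le> 1 + \<bar>T\<bar>" using cmod_le[of "Complex 1 T"] by simp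
    finally have n: "norm (1 / 2 + z) \<le> \<bar>T\<bar> + 14" using z by (simp add: norm_divide)
    have "norm (W z) \<le> C * (norm (1 / 2 + z) + C) ^ A"
      unfolding W_def using re by (intro growth) (auto simp: abs_le_iff)
    also have "\<dots> \<le> B" unfolding B_def using n C1 by (intro mult_left_mono power_mono) auto
    finally show ?thesis .
  qed
  have bc: "norm (W (Complex 1 T)) \<ge> b"
  proof -
    have "norm (W (Complex 1 T)) = exp (Re (log_L (Complex 1 T)))"
      using log_L(2)[of "Complex 1 T"] by (metis norm_exp_eq_Re zero_less_one complex.sel(1))
    moreover have "- G0 \<le> Re (log_L (Complex 1 T))"
      using abs_Re_le_cmod[of "log_L (Complex 1 T)"] log_L_centre[of T] by linarith
    ultimately show ?thesis unfolding b_def by simp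
  qed
  have b0: "b > 0" by (simp add: b_def)
  define y where "y = (1 + \<bar>T\<bar>) powr (1 / 4)"
  have y1: "y \<ge> 1" unfolding y_def by (rule ge_one_powr_ge_zero) auto
  have "ln (B / b) = ln C + real A * ln (\<bar>T\<bar> + 14 + C) + G0"
    unfolding B_def b_def using C1 by (simp add: ln_div ln_mult ln_realpow)
  moreover have "ln (\<bar>T\<bar> + 14 + C) \<le> (4 + ln (14 + C)) * y"
  proof -
    have "ln (\<bar>T\<bar> + 14 + C) \<le> ln ((1 + \<bar>T\<bar>) * (14 + C))"
      using C1 by (subst ln_le_cancel_iff) (auto simp: algebra_simps intro!: mult_nonneg_nonneg add_pos_nonneg)
    also have "\<dots> = ln (1 + \<bar>T\<bar>) + ln (14 + C)" using C1 by (intro ln_mult_pos) auto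
    also have "\<dots> \<le> 4 * y + ln (14 + C) * y"
    proof (rule add_mono)
      show "ln (1 + \<bar>T\<bar>) \<le> 4 * y" unfolding y_def by (rule ln_le_root) simp
      show "ln (14 + C) \<le> ln (14 + C) * y" using y1 C1 mult_left_mono[of 1 y "ln (14 + C)"] by simp
    qed
    finally show ?thesis by (simp add: algebra_simps)
  qed
  then have "real A * ln (\<bar>T\<bar> + 14 + C) \<le> real A * ((4 + ln (14 + C)) * y)" by (rule mult_left_mono) simp
  ultimately have "X \<le> G0 + 26 * (ln C + real A * ((4 + ln (14 + C)) * y) + G0 + 1)"
    unfolding X_def by simp
  also have "\<dots> \<le> G0 * y + 26 * (ln C * y + real A * ((4 + ln (14 + C)) * y) + G0 * y + 1 * y)"
  proof -
    have "G0 * 1 \<le> G0 * y" "ln C * 1 \<le> ln C * y" "1 * 1 \<le> 1 * y"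
      using y1 G0_nonneg C1 by (intro mult_left_mono; simp)+
    then show ?thesis by (intro add_mono mult_left_mono order_refl) simp_all
  qed
  also have "\<dots> = D1 * y" unfolding D1_def by (simp add: algebra_simps)
  finally have XD: "X \<le> D1 * y" .
  note loc = local_log_L2[where W = W and g = log_L and T = T and B = B and b = b and G = G0, OF W_holomorphic W_nonzero log_L(1) log_L(2) Bb bc b0 log_L_centre]
  have X1: "norm (log_L (Complex s T)) \<le> X * (5 + \<bar>ln s\<bar>)" unfolding X_def by (rule loc(1)[OF _ _ _ s]) auto
  have X2: "(\<integral>\<^sup>+u. ennreal (indicator {T-1..T+1} u * (norm (log_L (Complex s u)))\<^sup>2) \<partial>lborel) \<le> ennreal (300 * X\<^sup>2)"
    unfolding X_def by (rule loc(2)[OF _ _ _ s]) auto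
  have "0 \<le> X * (5 + \<bar>ln s\<bar>)" using order_trans[OF norm_ge_zero X1] .
  moreover have "5 + \<bar>ln s\<bar> > 0" by linarith
  ultimately have X0: "X \<ge> 0" by (metis zero_le_mult_iff not_less)
  show "norm (log_L (Complex s T)) \<le> (D1 * (1 + \<bar>T\<bar>) powr (1 / 4)) * (5 + \<bar>ln s\<bar>)"
    using X1 mult_right_mono[OF XD, of "5 + \<bar>ln s\<bar>"] unfolding y_def by simp
  have "300 * X\<^sup>2 \<le> 300 * (D1 * y)\<^sup>2" using XD X0 by (intro mult_left_mono power_mono) auto
  from order_trans[OF X2 ennreal_leI[OF this]]
  show "(\<integral>\<^sup>+u. ennreal (indicator {T-1..T+1} u * (norm (log_L (Complex s u)))\<^sup>2) \<partial>lborel)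
       \<le> ennreal (300 * (D1 * (1 + \<bar>T\<bar>) powr (1 / 4))\<^sup>2)" unfolding y_def .
qed

end

section \<open>The comparison function log (1 - exp (- s))\<close>

definition log_one_minus_exp :: "complex \<Rightarrow> complex" where "log_one_minus_exp s = Ln (1 - exp (- s))"

lemma log_one_minus_exp: "log_one_minus_exp holomorphic_on {s. Re s > 0}" "Re s > 0 \<Longrightarrow> exp (log_one_minus_exp s) = 1 - exp (- s)"
proof -
  have n: "norm (exp (- s)) < 1" if "Re s > 0" for s using that by simp
  show "log_one_minus_exp holomorphic_on {s. Re s > 0}" unfolding log_one_minus_exp_def[abs_def]
    using one_minus_not_nonpos[OF n] by (intro holomorphic_intros) auto
  assume s: "Re s > 0"
  have "1 - exp (- s) \<noteq> 0"
  proof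
    assume "1 - exp (- s) = 0"
    then have "norm (exp (- s)) = norm (1 :: complex)" by (metis right_minus_eq)
    then show False using n[OF s] by (simp only: norm_one)
  qed
  then show "exp (log_one_minus_exp s) = 1 - exp (- s)" unfolding log_one_minus_exp_def by simp
qed

text \<open>The local estimate for log L applies to 1 - exp (- s) too: its zeros 2 pi i k lie on the
  imaginary axis, and the bounds on the circle and at the centre do not depend on the
  height.\<close>

lemma log_one_minus_exp_bounds: "\<exists>X\<ge>0. \<forall>s T. 0 < s \<and> s \<le> 1 \<longrightarrow> norm (log_one_minus_exp (Complex s T)) \<le> X * (5 + \<bar>ln s\<bar>) \<and>
   (\<integral>\<^sup>+u. ennreal (indicator {T-1..T+1} u * (norm (log_one_minus_exp (Complex s u)))\<^sup>2) \<partial>lborel) \<le> ennreal (300 * X\<^sup>2)"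
proof -
  define w :: "complex \<Rightarrow> complex" where "w = (\<lambda>s. 1 - exp (- s))"
  \<comment> \<open>The circle of radius 12 around abscissa 1 reaches Re z = - 11.\<close>
  define B where "B = 1 + exp (11 :: real)"
  define b where "b = 1 - exp (- 1 :: real)"
  define X where "X = 5 + 26 * (ln (B / b) + 1)"
  have e1: "exp (- 1) \<le> (4 / 5 :: real)"
    using exp_lower_Taylor_quadratic[of "1::real"] by (simp add: exp_minus field_simps)
  have b0: "b > 0" unfolding b_def by simp
  have wh: "w holomorphic_on UNIV" unfolding w_def by (intro holomorphic_intros)
  have wnz: "w z \<noteq> 0" if "Re z > 0" for z
  proof
    assume "w z = 0"
    then have "norm (exp (- z)) = 1" by (simp add: w_def)
    then show False using that by simp
  qed
  have wB: "norm (w z) \<le> B" if z: "norm (z - Complex 1 T) = 12" for z T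
  proof -
    have "\<bar>Re z - 1\<bar> \<le> 12" using abs_Re_le_cmod[of "z - Complex 1 T"] z by simp
    then have "exp (- Re z) \<le> exp 11" by simp
    moreover have "norm (w z) \<le> 1 + exp (- Re z)"
      unfolding w_def using norm_triangle_ineq4[of 1 "exp (- z)"] by simp
    ultimately show ?thesis unfolding B_def by linarith
  qed
  have wb: "norm (w (Complex 1 T)) \<ge> b" for T
    unfolding w_def b_def using norm_triangle_ineq2[of 1 "exp (- Complex 1 T)"] by simp
  have gG: "norm (log_one_minus_exp (Complex 1 T)) \<le> 5" for T
  proof -
    have n: "norm (exp (- Complex 1 T)) \<le> 4 / 5" using e1 by simp
    then have "norm (- Ln (1 - exp (- Complex 1 T))) \<le> 5 * norm (exp (- Complex 1 T)) ^ 1"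
      using small_order_log(1) unfolding small_order_def by blast
    then show ?thesis unfolding log_one_minus_exp_def using n by simp
  qed
  have eg: "exp (log_one_minus_exp z) = w z" if "Re z > 0" for z unfolding w_def by (rule log_one_minus_exp(2)[OF that])
  have loc: "norm (log_one_minus_exp (Complex s T)) \<le> X * (5 + \<bar>ln s\<bar>)"
    "(\<integral>\<^sup>+u. ennreal (indicator {T-1..T+1} u * (norm (log_one_minus_exp (Complex s u)))\<^sup>2) \<partial>lborel) \<le> ennreal (300 * X\<^sup>2)"
    if "0 < s" "s \<le> 1" for s T
    unfolding X_def
    by (rule local_log_L2[where W = w and g = log_one_minus_exp and T = T and B = B and b = b and G = 5]; (rule that wh log_one_minus_exp(1) b0)?; use wnz eg wB wb gG in blast)+
  have "0 \<le> X * (5 + \<bar>ln 1\<bar>)" using order_trans[OF norm_ge_zero loc(1)[of 1 0]] by simp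
  then have "X \<ge> 0" by simp
  then show ?thesis using loc by blast
qed

context central_L
begin

lemma log_tail: "log_tail holomorphic_on {s. Re s > 2 / 5}" "\<exists>B\<ge>0. \<forall>s. Re s \<ge> 1 / 2 \<longrightarrow> norm (log_tail s) \<le> B"
proof -
  show "log_tail holomorphic_on {s. Re s > 2 / 5}" unfolding log_tail_def
    by (rule prime_series_holomorphic[OF \<alpha> small_order_log(3)]) auto
  have "norm (log_tail s) \<le> (\<Sum>n. 5 * real CARD('n) * real n powr (- (1 / 2 * real 3)))" if "Re s \<ge> 1 / 2" for s
    unfolding log_tail_def by (rule prime_series_summable(2)[OF \<alpha> small_order_log(3) that]) auto
  moreover from order_trans[OF norm_ge_zero this[of 1]] have "(\<Sum>n. 5 * real CARD('n) * real n powr (- (1 / 2 * real 3))) \<ge> 0" by simp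
  ultimately show "\<exists>B\<ge>0. \<forall>s. Re s \<ge> 1 / 2 \<longrightarrow> norm (log_tail s) \<le> B" by blast
qed

text \<open>In the region of absolute convergence this is \<open>s\<close> times the Laplace
  transform of the error term. The tail of third order, bounded for Re s > 0, is taken off log L;
  the constant \<open>c\<close> is free until it is chosen to make the value at 0 vanish.\<close>

definition numer :: "complex \<Rightarrow> complex \<Rightarrow> complex" where
  "numer c s = log_L s - log_tail (1 / 2 + s) - of_nat m * log_one_minus_exp s - c"

lemma numer_holomorphic: "numer c holomorphic_on {s. Re s > 0}"
proof -
  have "(log_tail \<circ> (\<lambda>s. 1 / 2 + s)) holomorphic_on {s. Re s > 0}"
    by (rule holomorphic_on_compose_gen[OF _ log_tail(1)]) (auto intro!: holomorphic_intros)
  then have "(\<lambda>s. log_tail (1 / 2 + s)) holomorphic_on {s. Re s > 0}" by (simp add: o_def)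
  then show ?thesis unfolding numer_def[abs_def] by (intro holomorphic_intros log_L(1) log_one_minus_exp(1))
qed

text \<open>The zero of \<open>L\<close> of order \<open>m\<close> is compensated by the power of \<open>1 - exp (- s)\<close>.\<close>

lemma numer_near_zero:
  "\<exists>c r M. 0 < r \<and> r \<le> 1 \<and> M \<ge> 0 \<and> (\<forall>s. Re s > 0 \<and> norm s < r \<longrightarrow> norm (numer c s) \<le> M * norm s)"
proof -
  obtain r1 q where r1: "r1 > 0" and q: "q holomorphic_on ball (1 / 2) r1"
    "\<And>s. s \<in> ball (1 / 2) r1 \<Longrightarrow> L s = q s * (s - 1 / 2) ^ m" "\<And>s. s \<in> ball (1 / 2) r1 \<Longrightarrow> q s \<noteq> 0"
    using zero by blast
  have eh: "(\<lambda>s::complex. 1 - exp (- s)) holomorphic_on UNIV" by (intro holomorphic_intros)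
  \<comment> \<open>\<open>e\<close> is (1 - exp (- s)) / s, extended to 0 by the derivative 1. It
    has no zero in the unit disc, since the other zeros of 1 - exp (- s) are 2 pi i n.\<close>
  obtain e where e: "e holomorphic_on UNIV" "\<And>s. 1 - exp (- s) = (s - 0) * e s"
    by (rule holomorphic_factor_zero[OF eh, of 0]) (simp, blast)
  have enz: "e s \<noteq> 0" if "norm s < 1" for s
  proof (cases "s = 0")
    case True
    have "((\<lambda>s::complex. 1 - exp (- s)) has_field_derivative 1) (at 0)"
      by (auto intro!: derivative_eq_intros)
    moreover have "((\<lambda>s. s * e s) has_field_derivative (1 * e 0 + deriv e 0 * 0)) (at 0)"
      by (rule DERIV_mult[OF DERIV_ident]) (rule holomorphic_derivI[OF e(1)], auto)
    ultimately have "1 = 1 * e 0 + deriv e 0 * 0"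
      using e(2) by (intro DERIV_unique[of "\<lambda>s. 1 - exp (- s)"]) simp_all
    then show ?thesis using True by auto
  next
    case False
    have "exp (- s) \<noteq> 1"
    proof
      assume "exp (- s) = 1"
      then obtain n :: int where n: "- s = of_int (2 * n) * of_real pi * \<i>"
        unfolding exp_eq_1 by (auto simp: complex_eq_iff)
      then have "n \<noteq> 0" using False by auto
      have "norm s = norm (of_int (2 * n) * of_real pi * \<i>)" using n by (metis norm_minus_cancel)
      also have "\<dots> = 2 * \<bar>real_of_int n\<bar> * pi" by (simp add: norm_mult)
      also have "\<dots> \<ge> 2 * 1 * 1" using \<open>n \<noteq> 0\<close> pi_ge_two by (intro mult_mono) auto
      finally show False using that by simp
    qed
    then show ?thesis using e(2)[of s] by auto
  qed
  \<comment> \<open>1/20 is below 1/10, so 1/2 + s stays in the domain Re > 2/5 of the tail.\<close>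
  define r where "r = min r1 (1 / 20)"
  have r: "r > 0" "r \<le> r1" "r \<le> 1 / 20" unfolding r_def using r1 by auto
  have memb: "1 / 2 + s \<in> ball (1 / 2) r1" if "norm s < r" for s :: complex
    using that r by (simp add: dist_norm)
  define Q where "Q = (\<lambda>s. q (1 / 2 + s) / e s ^ m)"
  have Qh: "Q holomorphic_on ball 0 r"
  proof -
    have "(q \<circ> (\<lambda>s. 1 / 2 + s)) holomorphic_on ball 0 r"
    proof (rule holomorphic_on_compose_gen[OF _ q(1)])
      show "(\<lambda>s. 1 / 2 + s) ` ball 0 r \<subseteq> ball (1 / 2 :: complex) r1" using memb by (intro image_subsetI) simp
    qed (intro holomorphic_intros)
    then have "(\<lambda>s. q (1 / 2 + s)) holomorphic_on ball 0 r" by (simp add: o_def)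
    then show ?thesis unfolding Q_def using enz r
      by (intro holomorphic_intros holomorphic_on_subset[OF e(1)]) auto
  qed
  have Qnz: "Q s \<noteq> 0" if "s \<in> ball 0 r" for s
    using that q(3)[OF memb, of s] enz[of s] r by (simp add: Q_def)
  obtain k where k: "k holomorphic_on ball 0 r" "\<And>s. s \<in> ball 0 r \<Longrightarrow> exp (k s) = Q s"
    by (rule holomorphic_logarithm_exists[of "ball 0 r" Q 0]) (use Qh Qnz r in auto)
  define U where "U = ball 0 r \<inter> {s::complex. Re s > 0}"
  have U: "convex U" "open U" unfolding U_def
    by (auto intro!: convex_Int open_Int convex_halfspace_Re_gt open_halfspace_Re_gt)
  define D where "D = (\<lambda>s. log_L s - of_nat m * log_one_minus_exp s - k s)"
  have Dh: "D holomorphic_on U" unfolding D_def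
    by (intro holomorphic_intros holomorphic_on_subset[OF log_L(1)] holomorphic_on_subset[OF log_one_minus_exp(1)] holomorphic_on_subset[OF k(1)])
       (auto simp: U_def)
  have De: "exp (D s) = 1" if s: "s \<in> U" for s
  proof -
    have s': "Re s > 0" "s \<in> ball 0 r" "norm s < r" using s by (auto simp: U_def)
    have s0: "s \<noteq> 0" using s'(1) by auto
    have e0: "e s \<noteq> 0" using enz s' r by simp
    have "exp (D s) = W s / (1 - exp (- s)) ^ m / Q s"
      unfolding D_def exp_diff exp_of_nat_mult log_L(2)[OF s'(1)] log_one_minus_exp(2)[OF s'(1)] k(2)[OF s'(2)] ..
    also have "W s = q (1 / 2 + s) * s ^ m" unfolding W_def q(2)[OF memb[OF s'(3)]] by simp
    also have "(1 - exp (- s)) ^ m = s ^ m * e s ^ m" unfolding e(2) by (simp add: power_mult_distrib)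
    finally show ?thesis using s0 e0 q(3)[OF memb[OF s'(3)]] by (simp add: Q_def)
  qed
  define u where "u = complex_of_real (r / 2)"
  have u: "u \<in> U" unfolding U_def u_def using r by simp
  have Dc: "D s = D u" if "s \<in> U" for s by (rule exp_const_imp_const[OF U Dh De that u])
  define H where "H = (\<lambda>s. k s + D u - log_tail (1 / 2 + s))"
  have Hh: "H holomorphic_on ball 0 r"
  proof -
    have "(log_tail \<circ> (\<lambda>s. 1 / 2 + s)) holomorphic_on ball 0 r"
    proof (rule holomorphic_on_compose_gen[OF _ log_tail(1)])
      show "(\<lambda>s. 1 / 2 + s) ` ball 0 r \<subseteq> {s. 2 / 5 < Re s}"
      proof safe
        fix s :: complex assume "s \<in> ball 0 r"
        then show "2 / 5 < Re (1 / 2 + s)" using abs_Re_le_cmod[of s] r by simp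
      qed
    qed (intro holomorphic_intros)
    then have "(\<lambda>s. log_tail (1 / 2 + s)) holomorphic_on ball 0 r" by (simp add: o_def)
    then show ?thesis unfolding H_def by (intro holomorphic_intros k(1))
  qed
  \<comment> \<open>\<open>H\<close> is holomorphic across 0 and equals the numerator up to
    \<open>c\<close>; with this choice the numerator tends to 0 at least to first order.\<close>
  define c where "c = H 0"
  have nH: "numer c s = H s - H 0" if "s \<in> U" for s
  proof -
    have "log_L s - of_nat m * log_one_minus_exp s - k s = D u" using Dc[OF that] by (simp only: D_def)
    then have "D u = log_L s - of_nat m * log_one_minus_exp s - k s" ..
    then show ?thesis unfolding numer_def H_def c_def by simp
  qed
  have "(H has_field_derivative deriv H 0) (at 0)" by (rule holomorphic_derivI[OF Hh]) (use r in auto)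
  then have "((\<lambda>s. (H s - H 0) / (s - 0)) \<longlongrightarrow> deriv H 0) (at 0)" by (simp add: has_field_derivative_iff)
  then have "((\<lambda>s. norm ((H s - H 0) / (s - 0))) \<longlongrightarrow> norm (deriv H 0)) (at 0)" by (rule tendsto_norm)
  then have "\<forall>\<^sub>F s in at 0. norm ((H s - H 0) / (s - 0)) < norm (deriv H 0) + 1"
    by (rule order_tendstoD) simp
  then obtain d where d: "d > 0" "\<And>s. s \<noteq> 0 \<Longrightarrow> norm s < d \<Longrightarrow> norm ((H s - H 0) / s) < norm (deriv H 0) + 1"
    unfolding eventually_at by (auto simp: dist_norm)
  show ?thesis
  proof (intro exI conjI allI impI)
    show "0 < min d r" "min d r \<le> 1" using d r by auto
    show "0 \<le> norm (deriv H 0) + 1" by simp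
    fix s assume s: "0 < Re s \<and> norm s < min d r"
    then have s0: "s \<noteq> 0" by auto
    have "norm ((H s - H 0) / s) \<le> norm (deriv H 0) + 1" using d(2)[OF s0] s by simp
    moreover have "numer c s = H s - H 0" using s by (intro nH) (simp add: U_def)
    ultimately show "norm (numer c s) \<le> (norm (deriv H 0) + 1) * norm s"
      using s0 by (simp add: norm_divide divide_le_eq)
  qed
qed

text \<open>The local estimates are added term by term. The pointwise bound makes the quotient by
  \<open>s\<close> bounded on Re s >= a > 0; the mean square over unit intervals, where three terms
  cost a factor 3, is what Plancherel needs.\<close>

lemma numer_bounds:
  "\<exists>D\<ge>0. (\<forall>s T. 0 < s \<and> s \<le> 1 \<longrightarrow> norm (numer c (Complex s T)) \<le> D * (1 + \<bar>T\<bar>) * (5 + \<bar>ln s\<bar>) \<and>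
     (\<integral>\<^sup>+u. ennreal (indicator {T-1..T+1} u * (norm (numer c (Complex s u)))\<^sup>2) \<partial>lborel) \<le> ennreal (D * (1 + \<bar>T\<bar>) powr (1 / 2)))"
proof -
  obtain X where X: "X \<ge> 0" "\<And>s T. 0 < s \<Longrightarrow> s \<le> 1 \<Longrightarrow> norm (log_one_minus_exp (Complex s T)) \<le> X * (5 + \<bar>ln s\<bar>)"
   "\<And>s T. 0 < s \<Longrightarrow> s \<le> 1 \<Longrightarrow> (\<integral>\<^sup>+u. ennreal (indicator {T-1..T+1} u * (norm (log_one_minus_exp (Complex s u)))\<^sup>2) \<partial>lborel) \<le> ennreal (300 * X\<^sup>2)"
    using log_one_minus_exp_bounds by blast
  obtain B where B: "B \<ge> 0" "\<And>s. Re s \<ge> 1 / 2 \<Longrightarrow> norm (log_tail s) \<le> B" using log_tail(2) by blast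
  define M where "M = real m"
  define b where "b = B + norm c"
  have b0: "b \<ge> 0" unfolding b_def using B by simp
  define Da where "Da = D1 + M * X + b"
  define Db where "Db = 3 * (300 * D1\<^sup>2 + M\<^sup>2 * (300 * X\<^sup>2) + 2 * b\<^sup>2)"
  have tri: "norm (numer c (Complex s u)) \<le> norm (log_L (Complex s u)) + M * norm (log_one_minus_exp (Complex s u)) + b"
    if "s > 0" for s u
  proof -
    have "norm (numer c (Complex s u)) \<le> norm (log_L (Complex s u)) + norm (log_tail (1 / 2 + Complex s u)) + norm (of_nat m * log_one_minus_exp (Complex s u)) + norm c"
      unfolding numer_def by (meson add_mono norm_triangle_ineq4 order_refl order_trans)
    moreover have "norm (log_tail (1 / 2 + Complex s u)) \<le> B" using that by (intro B(2)) simp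
    ultimately show ?thesis by (simp add: norm_mult M_def b_def)
  qed
  have 1: "norm (numer c (Complex s T)) \<le> Da * (1 + \<bar>T\<bar>) * (5 + \<bar>ln s\<bar>)" if s: "0 < s" "s \<le> 1" for s T
  proof -
    have p: "(1 + \<bar>T\<bar>) powr (1 / 4) \<le> 1 + \<bar>T\<bar>" using powr_mono[of "1 / 4" 1 "1 + \<bar>T\<bar>"] by simp
    have l: "1 \<le> 5 + \<bar>ln s\<bar>" by simp
    have w: "1 * 1 \<le> (1 + \<bar>T\<bar>) * (5 + \<bar>ln s\<bar>)" by (intro mult_mono) auto
    have "norm (log_L (Complex s T)) \<le> (D1 * (1 + \<bar>T\<bar>) powr (1 / 4)) * (5 + \<bar>ln s\<bar>)" by (rule log_L_bounds(1)[OF s])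
    also have "\<dots> \<le> (D1 * (1 + \<bar>T\<bar>)) * (5 + \<bar>ln s\<bar>)"
      using p D1_nonneg by (intro mult_right_mono mult_left_mono) auto
    finally have a: "norm (log_L (Complex s T)) \<le> D1 * ((1 + \<bar>T\<bar>) * (5 + \<bar>ln s\<bar>))" by (simp only: mult.assoc)
    have "M * norm (log_one_minus_exp (Complex s T)) \<le> M * (X * (5 + \<bar>ln s\<bar>))" using X(2)[OF s] by (intro mult_left_mono) (auto simp: M_def)
    also have "\<dots> \<le> M * (X * ((1 + \<bar>T\<bar>) * (5 + \<bar>ln s\<bar>)))"
      using X(1) mult_right_mono[of 1 "1 + \<bar>T\<bar>" "5 + \<bar>ln s\<bar>"] by (intro mult_left_mono) (auto simp: M_def)
    finally have g: "M * norm (log_one_minus_exp (Complex s T)) \<le> (M * X) * ((1 + \<bar>T\<bar>) * (5 + \<bar>ln s\<bar>))" by (simp only: mult.assoc)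
    have bb: "b \<le> b * ((1 + \<bar>T\<bar>) * (5 + \<bar>ln s\<bar>))" using w b0 mult_left_mono[of 1 "(1 + \<bar>T\<bar>) * (5 + \<bar>ln s\<bar>)" b] by simp
    have "norm (numer c (Complex s T)) \<le> D1 * ((1 + \<bar>T\<bar>) * (5 + \<bar>ln s\<bar>)) + (M * X) * ((1 + \<bar>T\<bar>) * (5 + \<bar>ln s\<bar>)) + b * ((1 + \<bar>T\<bar>) * (5 + \<bar>ln s\<bar>))"
      using tri[OF s(1), of T] a g bb by linarith
    also have "\<dots> = Da * (1 + \<bar>T\<bar>) * (5 + \<bar>ln s\<bar>)" unfolding Da_def by (simp only: distrib_right mult.assoc)
    finally show ?thesis .
  qed
  have 2: "(\<integral>\<^sup>+u. ennreal (indicator {T-1..T+1} u * (norm (numer c (Complex s u)))\<^sup>2) \<partial>lborel) \<le> ennreal (Db * (1 + \<bar>T\<bar>) powr (1 / 2))"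
    if s: "0 < s" "s \<le> 1" for s T
  proof -
    have [measurable]: "(\<lambda>u. log_L (Complex s u)) \<in> borel_measurable borel" "(\<lambda>u. log_one_minus_exp (Complex s u)) \<in> borel_measurable borel"
      using continuous_on_vertical[OF log_L(1) s(1)] continuous_on_vertical[OF log_one_minus_exp(1) s(1)]
      by (auto intro: borel_measurable_continuous_onI)
    define I where "I = (\<lambda>u. indicator {T-1..T+1} u :: real)"
    have [measurable]: "I \<in> borel_measurable borel" unfolding I_def by measurable
    have pt: "I u * (norm (numer c (Complex s u)))\<^sup>2 \<le> 3 * (I u * (norm (log_L (Complex s u)))\<^sup>2) + 3 * M\<^sup>2 * (I u * (norm (log_one_minus_exp (Complex s u)))\<^sup>2) + 3 * b\<^sup>2 * I u" for u
    proof -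
      have sq: "(x + y + z)\<^sup>2 \<le> 3 * x\<^sup>2 + 3 * y\<^sup>2 + 3 * z\<^sup>2" for x y z :: real
      proof -
        have "3 * x\<^sup>2 + 3 * y\<^sup>2 + 3 * z\<^sup>2 - (x + y + z)\<^sup>2 = (x - y)\<^sup>2 + (x - z)\<^sup>2 + (y - z)\<^sup>2"
          by (simp add: power2_eq_square algebra_simps)
        then show ?thesis by (smt (verit) zero_le_power2)
      qed
      have "(norm (numer c (Complex s u)))\<^sup>2 \<le> (norm (log_L (Complex s u)) + M * norm (log_one_minus_exp (Complex s u)) + b)\<^sup>2"
        using tri[OF s(1), of u] by (intro power_mono) auto
      also have "\<dots> \<le> 3 * (norm (log_L (Complex s u)))\<^sup>2 + 3 * (M * norm (log_one_minus_exp (Complex s u)))\<^sup>2 + 3 * b\<^sup>2" by (rule sq)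
      finally have "I u * (norm (numer c (Complex s u)))\<^sup>2 \<le> I u * (3 * (norm (log_L (Complex s u)))\<^sup>2 + 3 * (M * norm (log_one_minus_exp (Complex s u)))\<^sup>2 + 3 * b\<^sup>2)"
        by (rule mult_left_mono) (simp add: I_def)
      then show ?thesis by (simp add: algebra_simps power_mult_distrib)
    qed
    have "(\<integral>\<^sup>+u. ennreal (I u * (norm (numer c (Complex s u)))\<^sup>2) \<partial>lborel)
      \<le> (\<integral>\<^sup>+u. ennreal 3 * ennreal (I u * (norm (log_L (Complex s u)))\<^sup>2) + ennreal (3 * M\<^sup>2) * ennreal (I u * (norm (log_one_minus_exp (Complex s u)))\<^sup>2) + ennreal (3 * b\<^sup>2) * indicator {T-1..T+1} u \<partial>lborel)"
    proof (rule nn_integral_mono)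
      fix u
      have "ennreal 3 * ennreal (I u * (norm (log_L (Complex s u)))\<^sup>2) + ennreal (3 * M\<^sup>2) * ennreal (I u * (norm (log_one_minus_exp (Complex s u)))\<^sup>2) + ennreal (3 * b\<^sup>2) * indicator {T-1..T+1} u
        = ennreal (3 * (I u * (norm (log_L (Complex s u)))\<^sup>2) + 3 * M\<^sup>2 * (I u * (norm (log_one_minus_exp (Complex s u)))\<^sup>2) + 3 * b\<^sup>2 * I u)"
      proof -
        have n: "0 \<le> I u" "ennreal (I u) = indicator {T-1..T+1} u" by (auto simp: I_def indicator_def)
        have "ennreal (3 * (I u * (norm (log_L (Complex s u)))\<^sup>2) + 3 * M\<^sup>2 * (I u * (norm (log_one_minus_exp (Complex s u)))\<^sup>2) + 3 * b\<^sup>2 * I u)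
          = ennreal (3 * (I u * (norm (log_L (Complex s u)))\<^sup>2)) + ennreal (3 * M\<^sup>2 * (I u * (norm (log_one_minus_exp (Complex s u)))\<^sup>2)) + ennreal (3 * b\<^sup>2 * I u)"
          using n(1) by (subst ennreal_plus, simp, simp, subst ennreal_plus) auto
        then show ?thesis using n by (simp only: ennreal_mult' ennreal_mult'' mult_nonneg_nonneg zero_le_power2 zero_le_numeral)
      qed
      then show "ennreal (I u * (norm (numer c (Complex s u)))\<^sup>2) \<le> ennreal 3 * ennreal (I u * (norm (log_L (Complex s u)))\<^sup>2) + ennreal (3 * M\<^sup>2) * ennreal (I u * (norm (log_one_minus_exp (Complex s u)))\<^sup>2) + ennreal (3 * b\<^sup>2) * indicator {T-1..T+1} u"
        using ennreal_leI[OF pt[of u]] by (simp only:)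
    qed
    also have "\<dots> = ennreal 3 * (\<integral>\<^sup>+u. ennreal (I u * (norm (log_L (Complex s u)))\<^sup>2) \<partial>lborel)
        + ennreal (3 * M\<^sup>2) * (\<integral>\<^sup>+u. ennreal (I u * (norm (log_one_minus_exp (Complex s u)))\<^sup>2) \<partial>lborel) + ennreal (3 * b\<^sup>2) * ennreal 2"
      by (simp add: nn_integral_add nn_integral_cmult)
    also have "\<dots> \<le> ennreal 3 * ennreal (300 * (D1 * (1 + \<bar>T\<bar>) powr (1 / 4))\<^sup>2) + ennreal (3 * M\<^sup>2) * ennreal (300 * X\<^sup>2) + ennreal (3 * b\<^sup>2) * ennreal 2"
      unfolding I_def using log_L_bounds(2)[OF s] X(3)[OF s] by (intro add_mono mult_left_mono) auto
    also have "\<dots> = ennreal (3 * (300 * (D1 * (1 + \<bar>T\<bar>) powr (1 / 4))\<^sup>2) + 3 * M\<^sup>2 * (300 * X\<^sup>2) + 3 * b\<^sup>2 * 2)"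
    proof -
      have "ennreal (p1 * q1 + p2 * q2 + p3 * q3) = ennreal p1 * ennreal q1 + ennreal p2 * ennreal q2 + ennreal p3 * ennreal q3"
        if "p1 \<ge> 0" "q1 \<ge> 0" "p2 \<ge> 0" "q2 \<ge> 0" "p3 \<ge> 0" "q3 \<ge> 0" for p1 q1 p2 q2 p3 q3
        using that by (simp add: ennreal_mult)
      from this[of 3 "300 * (D1 * (1 + \<bar>T\<bar>) powr (1 / 4))\<^sup>2" "3 * M\<^sup>2" "300 * X\<^sup>2" "3 * b\<^sup>2" 2] show ?thesis by simp
    qed
    also have "\<dots> \<le> ennreal (Db * (1 + \<bar>T\<bar>) powr (1 / 2))"
    proof (rule ennreal_leI)
      define y where "y = (1 + \<bar>T\<bar>) powr (1 / 2)"
      have y1: "1 \<le> y" unfolding y_def by (rule ge_one_powr_ge_zero) auto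
      have p2: "((1 + \<bar>T\<bar>) powr (1 / 4))\<^sup>2 = y" unfolding y_def by (simp add: power2_eq_square flip: powr_add)
      have "3 * (300 * (D1 * (1 + \<bar>T\<bar>) powr (1 / 4))\<^sup>2) + 3 * M\<^sup>2 * (300 * X\<^sup>2) + 3 * b\<^sup>2 * 2
        = (900 * D1\<^sup>2) * y + (900 * M\<^sup>2 * X\<^sup>2 + 6 * b\<^sup>2) * 1"
        unfolding power_mult_distrib p2 by (simp add: algebra_simps)
      also have "\<dots> \<le> (900 * D1\<^sup>2) * y + (900 * M\<^sup>2 * X\<^sup>2 + 6 * b\<^sup>2) * y"
        using y1 by (intro add_left_mono mult_left_mono) auto
      also have "\<dots> = Db * y" unfolding Db_def by (simp add: algebra_simps)
      finally show "3 * (300 * (D1 * (1 + \<bar>T\<bar>) powr (1 / 4))\<^sup>2) + 3 * M\<^sup>2 * (300 * X\<^sup>2) + 3 * b\<^sup>2 * 2 \<le> Db * (1 + \<bar>T\<bar>) powr (1 / 2)"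
        unfolding y_def .
    qed
    finally show ?thesis unfolding I_def .
  qed
  define D where "D = max Da Db"
  have "Da \<ge> 0" unfolding Da_def using D1_nonneg X b0 by (simp add: M_def)
  then have D0: "D \<ge> 0" unfolding D_def by simp
  show ?thesis
  proof (intro exI conjI allI impI)
    show "D \<ge> 0" by (rule D0)
    fix s T :: real assume s: "0 < s \<and> s \<le> 1"
    have "Da * (1 + \<bar>T\<bar>) * (5 + \<bar>ln s\<bar>) \<le> D * (1 + \<bar>T\<bar>) * (5 + \<bar>ln s\<bar>)"
      unfolding D_def by (intro mult_right_mono) auto
    then show "norm (numer c (Complex s T)) \<le> D * (1 + \<bar>T\<bar>) * (5 + \<bar>ln s\<bar>)" using 1[of s T] s by linarith
    have "Db * (1 + \<bar>T\<bar>) powr (1 / 2) \<le> D * (1 + \<bar>T\<bar>) powr (1 / 2)" unfolding D_def by (intro mult_right_mono) auto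
    with 2[of s T] s show "(\<integral>\<^sup>+u. ennreal (indicator {T-1..T+1} u * (norm (numer c (Complex s u)))\<^sup>2) \<partial>lborel) \<le> ennreal (D * (1 + \<bar>T\<bar>) powr (1 / 2))"
      by (meson ennreal_leI order_trans)
  qed
qed

end

section \<open>The exceptional set\<close>

context central_L
begin

definition coeff1 :: "nat \<Rightarrow> complex" where
  "coeff1 n = (if prime n then (\<Sum>j\<in>UNIV. \<alpha> n j) / of_real (sqrt (real n)) else 0)"

text \<open>The quadratic term of - Ln (1 - z) at z = \<alpha> n^(- 1/2 - s) carries n^(- 2 s) = exp
  (- 2 s ln n), so its jump sits at 2 ln n; with t = ln x this is the range p <= sqrt x.\<close>

definition coeff2 :: "nat \<Rightarrow> complex" where
  "coeff2 n = (if prime n then (\<Sum>j\<in>UNIV. (\<alpha> n j)\<^sup>2) / (2 * of_nat n) else 0)"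

lemma coeff1_bound: "n > 0 \<Longrightarrow> norm (coeff1 n) \<le> real CARD('n) * real n powr (- (1 / 2))"
proof (cases "prime n")
  case True
  assume n: "n > 0"
  have "norm (\<Sum>j\<in>UNIV. \<alpha> n j) \<le> real CARD('n)"
    using sum_norm_bound[of UNIV "\<alpha> n" 1] \<alpha>[OF True] by simp
  then have "norm (\<Sum>j\<in>UNIV. \<alpha> n j) / sqrt (real n) \<le> real CARD('n) / sqrt (real n)"
    by (rule divide_right_mono) simp
  moreover have "real n powr (- (1 / 2)) = 1 / sqrt (real n)"
    using n by (simp add: powr_minus_divide powr_half_sqrt)
  ultimately show ?thesis using True by (simp add: coeff1_def norm_divide)
qed (simp add: coeff1_def)

lemma coeff2_bound: "n > 0 \<Longrightarrow> norm (coeff2 n) \<le> real CARD('n) * real n powr (- 1)"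
proof (cases "prime n")
  case True
  assume n: "n > 0"
  have "norm (\<Sum>j\<in>UNIV. (\<alpha> n j)\<^sup>2) \<le> real CARD('n)"
    using sum_norm_bound[of UNIV "\<lambda>j. (\<alpha> n j)\<^sup>2" 1] \<alpha>[OF True] by (simp add: norm_power power_le_one)
  then have "norm (\<Sum>j\<in>UNIV. (\<alpha> n j)\<^sup>2) / (2 * real n) \<le> real CARD('n) / (2 * real n)"
    by (rule divide_right_mono) simp
  also have "\<dots> \<le> real CARD('n) / real n" using n by (intro divide_left_mono) auto
  also have "\<dots> = real CARD('n) * real n powr (- 1)" using n by (simp add: powr_minus_divide)
  finally show ?thesis using True by (simp add: coeff2_def norm_divide norm_mult)
qed (simp add: coeff2_def)

lemma coeff_summable:
  assumes "d > 1 / 2"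
  shows "summable (\<lambda>n. norm (coeff1 n) * exp (- (d * ln (real n))))"
    and "summable (\<lambda>n. norm (coeff2 n) * exp (- (d * (2 * ln (real n)))))"
proof -
  show "summable (\<lambda>n. norm (coeff1 n) * exp (- (d * ln (real n))))"
    by (rule summable_ln_exp[OF coeff1_bound]) (use assms in \<open>simp_all add: coeff1_def\<close>)
  have "summable (\<lambda>n. norm (coeff2 n) * exp (- ((2 * d) * ln (real n))))"
    by (rule summable_ln_exp[OF coeff2_bound]) (use assms in \<open>simp_all add: coeff2_def\<close>)
  moreover have "(2 * d) * ln (real n) = d * (2 * ln (real n))" for n by simp
  ultimately show "summable (\<lambda>n. norm (coeff2 n) * exp (- (d * (2 * ln (real n)))))" by (simp only:)
qed

lemma filterlim_double_ln: "filterlim (\<lambda>n. 2 * ln (real n)) at_top sequentially"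
  by (rule filterlim_tendsto_pos_mult_at_top[OF tendsto_const _ filterlim_ln_real]) simp

text \<open>The Taylor polynomial z + z^2 / 2 is split off prime by prime; each of the three series
  converges absolutely for Re s > 1/2.\<close>

lemma log_series_split:
  assumes s: "Re s > 1 / 2"
  shows "log_series (1 / 2 + s) = log_tail (1 / 2 + s) + (\<Sum>n. coeff1 n * exp (- (s * of_real (ln (real n)))))
     + (\<Sum>n. coeff2 n * exp (- (s * of_real (2 * ln (real n)))))"
proof -
  let ?\<phi> = "\<lambda>z::complex. - Ln (1 - z) - z - z\<^sup>2 / 2"
  have term_eq: "prime_term \<alpha> (\<lambda>z. - Ln (1 - z)) n (1 / 2 + s) = prime_term \<alpha> ?\<phi> n (1 / 2 + s)
     + coeff1 n * exp (- (s * of_real (ln (real n)))) + coeff2 n * exp (- (s * of_real (2 * ln (real n))))" for n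
  proof (cases "prime n")
    case True
    then have n: "n > 0" by (rule prime_gt_0_nat)
    define e where "e = exp (- (s * of_real (ln (real n))))"
    define w where "w = of_nat n powr (- (1 / 2 + s))"
    have "w = exp (- ((1 / 2 + s) * of_real (ln (real n))))"
      unfolding w_def using cexp_ln_powr[OF n] by simp
    also have "\<dots> = e * of_real (exp (- (1 / 2 * ln (real n))))"
    proof -
      have 1: "- ((1 / 2 + s) * complex_of_real (ln (real n))) = - (s * of_real (ln (real n))) + of_real (- (1 / 2 * ln (real n)))"
        by (simp add: ring_distribs)
      show ?thesis unfolding 1 e_def exp_of_real[symmetric] by (rule exp_add)
    qed
    also have "exp (- (1 / 2 * ln (real n))) = 1 / sqrt (real n)"
      unfolding exp_ln_powr[OF n] by (simp add: powr_minus_divide powr_half_sqrt)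
    finally have w: "w = e / of_real (sqrt (real n))" by simp
    have "w\<^sup>2 = e\<^sup>2 / of_real ((sqrt (real n))\<^sup>2)" unfolding w by (simp add: power_divide del: real_sqrt_pow2)
    then have w2: "w\<^sup>2 = e\<^sup>2 / of_nat n" by simp
    have e2: "exp (- (s * of_real (2 * ln (real n)))) = e\<^sup>2"
      unfolding e_def by (simp add: power2_eq_square mult_ac flip: exp_add)
    have c1: "coeff1 n * e = (\<Sum>j\<in>UNIV. \<alpha> n j * w)" unfolding w using True by (simp add: coeff1_def sum_distrib_right sum_divide_distrib)
    have c2: "coeff2 n * e\<^sup>2 = (\<Sum>j\<in>UNIV. (\<alpha> n j * w)\<^sup>2 / 2)"
      unfolding power_mult_distrib w2 using True by (simp add: coeff2_def sum_distrib_right sum_divide_distrib) (simp add: mult.commute)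
    have "prime_term \<alpha> (\<lambda>z. - Ln (1 - z)) n (1 / 2 + s) = (\<Sum>j\<in>UNIV. ?\<phi> (\<alpha> n j * w) + \<alpha> n j * w + (\<alpha> n j * w)\<^sup>2 / 2)"
      using True by (simp add: prime_term_def w_def)
    also have "\<dots> = prime_term \<alpha> ?\<phi> n (1 / 2 + s) + coeff1 n * e + coeff2 n * e\<^sup>2"
      unfolding sum.distrib c1 c2 using True by (simp add: prime_term_def w_def)
    finally show ?thesis unfolding e2 e_def .
  qed (simp add: prime_term_def coeff1_def coeff2_def)
  have s0: "Re s > 0" using s by simp
  have sa: "summable (\<lambda>n. coeff1 n * exp (- (s * of_real (ln (real n)))))"
    by (rule step_sum_laplace(3)[OF s0 ln_of_nat_nonneg coeff_summable(1)[OF s] filterlim_ln_real])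
  have sb: "summable (\<lambda>n. coeff2 n * exp (- (s * of_real (2 * ln (real n)))))"
    by (rule step_sum_laplace(3)[OF s0 _ coeff_summable(2)[OF s] filterlim_double_ln]) (simp add: ln_of_nat_nonneg)
  have st: "summable (\<lambda>n. prime_term \<alpha> ?\<phi> n (1 / 2 + s))"
    by (rule prime_series_summable(1)[OF \<alpha> small_order_log(3), where \<sigma> = "1 / 2"]) (use s in auto)
  show ?thesis unfolding log_series_def log_tail_def prime_series_def term_eq
    by (subst suminf_add[OF summable_add[OF st sa] sb, symmetric], subst suminf_add[OF st sa, symmetric]) (rule refl)
qed

text \<open>Near 0 the numerator compensates the division by \<open>s\<close>. Elsewhere |s|^2 is at
  least a fixed multiple of 1 + u^2, uniformly in \<sigma>, so the weighted bound over unit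
  intervals applies.\<close>

lemma numer_quotient_L2:
  assumes r0: "0 < r0" "r0 \<le> 1" and M: "M \<ge> 0" "\<And>s. Re s > 0 \<Longrightarrow> norm s < r0 \<Longrightarrow> norm (numer c s) \<le> M * norm s"
  shows "\<exists>K. \<forall>\<sigma>. 0 < \<sigma> \<and> \<sigma> \<le> 1 \<longrightarrow> (\<integral>\<^sup>+u. ennreal ((norm (numer c (Complex \<sigma> u) / Complex \<sigma> u))\<^sup>2) \<partial>lborel) \<le> ennreal K"
proof -
  obtain D where D: "D \<ge> 0"
   "\<And>s T. 0 < s \<Longrightarrow> s \<le> 1 \<Longrightarrow> (\<integral>\<^sup>+u. ennreal (indicator {T-1..T+1} u * (norm (numer c (Complex s u)))\<^sup>2) \<partial>lborel) \<le> ennreal (D * (1 + \<bar>T\<bar>) powr (1 / 2))"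
    using numer_bounds[of c] by blast
  obtain K1 where K1: "K1 \<ge> 0" "\<And>h. h \<in> borel_measurable borel \<Longrightarrow> (\<And>u. h u \<ge> 0) \<Longrightarrow>
     (\<And>T::real. (\<integral>\<^sup>+u. ennreal (indicator {T-1..T+1} u * h u) \<partial>lborel) \<le> ennreal (D * (1 + \<bar>T\<bar>) powr (1 / 2))) \<Longrightarrow>
     (\<integral>\<^sup>+u. ennreal (h u / (1 + u\<^sup>2)) \<partial>lborel) \<le> ennreal K1"
    by (rule weighted_unit_intervals[OF D(1)]) blast
  \<comment> \<open>From |s| >= r0 and |s| >= |u| it follows that 1 + u^2 <= K0 |s|^2.\<close>
  define K0 where "K0 = 1 + 1 / r0\<^sup>2"
  have K0: "K0 \<ge> 0" unfolding K0_def by simp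
  have "(\<integral>\<^sup>+u. ennreal ((norm (numer c (Complex \<sigma> u) / Complex \<sigma> u))\<^sup>2) \<partial>lborel) \<le> ennreal (M\<^sup>2 * 2 + K0 * K1)"
    if \<sigma>: "0 < \<sigma>" "\<sigma> \<le> 1" for \<sigma>
  proof -
    define h where "h = (\<lambda>u. (norm (numer c (Complex \<sigma> u)))\<^sup>2)"
    have [measurable]: "(\<lambda>u. numer c (Complex \<sigma> u)) \<in> borel_measurable borel"
      using continuous_on_vertical[OF numer_holomorphic \<sigma>(1)] by (rule borel_measurable_continuous_onI)
    have hm [measurable]: "h \<in> borel_measurable borel" unfolding h_def by measurable
    have h0: "h u \<ge> 0" for u unfolding h_def by simp
    have pt: "(norm (numer c (Complex \<sigma> u) / Complex \<sigma> u))\<^sup>2 \<le> M\<^sup>2 * indicator {-1..1} u + K0 * (h u / (1 + u\<^sup>2))" for u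
    proof -
      let ?s = "Complex \<sigma> u"
      have s0: "norm ?s > 0" using \<sigma> complex_Re_le_cmod[of ?s] unfolding complex.sel by linarith
      have us: "\<bar>u\<bar> \<le> norm ?s" using abs_Im_le_cmod[of ?s] by simp
      have second: "0 \<le> K0 * (h u / (1 + u\<^sup>2))" using K0 h0 by (intro mult_nonneg_nonneg divide_nonneg_nonneg) auto
      show ?thesis
      proof (cases "norm ?s < r0")
        case True
        then have "norm (numer c ?s / ?s) \<le> M" using M(2)[of ?s] \<sigma> s0 by (simp add: norm_divide divide_le_eq)
        then have "(norm (numer c ?s / ?s))\<^sup>2 \<le> M\<^sup>2" by (intro power_mono) auto
        moreover have "u \<in> {-1..1}" using True us r0 by auto
        ultimately show ?thesis using second by simp
      next
        case False
        have 1: "r0\<^sup>2 \<le> (norm ?s)\<^sup>2" using False r0 by (intro power_mono) auto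
        have 2: "u\<^sup>2 \<le> (norm ?s)\<^sup>2" using power_mono[OF us, of 2] by simp
        have "1 + u\<^sup>2 \<le> (norm ?s)\<^sup>2 / r0\<^sup>2 + (norm ?s)\<^sup>2" using 1 2 r0 by (intro add_mono) auto
        also have "\<dots> = K0 * (norm ?s)\<^sup>2" unfolding K0_def by (simp add: algebra_simps)
        finally have 3: "1 + u\<^sup>2 \<le> K0 * (norm ?s)\<^sup>2" .
        have u1: "0 < 1 + u\<^sup>2" by (rule add_pos_nonneg) auto
        have "h u * (1 + u\<^sup>2) \<le> h u * (K0 * (norm ?s)\<^sup>2)" by (rule mult_left_mono[OF 3 h0])
        then have "h u / (norm ?s)\<^sup>2 \<le> K0 * (h u / (1 + u\<^sup>2))" using s0 u1 by (simp add: divide_simps mult_ac)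
        moreover have "(norm (numer c ?s / ?s))\<^sup>2 = h u / (norm ?s)\<^sup>2" unfolding h_def norm_divide power_divide ..
        ultimately show ?thesis by (simp add: add_increasing)
      qed
    qed
    have "(\<integral>\<^sup>+u. ennreal ((norm (numer c (Complex \<sigma> u) / Complex \<sigma> u))\<^sup>2) \<partial>lborel)
       \<le> (\<integral>\<^sup>+u. ennreal (M\<^sup>2) * indicator {-1..1} u + ennreal K0 * ennreal (h u / (1 + u\<^sup>2)) \<partial>lborel)"
    proof (rule nn_integral_mono)
      fix u
      have q: "0 \<le> h u / (1 + u\<^sup>2)" using h0 by (intro divide_nonneg_nonneg) auto
      have "ennreal ((norm (numer c (Complex \<sigma> u) / Complex \<sigma> u))\<^sup>2) \<le> ennreal (M\<^sup>2 * indicator {-1..1} u + K0 * (h u / (1 + u\<^sup>2)))"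
        by (rule ennreal_leI[OF pt])
      also have "\<dots> = ennreal (M\<^sup>2 * indicator {-1..1} u) + ennreal (K0 * (h u / (1 + u\<^sup>2)))"
        using K0 q by (intro ennreal_plus mult_nonneg_nonneg) auto
      also have "\<dots> = ennreal (M\<^sup>2) * indicator {-1..1} u + ennreal K0 * ennreal (h u / (1 + u\<^sup>2))"
        by (simp only: ennreal_mult[OF K0 q] ennreal_mult'[OF zero_le_power2] ennreal_indicator)
      finally show "ennreal ((norm (numer c (Complex \<sigma> u) / Complex \<sigma> u))\<^sup>2) \<le> ennreal (M\<^sup>2) * indicator {-1..1} u + ennreal K0 * ennreal (h u / (1 + u\<^sup>2))" .
    qed
    also have "\<dots> = ennreal (M\<^sup>2) * ennreal 2 + ennreal K0 * (\<integral>\<^sup>+u. ennreal (h u / (1 + u\<^sup>2)) \<partial>lborel)"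
      by (simp add: nn_integral_add nn_integral_cmult)
    also have "\<dots> \<le> ennreal (M\<^sup>2) * ennreal 2 + ennreal K0 * ennreal K1"
      using K1(2)[OF hm h0] D(2)[OF \<sigma>] by (intro add_mono mult_left_mono order_refl) (auto simp: h_def)
    also have "\<dots> = ennreal (M\<^sup>2 * 2 + K0 * K1)" using K0 K1(1) by (simp add: ennreal_mult)
    finally show ?thesis .
  qed
  then show ?thesis by blast
qed

text \<open>The step function \<open>f\<close> is the error term. Its transform is numer c s / s,
  hence it is square integrable and tends to 0 off a set of finite measure; Euler's constant then
  replaces the harmonic sum by a logarithm.\<close>

theorem prime_sum_off_small_set:
  "\<exists>c E. E \<in> sets borel \<and> emeasure lborel E < \<infinity> \<and>
    ((\<lambda>t. (\<Sum>p | prime p \<and> ln (real p) \<le> t. (\<Sum>j\<in>UNIV. \<alpha> p j) / of_real (sqrt (real p)))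
       + (\<Sum>p | prime p \<and> 2 * ln (real p) \<le> t. (\<Sum>j\<in>UNIV. (\<alpha> p j)\<^sup>2) / (2 * of_nat p)) + of_real (real m * ln t)) \<longlongrightarrow> c)
      (inf at_top (principal (- E)))"
proof -
  obtain c r0 M where r0: "0 < r0" "r0 \<le> 1" and M: "M \<ge> 0" "\<And>s. Re s > 0 \<Longrightarrow> norm s < r0 \<Longrightarrow> norm (numer c s) \<le> M * norm s"
    using numer_near_zero by blast
  define F where "F = (\<lambda>s. numer c s / s)"
  \<comment> \<open>Index 0 contributes - c to the Dirichlet series of the step function, the other
    indices - m log (1 - exp (- s)), as in \<open>numer\<close>.\<close>
  define h where "h = (\<lambda>n::nat. if n = 0 then - c else of_nat m / of_nat n)"
  define f where "f = (\<lambda>t. step_sum (\<lambda>n. ln (real n)) coeff1 t + step_sum (\<lambda>n. 2 * ln (real n)) coeff2 t + step_sum real h t)"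
  have hs: "summable (\<lambda>n. norm (h n) * exp (- (d * real n)))" if "d > 0" for d
    unfolding h_def by (rule harmonic_exp_summable[OF that])
  have ln2: "0 \<le> 2 * ln (real n)" for n by (simp add: ln_of_nat_nonneg)
  have fm: "f \<in> borel_measurable borel" unfolding f_def by measurable
  \<comment> \<open>3/4 lies between the abscissa 1/2 of absolute convergence and the abscissa 1
    where the transform is taken.\<close>
  define C0 where "C0 = (\<Sum>n. norm (coeff1 n) * exp (- (3/4 * ln (real n)))) + (\<Sum>n. norm (coeff2 n) * exp (- (3/4 * (2 * ln (real n))))) + (\<Sum>n. norm (h n) * exp (- (3/4 * real n)))"
  have bd: "norm (f v) \<le> C0 * exp (3/4 * v)" for v
  proof -
    have "norm (step_sum (\<lambda>n. ln (real n)) coeff1 v) \<le> (\<Sum>n. norm (coeff1 n) * exp (- (3/4 * ln (real n)))) * exp (3/4 * v)"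
      by (rule step_sum_bound[OF filterlim_ln_real coeff_summable(1)]) auto
    moreover have "norm (step_sum (\<lambda>n. 2 * ln (real n)) coeff2 v) \<le> (\<Sum>n. norm (coeff2 n) * exp (- (3/4 * (2 * ln (real n))))) * exp (3/4 * v)"
      by (rule step_sum_bound[OF filterlim_double_ln coeff_summable(2)]) auto
    moreover have "norm (step_sum real h v) \<le> (\<Sum>n. norm (h n) * exp (- (3/4 * real n))) * exp (3/4 * v)"
      by (rule step_sum_bound[OF filterlim_real_sequentially hs]) auto
    ultimately show ?thesis unfolding f_def C0_def distrib_right by (meson add_mono norm_triangle_ineq order_trans)
  qed
  have neg: "f v = 0" if "v < 0" for v
    unfolding f_def using step_sum_neg[OF ln_of_nat_nonneg that] step_sum_neg[of "\<lambda>n. 2 * ln (real n)", OF ln2 that]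
      step_sum_neg[of real, OF _ that] by simp
  have cont: "AE t in lborel. isCont f t"
    using step_sum_AE_isCont[OF filterlim_ln_real, of coeff1] step_sum_AE_isCont[OF filterlim_double_ln, of coeff2]
      step_sum_AE_isCont[OF filterlim_real_sequentially, of h]
  proof eventually_elim
    case (elim t)
    then show ?case unfolding f_def by (intro isCont_add)
  qed
  have hol: "F holomorphic_on {s. Re s > 0}"
    unfolding F_def by (intro holomorphic_intros numer_holomorphic) auto
  have FL: "F s = (\<integral>v. f v * exp (- (s * of_real v)) \<partial>lborel)" if s: "Re s = 1" for s
  proof -
    have s0: "Re s > 0" and s1: "Re s > 1 / 2" using s by auto
    note L1 = step_sum_laplace[OF s0 ln_of_nat_nonneg coeff_summable(1)[OF s1] filterlim_ln_real]
    note L2 = step_sum_laplace[OF s0 ln2 coeff_summable(2)[OF s1] filterlim_double_ln]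
    note L3 = step_sum_laplace[OF s0 of_nat_0_le_iff hs[OF s0] filterlim_real_sequentially]
    have S3: "(\<Sum>n. h n * exp (- (s * of_real (real n)))) = - c - of_nat m * log_one_minus_exp s"
      unfolding h_def log_one_minus_exp_def using harmonic_exp_sums[OF s0, of "- c" "of_nat m"] by (simp add: sums_iff)
    have "(\<integral>v. f v * exp (- (s * of_real v)) \<partial>lborel) =
       ((\<Sum>n. coeff1 n * exp (- (s * of_real (ln (real n))))) + (\<Sum>n. coeff2 n * exp (- (s * of_real (2 * ln (real n))))) + (- c - of_nat m * log_one_minus_exp s)) / s"
      unfolding f_def distrib_right
      by (subst Bochner_Integration.integral_add[OF Bochner_Integration.integrable_add[OF L1(2) L2(2)] L3(2)],
          subst Bochner_Integration.integral_add[OF L1(2) L2(2)], unfold L1(1) L2(1) L3(1) S3)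
         (simp only: add_divide_distrib)
    moreover have "numer c s = (\<Sum>n. coeff1 n * exp (- (s * of_real (ln (real n))))) + (\<Sum>n. coeff2 n * exp (- (s * of_real (2 * ln (real n))))) + (- c - of_nat m * log_one_minus_exp s)"
      unfolding numer_def log_L(3)[OF s1] log_series_split[OF s1] by simp
    ultimately show ?thesis unfolding F_def by simp
  qed
  have Fb: "\<exists>B. \<forall>s. a \<le> Re s \<and> Re s \<le> 1 \<longrightarrow> norm (F s) \<le> B" if a: "0 < a" for a
  proof -
    obtain D where D: "D \<ge> 0" "\<And>s T. 0 < s \<Longrightarrow> s \<le> 1 \<Longrightarrow> norm (numer c (Complex s T)) \<le> D * (1 + \<bar>T\<bar>) * (5 + \<bar>ln s\<bar>)"
      using numer_bounds[of c] by blast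
    have "norm (F s) \<le> D * (1 / a + 1) * (5 + \<bar>ln a\<bar>)" if s: "a \<le> Re s" "Re s \<le> 1" for s
    proof -
      have re: "0 < Re s" using a s by simp
      have n: "Re s \<le> norm s" "\<bar>Im s\<bar> \<le> norm s" using complex_Re_le_cmod abs_Im_le_cmod by auto
      then have n0: "norm s > 0" using re by linarith
      have "1 + \<bar>Im s\<bar> \<le> norm s / a + norm s" using n s a by (intro add_mono) auto
      then have x: "1 + \<bar>Im s\<bar> \<le> (1 / a + 1) * norm s" by (simp add: algebra_simps)
      have "ln a \<le> ln (Re s)" "ln (Re s) \<le> 0" using s a re by auto
      then have y: "5 + \<bar>ln (Re s)\<bar> \<le> 5 + \<bar>ln a\<bar>" by linarith
      have "norm (numer c s) \<le> D * (1 + \<bar>Im s\<bar>) * (5 + \<bar>ln (Re s)\<bar>)" using D(2)[OF re s(2), of "Im s"] by simp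
      also have "\<dots> \<le> D * ((1 / a + 1) * norm s) * (5 + \<bar>ln a\<bar>)"
        using x y D(1) a by (intro mult_mono mult_nonneg_nonneg add_nonneg_nonneg) auto
      finally show ?thesis using n0 unfolding F_def norm_divide by (simp add: divide_le_eq mult_ac)
    qed
    then show ?thesis by blast
  qed
  obtain K where K: "\<And>\<sigma>. 0 < \<sigma> \<Longrightarrow> \<sigma> \<le> 1 \<Longrightarrow> (\<integral>\<^sup>+u. ennreal ((norm (F (Complex \<sigma> u)))\<^sup>2) \<partial>lborel) \<le> ennreal K"
    using numer_quotient_L2[OF r0 M] unfolding F_def by blast
  have "(\<integral>\<^sup>+t. ennreal ((norm (f t))\<^sup>2) \<partial>lborel) < \<infinity>"
    by (rule laplace_L2_bound[OF fm bd neg _ _ cont hol FL Fb K]) auto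
  then obtain E where E: "E \<in> sets borel" "emeasure lborel E < \<infinity>" "(f \<longlongrightarrow> 0) (inf at_top (principal (- E)))"
    using L2_tendsto_zero[OF fm] by blast
  have fin1: "finite {n. ln (real n) \<le> t}" and fin2: "finite {n. 2 * ln (real n) \<le> t}" for t
    by (rule step_sum_finite(1)[OF filterlim_ln_real], rule step_sum_finite(1)[OF filterlim_double_ln])
  have sum1: "step_sum (\<lambda>n. ln (real n)) coeff1 t = (\<Sum>p | prime p \<and> ln (real p) \<le> t. (\<Sum>j\<in>UNIV. \<alpha> p j) / of_real (sqrt (real p)))" for t
    unfolding step_sum_finite(2)[OF filterlim_ln_real]
    by (rule sum.mono_neutral_cong_right[OF fin1]) (auto simp: coeff1_def)
  have sum2: "step_sum (\<lambda>n. 2 * ln (real n)) coeff2 t = (\<Sum>p | prime p \<and> 2 * ln (real p) \<le> t. (\<Sum>j\<in>UNIV. (\<alpha> p j)\<^sup>2) / (2 * of_nat p))" for t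
    unfolding step_sum_finite(2)[OF filterlim_double_ln]
    by (rule sum.mono_neutral_cong_right[OF fin2]) (auto simp: coeff2_def)
  let ?G = "inf at_top (principal (- E)) :: real filter"
  let ?S = "\<lambda>t. step_sum (\<lambda>n. ln (real n)) coeff1 t + step_sum (\<lambda>n. 2 * ln (real n)) coeff2 t + of_real (real m * ln t)"
  have "((\<lambda>t::real. of_nat m * complex_of_real (harm (nat \<lfloor>t\<rfloor>) - ln t)) \<longlongrightarrow> of_nat m * of_real euler_mascheroni) ?G"
    by (intro tendsto_mult_left tendsto_of_real tendsto_mono[OF inf_le1 harm_floor_minus_ln])
  from tendsto_diff[OF tendsto_add[OF E(3) tendsto_const[of c]] this]
  have lim: "((\<lambda>t. f t + c - of_nat m * complex_of_real (harm (nat \<lfloor>t\<rfloor>) - ln t)) \<longlongrightarrow> 0 + c - of_nat m * of_real euler_mascheroni) ?G" .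
  have "\<forall>\<^sub>F t in ?G. t \<ge> 0" by (rule filter_leD[OF inf_le1 eventually_ge_at_top])
  then have ev: "\<forall>\<^sub>F t in ?G. f t + c - of_nat m * complex_of_real (harm (nat \<lfloor>t\<rfloor>) - ln t) = ?S t"
  proof eventually_elim
    case (elim t)
    have "step_sum real h t = - c + of_nat m * of_real (harm (nat \<lfloor>t\<rfloor>))" unfolding h_def by (rule step_sum_harmonic[OF elim])
    then show ?case unfolding f_def by (simp add: algebra_simps)
  qed
  have "(?S \<longlongrightarrow> 0 + c - of_nat m * of_real euler_mascheroni) ?G" by (rule Lim_transform_eventually[OF lim ev])
  then show ?thesis unfolding sum1 sum2 using E(1,2) by (intro exI conjI)
qed

end

section \<open>Removing the ramified primes\<close>

text \<open>The reciprocal of the Euler product over \<open>P\<close>: multiplying by it sets the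
  parameters at \<open>P\<close> to 0.\<close>

definition local_factors :: "(nat \<Rightarrow> 'n::finite \<Rightarrow> complex) \<Rightarrow> nat set \<Rightarrow> complex \<Rightarrow> complex" where
  "local_factors \<alpha> P s = (\<Prod>p\<in>P. \<Prod>j\<in>UNIV. 1 - \<alpha> p j * of_nat p powr (- s))"

lemma local_factors_holomorphic:
  assumes "\<And>p. p \<in> P \<Longrightarrow> prime p"
  shows "local_factors \<alpha> P holomorphic_on UNIV"
proof -
  have "p \<noteq> 0" if "p \<in> P" for p using assms[OF that] by auto
  then show ?thesis unfolding local_factors_def[abs_def] by (intro holomorphic_intros) auto
qed

text \<open>The bound gives |\<alpha> p j p^(- s)| < 1 for Re s >= \<sigma>. With \<sigma> = 1/2 it
  is applied to the parameters, with \<sigma> = 1 to their squares.\<close>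

lemma local_factors_nonzero:
  assumes P: "finite P" "\<And>p. p \<in> P \<Longrightarrow> prime p" and \<alpha>: "\<And>p j. p \<in> P \<Longrightarrow> norm (\<alpha> p j) < real p powr \<sigma>" and s: "Re s \<ge> \<sigma>"
  shows "p \<in> P \<Longrightarrow> \<alpha> p j * of_nat p powr (- s) \<noteq> 1" and "local_factors \<alpha> P s \<noteq> 0"
proof -
  show *: "\<alpha> p j * of_nat p powr (- s) \<noteq> 1" if p: "p \<in> P" for p j
  proof
    have p1: "real p \<ge> 1" using prime_ge_1_nat[OF P(2)[OF p]] by simp
    assume "\<alpha> p j * of_nat p powr (- s) = 1"
    then have e: "norm (\<alpha> p j) * norm (of_nat p powr (- s) :: complex) = 1" by (metis norm_mult norm_one)
    have "norm (of_nat p powr (- s) :: complex) = real p powr (- Re s)"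
      using p1 norm_powr_real_powr[of "of_nat p" "- s"] by simp
    from e[unfolded this] have "norm (\<alpha> p j) * real p powr (- Re s) = 1" .
    moreover have "norm (\<alpha> p j) * real p powr (- Re s) < real p powr \<sigma> * real p powr (- Re s)"
      using \<alpha>[OF p, of j] p1 by (intro mult_strict_right_mono) auto
    moreover have "real p powr \<sigma> * real p powr (- Re s) \<le> 1"
      using p1 s powr_mono[of "\<sigma> - Re s" 0 "real p"] by (simp flip: powr_add)
    ultimately show False by linarith
  qed
  show "local_factors \<alpha> P s \<noteq> 0" unfolding local_factors_def using P(1) * by (auto simp: prod_zero_iff)
qed

lemma local_factors_bounded:
  assumes P: "finite P" "\<And>p. p \<in> P \<Longrightarrow> prime p" and d: "d \<ge> 0"
  shows "\<exists>K. \<forall>s. Re s \<ge> - d \<longrightarrow> norm (local_factors \<alpha> P s) \<le> K"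
proof (intro exI allI impI)
  fix s :: complex assume s: "Re s \<ge> - d"
  have "norm (1 - \<alpha> p j * of_nat p powr (- s)) \<le> 1 + norm (\<alpha> p j) * real p powr d" if p: "p \<in> P" for p j
  proof -
    have p1: "real p \<ge> 1" using prime_ge_1_nat[OF P(2)[OF p]] by simp
    have "norm (of_nat p powr (- s) :: complex) = real p powr (- Re s)"
      using p1 norm_powr_real_powr[of "of_nat p" "- s"] by simp
    also have "\<dots> \<le> real p powr d" using p1 s by (intro powr_mono) auto
    finally have "norm (\<alpha> p j) * norm (of_nat p powr (- s) :: complex) \<le> norm (\<alpha> p j) * real p powr d"
      by (rule mult_left_mono) simp
    then show ?thesis using norm_triangle_ineq4[of 1 "\<alpha> p j * of_nat p powr (- s)"] by (simp add: norm_mult)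
  qed
  then show "norm (local_factors \<alpha> P s) \<le> (\<Prod>p\<in>P. \<Prod>j\<in>UNIV. 1 + norm (\<alpha> p j) * real p powr d)"
    unfolding local_factors_def prod_norm[symmetric] by (intro prod_mono conjI prod_nonneg) auto
qed

text \<open>Each factor differs from 1 by at most 1 / p <= 1/2.\<close>

lemma local_factors_lower:
  assumes P: "\<And>p. p \<in> P \<Longrightarrow> prime p" and \<alpha>: "\<And>p j. p \<in> P \<Longrightarrow> norm (\<alpha> p j) \<le> real p powr (Re s - 1)"
  shows "norm (local_factors (\<alpha> :: nat \<Rightarrow> 'n::finite \<Rightarrow> complex) P s) \<ge> (\<Prod>p\<in>P. \<Prod>j\<in>(UNIV :: 'n set). 1 / 2)"
proof -
  have "norm (1 - \<alpha> p j * of_nat p powr (- s)) \<ge> 1 / 2" if p: "p \<in> P" for p j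
  proof -
    have p2: "real p \<ge> 2" using prime_ge_2_nat[OF P[OF p]] by simp
    have "norm (of_nat p powr (- s) :: complex) = real p powr (- Re s)"
      using p2 norm_powr_real_powr[of "of_nat p" "- s"] by simp
    then have "norm (\<alpha> p j * of_nat p powr (- s)) \<le> real p powr (Re s - 1) * real p powr (- Re s)"
      using \<alpha>[OF p, of j] by (simp add: norm_mult mult_right_mono)
    also have "\<dots> = real p powr (- 1)" by (simp flip: powr_add)
    also have "\<dots> = 1 / real p" using p2 by (simp add: powr_minus_divide)
    also have "\<dots> \<le> 1 / 2" using p2 by (intro divide_left_mono) auto
    finally show ?thesis using norm_triangle_ineq2[of 1 "\<alpha> p j * of_nat p powr (- s)"] by simp
  qed
  then show ?thesis unfolding local_factors_def prod_norm[symmetric] by (intro prod_mono conjI prod_nonneg) auto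
qed

lemma euler_product_remove:
  assumes P: "finite P" "\<And>p. p \<in> P \<Longrightarrow> prime p"
    and nz: "\<And>p j. p \<in> P \<Longrightarrow> \<alpha> p j * of_nat p powr (- s) \<noteq> 1"
    and ep: "euler_product \<alpha> s z"
  shows "euler_product (\<lambda>p j. if p \<in> P then 0 else \<alpha> p j) s (z * local_factors \<alpha> P s)"
proof -
  let ?f = "\<lambda>p. if prime p then \<Prod>j\<in>UNIV. inverse (1 - \<alpha> p j * of_nat p powr (- s)) else 1"
  let ?g = "\<lambda>p. if p \<in> P then \<Prod>j\<in>UNIV. 1 - \<alpha> p j * of_nat p powr (- s) else 1"
  let ?h = "\<lambda>p. if prime p then \<Prod>j\<in>UNIV. inverse (1 - (if p \<in> P then 0 else \<alpha> p j) * of_nat p powr (- s)) else 1"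
  have "(\<lambda>p. ?f p * ?g p) has_prod (z * local_factors \<alpha> P s)"
    using has_prod_mult[OF ep[unfolded euler_product_def] has_prod_If_finite_set[OF P(1)]] unfolding local_factors_def .
  moreover have "?f p * ?g p = ?h p" for p
  proof (cases "p \<in> P")
    case True
    have "(\<Prod>j\<in>UNIV. inverse (1 - \<alpha> p j * of_nat p powr (- s))) * (\<Prod>j\<in>UNIV. 1 - \<alpha> p j * of_nat p powr (- s))
       = (\<Prod>j\<in>UNIV. inverse (1 - \<alpha> p j * of_nat p powr (- s)) * (1 - \<alpha> p j * of_nat p powr (- s)))"
      by (rule prod.distrib[symmetric])
    also have "\<dots> = 1" using nz[OF True] by (intro prod.neutral) (metis left_inverse right_minus_eq)
    finally show ?thesis using True P(2)[OF True] by simp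
  qed simp
  ultimately show ?thesis unfolding euler_product_def by simp
qed

text \<open>To the right of 1, the logarithm of the Euler product is R log (s - 1) plus a function
  holomorphic at 1, as the exponentials agree. The sum over primes differs from that logarithm by
  second order remainders, holomorphic for Re s > 1/2, so the limit along s = 1 + d exists.\<close>

lemma zorder_log_limit:
  fixes \<beta> :: "nat \<Rightarrow> 'n::finite \<Rightarrow> complex"
  assumes \<beta>: "\<And>p j. prime p \<Longrightarrow> norm (\<beta> p j) \<le> 1"
    and ep: "\<And>s. Re s > 1 \<Longrightarrow> euler_product \<beta> s (M s)"
    and r: "r > 0" and q: "q holomorphic_on ball 1 r" "\<And>s. s \<in> ball 1 r \<Longrightarrow> q s \<noteq> 0"
    and M: "\<And>s. s \<in> ball 1 r \<Longrightarrow> s \<noteq> 1 \<Longrightarrow> M s = q s * (s - 1) powi R"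
  shows "\<exists>C. ((\<lambda>d. (\<Sum>n. (if prime n then (\<Sum>j\<in>UNIV. \<beta> n j) / of_nat n else 0) * exp (- (of_real d * of_real (ln (real n)))))
     - of_real (of_int R * ln d)) \<longlongrightarrow> C) (at_right 0)"
proof -
  let ?l = "prime_series \<beta> (\<lambda>z. - Ln (1 - z))"
  let ?t = "prime_series \<beta> (\<lambda>z. - Ln (1 - z) - z)"
  obtain k where k: "k holomorphic_on ball 1 r" "\<And>s. s \<in> ball 1 r \<Longrightarrow> exp (k s) = q s"
    by (rule holomorphic_logarithm_exists[of "ball 1 r" q 1]) (use q r in auto)
  define U where "U = ball 1 r \<inter> {s::complex. Re s > 1}"
  have U: "convex U" "open U" unfolding U_def
    by (auto intro!: convex_Int open_Int convex_halfspace_Re_gt open_halfspace_Re_gt)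
  define D where "D = (\<lambda>s. ?l s - of_int R * Ln (s - 1) - k s)"
  have np: "s - 1 \<notin> \<real>\<^sub>\<le>\<^sub>0" if "s \<in> U" for s using that by (auto simp: U_def complex_nonpos_Reals_iff)
  have lh: "?l holomorphic_on {s. Re s > 1}" by (rule prime_series_holomorphic[OF \<beta> small_order_log(1)]) auto
  have Dh: "D holomorphic_on U" unfolding D_def
    by (intro holomorphic_intros holomorphic_on_subset[OF lh] holomorphic_on_subset[OF k(1)] np) (auto simp: U_def)
  have De: "exp (D s) = 1" if s: "s \<in> U" for s
  proof -
    have s': "Re s > 1" "s \<in> ball 1 r" using s by (auto simp: U_def)
    then have s1: "s \<noteq> 1" by auto
    have "exp (of_int R * Ln (s - 1)) = (s - 1) powi R" using s1 by (simp flip: exp_power_int)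
    moreover have "exp (?l s) = M s" by (rule exp_prime_series_log[OF \<beta> s'(1) ep[OF s'(1)]])
    ultimately have "exp (D s) = M s / (s - 1) powi R / q s"
      unfolding D_def exp_diff k(2)[OF s'(2)] by (simp only:)
    also have "\<dots> = 1" unfolding M[OF s'(2) s1] using s1 q(2)[OF s'(2)] by simp
    finally show ?thesis .
  qed
  define u where "u = 1 + complex_of_real (r / 2)"
  have u: "u \<in> U" unfolding U_def u_def using r by (simp add: dist_norm norm_divide)
  have Dc: "D s = D u" if "s \<in> U" for s by (rule exp_const_imp_const[OF U Dh De that u])
  have th: "?t holomorphic_on {s. Re s > 1 / 2}" by (rule prime_series_holomorphic[OF \<beta> small_order_log(2)]) auto
  have eq: "(\<Sum>n. (if prime n then (\<Sum>j\<in>UNIV. \<beta> n j) / of_nat n else 0) * exp (- (of_real d * of_real (ln (real n)))))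
     - of_real (of_int R * ln d) = D u + k (1 + of_real d) - ?t (1 + of_real d)" if d: "0 < d" "d < r" for d :: real
  proof -
    let ?s = "1 + complex_of_real d"
    have s: "?s \<in> U" using d by (simp add: U_def dist_norm)
    have m: "(if prime n then (\<Sum>j\<in>UNIV. \<beta> n j) / of_nat n else 0) * exp (- (of_real d * of_real (ln (real n))))
       = prime_term \<beta> (\<lambda>z. - Ln (1 - z)) n ?s - prime_term \<beta> (\<lambda>z. - Ln (1 - z) - z) n ?s" for n
    proof (cases "prime n")
      case True
      then have n: "n > 0" by (rule prime_gt_0_nat)
      have "of_nat n powr (- ?s) = of_nat n powr (- 1) * of_nat n powr (- of_real d :: complex)" by (simp flip: powr_add)
      also have "\<dots> = exp (- (of_real d * of_real (ln (real n)))) / of_nat n"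
        using cexp_ln_powr[OF n, of "of_real d"] n by (simp add: powr_minus_divide)
      finally have w: "of_nat n powr (- ?s) = exp (- (of_real d * of_real (ln (real n)))) / of_nat n" .
      show ?thesis using True unfolding prime_term_def w
        by (simp add: sum_distrib_right sum_divide_distrib flip: sum_subtractf)
    qed (simp add: prime_term_def)
    have "(\<Sum>n. (if prime n then (\<Sum>j\<in>UNIV. \<beta> n j) / of_nat n else 0) * exp (- (of_real d * of_real (ln (real n))))) = ?l ?s - ?t ?s"
      unfolding m prime_series_def
      by (rule suminf_diff[symmetric], rule prime_series_summable(1)[OF \<beta> small_order_log(1), where \<sigma> = "1 + d"])
         (use d in \<open>auto intro!: prime_series_summable(1)[OF \<beta> small_order_log(2), where \<sigma> = "1"]\<close>)
    moreover have "Ln (?s - 1) = of_real (ln d)" using Ln_of_real[OF d(1)] by simp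
    moreover have "D u = ?l ?s - of_int R * Ln (?s - 1) - k ?s" using Dc[OF s] by (simp only: D_def)
    ultimately show ?thesis by simp
  qed
  define H where "H = (\<lambda>s. D u + k s - ?t s)"
  have "ball 1 (min r (1 / 2)) \<subseteq> {s::complex. Re s > 1 / 2}"
  proof
    fix s :: complex assume "s \<in> ball 1 (min r (1 / 2))"
    then have "norm (1 - s) < 1 / 2" by (simp add: dist_norm)
    moreover have "\<bar>1 - Re s\<bar> \<le> norm (1 - s)" using abs_Re_le_cmod[of "1 - s"] by simp
    ultimately have "Re s > 1 / 2" by linarith
    then show "s \<in> {s. Re s > 1 / 2}" by simp
  qed
  then have "H holomorphic_on ball 1 (min r (1 / 2))" unfolding H_def
    by (intro holomorphic_intros holomorphic_on_subset[OF k(1)] holomorphic_on_subset[OF th]) auto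
  then have "continuous_on (ball 1 (min r (1 / 2))) H" by (rule holomorphic_on_imp_continuous_on)
  then have "isCont H 1" using r by (simp add: continuous_on_eq_continuous_at)
  moreover have "((\<lambda>d. 1 + complex_of_real d) \<longlongrightarrow> 1 + of_real 0) (at_right 0)" by (intro tendsto_intros)
  ultimately have "((\<lambda>d. H (1 + complex_of_real d)) \<longlongrightarrow> H 1) (at_right 0)"
    by (intro isCont_tendsto_compose[of 1 H]) simp_all
  moreover have "\<forall>\<^sub>F d in at_right 0. H (1 + complex_of_real d) = (\<Sum>n. (if prime n then (\<Sum>j\<in>UNIV. \<beta> n j) / of_nat n else 0) * exp (- (of_real d * of_real (ln (real n)))))
     - of_real (of_int R * ln d)"
    unfolding eventually_at_right_field using eq r by (intro exI[of _ r]) (simp add: H_def)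
  ultimately have "((\<lambda>d. (\<Sum>n. (if prime n then (\<Sum>j\<in>UNIV. \<beta> n j) / of_nat n else 0) * exp (- (of_real d * of_real (ln (real n)))))
     - of_real (of_int R * ln d)) \<longlongrightarrow> H 1) (at_right 0)" by (rule Lim_transform_eventually)
  then show ?thesis by (rule exI)
qed

section \<open>Return to the variable x and to all primes\<close>

lemma ln_filterlim_off_set:
  "filterlim ln (inf at_top (principal (- E))) (inf at_top (principal (- {x::real. 2 \<le> x \<and> ln x \<in> E})))"
  unfolding filterlim_inf
proof
  show "filterlim ln at_top (inf at_top (principal (- {x::real. 2 \<le> x \<and> ln x \<in> E})))"
    by (rule filterlim_mono[OF ln_at_top order_refl inf_le1])
  show "filterlim ln (principal (- E)) (inf at_top (principal (- {x::real. 2 \<le> x \<and> ln x \<in> E})))"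
    unfolding filterlim_principal eventually_inf_principal
    by (rule eventually_mono[OF eventually_ge_at_top[of 2]]) auto
qed

lemma finite_log_measure_ln_vimage:
  assumes E [measurable]: "E \<in> sets borel" and fin: "emeasure lborel E < \<infinity>"
  shows "finite_log_measure {x::real. 2 \<le> x \<and> ln x \<in> E}"
  unfolding finite_log_measure_def
proof (intro conjI)
  let ?S = "{x::real. 2 \<le> x \<and> ln x \<in> E}"
  have "?S \<in> sets borel" by measurable
  then show "?S \<in> sets lebesgue" by simp
  have "(\<integral>\<^sup>+t\<in>?S. ennreal (1 / t) \<partial>lebesgue) = (\<integral>\<^sup>+t\<in>?S. ennreal (1 / t) \<partial>lborel)"
    by (rule nn_integral_completion)
  also have "\<dots> \<le> (\<integral>\<^sup>+x. ennreal (1 / x) * indicator {x. 1 \<le> x \<and> ln x \<in> E} x \<partial>lborel)"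
    by (rule nn_integral_mono) (auto simp: indicator_def)
  also have "\<dots> \<le> emeasure lborel E" by (rule nn_integral_log_measure[OF E])
  finally show "(\<integral>\<^sup>+t\<in>?S. ennreal (1 / t) \<partial>lebesgue) < \<infinity>" using fin by (rule order.strict_trans1)
qed auto

text \<open>The removed factors are entire, bounded on right half-planes and nonzero for Re s >=
  1/2. Multiplying by their product therefore preserves the zero-free half-plane, the order at 1/2
  and polynomial growth.\<close>

lemma standard_central_L:
  fixes V :: "('n::finite) adelic_fun set"
  assumes std: "standard_L_function V \<alpha> \<mu> Q \<epsilon> L" and L: "L holomorphic_on UNIV"
    and RP: "ramanujan_petersson V \<alpha>" and RH: "riemann_hypothesis \<mu> L"
    and P: "finite P" "P = {p. prime p \<and> \<not> unramified V p}"
  shows "\<exists>C A. central_L (\<lambda>p j. if p \<in> P then 0 else \<alpha> p j) (\<lambda>s. L s * local_factors \<alpha> P s) C A (nat (zorder L (1 / 2)))"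
    and "zorder L (1 / 2) \<ge> 0"
proof -
  let ?\<alpha> = "\<lambda>p j. if p \<in> P then 0 else \<alpha> p j"
  let ?L = "\<lambda>s. L s * local_factors \<alpha> P s"
  note std = std[unfolded standard_L_function_def]
  have Pp: "prime p" if "p \<in> P" for p using that P(2) by simp
  have \<alpha>P: "norm (\<alpha> p j) < real p powr (1 / 2)" if "p \<in> P" for p j
    using std Pp[OF that] by (simp add: powr_half_sqrt)
  have \<alpha>1: "norm (?\<alpha> p j) \<le> 1" if "prime p" for p j
    using RP that unfolding ramanujan_petersson_def P(2) by auto
  have epL: "euler_product \<alpha> s (L s)" if "Re s > 1" for s using std that by blast
  have ep: "euler_product ?\<alpha> s (?L s)" if s: "Re s > 1" for s
    by (rule euler_product_remove[OF P(1) Pp _ epL[OF s]], assumption,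
        rule local_factors_nonzero(1)[OF P(1) Pp \<alpha>P]) (use s in auto)
  have Lnz1: "?L s \<noteq> 0" if s: "Re s > 1" for s
    using exp_prime_series_log[OF \<alpha>1 s ep[OF s]] exp_not_eq_zero by metis
  have Eh: "local_factors \<alpha> P holomorphic_on UNIV" by (rule local_factors_holomorphic[OF Pp])
  have Enz: "local_factors \<alpha> P s \<noteq> 0" if "Re s \<ge> 1 / 2" for s
    by (rule local_factors_nonzero(2)[OF P(1) Pp \<alpha>P that])
  have Lnz: "L s \<noteq> 0" if s: "Re s > 1 / 2" for s
  proof
    assume "L s = 0"
    moreover have "\<not> is_pole L s" by (rule not_is_pole_holomorphic[OF open_UNIV UNIV_I L])
    \<comment> \<open>Trivial zeros have real part below 1/2, because Re (\<mu> j) > - 1/2; so the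
      Riemann Hypothesis excludes every zero to the right.\<close>
    moreover have "s \<noteq> - 2 * of_nat k - \<mu> j" for k j
    proof
      assume "s = - 2 * of_nat k - \<mu> j"
      then have "Re s = - 2 * real k - Re (\<mu> j)" by simp
      moreover have "Re (\<mu> j) > - 1 / 2" using std by blast
      ultimately show False using s by simp
    qed
    ultimately show False using RH s unfolding riemann_hypothesis_def by (metis less_irrefl)
  qed
  have "\<exists>w\<in>UNIV. L w \<noteq> 0" using Lnz[of 1] by auto
  from zorder_exist_zero[OF L open_UNIV connected_UNIV UNIV_I this, of "1 / 2"]
  obtain r where z: "if L (1 / 2) = 0 then zorder L (1 / 2) > 0 else zorder L (1 / 2) = 0"
    and r: "r > 0" "zor_poly L (1 / 2) holomorphic_on cball (1 / 2) r"
    "\<And>w. w \<in> cball (1 / 2) r \<Longrightarrow> L w = zor_poly L (1 / 2) w * (w - 1 / 2) ^ nat (zorder L (1 / 2))"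
    "\<And>w. w \<in> cball (1 / 2) r \<Longrightarrow> zor_poly L (1 / 2) w \<noteq> 0" by blast
  show z0: "zorder L (1 / 2) \<ge> 0" using z by (auto split: if_splits)
  have "isCont (local_factors \<alpha> P) (1 / 2)"
    using holomorphic_on_imp_continuous_on[OF Eh] by (simp add: continuous_on_eq_continuous_at)
  then obtain e where e: "e > 0" "\<And>y. dist (1 / 2) y < e \<Longrightarrow> local_factors \<alpha> P y \<noteq> 0"
    using continuous_at_avoid[of "1 / 2" "local_factors \<alpha> P" 0] Enz[of "1 / 2"] by auto
  obtain K where K: "\<And>s. Re s \<ge> - 14 \<Longrightarrow> norm (local_factors \<alpha> P s) \<le> K"
    using local_factors_bounded[OF P(1) Pp, of 14 \<alpha>] by auto
  define G where "G = (\<Sum>n. 5 * real CARD('n) * real n powr (- (29 / 2 * real 1)))"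
  define b where "b = (\<Prod>p\<in>P. \<Prod>j\<in>(UNIV :: 'n set). 1 / 2 :: real)"
  have b0: "b > 0" unfolding b_def by (intro prod_pos) auto
  \<comment> \<open>At abscissa 29/2 the logarithm bounds the stripped Euler product, and the
    removed factors are bounded below.\<close>
  have right: "norm (L s) \<le> exp G / b" if s: "Re s = 1 / 2 + real 14" for s
  proof -
    have s1: "Re s > 1" using s by simp
    have "norm (prime_series ?\<alpha> (\<lambda>z. - Ln (1 - z)) s) \<le> G" unfolding G_def
      by (rule prime_series_summable(2)[OF \<alpha>1 small_order_log(1)]) (use s in auto)
    then have "norm (exp (prime_series ?\<alpha> (\<lambda>z. - Ln (1 - z)) s)) \<le> exp G"
      by (meson exp_le_cancel_iff norm_exp order_trans)
    moreover have "exp (prime_series ?\<alpha> (\<lambda>z. - Ln (1 - z)) s) = ?L s" by (rule exp_prime_series_log[OF \<alpha>1 s1 ep[OF s1]])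
    ultimately have "norm (?L s) \<le> exp G" by (simp only:)
    moreover have "norm (local_factors \<alpha> P s) \<ge> b" unfolding b_def
    proof (rule local_factors_lower[OF Pp])
      fix p j assume p: "p \<in> P"
      have "real p powr (1 / 2) \<le> real p powr (Re s - 1)"
        using s prime_ge_1_nat[OF Pp[OF p]] by (intro powr_mono) auto
      then show "norm (\<alpha> p j) \<le> real p powr (Re s - 1)" using \<alpha>P[OF p, of j] by linarith
    qed
    then have "norm (L s) * b \<le> norm (?L s)" unfolding norm_mult by (rule mult_left_mono) simp
    ultimately show ?thesis using b0 by (simp add: le_divide_eq)
  qed
  have std': "Q > 0" "norm \<epsilon> = 1" "\<And>j. Re (\<mu> j) > - 1 / 2"
    "\<forall>\<^sub>\<approx>s\<in>UNIV. completed_L Q \<mu> L s = \<epsilon> * completed_L Q (\<lambda>j. cnj (\<mu> j)) (\<lambda>z. cnj (L (cnj z))) (1 - s)"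
    "\<forall>a b. \<exists>T C. \<forall>s. a \<le> Re s \<and> Re s \<le> b \<and> \<bar>Im s\<bar> \<ge> T \<longrightarrow> norm (completed_L Q \<mu> L s) \<le> C"
    using std by blast+
  obtain C A where CA: "\<And>s. \<bar>Re s - 1 / 2\<bar> \<le> real 14 \<Longrightarrow> norm (L s) \<le> C * (norm s + C) ^ A"
    using polynomial_growth[of Q L \<epsilon> \<mu> 14 "exp G / b", OF std'(1) L std'(2,4,3,5) _ right] by auto
  \<comment> \<open>A single constant has to serve as factor and as shift, so it dominates |C|, is
    at least 1 and includes the bound \<open>K\<close> of the removed factors.\<close>
  define C' where "C' = (\<bar>C\<bar> + 1) * (\<bar>K\<bar> + 1)"
  have C': "C' \<ge> 1" "\<bar>C\<bar> \<le> C'"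
  proof -
    show "C' \<ge> 1" unfolding C'_def using mult_mono[of 1 "\<bar>C\<bar> + 1" 1 "\<bar>K\<bar> + 1"] by simp
    show "\<bar>C\<bar> \<le> C'" unfolding C'_def using mult_mono[of "\<bar>C\<bar>" "\<bar>C\<bar> + 1" 1 "\<bar>K\<bar> + 1"] by simp
  qed
  have "central_L ?\<alpha> ?L C' A (nat (zorder L (1 / 2)))"
  proof
    show "norm (?\<alpha> p j) \<le> 1" if "prime p" for p j by (rule \<alpha>1[OF that])
    show "?L holomorphic_on UNIV" by (intro holomorphic_intros L Eh)
    show "euler_product ?\<alpha> s (?L s)" if "Re s > 1" for s by (rule ep[OF that])
    show "?L s \<noteq> 0" if "Re s > 1 / 2" for s using Lnz[OF that] Enz[of s] that by simp
    show "C' \<ge> 1" by (rule C'(1))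
    show "norm (?L s) \<le> C' * (norm s + C') ^ A" if s: "\<bar>Re s - 1 / 2\<bar> \<le> 14" for s
    proof -
      have "norm (L s) \<le> C * (norm s + C) ^ A" using CA[of s] s by simp
      also have "\<dots> \<le> \<bar>C * (norm s + C) ^ A\<bar>" by (rule abs_ge_self)
      also have "\<dots> = \<bar>C\<bar> * \<bar>norm s + C\<bar> ^ A" by (simp add: abs_mult power_abs)
      also have "\<dots> \<le> (\<bar>C\<bar> + 1) * (norm s + C') ^ A"
        using C' abs_triangle_ineq[of "norm s" C] by (intro mult_mono power_mono) auto
      finally have 1: "norm (L s) \<le> (\<bar>C\<bar> + 1) * (norm s + C') ^ A" .
      have "- 14 \<le> Re s" using s by (simp add: abs_le_iff)
      from K[OF this] have 2: "norm (local_factors \<alpha> P s) \<le> \<bar>K\<bar> + 1" by linarith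
      have "norm (?L s) \<le> ((\<bar>C\<bar> + 1) * (norm s + C') ^ A) * (\<bar>K\<bar> + 1)"
        unfolding norm_mult using 1 2 C' by (intro mult_mono mult_nonneg_nonneg zero_le_power add_nonneg_nonneg) auto
      then show ?thesis unfolding C'_def[symmetric] by (simp add: C'_def mult_ac)
    qed
    show "\<exists>r>0. \<exists>q. q holomorphic_on ball (1 / 2) r \<and> (\<forall>s\<in>ball (1 / 2) r. ?L s = q s * (s - 1 / 2) ^ nat (zorder L (1 / 2)) \<and> q s \<noteq> 0)"
    proof (intro exI conjI ballI)
      show "min r e > 0" using r(1) e(1) by simp
      show "(\<lambda>s. zor_poly L (1 / 2) s * local_factors \<alpha> P s) holomorphic_on ball (1 / 2) (min r e)"
        by (intro holomorphic_intros holomorphic_on_subset[OF r(2)] holomorphic_on_subset[OF Eh]) auto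
      fix s :: complex assume "s \<in> ball (1 / 2) (min r e)"
      then have s: "s \<in> cball (1 / 2) r" "dist (1 / 2) s < e" by auto
      show "?L s = zor_poly L (1 / 2) s * local_factors \<alpha> P s * (s - 1 / 2) ^ nat (zorder L (1 / 2))"
        unfolding r(3)[OF s(1)] by (simp only: mult_ac)
      show "zor_poly L (1 / 2) s * local_factors \<alpha> P s \<noteq> 0" using r(4)[OF s(1)] e(2)[OF s(2)] by simp
    qed
  qed
  then show "\<exists>C A. central_L ?\<alpha> ?L C A (nat (zorder L (1 / 2)))" by blast
qed

text \<open>At ramified primes |\<alpha>|^2 < p, so the removed factors are nonzero for Re s >= 1
  and the order at 1 remains that of \<open>L2\<close>. The behaviour of the logarithm there and the
  Tauberian theorem give the sum.\<close>

lemma second_moment_asymptotics: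
  fixes V :: "('n::finite) adelic_fun set"
  assumes std: "standard_L_function V \<alpha> \<mu> Q \<epsilon> L" and sm: "second_moment_L_function \<alpha> L2"
    and RP: "ramanujan_petersson V \<alpha>"
    and P: "finite P" "P = {p. prime p \<and> \<not> unramified V p}"
  shows "\<exists>c. ((\<lambda>t. (\<Sum>p | prime p \<and> ln (real p) \<le> t. (\<Sum>j\<in>UNIV. (if p \<in> P then 0 else \<alpha> p j)\<^sup>2) / of_nat p)
     + of_real (of_int (zorder L2 1) * ln t)) \<longlongrightarrow> c) at_top"
proof -
  define \<beta> where "\<beta> = (\<lambda>p j. (if p \<in> P then 0 else \<alpha> p j)\<^sup>2)"
  define \<gamma> where "\<gamma> = (\<lambda>p j. (\<alpha> p j)\<^sup>2)"
  have \<beta>\<gamma>: "\<beta> = (\<lambda>p j. if p \<in> P then 0 else \<gamma> p j)" unfolding \<beta>_def \<gamma>_def by (intro ext) simp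
  note std = std[unfolded standard_L_function_def]
  have Pp: "prime p" if "p \<in> P" for p using that P(2) by simp
  have \<gamma>P: "norm (\<gamma> p j) < real p powr 1" if "p \<in> P" for p j
  proof -
    have "norm (\<alpha> p j) < sqrt (real p)" using std Pp[OF that] by blast
    then have "(norm (\<alpha> p j))\<^sup>2 < (sqrt (real p))\<^sup>2" by (intro power_strict_mono) auto
    then show ?thesis by (simp add: \<gamma>_def norm_power)
  qed
  have \<beta>1: "norm (\<beta> p j) \<le> 1" if "prime p" for p j
    using RP that unfolding ramanujan_petersson_def P(2) \<beta>_def by (auto simp: norm_power)
  let ?L = "\<lambda>s. L2 s * local_factors \<gamma> P s"
  have ep: "euler_product \<beta> s (?L s)" if s: "Re s > 1" for s
  proof -
    have ep: "euler_product \<gamma> s (L2 s)" using sm s unfolding second_moment_L_function_def \<gamma>_def by blast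
    show ?thesis unfolding \<beta>\<gamma>
      by (rule euler_product_remove[OF P(1) Pp _ ep], assumption,
          rule local_factors_nonzero(1)[OF P(1) Pp \<gamma>P]) (use s in auto)
  qed
  have nz: "?L s \<noteq> 0" if s: "Re s > 1" for s
    using exp_prime_series_log[OF \<beta>1 s ep[OF s]] exp_not_eq_zero by metis
  obtain U where U: "open U" "{s. Re s \<ge> 1} \<subseteq> U" "L2 nicely_meromorphic_on U"
    using sm unfolding second_moment_L_function_def by blast
  have "L2 meromorphic_on U" using U(3) unfolding nicely_meromorphic_on_def by blast
  then have mer: "L2 meromorphic_on {1}" by (rule meromorphic_on_subset) (use U(2) in auto)
  \<comment> \<open>\<open>L2\<close> cannot vanish identically near 1, as it is nonzero to the
    right of 1; hence its order there describes a genuine local factorisation.\<close>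
  have fr: "\<exists>\<^sub>F w in at 1. L2 w \<noteq> 0"
    unfolding frequently_def
  proof
    assume "\<forall>\<^sub>F w in at 1. \<not> L2 w \<noteq> 0"
    then obtain d where d: "d > 0" "\<And>w. w \<noteq> 1 \<Longrightarrow> dist w 1 < d \<Longrightarrow> L2 w = 0"
      unfolding eventually_at by auto
    have "L2 (1 + of_real (d / 2)) = 0" using d(1) by (intro d(2)) (auto simp: dist_norm)
    then show False using nz[of "1 + of_real (d / 2)"] d(1) by simp
  qed
  define g where "g = zor_poly L2 1"
  obtain r where r: "r > 0" "g holomorphic_on cball 1 r"
    "\<And>w. w \<in> cball 1 r - {1} \<Longrightarrow> L2 w = g w * (w - 1) powi zorder L2 1 \<and> g w \<noteq> 0" and g1: "g 1 \<noteq> 0"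
    using zorder_exist[OF meromorphic_on_isolated_singularity[OF mer] meromorphic_on_not_essential[OF mer] fr]
    unfolding g_def by blast
  have gnz: "g w \<noteq> 0" if "w \<in> cball 1 r" for w using r(3)[of w] g1 that by (cases "w = 1") auto
  have Eh: "local_factors \<gamma> P holomorphic_on UNIV" by (rule local_factors_holomorphic[OF Pp])
  have "isCont (local_factors \<gamma> P) 1"
    using holomorphic_on_imp_continuous_on[OF Eh] by (simp add: continuous_on_eq_continuous_at)
  moreover have "local_factors \<gamma> P 1 \<noteq> 0" by (rule local_factors_nonzero(2)[OF P(1) Pp \<gamma>P]) auto
  ultimately obtain e where e: "e > 0" "\<And>y. dist 1 y < e \<Longrightarrow> local_factors \<gamma> P y \<noteq> 0"
    using continuous_at_avoid[of 1 "local_factors \<gamma> P" 0] by auto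
  have "\<exists>C. ((\<lambda>d. (\<Sum>n. (if prime n then (\<Sum>j\<in>UNIV. \<beta> n j) / of_nat n else 0) * exp (- (of_real d * of_real (ln (real n)))))
     - of_real (of_int (zorder L2 1) * ln d)) \<longlongrightarrow> C) (at_right 0)"
  proof (rule zorder_log_limit[OF \<beta>1 ep, where r = "min r e" and q = "\<lambda>s. g s * local_factors \<gamma> P s"])
    show "min r e > 0" using r(1) e(1) by simp
    show "(\<lambda>s. g s * local_factors \<gamma> P s) holomorphic_on ball 1 (min r e)"
      by (intro holomorphic_intros holomorphic_on_subset[OF r(2)] holomorphic_on_subset[OF Eh]) auto
    fix s :: complex assume "s \<in> ball 1 (min r e)"
    then have s: "s \<in> cball 1 r" "dist 1 s < e" by auto
    show "g s * local_factors \<gamma> P s \<noteq> 0" using gnz[OF s(1)] e(2)[OF s(2)] by simp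
    assume "s \<noteq> 1"
    then have "L2 s = g s * (s - 1) powi zorder L2 1" using r(3)[of s] s(1) by blast
    then show "?L s = g s * local_factors \<gamma> P s * (s - 1) powi zorder L2 1" by (simp only: mult_ac)
  qed
  then obtain C where C: "((\<lambda>d. (\<Sum>n. (if prime n then (\<Sum>j\<in>UNIV. \<beta> n j) / of_nat n else 0) * exp (- (of_real d * of_real (ln (real n)))))
     - of_real (of_int (zorder L2 1) * ln d)) \<longlongrightarrow> C) (at_right 0)" by (rule exE)
  have "norm (\<Sum>j\<in>UNIV. \<beta> p j) \<le> real CARD('n)" if "prime p" for p
    using sum_norm_bound[of UNIV "\<beta> p" 1] \<beta>1[OF that] by simp
  from prime_sum_asymptotics[OF this C] show ?thesis unfolding \<beta>_def .
qed

text \<open>Half of the sum over squares, taken at t / 2 = ln (sqrt x), yields R / 2. The finitely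
  many ramified primes are restored at the end and change only the constant.\<close>

theorem theorem2:
  fixes V :: "('n::finite) adelic_fun set"
    and \<alpha> :: "nat \<Rightarrow> 'n \<Rightarrow> complex" and \<mu> :: "'n \<Rightarrow> complex"
    and Q :: nat and \<epsilon> :: complex
    and L L2 :: "complex \<Rightarrow> complex"
    and m R :: int
  assumes "cuspidal_automorphic_rep V" and "irreducible_rep V"
    and "standard_L_function V \<alpha> \<mu> Q \<epsilon> L"
    and "second_moment_L_function \<alpha> L2"
    and "L holomorphic_on UNIV"
    and "m = zorder L (1 / 2)"
    and "R = zorder L2 1"
    and "ramanujan_petersson V \<alpha>"
    and "riemann_hypothesis \<mu> L"
  shows "\<exists>c. \<exists>S. finite_log_measure S \<and>
    ((\<lambda>x::real. (\<Sum>p | prime p \<and> real p \<le> x. (\<Sum>j\<in>UNIV. \<alpha> p j) / of_real (sqrt (real p)))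
        - of_real ((of_int R / 2 - of_int m) * ln (ln x)))
      \<longlongrightarrow> c) (inf at_top (principal (- S)))"
proof -
  define P where "P = {p. prime p \<and> \<not> unramified V p}"
  have P: "finite P" unfolding P_def by (rule finite_ramified[OF assms(1,2)])
  let ?\<alpha> = "\<lambda>p j. if p \<in> P then 0 else \<alpha> p j"
  obtain C A where "central_L ?\<alpha> (\<lambda>s. L s * local_factors \<alpha> P s) C A (nat (zorder L (1 / 2)))"
    using standard_central_L(1)[OF assms(3,5,8,9) P P_def] by blast
  from central_L.prime_sum_off_small_set[OF this]
  obtain c1 E where E: "E \<in> sets borel" "emeasure lborel E < \<infinity>" and
    lim1: "((\<lambda>t. (\<Sum>p | prime p \<and> ln (real p) \<le> t. (\<Sum>j\<in>UNIV. ?\<alpha> p j) / of_real (sqrt (real p)))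
       + (\<Sum>p | prime p \<and> 2 * ln (real p) \<le> t. (\<Sum>j\<in>UNIV. (?\<alpha> p j)\<^sup>2) / (2 * of_nat p)) + of_real (real (nat (zorder L (1 / 2))) * ln t)) \<longlongrightarrow> c1)
      (inf at_top (principal (- E)))" by (elim exE conjE)
  have m: "real (nat (zorder L (1 / 2))) = of_int m"
    using standard_central_L(2)[OF assms(3,5,8,9) P P_def] assms(6) by simp
  define B where "B = (\<lambda>t. \<Sum>p | prime p \<and> ln (real p) \<le> t. (\<Sum>j\<in>UNIV. (?\<alpha> p j)\<^sup>2) / of_nat p)"
  obtain c2 where "((\<lambda>t. B t + of_real (of_int R * ln t)) \<longlongrightarrow> c2) at_top"
    using second_moment_asymptotics[OF assms(3,4,8) P P_def] unfolding assms(7) B_def by (elim exE)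
  moreover have "filterlim (\<lambda>t::real. t / 2) at_top at_top" by real_asymp
  ultimately have "((\<lambda>t. B (t / 2) + of_real (of_int R * ln (t / 2))) \<longlongrightarrow> c2) at_top" by (rule filterlim_compose)
  then have lim2: "((\<lambda>t. B (t / 2) + of_real (of_int R * ln (t / 2))) \<longlongrightarrow> c2) (inf at_top (principal (- E)))"
    by (rule tendsto_mono[OF inf_le1])
  have B2: "(\<Sum>p | prime p \<and> 2 * ln (real p) \<le> t. (\<Sum>j\<in>UNIV. (?\<alpha> p j)\<^sup>2) / (2 * of_nat p)) = B (t / 2) / 2" for t
  proof -
    have 1: "{p. prime p \<and> 2 * ln (real p) \<le> t} = {p. prime p \<and> ln (real p) \<le> t / 2}" by auto
    have 2: "z / (2 * of_nat p) = z / of_nat p / 2" for z :: complex and p by simp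
    show ?thesis unfolding 1 2 B_def sum_divide_distrib[symmetric] ..
  qed
  define S where "S = {x::real. 2 \<le> x \<and> ln x \<in> E}"
  define A' where "A' = (\<lambda>t. \<Sum>p | prime p \<and> ln (real p) \<le> t. (\<Sum>j\<in>UNIV. ?\<alpha> p j) / complex_of_real (sqrt (real p)))"
  \<comment> \<open>The last summand comes from ln (t / 2) = ln t - ln 2.\<close>
  define c3 where "c3 = c1 - c2 / 2 - of_real (of_int R * ln 2 / 2)"
  have "((\<lambda>t. A' t + B (t / 2) / 2 + of_real (of_int m * ln t) - (B (t / 2) + of_real (of_int R * ln (t / 2))) / 2 - of_real (of_int R * ln 2 / 2)) \<longlongrightarrow> c3)
      (inf at_top (principal (- E)))"
    unfolding c3_def A'_def
    by (intro tendsto_diff tendsto_const tendsto_divide lim2 lim1[unfolded B2 m]) simp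
  moreover have "\<forall>\<^sub>F t in inf at_top (principal (- E)). A' t + B (t / 2) / 2 + of_real (of_int m * ln t) - (B (t / 2) + of_real (of_int R * ln (t / 2))) / 2 - of_real (of_int R * ln 2 / 2)
     = A' t - of_real ((of_int R / 2 - of_int m) * ln t)"
  proof -
    have "\<forall>\<^sub>F t in inf at_top (principal (- E)). t > 0" by (rule filter_leD[OF inf_le1 eventually_gt_at_top])
    then show ?thesis
    proof eventually_elim
      case (elim t)
      then have l: "ln (t / 2) = ln t - ln 2" by (simp add: ln_div)
      show ?case unfolding l by (simp add: field_simps)
    qed
  qed
  ultimately have "((\<lambda>t. A' t - of_real ((of_int R / 2 - of_int m) * ln t)) \<longlongrightarrow> c3) (inf at_top (principal (- E)))"
    by (rule Lim_transform_eventually)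
  then have lim3: "((\<lambda>x. A' (ln x) - of_real ((of_int R / 2 - of_int m) * ln (ln x))) \<longlongrightarrow> c3) (inf at_top (principal (- S)))"
    unfolding S_def by (rule filterlim_compose) (rule ln_filterlim_off_set)
  define F where "F = (\<lambda>p. (\<Sum>j\<in>UNIV. \<alpha> p j) / complex_of_real (sqrt (real p)))"
  \<comment> \<open>Beyond the largest ramified prime, the restored terms form the constant
    \<open>sum F P\<close>.\<close>
  have ev: "\<forall>\<^sub>F x in inf at_top (principal (- S)). A' (ln x) - of_real ((of_int R / 2 - of_int m) * ln (ln x)) + sum F P
    = (\<Sum>p | prime p \<and> real p \<le> x. F p) - of_real ((of_int R / 2 - of_int m) * ln (ln x))"
  proof -
    have "\<forall>\<^sub>F x in inf at_top (principal (- S)). x \<ge> real (Max (insert 1 P))"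
      by (rule filter_leD[OF inf_le1 eventually_ge_at_top])
    then show ?thesis
    proof eventually_elim
      case (elim x)
      have x: "real p \<le> x" if "p \<in> insert 1 P" for p
      proof -
        have "p \<le> Max (insert 1 P)" using that P by (intro Max_ge) auto
        then show ?thesis using elim by linarith
      qed
      have x1: "x \<ge> 1" using x[of 1] by simp
      let ?T = "{p. prime p \<and> real p \<le> x}"
      have T: "finite ?T" by (rule finite_subset[of _ "{..nat \<lfloor>x\<rfloor>}"]) (auto simp: le_nat_floor)
      have "{p. prime p \<and> ln (real p) \<le> ln x} = ?T"
      proof -
        have "(ln (real p) \<le> ln x) = (real p \<le> x)" if "prime p" for p
          using prime_gt_0_nat[OF that] x1 by (intro ln_le_cancel_iff) auto
        then show ?thesis by blast
      qed
      then have "A' (ln x) = (\<Sum>p\<in>?T. if p \<in> P then 0 else F p)"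
        unfolding A'_def F_def by (simp only:) (rule sum.cong, auto)
      moreover have "sum F P = (\<Sum>p\<in>?T. if p \<in> P then F p else 0)"
      proof -
        have "?T \<inter> P = P" using x unfolding P_def by auto
        then show ?thesis using sum.inter_restrict[OF T, of F P] by simp
      qed
      ultimately have "A' (ln x) + sum F P = (\<Sum>p\<in>?T. (if p \<in> P then 0 else F p) + (if p \<in> P then F p else 0))"
        by (simp only: sum.distrib)
      also have "\<dots> = sum F ?T" by (rule sum.cong) auto
      finally show ?case by (simp add: algebra_simps)
    qed
  qed
  have "((\<lambda>x. (\<Sum>p | prime p \<and> real p \<le> x. F p) - of_real ((of_int R / 2 - of_int m) * ln (ln x))) \<longlongrightarrow> c3 + sum F P) (inf at_top (principal (- S)))"
    by (rule Lim_transform_eventually[OF tendsto_add[OF lim3 tendsto_const] ev])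
  moreover have "finite_log_measure S" unfolding S_def by (rule finite_log_measure_ln_vimage[OF E])
  ultimately show ?thesis unfolding F_def by (intro exI conjI)
qed

end
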